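(* Let $q$ be transcendental over $\mathbb{Q}$. Then $$\Xi(\mathfrak{HH}_m)=\mathrm{End}_{L_q^{\imath}(\mathfrak{sl}_{2r+4})}(\underline{V}^{\otimes m})^{\mathrm{op}},$$ where $\mathfrak{HH}_m$ is the duplex Hecke algebra of type $\mathsf{B}$ acting on the right on $\underline{V}^{\otimes m}$ via the anti-homomorphism $\Xi$, and $L_q^{\imath}(\mathfrak{sl}_{2r+4})$ is the $\imath$quantum group of Levi type acting on $\underline{V}^{\otimes m}$ via $\Phi$. That is, the set of operators $\Xi(h)$, $h\in\mathfrak{HH}_m$, equals the set of all $\mathbb{Q}(q)$-linear endomorphisms of $\underline{V}^{\otimes m}$ commuting with $\Phi(u)$ for every $u\in L_q^{\imath}(\mathfrak{sl}_{2r+4})$ (the superscript $\mathrm{op}$ reflecting that $\mathfrak{HH}_m$ acts on the right).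
   Context: Fix integers $r\ge 1$ and $m\ge 2$; $q$ is transcendental over $\mathbb{Q}$ and the base field is $\mathbb{Q}(q)$. Index sets: $\mathbb{I}_{2r+1}=\{-r,-r+1,\dots,r\}$, $\mathbb{I}_{2r+3}=\{-r-1,-r,\dots,r+1\}$, $\mathbb{I}_{2r+2}=\{-r-\tfrac12,-r+\tfrac12,\dots,r+\tfrac12\}$, $\mathbb{I}_{2r+4}=\{-r-\tfrac32,-r-\tfrac12,\dots,r+\tfrac32\}$. Quantum group. $\mathbf{U}_q(\mathfrak{sl}_{2r+4})$ is the usual quantum group over $\mathbb{Q}(q)$ with generators $E_i,F_i,K_i^{\pm1}$ indexed by $i\in\mathbb{I}_{2r+3}$: the $K_i$ commute, $K_iE_jK_i^{-1}=q^{c_{ij}}E_j$, $K_iF_jK_i^{-1}=q^{-c_{ij}}F_j$, $E_iF_j-F_jE_i=\delta_{ij}\frac{K_i-K_i^{-1}}{q-q^{-1}}$, and the quantum Serre relations, where $c_{ii}=2$, $c_{ij}=-1$ if $|i-j|=1$, and $c_{ij}=0$ if $|i-j|>1$. Comultiplication: $\Delta(K_i)=K_i\otimes K_i$, $\Delta(E_i)=1\otimes E_i+E_i\otimes K_i^{-1}$, $\Delta(F_i)=F_i\otimes 1+K_i\otimes F_i$. $\imath$quantum group of Levi type. In $\mathbf{U}_q(\mathfrak{sl}_{2r+4})$ put $k_i=K_iK_{-i}^{-1}$ ($i\in\mathbb{I}_{2r+3}$), $B_i=E_i+F_{-i}K_i^{-1}$ ($i\ne 0$), $B_0=E_0+qF_0K_0^{-1}+K_0^{-1}$.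 The $\imath$quantum group $\mathbf{U}_q^{\imath}(\mathfrak{sl}_{2r+4})$ is the $\mathbb{Q}(q)$-subalgebra generated by all $k_i,B_i$ with $i\in\mathbb{I}_{2r+3}$, and $L_q^{\imath}(\mathfrak{sl}_{2r+4})$ is its subalgebra generated by $k_i$ ($i\in\mathbb{I}_{2r+3}$) and $B_i$ ($i\in\mathbb{I}_{2r+1}$). Representation $\Phi$. $\underline{V}$ is the $\mathbb{Q}(q)$-space with basis $\{\eta_j: j\in\mathbb{I}_{2r+4}\}$, and $V\subset\underline{V}$ is the span of $\{\eta_j: j\in\mathbb{I}_{2r+2}\}$. $\mathbf{U}_q(\mathfrak{sl}_{2r+4})$ acts on $\underline{V}$ by $F_i\eta_{i-1/2}=\eta_{i+1/2}$, $F_i\eta_j=0$ for $j\neq i-\tfrac12$; $E_i\eta_{i+1/2}=\eta_{i-1/2}$, $E_i\eta_j=0$ for $j\ne i+\tfrac12$; $K_i\eta_{i-1/2}=q\eta_{i-1/2}$, $K_i\eta_{i+1/2}=q^{-1}\eta_{i+1/2}$, $K_i\eta_j=\eta_j$ for $j\neq i\pm\tfrac12$. It acts on $\underline{V}^{\otimes m}$ through the iterated comultiplication $\Delta^m=(\Delta\otimes\mathrm{id}^{\otimes m-2})\circ\cdots\circ(\Delta\otimes\mathrm{id})\circ\Delta$. $\Phi$ denotes this action and its restriction to $L_q^{\imath}(\mathfrak{sl}_{2r+4})$. Hecke algebra and its right action. $\mathcal{H}(\mathsf{B}_l)$ is the $\mathbb{Q}(q)$-algebra generated by $H_0,\dots,H_{l-1}$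 with relations $(H_i-q^{-1})(H_i+q)=0$; $H_iH_{i+1}H_i=H_{i+1}H_iH_{i+1}$ for $1\le i\le l-2$; $H_iH_j=H_jH_i$ for $|i-j|>1$; $H_0H_1H_0H_1=H_1H_0H_1H_0$ (with $\mathcal{H}(\mathsf{B}_0)=\mathbb{Q}(q)$). For $\sigma\in\mathfrak{S}_l=\langle s_1,\dots,s_{l-1}\rangle$ with reduced expression $s_{i_1}\cdots s_{i_k}$, $H_\sigma=H_{i_1}\cdots H_{i_k}$. For $f=(f(1),\dots,f(m))\in\mathbb{I}_{2r+4}^m$ put $M_f=\eta_{f(1)}\otimes\cdots\otimes\eta_{f(m)}$; $fs_i$ ($i\ge1$) is $f$ with entries $i,i+1$ swapped, and $fs_0=(-f(1),f(2),\dots,f(m))$. $\mathcal{H}(\mathsf{B}_m)$ acts on $\underline{V}^{\otimes m}$ on the right (action $\Psi$) by: for $i\ge1$, $M_fH_i=q^{-1}M_f$ if $f(i)=f(i+1)$, $M_fH_i=M_{fs_i}$ if $f(i)<f(i+1)$, $M_fH_i=M_{fs_i}+(q^{-1}-q)M_f$ if $f(i)>f(i+1)$; $M_fH_0=M_{fs_0}$ if $f(1)>0$, and $M_fH_0=M_{fs_0}+(q^{-1}-q)M_f$ if $f(1)<0$. By the same formulas $\mathcal{H}(\mathsf{B}_l)$ acts on the right on $V^{\otimes l}$; this action is denoted $\Psi_l^V$. We write $\Psi(h)$, $\Psi_l^V(h)$ for the corresponding operators (so $\Psi,\Psi^V_l$ are anti-homomorphisms). Duplex Hecke algebra. $\mathfrak{HH}_m$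 is the $\mathbb{Q}(q)$-algebra generated by $T_0,\dots,T_{m-1}$ and $x_\sigma^{(l)}$ ($0\le l\le m$, $\sigma\in\mathfrak{S}_l$, with $\mathfrak{S}_0=\mathfrak{S}_1$ trivial) with relations: the $T_i$ satisfy the relations of the generators $H_i$ of $\mathcal{H}(\mathsf{B}_m)$; for $0<i<l$, with $\ell$ the length function, $x_\sigma^{(l)}x_{s_i}^{(l)}=x_{\sigma s_i}^{(l)}$ if $\ell(\sigma s_i)=\ell(\sigma)+1$ and $=x_{\sigma s_i}^{(l)}+(q^{-1}-q)x_\sigma^{(l)}$ if $\ell(\sigma s_i)=\ell(\sigma)-1$; $x_{s_i}^{(l)}x_\sigma^{(l)}=x_{s_i\sigma}^{(l)}$ if $\ell(s_i\sigma)=\ell(\sigma)+1$ and $=x_{s_i\sigma}^{(l)}+(q^{-1}-q)x_\sigma^{(l)}$ if $\ell(s_i\sigma)=\ell(\sigma)-1$; $x_\sigma^{(l)}x_\gamma^{(k)}=0$ for $l\ne k$; $T_ix_\sigma^{(l)}=x_{s_i}^{(l)}x_\sigma^{(l)}$ and $x_\sigma^{(l)}T_i=x_\sigma^{(l)}x_{s_i}^{(l)}$ for $0<i<l$; $T_ix_\sigma^{(l)}=q^{-1}x_\sigma^{(l)}=x_\sigma^{(l)}T_i$ for $i>l$. Representation $\Xi$. Let $\underline{V}_{\underline{l},\emptyset}^{\otimes m}=V^{\otimes l}\otimes\eta_{r+3/2}^{\otimes m-l}$. $\Xi:\mathfrak{HH}_m\to\mathrm{End}(\underline{V}^{\otimes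 m})$ is the unique algebra anti-homomorphism with $\Xi(T_i)=\Psi(H_i)$, $\Xi(x_\sigma^{(l)})|_{\underline{V}_{\underline{l},\emptyset}^{\otimes m}}=\Psi_l^V(H_\sigma)\otimes\mathrm{id}^{\otimes m-l}$, and $\Xi(x_\sigma^{(l)})(M_f)=0$ for $M_f\notin\underline{V}_{\underline{l},\emptyset}^{\otimes m}$. *)

theory Defs
  imports
    "HOL-Library.Poly_Mapping"
    "HOL-Library.Product_Plus"
    "HOL-Library.FuncSet"
    "HOL-Combinatorics.Permutations"
    "HOL-Computational_Algebra.Polynomial"
    "HOL-Algebra.QuotRing"
    "HOL-Algebra.Generated_Rings"
begin

section \<open>Free algebras, presentations, and linear maps\<close>

text \<open>
  Lists form the free monoid, written additively because \<^theory>\<open>HOL-Library.Poly_Mapping\<close>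
  builds the monoid algebra of an additive monoid.  Hence \<open>'g list \<Rightarrow>\<^sub>0 'k\<close> is the free
  \<open>'k\<close>-algebra on \<open>'g\<close>, and \<open>('g list \<times> 'g list) \<Rightarrow>\<^sub>0 'k\<close> is the tensor square of that algebra,
  with the usual (componentwise) product.
\<close>

instantiation list :: (type) monoid_add
begin
definition zero_list :: "'a list" where "zero_list = []"
definition plus_list :: "'a list \<Rightarrow> 'a list \<Rightarrow> 'a list" where "plus_list xs ys = xs @ ys"
instance by standard (auto simp: zero_list_def plus_list_def)
end

definition scal :: "'k::field \<Rightarrow> ('a::monoid_add \<Rightarrow>\<^sub>0 'k)" where
  "scal c = Poly_Mapping.single 0 c"

definition gen :: "'g \<Rightarrow> ('g list \<Rightarrow>\<^sub>0 'k::field)" where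
  "gen g = Poly_Mapping.single [g] 1"

definition lin_ext :: "('b \<Rightarrow> ('a::monoid_add \<Rightarrow>\<^sub>0 'k)) \<Rightarrow> ('b \<Rightarrow>\<^sub>0 'k) \<Rightarrow> ('a \<Rightarrow>\<^sub>0 'k::field)" where
  "lin_ext \<phi> v = (\<Sum>b \<in> Poly_Mapping.keys v. scal (Poly_Mapping.lookup v b) * \<phi> b)"

definition free_alg :: "'g set \<Rightarrow> ('g list \<Rightarrow>\<^sub>0 'k::field) ring" where
  "free_alg X = \<lparr>carrier = {a. Poly_Mapping.keys a \<subseteq> lists X},
     mult = (*), one = 1, zero = 0, add = (+)\<rparr>"

definition rel_ideal :: "'g set \<Rightarrow> ('g list \<Rightarrow>\<^sub>0 'k::field) set \<Rightarrow> ('g list \<Rightarrow>\<^sub>0 'k) set" where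
  "rel_ideal X R = Idl\<^bsub>free_alg X\<^esub> R"

text \<open>The algebra with generators \<open>X\<close> and relations \<open>a = 0\<close> for \<open>a \<in> R\<close>; its elements are cosets.\<close>

definition presented :: "'g set \<Rightarrow> ('g list \<Rightarrow>\<^sub>0 'k::field) set \<Rightarrow> ('g list \<Rightarrow>\<^sub>0 'k) set ring" where
  "presented X R = free_alg X Quot rel_ideal X R"

definition cls :: "'g set \<Rightarrow> ('g list \<Rightarrow>\<^sub>0 'k::field) set \<Rightarrow> ('g list \<Rightarrow>\<^sub>0 'k) \<Rightarrow> ('g list \<Rightarrow>\<^sub>0 'k) set" where
  "cls X R a = rel_ideal X R +>\<^bsub>free_alg X\<^esub> a"

text \<open>
  A map on the free algebra that is constant on the cosets descends to the presented algebra;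
  this is the value of the descended map on a coset \<open>A\<close>.
\<close>

definition descend :: "('a \<Rightarrow> 'b) \<Rightarrow> 'a set \<Rightarrow> 'b" where
  "descend h A = the_elem (h ` A)"

definition lin_endos :: "('a::monoid_add \<Rightarrow>\<^sub>0 'k::field) set \<Rightarrow> (('a \<Rightarrow>\<^sub>0 'k) \<Rightarrow> ('a \<Rightarrow>\<^sub>0 'k)) set" where
  "lin_endos W = {T \<in> W \<rightarrow>\<^sub>E W.
     (\<forall>u\<in>W. \<forall>v\<in>W. T (u + v) = T u + T v) \<and> (\<forall>c. \<forall>v\<in>W. T (scal c * v) = scal c * T v)}"

text \<open>
  The right action on \<open>W\<close> of the free algebra in which each generator \<open>g\<close> acts by \<open>op g\<close>:
  the leftmost letter of a word is applied first, so \<open>a \<mapsto> free_right_act W op a\<close> is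
  the anti-homomorphism with \<open>g \<mapsto> op g\<close>.
\<close>

definition free_right_act ::
  "('a::monoid_add \<Rightarrow>\<^sub>0 'k::field) set \<Rightarrow> ('g \<Rightarrow> ('a \<Rightarrow>\<^sub>0 'k) \<Rightarrow> ('a \<Rightarrow>\<^sub>0 'k)) \<Rightarrow>
   ('g list \<Rightarrow>\<^sub>0 'k) \<Rightarrow> ('a \<Rightarrow>\<^sub>0 'k) \<Rightarrow> ('a \<Rightarrow>\<^sub>0 'k)" where
  "free_right_act W op a = (\<lambda>v\<in>W. lin_ext (\<lambda>w. fold op w v) a)"


section \<open>The tensor space\<close>

text \<open>\<open>half_idx s\<close> is \<open>{-s + 1/2, -s + 3/2, \<dots>, s - 1/2}\<close>.\<close>

definition half_idx :: "nat \<Rightarrow> rat set" where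
  "half_idx s = (\<lambda>k::int. of_int k + 1/2) ` {- int s .. int s - 1}"

definition I_small :: "nat \<Rightarrow> rat set" where  \<comment> \<open>\<open>\<I>\<^sub>2\<^sub>r\<^sub>+\<^sub>2\<close>\<close>
  "I_small r = half_idx (r + 1)"

definition I_big :: "nat \<Rightarrow> rat set" where  \<comment> \<open>\<open>\<I>\<^sub>2\<^sub>r\<^sub>+\<^sub>4\<close>\<close>
  "I_big r = half_idx (r + 2)"

definition top_idx :: "nat \<Rightarrow> rat" where
  "top_idx r = of_nat r + 3/2"

text \<open>
  Tensors are elements of the tensor algebra, i.e. of the free algebra on the \<open>\<eta>\<^sub>j\<close>:
  \<open>Mvec f\<close> is the word \<open>f = [f(1), \<dots>, f(m)]\<close>, the multiplication \<open>*\<close> is the tensor product, and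
  the \<open>n\<close>-th tensor power of the span of \<open>{\<eta>\<^sub>j. j \<in> J}\<close> is the homogeneous component \<open>tensors J n\<close>.
\<close>

definition Mvec :: "rat list \<Rightarrow> (rat list \<Rightarrow>\<^sub>0 'k::field)" where
  "Mvec f = Poly_Mapping.single f 1"

abbreviation eta :: "rat \<Rightarrow> (rat list \<Rightarrow>\<^sub>0 'k::field)" where
  "eta j \<equiv> Mvec [j]"

definition tensors :: "rat set \<Rightarrow> nat \<Rightarrow> (rat list \<Rightarrow>\<^sub>0 'k::field) set" where
  "tensors J n = {v. Poly_Mapping.keys v \<subseteq> {f. length f = n \<and> set f \<subseteq> J}}"


section \<open>The quantum group\<close>

datatype qgen = qE int | qF int | qK int | qKinv int

definition I_int :: "nat \<Rightarrow> int set" where  \<comment> \<open>\<open>I_int r = \<I>\<^sub>2\<^sub>r\<^sub>+\<^sub>1\<close> and \<open>I_int (r + 1) = \<I>\<^sub>2\<^sub>r\<^sub>+\<^sub>3\<close>\<close>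
  "I_int n = {- int n .. int n}"

definition cartan :: "int \<Rightarrow> int \<Rightarrow> int" where
  "cartan i j = (if i = j then 2 else if \<bar>i - j\<bar> = 1 then -1 else 0)"

definition qgens :: "nat \<Rightarrow> qgen set" where
  "qgens r = (\<Union>i \<in> I_int (r + 1). {qE i, qF i, qK i, qKinv i})"

definition qrels :: "nat \<Rightarrow> 'k::field \<Rightarrow> (qgen list \<Rightarrow>\<^sub>0 'k) set" where
  "qrels r q = (\<Union>i \<in> I_int (r + 1). \<Union>j \<in> I_int (r + 1).
     { gen (qK i) * gen (qKinv i) - 1,
       gen (qKinv i) * gen (qK i) - 1,
       gen (qK i) * gen (qK j) - gen (qK j) * gen (qK i),
       gen (qK i) * gen (qE j) * gen (qKinv i) - scal (q powi cartan i j) * gen (qE j),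
       gen (qK i) * gen (qF j) * gen (qKinv i) - scal (q powi (- cartan i j)) * gen (qF j),
       gen (qE i) * gen (qF j) - gen (qF j) * gen (qE i)
         - (if i = j then scal (1 / (q - inverse q)) * (gen (qK i) - gen (qKinv i)) else 0) }
   \<union> (if \<bar>i - j\<bar> = 1 then
       { gen (qE i) ^ 2 * gen (qE j) - scal (q + inverse q) * (gen (qE i) * gen (qE j) * gen (qE i))
           + gen (qE j) * gen (qE i) ^ 2,
         gen (qF i) ^ 2 * gen (qF j) - scal (q + inverse q) * (gen (qF i) * gen (qF j) * gen (qF i))
           + gen (qF j) * gen (qF i) ^ 2 }
      else {})
   \<union> (if \<bar>i - j\<bar> > 1 then
       { gen (qE i) * gen (qE j) - gen (qE j) * gen (qE i),
         gen (qF i) * gen (qF j) - gen (qF j) * gen (qF i) }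
      else {}))"

definition Uq :: "nat \<Rightarrow> 'k::field \<Rightarrow> (qgen list \<Rightarrow>\<^sub>0 'k) set ring" where
  "Uq r q = presented (qgens r) (qrels r q)"

definition Uq_cls :: "nat \<Rightarrow> 'k::field \<Rightarrow> (qgen list \<Rightarrow>\<^sub>0 'k) \<Rightarrow> (qgen list \<Rightarrow>\<^sub>0 'k) set" where
  "Uq_cls r q = cls (qgens r) (qrels r q)"

subsection \<open>The subalgebra of Levi type\<close>

definition k_el :: "int \<Rightarrow> (qgen list \<Rightarrow>\<^sub>0 'k::field)" where
  "k_el i = gen (qK i) * gen (qKinv (- i))"

definition B_el :: "'k::field \<Rightarrow> int \<Rightarrow> (qgen list \<Rightarrow>\<^sub>0 'k)" where
  "B_el q i = (if i = 0 then gen (qE 0) + scal q * (gen (qF 0) * gen (qKinv 0)) + gen (qKinv 0)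
               else gen (qE i) + gen (qF (- i)) * gen (qKinv i))"

text \<open>The subalgebra of \<open>Uq r q\<close> generated by \<open>S\<close>, over the base field (hence the scalars).\<close>

definition Uq_subalg :: "nat \<Rightarrow> 'k::field \<Rightarrow> (qgen list \<Rightarrow>\<^sub>0 'k) set set \<Rightarrow> (qgen list \<Rightarrow>\<^sub>0 'k) set set" where
  "Uq_subalg r q S = generate_ring (Uq r q) (range (\<lambda>c. Uq_cls r q (scal c)) \<union> S)"

definition U_iota :: "nat \<Rightarrow> 'k::field \<Rightarrow> (qgen list \<Rightarrow>\<^sub>0 'k) set set" where
  "U_iota r q = Uq_subalg r q
     ((\<lambda>i. Uq_cls r q (k_el i)) ` I_int (r + 1) \<union> (\<lambda>i. Uq_cls r q (B_el q i)) ` I_int (r + 1))"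

text \<open>All generators below lie in \<open>U_iota r q\<close>, so this is a subalgebra of \<open>U_iota r q\<close>.\<close>

definition L_iota :: "nat \<Rightarrow> 'k::field \<Rightarrow> (qgen list \<Rightarrow>\<^sub>0 'k) set set" where
  "L_iota r q = Uq_subalg r q
     ((\<lambda>i. Uq_cls r q (k_el i)) ` I_int (r + 1) \<union> (\<lambda>i. Uq_cls r q (B_el q i)) ` I_int r)"

subsection \<open>Comultiplication and the representation \<open>\<Phi>\<close>\<close>

primrec comult_gen :: "qgen \<Rightarrow> (qgen list \<times> qgen list \<Rightarrow>\<^sub>0 'k::field)" where
  "comult_gen (qE i) = Poly_Mapping.single ([], [qE i]) 1 + Poly_Mapping.single ([qE i], [qKinv i]) 1"
| "comult_gen (qF i) = Poly_Mapping.single ([qF i], []) 1 + Poly_Mapping.single ([qK i], [qF i]) 1"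
| "comult_gen (qK i) = Poly_Mapping.single ([qK i], [qK i]) 1"
| "comult_gen (qKinv i) = Poly_Mapping.single ([qKinv i], [qKinv i]) 1"

definition comult_word :: "qgen list \<Rightarrow> (qgen list \<times> qgen list \<Rightarrow>\<^sub>0 'k::field)" where
  "comult_word w = prod_list (map comult_gen w)"

text \<open>
  A pure tensor \<open>w\<^sub>1 \<otimes> \<dots> \<otimes> w\<^sub>n\<close> of words is the list \<open>[w\<^sub>1, \<dots>, w\<^sub>n]\<close>.  \<open>comult_first\<close> is
  \<open>\<Delta> \<otimes> id \<otimes> \<dots> \<otimes> id\<close>, and \<open>comult_iter m\<close> is \<open>\<Delta>\<^sup>m\<close>, with values in the \<open>m\<close>-fold tensor power.
\<close>

definition comult_first :: "(qgen list list \<Rightarrow>\<^sub>0 'k::field) \<Rightarrow> (qgen list list \<Rightarrow>\<^sub>0 'k)" where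
  "comult_first =
     lin_ext (\<lambda>ws. lin_ext (\<lambda>(u, v). Poly_Mapping.single (u # v # tl ws) 1) (comult_word (hd ws)))"

definition comult_iter :: "nat \<Rightarrow> (qgen list \<Rightarrow>\<^sub>0 'k::field) \<Rightarrow> (qgen list list \<Rightarrow>\<^sub>0 'k)" where
  "comult_iter m a = (comult_first ^^ (m - 1)) (lin_ext (\<lambda>w. Poly_Mapping.single [w] 1) a)"

text \<open>For a half-integer \<open>j\<close>: \<open>j = i - 1/2\<close> and \<open>j = i + 1/2\<close> are exclusive.\<close>

primrec eta_act :: "'k::field \<Rightarrow> qgen \<Rightarrow> rat \<Rightarrow> (rat list \<Rightarrow>\<^sub>0 'k)" where
  "eta_act q (qF i) j = (if j = of_int i - 1/2 then eta (of_int i + 1/2) else 0)"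
| "eta_act q (qE i) j = (if j = of_int i + 1/2 then eta (of_int i - 1/2) else 0)"
| "eta_act q (qK i) j = (if j = of_int i - 1/2 then scal q * eta j
     else if j = of_int i + 1/2 then scal (inverse q) * eta j else eta j)"
| "eta_act q (qKinv i) j = (if j = of_int i - 1/2 then scal (inverse q) * eta j
     else if j = of_int i + 1/2 then scal q * eta j else eta j)"

definition word_act :: "'k::field \<Rightarrow> qgen list \<Rightarrow> (rat list \<Rightarrow>\<^sub>0 'k) \<Rightarrow> (rat list \<Rightarrow>\<^sub>0 'k)" where
  "word_act q w v = foldr (\<lambda>g. lin_ext (\<lambda>f. eta_act q g (hd f))) w v"

definition tensor_act :: "'k::field \<Rightarrow> qgen list list \<Rightarrow> rat list \<Rightarrow> (rat list \<Rightarrow>\<^sub>0 'k)" where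
  "tensor_act q ws f = prod_list (map2 (\<lambda>w j. word_act q w (eta j)) ws f)"

definition Phi_free ::
  "nat \<Rightarrow> nat \<Rightarrow> 'k::field \<Rightarrow> (qgen list \<Rightarrow>\<^sub>0 'k) \<Rightarrow> (rat list \<Rightarrow>\<^sub>0 'k) \<Rightarrow> (rat list \<Rightarrow>\<^sub>0 'k)" where
  "Phi_free r m q a = (\<lambda>v \<in> tensors (I_big r) m.
     lin_ext (\<lambda>f. lin_ext (\<lambda>ws. tensor_act q ws f) (comult_iter m a)) v)"

definition Phi ::
  "nat \<Rightarrow> nat \<Rightarrow> 'k::field \<Rightarrow> (qgen list \<Rightarrow>\<^sub>0 'k) set \<Rightarrow> (rat list \<Rightarrow>\<^sub>0 'k) \<Rightarrow> (rat list \<Rightarrow>\<^sub>0 'k)" where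
  "Phi r m q = descend (Phi_free r m q)"


section \<open>The symmetric group\<close>

definition transp :: "nat \<Rightarrow> nat \<Rightarrow> nat" where
  "transp i = transpose i (i + 1)"

definition perm_of_word :: "nat list \<Rightarrow> nat \<Rightarrow> nat" where
  "perm_of_word is = foldr (\<lambda>i \<sigma>. transp i \<circ> \<sigma>) is id"

definition is_expr :: "nat \<Rightarrow> (nat \<Rightarrow> nat) \<Rightarrow> nat list \<Rightarrow> bool" where
  "is_expr l \<sigma> is \<longleftrightarrow> set is \<subseteq> {1..<l} \<and> perm_of_word is = \<sigma>"

definition len :: "nat \<Rightarrow> (nat \<Rightarrow> nat) \<Rightarrow> nat" where
  "len l \<sigma> = (LEAST k. \<exists>is. is_expr l \<sigma> is \<and> length is = k)"

text \<open>Any reduced expression will do: by Matsumoto's theorem \<open>H\<^sub>\<sigma>\<close> below does not depend on the choice.\<close>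

definition reduced_expr :: "nat \<Rightarrow> (nat \<Rightarrow> nat) \<Rightarrow> nat list" where
  "reduced_expr l \<sigma> = (SOME is. is_expr l \<sigma> is \<and> length is = len l \<sigma>)"


section \<open>Hecke algebras of type B and their right action\<close>

text \<open>The type-B relations for a family \<open>h 0, \<dots>, h (l - 1)\<close>; they are reused for the \<open>T\<^sub>i\<close> below.\<close>

definition hecke_rels :: "'k::field \<Rightarrow> nat \<Rightarrow> (nat \<Rightarrow> ('g list \<Rightarrow>\<^sub>0 'k)) \<Rightarrow> ('g list \<Rightarrow>\<^sub>0 'k) set" where
  "hecke_rels q l h =
     {(h i - scal (inverse q)) * (h i + scal q) | i. i < l}
   \<union> {h i * h (i + 1) * h i - h (i + 1) * h i * h (i + 1) | i. 1 \<le> i \<and> i + 1 < l}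
   \<union> {h i * h j - h j * h i | i j. i < l \<and> j < l \<and> i + 1 < j}
   \<union> (if 1 < l then {h 0 * h 1 * h 0 * h 1 - h 1 * h 0 * h 1 * h 0} else {})"

definition Hecke_cls :: "'k::field \<Rightarrow> nat \<Rightarrow> (nat list \<Rightarrow>\<^sub>0 'k) \<Rightarrow> (nat list \<Rightarrow>\<^sub>0 'k) set" where
  "Hecke_cls q l = cls {..<l} (hecke_rels q l gen)"

definition H_perm :: "'k::field \<Rightarrow> nat \<Rightarrow> (nat \<Rightarrow> nat) \<Rightarrow> (nat list \<Rightarrow>\<^sub>0 'k) set" where
  "H_perm q l \<sigma> = Hecke_cls q l (prod_list (map gen (reduced_expr l \<sigma>)))"

text \<open>Lists count from 0, so the \<open>i\<close>-th entry \<open>f(i)\<close>, for \<open>i = 1, \<dots>, m\<close>, is \<open>f ! (i - 1)\<close>.\<close>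

definition place :: "rat list \<Rightarrow> nat \<Rightarrow> rat list" where
  "place f i = (if i = 0 then f[0 := - (f ! 0)] else f[i - 1 := f ! i, i := f ! (i - 1)])"

definition M_act :: "'k::field \<Rightarrow> nat \<Rightarrow> rat list \<Rightarrow> (rat list \<Rightarrow>\<^sub>0 'k)" where
  "M_act q i f =
     (if i = 0 then
        (if f ! 0 > 0 then Mvec (place f 0) else Mvec (place f 0) + scal (inverse q - q) * Mvec f)
      else if f ! (i - 1) = f ! i then scal (inverse q) * Mvec f
      else if f ! (i - 1) < f ! i then Mvec (place f i)
      else Mvec (place f i) + scal (inverse q - q) * Mvec f)"

definition Psi_gen :: "'k::field \<Rightarrow> nat \<Rightarrow> (rat list \<Rightarrow>\<^sub>0 'k) \<Rightarrow> (rat list \<Rightarrow>\<^sub>0 'k)" where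
  "Psi_gen q i = lin_ext (M_act q i)"

definition PsiV ::
  "nat \<Rightarrow> 'k::field \<Rightarrow> nat \<Rightarrow> (nat list \<Rightarrow>\<^sub>0 'k) set \<Rightarrow> (rat list \<Rightarrow>\<^sub>0 'k) \<Rightarrow> (rat list \<Rightarrow>\<^sub>0 'k)" where
  "PsiV r q l = descend (free_right_act (tensors (I_small r) l) (Psi_gen q))"


section \<open>The duplex Hecke algebra and the representation \<open>\<Xi>\<close>\<close>

datatype dgen = DT nat | DX nat "nat \<Rightarrow> nat"

definition Sym :: "nat \<Rightarrow> (nat \<Rightarrow> nat) set" where
  "Sym l = {\<sigma>. \<sigma> permutes {1..l}}"

definition dgens :: "nat \<Rightarrow> dgen set" where
  "dgens m = {DT i | i. i < m} \<union> {DX l \<sigma> | l \<sigma>. l \<le> m \<and> \<sigma> \<in> Sym l}"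

definition drels :: "nat \<Rightarrow> 'k::field \<Rightarrow> (dgen list \<Rightarrow>\<^sub>0 'k) set" where
  "drels m q =
     hecke_rels q m (\<lambda>i. gen (DT i))
   \<union> {gen (DX l \<sigma>) * gen (DX l (transp i)) - gen (DX l (\<sigma> \<circ> transp i)) | l \<sigma> i.
        l \<le> m \<and> \<sigma> \<in> Sym l \<and> 0 < i \<and> i < l \<and> len l (\<sigma> \<circ> transp i) = len l \<sigma> + 1}
   \<union> {gen (DX l \<sigma>) * gen (DX l (transp i))
        - (gen (DX l (\<sigma> \<circ> transp i)) + scal (inverse q - q) * gen (DX l \<sigma>)) | l \<sigma> i.
        l \<le> m \<and> \<sigma> \<in> Sym l \<and> 0 < i \<and> i < l \<and> len l \<sigma> = len l (\<sigma> \<circ> transp i) + 1}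
   \<union> {gen (DX l (transp i)) * gen (DX l \<sigma>) - gen (DX l (transp i \<circ> \<sigma>)) | l \<sigma> i.
        l \<le> m \<and> \<sigma> \<in> Sym l \<and> 0 < i \<and> i < l \<and> len l (transp i \<circ> \<sigma>) = len l \<sigma> + 1}
   \<union> {gen (DX l (transp i)) * gen (DX l \<sigma>)
        - (gen (DX l (transp i \<circ> \<sigma>)) + scal (inverse q - q) * gen (DX l \<sigma>)) | l \<sigma> i.
        l \<le> m \<and> \<sigma> \<in> Sym l \<and> 0 < i \<and> i < l \<and> len l \<sigma> = len l (transp i \<circ> \<sigma>) + 1}
   \<union> {gen (DX l \<sigma>) * gen (DX k \<gamma>) | l k \<sigma> \<gamma>.
        l \<le> m \<and> k \<le> m \<and> l \<noteq> k \<and> \<sigma> \<in> Sym l \<and> \<gamma> \<in> Sym k}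
   \<union> {gen (DT i) * gen (DX l \<sigma>) - gen (DX l (transp i)) * gen (DX l \<sigma>) | l \<sigma> i.
        l \<le> m \<and> \<sigma> \<in> Sym l \<and> 0 < i \<and> i < l}
   \<union> {gen (DX l \<sigma>) * gen (DT i) - gen (DX l \<sigma>) * gen (DX l (transp i)) | l \<sigma> i.
        l \<le> m \<and> \<sigma> \<in> Sym l \<and> 0 < i \<and> i < l}
   \<union> {gen (DT i) * gen (DX l \<sigma>) - scal (inverse q) * gen (DX l \<sigma>) | l \<sigma> i.
        l \<le> m \<and> \<sigma> \<in> Sym l \<and> l < i \<and> i < m}
   \<union> {gen (DX l \<sigma>) * gen (DT i) - scal (inverse q) * gen (DX l \<sigma>) | l \<sigma> i.
        l \<le> m \<and> \<sigma> \<in> Sym l \<and> l < i \<and> i < m}"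

definition HH :: "nat \<Rightarrow> 'k::field \<Rightarrow> (dgen list \<Rightarrow>\<^sub>0 'k) set ring" where
  "HH m q = presented (dgens m) (drels m q)"

text \<open>\<open>Mvec f\<close> lies in the \<open>l\<close>-th tensor power of \<open>V\<close> tensored with \<open>m - l\<close> copies of \<open>\<eta>\<^sub>r\<^sub>+\<^sub>3\<^sub>/\<^sub>2\<close>.\<close>

definition in_layer :: "nat \<Rightarrow> nat \<Rightarrow> nat \<Rightarrow> rat list \<Rightarrow> bool" where
  "in_layer r m l f \<longleftrightarrow> length f = m \<and> set (take l f) \<subseteq> I_small r \<and> drop l f = replicate (m - l) (top_idx r)"

primrec Xi_gen :: "nat \<Rightarrow> nat \<Rightarrow> 'k::field \<Rightarrow> dgen \<Rightarrow> (rat list \<Rightarrow>\<^sub>0 'k) \<Rightarrow> (rat list \<Rightarrow>\<^sub>0 'k)" where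
  "Xi_gen r m q (DT i) = Psi_gen q i"
| "Xi_gen r m q (DX l \<sigma>) = lin_ext (\<lambda>f.
     if in_layer r m l f then PsiV r q l (H_perm q l \<sigma>) (Mvec (take l f)) * Mvec (drop l f) else 0)"

definition Xi ::
  "nat \<Rightarrow> nat \<Rightarrow> 'k::field \<Rightarrow> (dgen list \<Rightarrow>\<^sub>0 'k) set \<Rightarrow> (rat list \<Rightarrow>\<^sub>0 'k) \<Rightarrow> (rat list \<Rightarrow>\<^sub>0 'k)" where
  "Xi r m q = descend (free_right_act (tensors (I_big r) m) (Xi_gen r m q))"


section \<open>Commutant and base field\<close>

text \<open>
  As a set of operators, the opposite algebra is the same set; \<open>Xi\<close> reverses products.
\<close>

definition End_L :: "nat \<Rightarrow> nat \<Rightarrow> 'k::field \<Rightarrow> ((rat list \<Rightarrow>\<^sub>0 'k) \<Rightarrow> (rat list \<Rightarrow>\<^sub>0 'k)) set" where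
  "End_L r m q = {S \<in> lin_endos (tensors (I_big r) m).
     \<forall>u \<in> L_iota r q. \<forall>v \<in> tensors (I_big r) m. S (Phi r m q u v) = Phi r m q u (S v)}"

text \<open>The subfield \<open>\<rat>(q)\<close> of \<open>'k\<close>.\<close>

definition rat_adjoin :: "'k::field_char_0 \<Rightarrow> 'k set" where
  "rat_adjoin q = {poly a q / poly b q | a b.
     (\<forall>i. Polynomial.coeff a i \<in> \<rat>) \<and> (\<forall>i. Polynomial.coeff b i \<in> \<rat>) \<and> poly b q \<noteq> 0}"

end

theory Submission
  imports Defs
begin

text \<open>The operators of the quantum group act on words through a skew Leibniz rule, so every commutation
  relation is checked on letters and spreads over the whole tensor algebra. A word over the large alphabet is
  a pattern of letters \<open>\<eta>\<close> with indices \<open>\<plusminus>(r + 3/2)\<close> together with a word in \<open>V\<close>, and the Levi subalgebra sees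
  only the latter. Hence an endomorphism commuting with it is a matrix of blocks, one for each pair of patterns
  with the same number \<open>l\<close> of letters of \<open>V\<close>, and each block lies in the commutant of the Levi subalgebra on
  \<open>V\<^sup>\<otimes>\<^sup>l\<close>. All patterns with \<open>l\<close> such letters are reached from the basic one by Hecke operators, and the Hecke
  operators are symmetric for the standard bilinear form, so that blocks can be moved to the basic pattern on both sides,
  where they are produced by the \<open>x\<^sub>\<sigma>\<close>.

  It remains to show that the commutant on \<open>V\<^sup>\<otimes>\<^sup>l\<close> is spanned by Hecke operators. The standard form on matrices over
  \<open>\<rat>(q)\<close> is anisotropic, so an element of the commutant outside the span can be made orthogonal to the span; scaled to be
  regular and nonzero at \<open>q = 1\<close> it specialises to a nonzero rational matrix that commutes with the classical fixed
  point Lie algebra and is orthogonal to all signed permutations. The classical double commutant argument excludes it.\<close>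

text \<open>Comparing dimensions at generic q and at q = 1, or semisimplicity of the generic Hecke
  algebra, would be the usual way to the commutant on a power of V. Orthogonality replaces both: it
  rests on the fact that a sum of squares in \<rat>(q) vanishes only trivially. Transcendence of q
  enters three times: specialisation at q = 1 is well defined, the form is anisotropic, and the
  powers of q are distinct, so that the \<open>k_el i\<close> separate weights. The last point
  shapes the proof, because the \<open>k_el i\<close> become the identity at q = 1: what they say
  about an endomorphism is extracted before specialising and carried along as a vanishing condition
  on matrix entries. The element \<open>k_el (r + 1)\<close> stays in the Levi subalgebra although
  \<open>B_el q (r + 1)\<close> and its mirror image do not. Together with the other
  \<open>k_el i\<close> it determines the number of letters \<plusminus>(r + 3/2) in a word, so
  blocks between patterns with different numbers of letters of V vanish.\<close>

abbreviation cf :: "('a \<Rightarrow>\<^sub>0 'k::zero) \<Rightarrow> 'a \<Rightarrow> 'k" where "cf \<equiv> Poly_Mapping.lookup"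
abbreviation supp :: "('a \<Rightarrow>\<^sub>0 'k::zero) \<Rightarrow> 'a set" where "supp \<equiv> Poly_Mapping.keys"
abbreviation mono1 :: "'a \<Rightarrow> ('a \<Rightarrow>\<^sub>0 'k::zero_neq_one)" where "mono1 a \<equiv> Poly_Mapping.single a 1"

section \<open>Scalars and expansions in the monoid algebra\<close>

lemma cf_scal [simp]: "cf (scal c * v) f = c * cf v f"
proof -
  have "scal c * v = Poly_Mapping.map ((*) c) v"
    by (simp add: scal_def mult_map_scale_conv_mult)
  then show ?thesis by (simp add: Poly_Mapping.map.rep_eq when_def)
qed

lemma scal_0 [simp]: "scal 0 = 0" and scal_1 [simp]: "scal 1 = 1"
  by (simp_all add: scal_def)

lemma scal_single: "scal c * Poly_Mapping.single a d = Poly_Mapping.single a (c * d)"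
  by (simp add: scal_def mult_single)

lemma single_scal: "Poly_Mapping.single a d * scal c = Poly_Mapping.single a (c * d)"
  by (simp add: scal_def mult_single mult.commute)

lemma scal_add: "scal (a + b) = scal a + scal b" by (simp add: scal_def single_add)
lemma scal_diff: "scal (a - b) = scal a - scal b" by (simp add: scal_def single_diff)
lemma scal_uminus: "scal (- b) = - scal b" by (simp add: scal_def single_uminus)
lemma scal_mult: "scal (a * b) = scal a * scal b" by (simp add: scal_def mult_single)
lemma scal_scal: "scal a * (scal b * v) = scal (a * b) * v" by (simp add: scal_mult mult.assoc)

lemma expand_superset:
  assumes "finite A" "supp v \<subseteq> A"
  shows "v = (\<Sum>a\<in>A. scal (cf v a) * mono1 a)"
proof (rule poly_mapping_eqI)
  fix k
  have "cf (\<Sum>a\<in>A. scal (cf v a) * mono1 a) k = (\<Sum>a\<in>A. if a = k then cf v k else 0)"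
    by (simp add: lookup_sum lookup_single when_def cong: if_cong) (rule sum.cong, auto)
  also have "\<dots> = cf v k" using assms by (auto simp: in_keys_iff)
  finally show "cf v k = cf (\<Sum>a\<in>A. scal (cf v a) * mono1 a) k" by simp
qed

lemma expand: "v = (\<Sum>a\<in>supp v. scal (cf v a) * mono1 a)"
  by (rule expand_superset) auto

text \<open>Linearity is total, without a carrier. The members of \<open>End_L\<close>, in contrast,
  are \<open>undefined\<close> outside the tensor power and are compared with \<open>lin\<close>
  operators only on that subspace.\<close>

definition lin :: "(('a::monoid_add \<Rightarrow>\<^sub>0 'k::field) \<Rightarrow> ('b::monoid_add \<Rightarrow>\<^sub>0 'k)) \<Rightarrow> bool" where
  "lin T \<longleftrightarrow> (\<forall>u v. T (u + v) = T u + T v) \<and> (\<forall>c v. T (scal c * v) = scal c * T v)"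

lemma linI: "(\<And>u v. T (u + v) = T u + T v) \<Longrightarrow> (\<And>c v. T (scal c * v) = scal c * T v) \<Longrightarrow> lin T"
  by (simp add: lin_def)

lemma lin_add: "lin T \<Longrightarrow> T (u + v) = T u + T v" by (simp add: lin_def)
lemma lin_scal: "lin T \<Longrightarrow> T (scal c * v) = scal c * T v" by (simp add: lin_def)
lemma lin_0: "lin T \<Longrightarrow> T 0 = 0" using lin_scal[of T 0 0] by simp
lemma lin_uminus: "lin T \<Longrightarrow> T (- v) = - T v"
  using lin_scal[of T "-1" v] by (simp add: scal_uminus)
lemma lin_diff: "lin T \<Longrightarrow> T (u - v) = T u - T v"
  using lin_add[of T u "- v"] by (simp add: lin_uminus)
lemma lin_sum: "lin T \<Longrightarrow> T (\<Sum>i\<in>I. g i) = (\<Sum>i\<in>I. T (g i))"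
  by (induction I rule: infinite_finite_induct) (auto simp: lin_0 lin_add)

lemma scal_commute: "scal c * v = v * (scal c :: 'a::monoid_add \<Rightarrow>\<^sub>0 'k::field)"
proof -
  have "v * scal c = (\<Sum>a\<in>supp v. (scal (cf v a) * mono1 a) * scal c)"
    by (subst expand[of v]) (simp add: sum_distrib_right)
  also have "\<dots> = (\<Sum>a\<in>supp v. scal c * (scal (cf v a) * mono1 a))"
    by (simp add: scal_single single_scal)
  also have "\<dots> = scal c * v" by (subst (3) expand[of v]) (simp add: sum_distrib_left)
  finally show ?thesis by simp
qed

lemma scal_left_commute: "v * (scal c * w) = scal c * (v * w)"
  by (metis mult.assoc scal_commute)

lemma lin_ext_superset:
  assumes "finite A" "supp v \<subseteq> A"
  shows "lin_ext \<phi> v = (\<Sum>a\<in>A. scal (cf v a) * \<phi> a)"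
  unfolding lin_ext_def
  by (rule sum.mono_neutral_left) (use assms in \<open>auto simp: in_keys_iff\<close>)

lemma lin_lin_ext [simp]:
  fixes \<phi> :: "'b::monoid_add \<Rightarrow> ('a::monoid_add \<Rightarrow>\<^sub>0 'k::field)"
  shows "lin (lin_ext \<phi>)"
proof (rule linI)
  fix u v :: "'b \<Rightarrow>\<^sub>0 'k"
  let ?A = "supp u \<union> supp v"
  have "lin_ext \<phi> (u + v) = (\<Sum>a\<in>?A. scal (cf (u + v) a) * \<phi> a)"
    using keys_add[of u v] by (intro lin_ext_superset) auto
  also have "\<dots> = (\<Sum>a\<in>?A. scal (cf u a) * \<phi> a) + (\<Sum>a\<in>?A. scal (cf v a) * \<phi> a)"
    by (simp add: lookup_add scal_add algebra_simps sum.distrib)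
  also have "\<dots> = lin_ext \<phi> u + lin_ext \<phi> v"
    by (simp add: lin_ext_superset[of ?A])
  finally show "lin_ext \<phi> (u + v) = lin_ext \<phi> u + lin_ext \<phi> v" .
next
  fix c and v :: "'b \<Rightarrow>\<^sub>0 'k"
  have "lin_ext \<phi> (scal c * v) = (\<Sum>a\<in>supp v. scal (cf (scal c * v) a) * \<phi> a)"
    by (intro lin_ext_superset) (auto simp: in_keys_iff)
  also have "\<dots> = scal c * lin_ext \<phi> v"
    by (simp add: lin_ext_def sum_distrib_left scal_scal)
  finally show "lin_ext \<phi> (scal c * v) = scal c * lin_ext \<phi> v" .
qed

lemma lin_ext_single [simp]: "lin_ext \<phi> (mono1 a) = \<phi> a"
  by (simp add: lin_ext_def)

lemma lin_ext_Mvec [simp]: "lin_ext \<phi> (Mvec a) = \<phi> a"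
  by (simp add: Mvec_def)

lemmas lin_ext_simps = lin_add[OF lin_lin_ext] lin_scal[OF lin_lin_ext] lin_0[OF lin_lin_ext]
  lin_diff[OF lin_lin_ext] lin_uminus[OF lin_lin_ext] lin_sum[OF lin_lin_ext]

lemma lin_id [intro]: "lin (\<lambda>v. v)" by (simp add: lin_def)
lemma lin_zero [intro]: "lin (\<lambda>v. 0)" by (simp add: lin_def)
lemma lin_plus [intro]: "lin S \<Longrightarrow> lin T \<Longrightarrow> lin (\<lambda>v. S v + T v)"
  by (simp add: lin_def algebra_simps)
lemma lin_minus [intro]: "lin S \<Longrightarrow> lin T \<Longrightarrow> lin (\<lambda>v. S v - T v)"
  by (simp add: lin_def algebra_simps)
lemma lin_scal_mult [intro]: "lin S \<Longrightarrow> lin (\<lambda>v. scal c * S v)"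
  by (simp add: lin_def distrib_left scal_scal mult.commute)
lemma lin_left [intro]: "lin S \<Longrightarrow> lin (\<lambda>v. x * S v)"
  by (simp add: lin_def distrib_left scal_left_commute)
lemma lin_right [intro]: "lin S \<Longrightarrow> lin (\<lambda>v. S v * x)"
  by (simp add: lin_def distrib_right mult.assoc)
lemma lin_comp: "lin S \<Longrightarrow> lin T \<Longrightarrow> lin (\<lambda>v. S (T v))"
  by (simp add: lin_def)
lemma lin_ext_comp [intro]: "lin T \<Longrightarrow> lin (\<lambda>v. lin_ext \<phi> (T v))"
  by (rule lin_comp[OF lin_lin_ext])
lemma lin_Sum [intro]: "(\<And>i. i \<in> I \<Longrightarrow> lin (S i)) \<Longrightarrow> lin (\<lambda>v. \<Sum>i\<in>I. S i v)"
  by (induction I rule: infinite_finite_induct) auto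

lemma lin_eq_on:
  assumes "lin S" "lin T" "\<And>a. a \<in> supp v \<Longrightarrow> S (mono1 a) = T (mono1 a)"
  shows "S v = T v"
proof -
  have "S v = (\<Sum>a\<in>supp v. scal (cf v a) * S (mono1 a))"
    by (subst expand[of v]) (simp add: lin_sum lin_scal assms)
  also have "\<dots> = (\<Sum>a\<in>supp v. scal (cf v a) * T (mono1 a))" by (simp add: assms)
  also have "\<dots> = T v" by (subst (3) expand[of v]) (simp add: lin_sum lin_scal assms)
  finally show ?thesis .
qed

lemma lin_eq:
  assumes "lin S" "lin T" "\<And>a. S (mono1 a) = T (mono1 a)"
  shows "S v = T v"
  by (rule lin_eq_on) (use assms in auto)

lemma lin_eq_lin_ext: "lin T \<Longrightarrow> T v = lin_ext (\<lambda>a. T (mono1 a)) v"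
  by (rule lin_eq) auto

lemma lin_ext_lin: "(\<And>a. a \<in> supp u \<Longrightarrow> lin (\<lambda>v. \<phi> v a)) \<Longrightarrow> lin (\<lambda>v. lin_ext (\<phi> v) u)"
  unfolding lin_ext_def by (intro lin_Sum lin_scal_mult)

lemma lin_ext_cong_supp: "(\<And>a. a \<in> supp u \<Longrightarrow> \<phi> a = \<psi> a) \<Longrightarrow> lin_ext \<phi> u = lin_ext \<psi> u"
  by (simp add: lin_ext_def)

lemma cf_lin_ext: "cf (lin_ext \<phi> v) b = (\<Sum>a\<in>supp v. cf v a * cf (\<phi> a) b)"
  by (simp add: lin_ext_def lookup_sum)

lemma mono1_mult: "mono1 a * mono1 b = (mono1 (a + b) :: 'a::monoid_add \<Rightarrow>\<^sub>0 'k::field)"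
  by (simp add: mult_single)

lemma cf_Mvec: "cf (Mvec f) g = (if f = g then 1 else 0)"
  by (simp add: Mvec_def lookup_single when_def)

lemma Mvec_mult: "Mvec f * Mvec g = Mvec (f @ g)"
  by (simp add: Mvec_def mult_single plus_list_def)

lemma Mvec_Nil [simp]: "Mvec [] = 1"
  by (simp add: Mvec_def zero_list_def[symmetric])

lemma Mvec_Cons: "Mvec (j # f) = eta j * Mvec f"
  by (simp add: Mvec_mult)

lemma Mvec_neq_0 [simp]: "Mvec f \<noteq> (0 :: rat list \<Rightarrow>\<^sub>0 'k::field)"
  by (metis Mvec_def lookup_single_eq lookup_zero zero_neq_one)

lemma Mvec_expand: "v = (\<Sum>a\<in>supp v. scal (cf v a) * Mvec a)"
  unfolding Mvec_def by (rule expand)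

lemma lin_eqM:
  assumes "lin S" "lin T" "\<And>f. S (Mvec f) = T (Mvec f)"
  shows "S v = T v"
  by (rule lin_eq) (use assms in \<open>auto simp: Mvec_def\<close>)

lemma bilin_eqM:
  assumes "\<And>y. lin (\<lambda>x. S x y)" "\<And>x. lin (S x)" "\<And>y. lin (\<lambda>x. T x y)" "\<And>x. lin (T x)"
    "\<And>f g. S (Mvec f) (Mvec g) = T (Mvec f) (Mvec g)"
  shows "S x y = T x y"
proof -
  have "S (Mvec f) y = T (Mvec f) y" for f
    by (rule lin_eqM[OF assms(2,4,5)])
  then show ?thesis by (rule lin_eqM[OF assms(1,3)])
qed

section \<open>Tensor powers as spans of words\<close>

definition words :: "'a set \<Rightarrow> nat \<Rightarrow> 'a list set" where
  "words J n = {f. length f = n \<and> set f \<subseteq> J}"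

lemma tensors_alt: "tensors J n = {v. supp v \<subseteq> words J n}"
  by (simp add: tensors_def words_def)

lemma finite_words: "finite J \<Longrightarrow> finite (words J n)"
  using finite_lists_length_eq[of J n] by (simp add: words_def conj_commute)

lemma tensors_0 [simp, intro]: "0 \<in> tensors J n" by (simp add: tensors_alt)
lemma tensors_Mvec [intro]: "f \<in> words J n \<Longrightarrow> Mvec f \<in> tensors J n"
  by (simp add: tensors_alt Mvec_def)
lemma Mvec_in_tensors [simp]: "(Mvec f :: _ \<Rightarrow>\<^sub>0 'k::field) \<in> tensors J n \<longleftrightarrow> f \<in> words J n"
  by (simp add: tensors_alt Mvec_def)
lemma tensors_add [intro]: "u \<in> tensors J n \<Longrightarrow> v \<in> tensors J n \<Longrightarrow> u + v \<in> tensors J n"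
  using keys_add[of u v] by (auto simp: tensors_alt)
lemma tensors_scal [intro]: "v \<in> tensors J n \<Longrightarrow> scal c * v \<in> tensors J n"
  by (auto simp: tensors_alt in_keys_iff)
lemma tensors_uminus [intro]: "v \<in> tensors J n \<Longrightarrow> - v \<in> tensors J n"
  by (auto simp: tensors_alt in_keys_iff)
lemma tensors_diff [intro]: "u \<in> tensors J n \<Longrightarrow> v \<in> tensors J n \<Longrightarrow> u - v \<in> tensors J n"
  using tensors_add[of u J n "- v"] by auto
lemma tensors_sum [intro]: "(\<And>i. i \<in> I \<Longrightarrow> g i \<in> tensors J n) \<Longrightarrow> (\<Sum>i\<in>I. g i) \<in> tensors J n"
  by (induction I rule: infinite_finite_induct) auto

lemma tensors_lin_ext: "v \<in> tensors J n \<Longrightarrow> (\<And>f. f \<in> words J n \<Longrightarrow> \<phi> f \<in> tensors K k)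
    \<Longrightarrow> lin_ext \<phi> v \<in> tensors K k"
  unfolding lin_ext_def by (intro tensors_sum tensors_scal) (auto simp: tensors_alt)

lemma tensors_lin: "lin T \<Longrightarrow> v \<in> tensors J n \<Longrightarrow> (\<And>f. f \<in> words J n \<Longrightarrow> T (Mvec f) \<in> tensors K k)
    \<Longrightarrow> T v \<in> tensors K k"
  by (subst lin_eq_lin_ext, assumption) (auto simp: Mvec_def intro: tensors_lin_ext)

lemma tensors_mult [intro]:
  assumes "u \<in> tensors J m" "v \<in> tensors J n" shows "u * v \<in> tensors J (m + n)"
proof (rule tensors_lin[of "\<lambda>u. u * v", OF _ assms(1)])
  fix f assume f: "f \<in> words J m"
  show "Mvec f * v \<in> tensors J (m + n)"
    by (rule tensors_lin[of "\<lambda>v. Mvec f * v", OF _ assms(2)])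
       (use f in \<open>auto simp: Mvec_mult words_def\<close>)
qed auto

lemma lin_eq_tensors:
  assumes "lin S" "lin T" "v \<in> tensors J n" "\<And>f. f \<in> words J n \<Longrightarrow> S (Mvec f) = T (Mvec f)"
  shows "S v = T v"
  by (rule lin_eq_on) (use assms in \<open>auto simp: tensors_alt Mvec_def\<close>)

lemma tensors_expand:
  assumes "finite J" "v \<in> tensors J n"
  shows "v = (\<Sum>f\<in>words J n. scal (cf v f) * Mvec f)"
  unfolding Mvec_def by (rule expand_superset) (use assms in \<open>auto simp: tensors_alt finite_words\<close>)

lemma tensors_cf: "v \<in> tensors J n \<Longrightarrow> f \<notin> words J n \<Longrightarrow> cf v f = 0"
  by (auto simp: tensors_alt in_keys_iff)

lemma tensors_eqI:
  assumes "u \<in> tensors J n" "v \<in> tensors J n" "\<And>f. f \<in> words J n \<Longrightarrow> cf u f = cf v f"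
  shows "u = v"
  by (rule poly_mapping_eqI) (metis assms tensors_cf)

lemma tensors_mono: "J \<subseteq> K \<Longrightarrow> tensors J n \<subseteq> tensors K n"
  by (auto simp: tensors_alt words_def)

lemma words_Cons [simp]: "j # f \<in> words J (Suc n) \<longleftrightarrow> j \<in> J \<and> f \<in> words J n"
  by (auto simp: words_def)

lemma words_0 [simp]: "words J 0 = {[]}"
  by (auto simp: words_def)

section \<open>Presented algebras\<close>

lemma free_alg_simps [simp]:
  "carrier (free_alg X) = {a. supp a \<subseteq> lists X}"
  "a \<otimes>\<^bsub>free_alg X\<^esub> b = a * b" "\<one>\<^bsub>free_alg X\<^esub> = 1" "\<zero>\<^bsub>free_alg X\<^esub> = 0"
  "a \<oplus>\<^bsub>free_alg X\<^esub> b = a + b"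
  by (simp_all add: free_alg_def)

lemma supp_uminus: "supp (- a) = supp (a :: 'a \<Rightarrow>\<^sub>0 'k::ab_group_add)"
  by (auto simp: in_keys_iff)

lemma supp_mult_lists:
  assumes "supp a \<subseteq> lists X" "supp b \<subseteq> lists X" shows "supp (a * b) \<subseteq> lists X"
proof
  fix w assume "w \<in> supp (a * b)"
  with keys_mult[of a b] obtain u v where "w = u + v" "u \<in> supp a" "v \<in> supp b" by blast
  with assms show "w \<in> lists X" by (auto simp: plus_list_def)
qed

lemma ring_free_alg: "ring (free_alg X :: ('g list \<Rightarrow>\<^sub>0 'k::field) ring)"
proof (rule ringI)
  let ?A = "free_alg X :: ('g list \<Rightarrow>\<^sub>0 'k::field) ring"
  show "abelian_group ?A"
  proof (rule abelian_groupI)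
    fix x assume "x \<in> carrier ?A"
    then show "\<exists>y\<in>carrier ?A. y \<oplus>\<^bsub>?A\<^esub> x = \<zero>\<^bsub>?A\<^esub>"
      by (intro bexI[of _ "- x"]) (auto simp: supp_uminus)
  next
    fix x y assume "x \<in> carrier ?A" "y \<in> carrier ?A"
    then show "x \<oplus>\<^bsub>?A\<^esub> y \<in> carrier ?A" using keys_add[of x y] by auto
    show "x \<oplus>\<^bsub>?A\<^esub> y = y \<oplus>\<^bsub>?A\<^esub> x" by (simp only: free_alg_simps add.commute)
    fix z show "x \<oplus>\<^bsub>?A\<^esub> y \<oplus>\<^bsub>?A\<^esub> z = x \<oplus>\<^bsub>?A\<^esub> (y \<oplus>\<^bsub>?A\<^esub> z)" by (simp only: free_alg_simps add.assoc)
  qed auto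
  show "Group.monoid ?A"
  proof (rule monoidI)
    fix x y assume "x \<in> carrier ?A" "y \<in> carrier ?A"
    then show "x \<otimes>\<^bsub>?A\<^esub> y \<in> carrier ?A" by (simp add: supp_mult_lists)
    fix z show "x \<otimes>\<^bsub>?A\<^esub> y \<otimes>\<^bsub>?A\<^esub> z = x \<otimes>\<^bsub>?A\<^esub> (y \<otimes>\<^bsub>?A\<^esub> z)" by (simp only: free_alg_simps mult.assoc)
  qed (auto simp: zero_list_def)
qed (simp_all only: free_alg_simps distrib_left distrib_right)

lemma rel_ideal_ideal: "R \<subseteq> carrier (free_alg X) \<Longrightarrow> ideal (rel_ideal X R) (free_alg X)"
  unfolding rel_ideal_def by (rule ring.genideal_ideal[OF ring_free_alg])

lemma rel_ideal_minimal:
  assumes "R \<subseteq> K" "ideal K (free_alg X)"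
  shows "rel_ideal X R \<subseteq> K"
  unfolding rel_ideal_def by (rule ring.genideal_minimal[OF ring_free_alg assms(2,1)])

text \<open>Applied below to annihilators: an action descends to a presented algebra as soon as its
  annihilator passes this test and contains the relations.\<close>

lemma ideal_kernel:
  fixes K :: "('g list \<Rightarrow>\<^sub>0 'k::field) set"
  assumes "0 \<in> K" "\<And>a b. a \<in> K \<Longrightarrow> b \<in> K \<Longrightarrow> a + b \<in> K" "\<And>a. a \<in> K \<Longrightarrow> - a \<in> K"
    "\<And>a x. a \<in> K \<Longrightarrow> x \<in> carrier (free_alg X) \<Longrightarrow> x * a \<in> K \<and> a * x \<in> K"
    "K \<subseteq> carrier (free_alg X)"
  shows "ideal K (free_alg X)"
proof (rule idealI)
  show "ring (free_alg X)" by (rule ring_free_alg)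
  have "inv\<^bsub>add_monoid (free_alg X)\<^esub> a = - a" if "a \<in> carrier (free_alg X)" for a :: "'g list \<Rightarrow>\<^sub>0 'k"
  proof -
    interpret ring "free_alg X :: ('g list \<Rightarrow>\<^sub>0 'k) ring" by (rule ring_free_alg)
    have "\<ominus>\<^bsub>free_alg X\<^esub> a = - a"
      using that by (intro minus_equality) (auto simp: supp_uminus)
    then show ?thesis by (simp add: a_inv_def)
  qed
  then show "subgroup K (add_monoid (free_alg X))"
    using assms(1-3,5) by unfold_locales (auto simp: subset_iff)
next
  fix a and x :: "'g list \<Rightarrow>\<^sub>0 'k" assume "a \<in> K" "x \<in> carrier (free_alg X)"
  from assms(4)[OF this] show "x \<otimes>\<^bsub>free_alg X\<^esub> a \<in> K" "a \<otimes>\<^bsub>free_alg X\<^esub> x \<in> K" by simp_all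
qed

lemma cls_eq: "cls X R a = (\<lambda>i. i + a) ` rel_ideal X R"
  by (auto simp: cls_def a_r_coset_def r_coset_def)

text \<open>\<open>descend\<close> takes \<open>the_elem\<close> of an image, so the image has to be
  a singleton: constancy along the coset bounds it above, and \<open>0\<close> in the ideal makes it
  nonempty.\<close>

lemma descend_cls:
  assumes "\<And>i. i \<in> rel_ideal X R \<Longrightarrow> h (i + a) = h a" "0 \<in> rel_ideal X R"
  shows "descend h (cls X R a) = h a"
proof -
  have "h ` cls X R a = {h a}" using assms by (auto simp: cls_eq image_iff)
  then show ?thesis by (simp add: descend_def)
qed

lemma carrier_presented: "carrier (presented X R) = cls X R ` carrier (free_alg X)"
  unfolding presented_def FactRing_def A_RCOSETS_def' cls_def by (simp only: partial_object.simps ring.simps monoid.simps) blast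

lemma zero_in_rel_ideal: "R \<subseteq> carrier (free_alg X) \<Longrightarrow> 0 \<in> rel_ideal X R"
  using additive_subgroup.zero_closed[OF ideal.axioms(1)[OF rel_ideal_ideal]]
  by (simp only: free_alg_simps)

section \<open>The Hecke operators on tensors\<close>

lemma lin_Psi [simp, intro]: "lin (Psi_gen q i)" by (simp add: Psi_gen_def)

lemma lin_Psi_comp: "lin T \<Longrightarrow> lin (\<lambda>v. Psi_gen q i (T v))"
  by (rule lin_comp[OF lin_Psi])

lemmas lin_intros = lin_Psi lin_Psi_comp lin_lin_ext lin_ext_comp lin_id lin_zero lin_plus lin_minus
  lin_scal_mult lin_left lin_right

lemmas Psi_simps = lin_add[OF lin_Psi] lin_scal[OF lin_Psi] lin_0[OF lin_Psi]
  lin_diff[OF lin_Psi] lin_uminus[OF lin_Psi]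

lemma Psi_Mvec: "Psi_gen q i (Mvec f) = M_act q i f" by (simp add: Psi_gen_def)

lemma place_left: "i < length f \<Longrightarrow> place (f @ g) i = place f i @ g"
  by (cases i) (simp_all add: place_def nth_append list_update_append1)

lemma place_right: "place (p @ f) (Suc i + length p) = p @ place f (Suc i)"
  by (simp add: place_def nth_append list_update_append)

lemma M_act_left: "i < length f \<Longrightarrow> M_act q i (f @ g) = M_act q i f * Mvec g"
  by (cases i)
    (simp_all add: M_act_def place_left nth_append distrib_right mult.assoc flip: Mvec_mult)

lemma M_act_right: "M_act q (Suc i + length p) (p @ f) = Mvec p * M_act q (Suc i) f"
  unfolding M_act_def place_right
  by (simp add: nth_append distrib_left scal_left_commute flip: Mvec_mult)

text \<open>\<open>M_act q i\<close> with \<open>i \<ge> 1\<close> reads the positions i - 1 and i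
  counted from 0, and \<open>M_act q 0\<close> reads the first letter. The quadratic and braid
  relations therefore reduce to words of at most three letters, the other letters being tensored on
  by this lemma and by \<open>Psi_right\<close>, which asks for \<open>1 \<le> i\<close> because the
  sign change stays at the left end.\<close>

lemma Psi_left:
  assumes "v \<in> tensors J n" "i < n" shows "Psi_gen q i (v * w) = Psi_gen q i v * w"
proof (rule lin_eq_tensors[OF _ _ assms(1), of "\<lambda>v. Psi_gen q i (v * w)" "\<lambda>v. Psi_gen q i v * w"])
  fix f assume f: "f \<in> words J n"
  show "Psi_gen q i (Mvec f * w) = Psi_gen q i (Mvec f) * w"
  proof (rule lin_eqM[of "\<lambda>w. Psi_gen q i (Mvec f * w)" "\<lambda>w. Psi_gen q i (Mvec f) * w" w])
    show "Psi_gen q i (Mvec f * Mvec g) = Psi_gen q i (Mvec f) * Mvec g" for g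
      using f assms(2) by (simp add: Mvec_mult Psi_Mvec M_act_left words_def)
  qed (intro lin_intros)+
qed (intro lin_intros)+

lemma Psi_right:
  assumes "u \<in> tensors J n" "1 \<le> i" shows "Psi_gen q (i + n) (u * v) = u * Psi_gen q i v"
proof (rule lin_eq_tensors[OF _ _ assms(1), of "\<lambda>u. Psi_gen q (i + n) (u * v)" "\<lambda>u. u * Psi_gen q i v"])
  fix f assume f: "f \<in> words J n"
  show "Psi_gen q (i + n) (Mvec f * v) = Mvec f * Psi_gen q i v"
  proof (rule lin_eqM[of "\<lambda>v. Psi_gen q (i + n) (Mvec f * v)" "\<lambda>v. Mvec f * Psi_gen q i v" v])
    show "Psi_gen q (i + n) (Mvec f * Mvec g) = Mvec f * Psi_gen q i (Mvec g)" for g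
      using f assms(2) M_act_right[of q "i - 1" f g] by (simp add: Mvec_mult Psi_Mvec words_def)
  qed (intro lin_intros)+
qed (intro lin_intros)+

lemma place_words:
  assumes "f \<in> words J n" "i < n" "i = 0 \<Longrightarrow> uminus ` J \<subseteq> J"
  shows "place f i \<in> words J n"
proof (cases "i = 0")
  case True
  with assms have "f ! 0 \<in> J" by (auto simp: words_def)
  with True assms set_update_subset_insert[of f 0 "- (f ! 0)"] show ?thesis
    by (auto simp: words_def place_def image_subset_iff)
next
  case False
  with assms have "set (f[i - 1 := f ! i, i := f ! (i - 1)]) = set f"
    by (intro set_swap) (auto simp: words_def)
  with False assms show ?thesis by (auto simp: words_def place_def)
qed

lemma M_act_tensors:
  assumes "f \<in> words J n" "i < n" "i = 0 \<Longrightarrow> uminus ` J \<subseteq> J"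
  shows "M_act q i f \<in> tensors J n"
  using place_words[OF assms] place_words[of f J n 0] assms
  by (auto simp: M_act_def intro!: tensors_add tensors_scal)

lemma Psi_tensors:
  assumes "v \<in> tensors J n" "i < n" "i = 0 \<Longrightarrow> uminus ` J \<subseteq> J"
  shows "Psi_gen q i v \<in> tensors J n"
  unfolding Psi_gen_def by (rule tensors_lin_ext[OF assms(1)]) (use M_act_tensors assms(2,3) in blast)

text \<open>The letter 0 is excluded because the sign change fixes it while the formula still adds
  the correction term, and 1 + q^{-1} - q is in general not a root of the quadratic
  relation.\<close>

lemma Psi_quad:
  fixes q :: "'k::field"
  assumes "q \<noteq> 0" "0 \<notin> J" "v \<in> tensors J n" "i < n"
  shows "Psi_gen q i (Psi_gen q i v) = v + scal (inverse q - q) * Psi_gen q i v"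
proof (rule lin_eq_tensors[OF _ _ assms(3), of "\<lambda>v. Psi_gen q i (Psi_gen q i v)"
      "\<lambda>v. v + scal (inverse q - q) * Psi_gen q i v"])
  fix f assume f: "f \<in> words J n"
  have zero: "Psi_gen q 0 (Psi_gen q 0 (Mvec [a])) = Mvec [a] + scal (inverse q - q) * Psi_gen q 0 (Mvec [a])"
    if "a \<noteq> 0" for a
    using that by (auto simp: Psi_simps Psi_Mvec M_act_def place_def)
  have one: "Psi_gen q 1 (Psi_gen q 1 (Mvec [a, b])) = Mvec [a, b] + scal (inverse q - q) * Psi_gen q 1 (Mvec [a, b])"
    for a b
    by (cases a b rule: linorder_cases; rule poly_mapping_eqI)
       (use assms(1) in \<open>simp_all add: Psi_simps Psi_Mvec M_act_def place_def lookup_add field_simps\<close>)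
  show "Psi_gen q i (Psi_gen q i (Mvec f)) = Mvec f + scal (inverse q - q) * Psi_gen q i (Mvec f)"
  proof (cases "i = 0")
    case True
    with f assms obtain a s where fa: "f = a # s" "a \<noteq> 0" by (cases f) (auto simp: words_def)
    have t: "Mvec [a] \<in> tensors UNIV 1" "Psi_gen q 0 (Mvec [a]) \<in> tensors UNIV 1"
      by (auto simp: words_def intro!: Psi_tensors)
    show ?thesis
      using zero[OF fa(2)] unfolding fa True Mvec_Cons[of a s]
      by (simp add: Psi_left[OF t(1)] Psi_left[OF t(2)] algebra_simps del: Mvec_Nil)
  next
    case False
    define p where "p = take (i - 1) f"
    define s where "s = drop (i + 1) f"
    have "f = p @ [f ! (i - 1), f ! i] @ s"
      unfolding p_def s_def using False f assms(4)
      by (cases i) (auto simp: words_def Cons_nth_drop_Suc id_take_nth_drop)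
    then obtain a b where fa: "f = p @ [a, b] @ s" by blast
    have p: "Mvec p \<in> tensors UNIV (i - 1)" using False f assms(4) by (auto simp: p_def words_def)
    have t: "Mvec [a, b] \<in> tensors UNIV 2" "Psi_gen q 1 (Mvec [a, b]) \<in> tensors UNIV 2"
      by (auto simp: words_def intro!: Psi_tensors)
    have L: "Psi_gen q 1 (y * z) = Psi_gen q 1 y * z" if "y \<in> tensors UNIV 2" for y z
      by (rule Psi_left[OF that]) simp
    have "i = 1 + (i - 1)" using False by simp
    then have R: "Psi_gen q i (Mvec p * v) = Mvec p * Psi_gen q 1 v" for v
      using Psi_right[OF p, of 1 q v] by simp
    show ?thesis
      unfolding fa Mvec_mult[symmetric] R L[OF t(1)] L[OF t(2)] one
      by (simp add: algebra_simps scal_left_commute)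
  qed
qed (intro lin_intros)+

lemma Psi_far:
  assumes "v \<in> tensors J n" "i < n" "j < n" "i + 1 < j"
  shows "Psi_gen q i (Psi_gen q j v) = Psi_gen q j (Psi_gen q i v)"
proof (rule lin_eq_tensors[OF _ _ assms(1), of "\<lambda>v. Psi_gen q i (Psi_gen q j v)"
      "\<lambda>v. Psi_gen q j (Psi_gen q i v)"])
  fix f assume f: "f \<in> words J n"
  \<comment> \<open>Cutting before position j - 1 leaves all letters read by
    \<open>Psi_gen q i\<close> on the left, since i < j - 1, and makes \<open>Psi_gen q j\<close>
    the first adjacent swap on the right.\<close>
  have fa: "Mvec f = Mvec (take (j - 1) f) * Mvec (drop (j - 1) f)" by (simp add: Mvec_mult)
  have t: "Mvec (take (j - 1) f) \<in> tensors UNIV (j - 1)" "Psi_gen q i (Mvec (take (j - 1) f)) \<in> tensors UNIV (j - 1)"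
    using f assms by (auto simp: words_def intro!: Psi_tensors)
  have R: "Psi_gen q j (w * v) = w * Psi_gen q 1 v" if "w \<in> tensors UNIV (j - 1)" for w v
    using Psi_right[OF that, of 1 q v] assms(4) by simp
  show "Psi_gen q i (Psi_gen q j (Mvec f)) = Psi_gen q j (Psi_gen q i (Mvec f))"
    unfolding fa using assms(4) by (simp add: R[OF t(1)] R[OF t(2)] Psi_left[OF t(1)] del: One_nat_def)
qed (intro lin_intros)+

lemma Psi_braid3:
  fixes q :: "'k::field"
  assumes "q \<noteq> 0"
  shows "Psi_gen q 1 (Psi_gen q 2 (Psi_gen q 1 (Mvec [a, b, c])))
       = Psi_gen q 2 (Psi_gen q 1 (Psi_gen q 2 (Mvec [a, b, c])))"
  by (cases a b rule: linorder_cases; cases b c rule: linorder_cases; cases a c rule: linorder_cases;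
      rule poly_mapping_eqI)
     (use assms in \<open>simp_all add: Psi_simps Psi_Mvec M_act_def place_def lookup_add numeral_2_eq_2 field_simps\<close>)

lemma Psi_braid:
  fixes q :: "'k::field"
  assumes "q \<noteq> 0" "v \<in> tensors J n" "1 \<le> i" "i + 1 < n"
  shows "Psi_gen q i (Psi_gen q (i + 1) (Psi_gen q i v)) = Psi_gen q (i + 1) (Psi_gen q i (Psi_gen q (i + 1) v))"
proof (rule lin_eq_tensors[OF _ _ assms(2), of "\<lambda>v. Psi_gen q i (Psi_gen q (i + 1) (Psi_gen q i v))"
      "\<lambda>v. Psi_gen q (i + 1) (Psi_gen q i (Psi_gen q (i + 1) v))"])
  fix f assume f: "f \<in> words J n"
  define p where "p = take (i - 1) f"
  define s where "s = drop (i + 2) f"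
  have "f = p @ [f ! (i - 1), f ! i, f ! (i + 1)] @ s"
    unfolding p_def s_def using f assms(3,4)
    by (cases i) (auto simp: words_def Cons_nth_drop_Suc)
  then obtain a b c where fa: "f = p @ [a, b, c] @ s" by blast
  have p: "Mvec p \<in> tensors UNIV (i - 1)" using f assms(4) by (auto simp: p_def words_def)
  have R: "Psi_gen q i (Mvec p * v) = Mvec p * Psi_gen q 1 v"
          "Psi_gen q (i + 1) (Mvec p * v) = Mvec p * Psi_gen q 2 v" for v
    using Psi_right[OF p, of 1 q v] Psi_right[OF p, of 2 q v] assms(3) by simp_all
  have L: "Psi_gen q 1 (y * z) = Psi_gen q 1 y * z" "Psi_gen q 2 (y * z) = Psi_gen q 2 y * z"
     if "y \<in> tensors UNIV 3" for y z using Psi_left[OF that] by auto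
  have T: "Psi_gen q 1 y \<in> tensors UNIV 3" "Psi_gen q 2 y \<in> tensors UNIV 3" if "y \<in> tensors UNIV 3" for y
    using that by (auto intro!: Psi_tensors)
  show "Psi_gen q i (Psi_gen q (i + 1) (Psi_gen q i (Mvec f)))
      = Psi_gen q (i + 1) (Psi_gen q i (Psi_gen q (i + 1) (Mvec f)))"
    unfolding fa Mvec_mult[symmetric] R by (simp add: L T words_def Psi_braid3[OF assms(1)] del: One_nat_def)
qed (intro lin_intros)+

text \<open>Sign changes turn a comparison of a with b into one of a with - b, so the outcome
  depends on the signs of both letters and on both comparisons.\<close>

lemma Psi_B2:
  fixes q :: "'k::field"
  assumes "q \<noteq> 0" "a \<noteq> 0" "b \<noteq> 0"
  shows "Psi_gen q 1 (Psi_gen q 0 (Psi_gen q 1 (Psi_gen q 0 (Mvec [a, b]))))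
       = Psi_gen q 0 (Psi_gen q 1 (Psi_gen q 0 (Psi_gen q 1 (Mvec [a, b]))))"
  by (cases a "0::rat" rule: linorder_cases; cases b "0::rat" rule: linorder_cases;
      cases a b rule: linorder_cases; cases a "- b" rule: linorder_cases; rule poly_mapping_eqI)
     (use assms in \<open>simp_all add: Psi_simps Psi_Mvec M_act_def place_def lookup_add field_simps\<close>)

lemma Psi_braid0:
  fixes q :: "'k::field"
  assumes "q \<noteq> 0" "0 \<notin> J" "v \<in> tensors J n" "1 < n"
  shows "Psi_gen q 1 (Psi_gen q 0 (Psi_gen q 1 (Psi_gen q 0 v)))
       = Psi_gen q 0 (Psi_gen q 1 (Psi_gen q 0 (Psi_gen q 1 v)))"
proof (rule lin_eq_tensors[OF _ _ assms(3), of "\<lambda>v. Psi_gen q 1 (Psi_gen q 0 (Psi_gen q 1 (Psi_gen q 0 v)))"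
      "\<lambda>v. Psi_gen q 0 (Psi_gen q 1 (Psi_gen q 0 (Psi_gen q 1 v)))"])
  fix f assume f: "f \<in> words J n"
  then obtain a b s where fa: "f = [a, b] @ s" "a \<noteq> 0" "b \<noteq> 0"
    using assms(2,4) by (cases f; cases "tl f") (auto simp: words_def)
  have L: "Psi_gen q 1 (y * z) = Psi_gen q 1 y * z" "Psi_gen q 0 (y * z) = Psi_gen q 0 y * z"
     if "y \<in> tensors UNIV 2" for y z using Psi_left[OF that] by auto
  have T: "Psi_gen q 1 y \<in> tensors UNIV 2" "Psi_gen q 0 y \<in> tensors UNIV 2" if "y \<in> tensors UNIV 2" for y
    using that by (auto intro!: Psi_tensors)
  show "Psi_gen q 1 (Psi_gen q 0 (Psi_gen q 1 (Psi_gen q 0 (Mvec f))))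
       = Psi_gen q 0 (Psi_gen q 1 (Psi_gen q 0 (Psi_gen q 1 (Mvec f))))"
    unfolding fa Mvec_mult[symmetric] by (simp add: L T words_def Psi_B2[OF assms(1) fa(2,3)] del: One_nat_def)
qed (intro lin_intros)+

section \<open>Right and left actions of free algebras\<close>

text \<open>\<open>fold\<close> applies the leftmost letter first, so products are reversed. This is
  \<open>free_right_act\<close> without the restriction to a subspace.\<close>

definition ract :: "('g \<Rightarrow> ('a::monoid_add \<Rightarrow>\<^sub>0 'k::field) \<Rightarrow> ('a \<Rightarrow>\<^sub>0 'k)) \<Rightarrow> ('g list \<Rightarrow>\<^sub>0 'k) \<Rightarrow> ('a \<Rightarrow>\<^sub>0 'k) \<Rightarrow> ('a \<Rightarrow>\<^sub>0 'k)" where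
  "ract op a v = lin_ext (\<lambda>w. fold op w v) a"

lemma lin_fold: "(\<And>g. lin (op g)) \<Longrightarrow> lin (fold op w)"
  by (induction w) (auto simp: lin_def comp_def)

lemma lin_ract_left: "lin (\<lambda>a. ract op a v)" by (simp add: ract_def)

lemma lin_ract: "(\<And>g. lin (op g)) \<Longrightarrow> lin (ract op a)"
  unfolding ract_def[abs_def] by (rule lin_ext_lin) (use lin_fold in blast)

lemma ract_0 [simp]: "ract op 0 v = 0" by (simp add: ract_def lin_ext_simps)
lemma ract_add: "ract op (a + b) v = ract op a v + ract op b v" by (simp add: ract_def lin_ext_simps)
lemma ract_diff: "ract op (a - b) v = ract op a v - ract op b v" by (simp add: ract_def lin_ext_simps)
lemma ract_uminus: "ract op (- b) v = - ract op b v" by (simp add: ract_def lin_ext_simps)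
lemma ract_single: "ract op (mono1 w) v = fold op w v" by (simp add: ract_def)
lemma ract_gen: "ract op (gen g) v = op g v" by (simp add: ract_def gen_def)
lemma ract_1: "ract op 1 v = v"
proof -
  have "fold op 0 v = v" by (simp add: zero_list_def)
  then show ?thesis using ract_single[of op 0 v] by simp
qed
lemma ract_scal: "ract op (scal c) v = scal c * v"
  using lin_scal[OF lin_ract_left[of op v], of c 1] by (simp add: ract_1)

lemma ract_mult:
  assumes "\<And>g. lin (op g)"
  shows "ract op (a * b) v = ract op b (ract op a v)"
proof -
  have *: "ract op (mono1 u * b) v = ract op b (ract op (mono1 u) v)" for u
  proof (rule lin_eq[of "\<lambda>b. ract op (mono1 u * b) v" "\<lambda>b. ract op b (ract op (mono1 u) v)"])
    show "ract op (mono1 u * mono1 w) v = ract op (mono1 w) (ract op (mono1 u) v)" for w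
      by (simp add: mono1_mult ract_single plus_list_def)
  qed (unfold ract_def, (intro lin_intros)+)
  show ?thesis
  proof (rule lin_eq[of "\<lambda>a. ract op (a * b) v" "\<lambda>a. ract op b (ract op a v)"])
    show "lin (\<lambda>a. ract op b (ract op a v))"
      by (rule lin_comp[OF lin_ract[OF assms] lin_ract_left])
    show "lin (\<lambda>a. ract op (a * b) v)"
      by (rule lin_comp[OF lin_ract_left]) (intro lin_right lin_id)
  qed (rule *)
qed

lemmas ract_simps = ract_add ract_diff ract_uminus ract_gen ract_1 ract_scal ract_mult

lemma free_right_act_ract: "free_right_act W op a = (\<lambda>v\<in>W. ract op a v)"
  by (simp add: free_right_act_def ract_def)

lemma fold_tensors:
  "(\<And>g v. g \<in> set w \<Longrightarrow> v \<in> W \<Longrightarrow> op g v \<in> W) \<Longrightarrow> v \<in> W \<Longrightarrow> fold op w v \<in> W"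
  by (induction w arbitrary: v) auto

lemma ract_tensors:
  assumes "\<And>g v. g \<in> X \<Longrightarrow> v \<in> tensors J n \<Longrightarrow> op g v \<in> tensors J n" "supp a \<subseteq> lists X" "v \<in> tensors J n"
  shows "ract op a v \<in> tensors J n"
  unfolding ract_def lin_ext_def
  by (intro tensors_sum tensors_scal fold_tensors) (use assms in auto)

text \<open>The annihilator of \<open>tensors J n\<close> is a two-sided ideal because the
  generators in X map this space to itself: in a product, a relation acts on a vector that lies in
  it again.\<close>

lemma ract_rel_ideal:
  fixes op :: "'g \<Rightarrow> (rat list \<Rightarrow>\<^sub>0 'k::field) \<Rightarrow> (rat list \<Rightarrow>\<^sub>0 'k)"
  assumes "\<And>g. lin (op g)" "\<And>g v. g \<in> X \<Longrightarrow> v \<in> tensors J n \<Longrightarrow> op g v \<in> tensors J n"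
    "\<And>a v. a \<in> R \<Longrightarrow> v \<in> tensors J n \<Longrightarrow> ract op a v = 0" "R \<subseteq> carrier (free_alg X)"
    "a \<in> rel_ideal X R" "v \<in> tensors J n"
  shows "ract op a v = 0"
proof -
  let ?K = "{a :: 'g list \<Rightarrow>\<^sub>0 'k. supp a \<subseteq> lists X \<and> (\<forall>v\<in>tensors J n. ract op a v = 0)}"
  have "ideal ?K (free_alg X)"
  proof (rule ideal_kernel)
    fix a and x :: "'g list \<Rightarrow>\<^sub>0 'k" assume a: "a \<in> ?K" "x \<in> carrier (free_alg X)"
    then show "x * a \<in> ?K \<and> a * x \<in> ?K"
      by (auto simp: ract_mult assms(1) supp_mult_lists lin_0[OF lin_ract[OF assms(1)]] ract_tensors[OF assms(2)])
  next
    fix a b assume "a \<in> ?K" "b \<in> ?K"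
    then show "a + b \<in> ?K" using subset_trans[OF keys_add[of a b], of "lists X"] by (simp add: ract_add)
  qed (auto simp: ract_uminus supp_uminus)
  moreover have "R \<subseteq> ?K"
  proof
    fix a assume "a \<in> R"
    with assms(4) have "a \<in> carrier (free_alg X)" by blast
    with assms(3) \<open>a \<in> R\<close> show "a \<in> ?K" by simp
  qed
  ultimately have "rel_ideal X R \<subseteq> ?K" by (rule rel_ideal_minimal[rotated])
  with assms(5,6) show ?thesis by auto
qed

lemma descend_free_right_act:
  fixes op :: "'g \<Rightarrow> (rat list \<Rightarrow>\<^sub>0 'k::field) \<Rightarrow> (rat list \<Rightarrow>\<^sub>0 'k)"
  assumes "\<And>g. lin (op g)" "\<And>g v. g \<in> X \<Longrightarrow> v \<in> tensors J n \<Longrightarrow> op g v \<in> tensors J n"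
    "\<And>a v. a \<in> R \<Longrightarrow> v \<in> tensors J n \<Longrightarrow> ract op a v = 0" "R \<subseteq> carrier (free_alg X)"
  shows "descend (free_right_act (tensors J n) op) (cls X R a) = (\<lambda>v\<in>tensors J n. ract op a v)"
proof -
  have "descend (free_right_act (tensors J n) op) (cls X R a) = free_right_act (tensors J n) op a"
  proof (rule descend_cls)
    fix i assume "i \<in> rel_ideal X R"
    then show "free_right_act (tensors J n) op (i + a) = free_right_act (tensors J n) op a"
      using ract_rel_ideal[OF assms] unfolding free_right_act_ract
      by (intro restrict_ext) (auto simp: ract_add)
  qed (rule zero_in_rel_ideal[OF assms(4)])
  then show ?thesis by (simp add: free_right_act_ract)
qed

text \<open>The family h is arbitrary so that one computation serves both the generators of the
  Hecke algebra and the \<open>DT i\<close> of the duplex algebra.\<close>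

lemma hecke_rels_Psi:
  fixes op :: "'g \<Rightarrow> (rat list \<Rightarrow>\<^sub>0 'k::field) \<Rightarrow> (rat list \<Rightarrow>\<^sub>0 'k)"
  assumes "\<And>g. lin (op g)" "\<And>i v. ract op (h i) v = Psi_gen q i v" "q \<noteq> 0" "0 \<notin> J" "l \<le> n"
    "v \<in> tensors J n" "a \<in> hecke_rels q l h"
  shows "ract op a v = 0"
proof -
  consider i where "i < l" "a = (h i - scal (inverse q)) * (h i + scal q)"
    | i where "1 \<le> i" "i + 1 < l" "a = h i * h (i + 1) * h i - h (i + 1) * h i * h (i + 1)"
    | i j where "i < l" "j < l" "i + 1 < j" "a = h i * h j - h j * h i"
    | "1 < l" "a = h 0 * h 1 * h 0 * h 1 - h 1 * h 0 * h 1 * h 0"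
    using assms(7) unfolding hecke_rels_def by (auto split: if_splits)
  then show ?thesis
  proof cases
    case 1
    then have "Psi_gen q i (Psi_gen q i v) = v + scal (inverse q - q) * Psi_gen q i v"
      by (intro Psi_quad[OF assms(3,4,6)]) (use assms(5) in auto)
    then show ?thesis
      using assms(3) by (simp add: 1 ract_simps assms(1,2) Psi_simps)
        (simp add: scal_diff algebra_simps scal_scal)
  next
    case 2
    then show ?thesis using Psi_braid[OF assms(3,6), of i] assms(5)
      by (simp add: ract_simps assms(1,2))
  next
    case 3
    then show ?thesis using Psi_far[OF assms(6), of i j] assms(5)
      by (simp add: ract_simps assms(1,2))
  next
    case 4
    then show ?thesis using Psi_braid0[OF assms(3,4,6)] assms(5)
      by (simp add: ract_simps assms(1,2))
  qed
qed

section \<open>Matsumoto's theorem for the symmetric group\<close>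

lemma perm_of_word_Nil [simp]: "perm_of_word [] = id" by (simp add: perm_of_word_def)
lemma perm_of_word_Cons [simp]: "perm_of_word (i # u) = transp i \<circ> perm_of_word u"
  by (simp add: perm_of_word_def)
lemma perm_of_word_append: "perm_of_word (u @ v) = perm_of_word u \<circ> perm_of_word v"
  by (induction u) (auto simp: comp_assoc)

lemma transp_transp [simp]: "transp i \<circ> transp i = id"
  by (auto simp: transp_def)

lemma comp_transp_transp [simp]: "\<sigma> \<circ> transp i \<circ> transp i = \<sigma>"
  by (simp add: comp_assoc)

lemma transp_Sym: "0 < i \<Longrightarrow> i < l \<Longrightarrow> transp i \<in> Sym l"
  by (auto simp: Sym_def transp_def intro: permutes_swap_id)

lemma comp_Sym: "\<sigma> \<in> Sym l \<Longrightarrow> \<tau> \<in> Sym l \<Longrightarrow> \<sigma> \<circ> \<tau> \<in> Sym l"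
  by (auto simp: Sym_def intro: permutes_compose)

lemma id_Sym [simp]: "id \<in> Sym l" by (simp add: Sym_def)

lemma perm_of_word_Sym: "set u \<subseteq> {1..<l} \<Longrightarrow> perm_of_word u \<in> Sym l"
  by (induction u) (auto intro!: comp_Sym transp_Sym)

definition inv_pairs :: "nat \<Rightarrow> (nat \<Rightarrow> nat) \<Rightarrow> (nat \<times> nat) set" where
  "inv_pairs l \<sigma> = {(a, b). a \<in> {1..l} \<and> b \<in> {1..l} \<and> a < b \<and> \<sigma> a > \<sigma> b}"

definition ninv :: "nat \<Rightarrow> (nat \<Rightarrow> nat) \<Rightarrow> nat" where
  "ninv l \<sigma> = card (inv_pairs l \<sigma>)"

lemma finite_inv_pairs: "finite (inv_pairs l \<sigma>)"
  by (rule finite_subset[of _ "{1..l} \<times> {1..l}"]) (auto simp: inv_pairs_def)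

text \<open>Composing with an adjacent transposition reverses the order of the single pair (i, i +
  1). It carries the inversions of \<sigma> to the other inversions of the product, and this one
  pair becomes a new inversion.\<close>

lemma ninv_up:
  assumes "0 < i" "i < l" "\<sigma> i < \<sigma> (i + 1)"
  shows "ninv l (\<sigma> \<circ> transp i) = ninv l \<sigma> + 1"
proof -
  let ?f = "\<lambda>(a, b). (transp i a, transp i b)"
  have t: "transp i i = i + 1" "transp i (Suc i) = i" "transp i (transp i a) = a" for a
    by (auto simp: transp_def)
  have o: "transp i a < transp i b \<longleftrightarrow> a < b \<and> (a, b) \<noteq> (i, i + 1) \<or> (a, b) = (i + 1, i)" for a b
    by (auto simp: transp_def transpose_def split: if_splits)
  have r: "transp i a \<in> {Suc 0..l} \<longleftrightarrow> a \<in> {Suc 0..l}" for a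
    using assms(1,2) by (auto simp: transp_def transpose_def split: if_splits)
  have "inv_pairs l (\<sigma> \<circ> transp i) = insert (i, i + 1) (?f ` inv_pairs l \<sigma>)"
  proof (rule equalityI; rule subsetI)
    fix p assume p: "p \<in> inv_pairs l (\<sigma> \<circ> transp i)"
    obtain a b where ab: "p = (a, b)" by (cases p)
    show "p \<in> insert (i, i + 1) (?f ` inv_pairs l \<sigma>)"
    proof (cases "p = (i, i + 1)")
      case False
      have "(transp i a, transp i b) \<in> inv_pairs l \<sigma>"
        using p False by (simp add: ab inv_pairs_def o r del: atLeastAtMost_iff)
      then show ?thesis by (auto simp: ab t intro!: image_eqI[of _ _ "(transp i a, transp i b)"])
    qed auto
  next
    fix p assume "p \<in> insert (i, i + 1) (?f ` inv_pairs l \<sigma>)"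
    then consider "p = (i, i + 1)" | a b where "(a, b) \<in> inv_pairs l \<sigma>" "p = (transp i a, transp i b)" by auto
    then show "p \<in> inv_pairs l (\<sigma> \<circ> transp i)"
    proof cases
      case 1 then show ?thesis using assms by (simp add: inv_pairs_def t)
    next
      case 2
      then show ?thesis using assms(3)
        by (auto simp add: inv_pairs_def o r t simp del: atLeastAtMost_iff)
    qed
  qed
  moreover have "(i, i + 1) \<notin> ?f ` inv_pairs l \<sigma>"
  proof
    assume "(i, i + 1) \<in> ?f ` inv_pairs l \<sigma>"
    then obtain a b where ab: "i = transp i a" "i + 1 = transp i b" "a < b" by (auto simp: inv_pairs_def)
    then have "a = i + 1" "b = i" using t by (metis, metis Suc_eq_plus1)
    with ab(3) show False by simp
  qed
  moreover have "inj_on ?f (inv_pairs l \<sigma>)"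
    by (rule inj_on_inverseI[of _ ?f]) (auto simp: t)
  ultimately show ?thesis
    by (simp add: ninv_def finite_inv_pairs card_image)
qed

lemma ninv_down:
  assumes "0 < i" "i < l" "\<sigma> (i + 1) < \<sigma> i"
  shows "ninv l \<sigma> = ninv l (\<sigma> \<circ> transp i) + 1"
proof -
  have "(\<sigma> \<circ> transp i) i < (\<sigma> \<circ> transp i) (i + 1)" using assms(3) by (simp add: transp_def)
  from ninv_up[OF assms(1,2) this] show ?thesis by (simp only: comp_transp_transp)
qed

lemma Sym_inj: "\<sigma> \<in> Sym l \<Longrightarrow> \<sigma> a = \<sigma> b \<longleftrightarrow> a = b"
  by (metis Sym_def inj_eq mem_Collect_eq permutes_inj)

lemma ninv_cases:
  assumes "0 < i" "i < l" "\<sigma> \<in> Sym l"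
  obtains "\<sigma> i < \<sigma> (i + 1)" "ninv l (\<sigma> \<circ> transp i) = ninv l \<sigma> + 1"
    | "\<sigma> (i + 1) < \<sigma> i" "ninv l \<sigma> = ninv l (\<sigma> \<circ> transp i) + 1"
  using Sym_inj[OF assms(3), of i "i + 1"] ninv_up[OF assms(1,2)] ninv_down[OF assms(1,2)]
  by (metis Suc_eq_plus1 n_not_Suc_n nat_neq_iff)

lemma ninv_id [simp]: "ninv l id = 0"
proof -
  have "inv_pairs l id = {}" by (auto simp: inv_pairs_def)
  then show ?thesis by (simp add: ninv_def)
qed

lemma ninv_word: "set u \<subseteq> {1..<l} \<Longrightarrow> ninv l (perm_of_word u) \<le> length u"
proof (induction u rule: rev_induct)
  case (snoc i u)
  then have i: "0 < i" "i < l" and u: "set u \<subseteq> {1..<l}" by auto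
  have p: "perm_of_word u \<in> Sym l" by (rule perm_of_word_Sym[OF u])
  have e: "perm_of_word (u @ [i]) = perm_of_word u \<circ> transp i" by (auto simp: perm_of_word_append)
  have "ninv l (perm_of_word u) \<le> length u" by (rule snoc.IH[OF u])
  then show ?case unfolding e by (rule_tac ninv_cases[OF i p]) (unfold length_append list.size, linarith+)
qed simp

lemma mono_perm_id:
  assumes "\<sigma> \<in> Sym l" "\<And>i. 0 < i \<Longrightarrow> i < l \<Longrightarrow> \<sigma> i < \<sigma> (i + 1)"
  shows "\<sigma> = id"
proof -
  have p: "\<sigma> permutes {1..l}" using assms(1) by (simp add: Sym_def)
  have ge: "i \<le> l \<Longrightarrow> i \<le> \<sigma> i" for i
  proof (induction i)
    case (Suc i)
    show ?case
    proof (cases "i = 0")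
      case True
      then show ?thesis using permutes_in_image[OF p, of 1] Suc by auto
    next
      case False
      then show ?thesis using Suc assms(2)[of i] by simp
    qed
  qed simp
  have le: "i \<le> \<sigma> i" for i
    using ge[of i] p by (cases "i \<le> l") (auto simp: permutes_def)
  show ?thesis
  proof
    fix i show "\<sigma> i = id i"
      using permutes_natset_ge[OF p] le by simp
  qed
qed

text \<open>Sorting by adjacent transpositions: a permutation other than the identity has a descent,
  and removing it costs one letter and one inversion.\<close>

lemma reduced_exists:
  "\<sigma> \<in> Sym l \<Longrightarrow> \<exists>u. set u \<subseteq> {1..<l} \<and> perm_of_word u = \<sigma> \<and> length u = ninv l \<sigma>"
proof (induction "ninv l \<sigma>" arbitrary: \<sigma>)
  case 0
  have "\<sigma> i < \<sigma> (i + 1)" if "0 < i" "i < l" for i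
    using ninv_cases[OF that 0(2)] 0(1) by (metis add_is_0 one_neq_zero)
  then have "\<sigma> = id" by (intro mono_perm_id[OF 0(2)])
  with 0 show ?case by (intro exI[of _ "[]"]) auto
next
  case (Suc n)
  have "\<sigma> \<noteq> id" using Suc(2) by (metis ninv_id nat.simps(3))
  then obtain i where i: "0 < i" "i < l" "\<not> \<sigma> i < \<sigma> (i + 1)"
    using mono_perm_id[OF Suc(3)] by blast
  have n: "ninv l \<sigma> = ninv l (\<sigma> \<circ> transp i) + 1"
    using ninv_cases[OF i(1,2) Suc(3)] i(3) by blast
  then have "\<exists>u. set u \<subseteq> {1..<l} \<and> perm_of_word u = \<sigma> \<circ> transp i \<and> length u = ninv l (\<sigma> \<circ> transp i)"
    using Suc i transp_Sym comp_Sym by (intro Suc(1)) auto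
  then obtain u where u: "set u \<subseteq> {1..<l}" "perm_of_word u = \<sigma> \<circ> transp i" "length u = ninv l (\<sigma> \<circ> transp i)"
    by blast
  then show ?case
    using i n by (intro exI[of _ "u @ [i]"]) (auto simp: perm_of_word_append)
qed

text \<open>Replaces the \<open>LEAST\<close> over all expressions by a count. A letter changes the
  number of inversions by one, which bounds word lengths below, and sorting attains the
  bound.\<close>

lemma len_ninv: "\<sigma> \<in> Sym l \<Longrightarrow> len l \<sigma> = ninv l \<sigma>"
  unfolding len_def
proof (rule Least_equality)
  assume "\<sigma> \<in> Sym l"
  then show "\<exists>u. is_expr l \<sigma> u \<and> length u = ninv l \<sigma>"
    using reduced_exists[of \<sigma> l] by (auto simp: is_expr_def)
qed (auto simp: is_expr_def ninv_word)

lemma reduced_expr: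
  assumes "\<sigma> \<in> Sym l"
  shows "set (reduced_expr l \<sigma>) \<subseteq> {1..<l}" "perm_of_word (reduced_expr l \<sigma>) = \<sigma>"
    "length (reduced_expr l \<sigma>) = ninv l \<sigma>"
proof -
  have "\<exists>u. is_expr l \<sigma> u \<and> length u = len l \<sigma>"
    using reduced_exists[OF assms] by (auto simp: is_expr_def len_ninv[OF assms])
  then have "is_expr l \<sigma> (reduced_expr l \<sigma>) \<and> length (reduced_expr l \<sigma>) = len l \<sigma>"
    unfolding reduced_expr_def by (rule someI_ex)
  then show "set (reduced_expr l \<sigma>) \<subseteq> {1..<l}" "perm_of_word (reduced_expr l \<sigma>) = \<sigma>"
    "length (reduced_expr l \<sigma>) = ninv l \<sigma>"
    by (auto simp: is_expr_def len_ninv[OF assms])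
qed

lemma transp_commute: "i + 1 < j \<Longrightarrow> transp i \<circ> transp j = transp j \<circ> transp i"
  by (auto simp: transp_def transpose_def fun_eq_iff)

lemma transp_braid: "transp i \<circ> transp (Suc i) \<circ> transp i = transp (Suc i) \<circ> transp i \<circ> transp (Suc i)"
  by (auto simp: transp_def transpose_def fun_eq_iff)

text \<open>Two reduced words ending in different letters \<open>i\<close>, \<open>j\<close> are both compared with a reduced word
  ending in the longest element of the dihedral group generated by \<open>s\<^sub>i\<close>, \<open>s\<^sub>j\<close>.\<close>

lemma matsumoto:
  fixes op :: "nat \<Rightarrow> 'a \<Rightarrow> 'a"
  assumes inv: "\<And>i x. 1 \<le> i \<Longrightarrow> i < l \<Longrightarrow> x \<in> W \<Longrightarrow> op i x \<in> W"
    and braid: "\<And>i x. 1 \<le> i \<Longrightarrow> i + 1 < l \<Longrightarrow> x \<in> W \<Longrightarrow>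
      op i (op (i + 1) (op i x)) = op (i + 1) (op i (op (i + 1) x))"
    and far: "\<And>i j x. 1 \<le> i \<Longrightarrow> i + 1 < j \<Longrightarrow> j < l \<Longrightarrow> x \<in> W \<Longrightarrow> op i (op j x) = op j (op i x)"
    and x: "x \<in> W"
  shows "\<lbrakk>set u \<subseteq> {1..<l}; set v \<subseteq> {1..<l}; perm_of_word u = perm_of_word v;
    length u = ninv l (perm_of_word u); length v = ninv l (perm_of_word v)\<rbrakk> \<Longrightarrow> fold op u x = fold op v x"
proof (induction "length u" arbitrary: u v rule: less_induct)
  case less
  note IH = less(1)
  define \<sigma> where "\<sigma> = perm_of_word u"
  have \<sigma>: "\<sigma> \<in> Sym l" "perm_of_word v = \<sigma>" "length u = ninv l \<sigma>" "length v = ninv l \<sigma>"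
    using less.prems by (auto simp: \<sigma>_def perm_of_word_Sym)
  have fW: "fold op t x \<in> W" if "set t \<subseteq> {1..<l}" for t
    using that by (intro fold_tensors x) (rule inv, auto)
  \<comment> \<open>Words ending in the same letter i: deleting it leaves two reduced words of
    \<sigma> s_i, which agree by induction. The second word is kept as t' @ w so that w can be one
    of the braid words below.\<close>
  have step: "fold op (t @ [i]) x = fold op (t' @ w) x"
    if "set t \<subseteq> {1..<l}" "set (t' @ w) \<subseteq> {1..<l}" "0 < i" "i < l" "perm_of_word (t @ [i]) = \<sigma>"
       "perm_of_word (t' @ w) = \<sigma>" "length t + 1 = ninv l \<sigma>" "length (t' @ w) = ninv l \<sigma>"
       "w \<noteq> []" "last w = i" for t t' w i
  proof -
    have p: "perm_of_word t = \<sigma> \<circ> transp i"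
      using that(5) by (auto simp: perm_of_word_append)
    have w: "t' @ w = (t' @ butlast w) @ [i]" using that(9,10) by (metis append.assoc append_butlast_last_id)
    have p': "perm_of_word (t' @ butlast w) = \<sigma> \<circ> transp i"
      using that(6) unfolding w perm_of_word_append[of _ "[i]"] by auto
    have l: "length (t' @ butlast w) = length t" using that(7,8,9) by (cases w) auto
    have "ninv l (perm_of_word t) \<le> length t" using that by (intro ninv_word)
    moreover have "ninv l \<sigma> \<le> ninv l (\<sigma> \<circ> transp i) + 1"
      by (rule ninv_cases[OF that(3,4) \<sigma>(1)]) auto
    ultimately have n: "ninv l (\<sigma> \<circ> transp i) = length t" using that(7) p by simp
    have "set (butlast w) \<subseteq> {1..<l}" using that(2) by (auto dest: in_set_butlastD)
    then have "fold op t x = fold op (t' @ butlast w) x"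
      using that n p p' l \<sigma>(3) by (intro IH) auto
    then show ?thesis unfolding w by (simp only: fold_append comp_apply)
  qed
  show ?case
  proof (cases u rule: rev_cases)
    case Nil
    then have "length v = 0" using \<sigma> by simp
    then show ?thesis using Nil by simp
  next
    case (snoc u' i)
    then obtain v' j where v: "v = v' @ [j]" using \<sigma> by (cases v rule: rev_cases) auto
    have ij: "0 < i" "i < l" "0 < j" "j < l" and sets: "set u' \<subseteq> {1..<l}" "set v' \<subseteq> {1..<l}"
      using less.prems snoc v by auto
    have desc: "\<sigma> (i + 1) < \<sigma> i" if "set t \<subseteq> {1..<l}" "0 < i" "i < l" "perm_of_word (t @ [i]) = \<sigma>"
      "length t + 1 = ninv l \<sigma>" for t i
    proof (rule ninv_cases[OF that(2,3) \<sigma>(1)])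
      assume "ninv l (\<sigma> \<circ> transp i) = ninv l \<sigma> + 1"
      moreover have "perm_of_word t = \<sigma> \<circ> transp i" using that(4) by (auto simp: perm_of_word_append)
      ultimately show ?thesis using ninv_word[OF that(1)] that(5) by simp
    qed
    have di: "\<sigma> (i + 1) < \<sigma> i" and dj: "\<sigma> (j + 1) < \<sigma> j"
      using desc[OF sets(1) ij(1,2)] desc[OF sets(2) ij(3,4)] snoc v \<sigma> \<sigma>_def by auto
    \<comment> \<open>Restricting to i \<le> j leaves three cases; the other order follows by
      exchanging the two words.\<close>
    have main: "fold op (a @ [i]) x = fold op (b @ [j]) x"
      if "i \<le> j" "set a \<subseteq> {1..<l}" "set b \<subseteq> {1..<l}" "0 < i" "i < l" "0 < j" "j < l"
        "perm_of_word (a @ [i]) = \<sigma>" "perm_of_word (b @ [j]) = \<sigma>"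
        "length a + 1 = ninv l \<sigma>" "length b + 1 = ninv l \<sigma>"
        "\<sigma> (i + 1) < \<sigma> i" "\<sigma> (j + 1) < \<sigma> j" for a b i j
    proof -
      note ij = that(4-7) and di = that(12) and dj = that(13)
      have n1: "ninv l \<sigma> = ninv l (\<sigma> \<circ> transp i) + 1" "ninv l \<sigma> = ninv l (\<sigma> \<circ> transp j) + 1"
        using ninv_down[OF ij(1,2) di] ninv_down[OF ij(3,4) dj] by auto
      have "i \<le> j" by (rule that(1))
      then consider "i = j" | "i + 1 < j" | "j = i + 1" by linarith
      then show ?thesis
      proof cases
        case 1
        then show ?thesis using that by (intro step) auto
      next
        case 2
        let ?\<tau> = "\<sigma> \<circ> transp i \<circ> transp j"
        \<comment> \<open>The positions moved by s_i and s_j are disjoint, so the descent at j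
          survives the removal of the one at i.\<close>
        have "(\<sigma> \<circ> transp i) (j + 1) < (\<sigma> \<circ> transp i) j" using 2 dj by (simp add: transp_def transpose_def)
        from ninv_down[of j l "\<sigma> \<circ> transp i", OF ij(3,4) this] n1 have n: "ninv l \<sigma> = ninv l ?\<tau> + 2" by simp
        have "?\<tau> \<in> Sym l" using \<sigma> ij by (intro comp_Sym transp_Sym)
        then obtain t where t: "set t \<subseteq> {1..<l}" "perm_of_word t = ?\<tau>" "length t = ninv l ?\<tau>"
          using reduced_exists by blast
        have pe: "perm_of_word (t @ [j, i]) = \<sigma>"
          using t by (simp add: perm_of_word_append comp_assoc[symmetric])
        have pe': "perm_of_word (t @ [i, j]) = \<sigma>"
          using pe transp_commute[OF 2] by (simp add: perm_of_word_append comp_assoc)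
        have "fold op (a @ [i]) x = fold op (t @ [j, i]) x"
          using t n pe that by (intro step) auto
        also have "\<dots> = fold op (t @ [i, j]) x"
          using far[of i j "fold op t x"] 2 ij fW[OF t(1)] by simp
        also have "\<dots> = fold op (b @ [j]) x"
          using t n pe' that by (intro step[symmetric]) auto
        finally show ?thesis .
      next
        case 3
        let ?\<tau> = "\<sigma> \<circ> transp i \<circ> transp j \<circ> transp i"
        \<comment> \<open>Here \<sigma> is decreasing on i, i + 1, i + 2, so all three letters of
          the longest element of the dihedral group can be removed, each lowering the number of
          inversions.\<close>
        have ineq: "\<sigma> (i + 2) < \<sigma> (i + 1)" using dj 3 by simp
        have "(\<sigma> \<circ> transp i) (j + 1) < (\<sigma> \<circ> transp i) j"
          using 3 di ineq by (simp add: transp_def transpose_def)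
        from ninv_down[of j l "\<sigma> \<circ> transp i", OF ij(3,4) this] n1 have n: "ninv l \<sigma> = ninv l (\<sigma> \<circ> transp i \<circ> transp j) + 2" by simp
        have "(\<sigma> \<circ> transp i \<circ> transp j) (i + 1) < (\<sigma> \<circ> transp i \<circ> transp j) i"
          using 3 di ineq by (simp add: transp_def transpose_def)
        from ninv_down[of i l "\<sigma> \<circ> transp i \<circ> transp j", OF ij(1,2) this] n have n: "ninv l \<sigma> = ninv l ?\<tau> + 3" by simp
        have "?\<tau> \<in> Sym l" using \<sigma> ij by (intro comp_Sym transp_Sym)
        then obtain t where t: "set t \<subseteq> {1..<l}" "perm_of_word t = ?\<tau>" "length t = ninv l ?\<tau>"
          using reduced_exists by blast
        have pe: "perm_of_word (t @ [i, j, i]) = \<sigma>"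
          using t by (simp add: perm_of_word_append comp_assoc[symmetric])
        have "transp i \<circ> transp j \<circ> transp i = transp j \<circ> transp i \<circ> transp j"
          using transp_braid[of i] 3 by simp
        then have pe': "perm_of_word (t @ [j, i, j]) = \<sigma>"
          using pe by (simp add: perm_of_word_append comp_assoc)
        have "fold op (a @ [i]) x = fold op (t @ [i, j, i]) x"
          using t n pe that by (intro step) auto
        also have "\<dots> = fold op (t @ [j, i, j]) x"
          using braid[of i "fold op t x"] 3 ij fW[OF t(1)] by simp
        also have "\<dots> = fold op (b @ [j]) x"
          using t n pe' that by (intro step[symmetric]) auto
        finally show ?thesis .
      qed
    qed
    show ?thesis
    proof (cases "i \<le> j")
      case True
      then show ?thesis unfolding snoc v using sets ij di dj \<sigma> snoc v \<sigma>_def by (intro main) auto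
    next
      case False
      then show ?thesis unfolding snoc v using sets ij di dj \<sigma> snoc v \<sigma>_def by (intro main[symmetric]) auto
    qed
  qed
qed

section \<open>The tensor algebra as a module algebra\<close>

text \<open>The coproduct unrolled along a word: the first letter is split off and the generator is
  distributed over it and the rest. The empty word carries the counit, so all tensor powers are
  treated at once.\<close>

primrec gact :: "'k::field \<Rightarrow> rat list \<Rightarrow> qgen \<Rightarrow> (rat list \<Rightarrow>\<^sub>0 'k)" where
  "gact q [] = (\<lambda>g. case g of qE i \<Rightarrow> 0 | qF i \<Rightarrow> 0 | qK i \<Rightarrow> 1 | qKinv i \<Rightarrow> 1)"
| "gact q (j # f) = (\<lambda>g. case g of
      qE i \<Rightarrow> eta j * gact q f (qE i) + eta_act q (qE i) j * gact q f (qKinv i)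
    | qF i \<Rightarrow> eta_act q (qF i) j * Mvec f + eta_act q (qK i) j * gact q f (qF i)
    | qK i \<Rightarrow> eta_act q (qK i) j * gact q f (qK i)
    | qKinv i \<Rightarrow> eta_act q (qKinv i) j * gact q f (qKinv i))"

definition gop :: "'k::field \<Rightarrow> qgen \<Rightarrow> (rat list \<Rightarrow>\<^sub>0 'k) \<Rightarrow> (rat list \<Rightarrow>\<^sub>0 'k)" where
  "gop q g = lin_ext (\<lambda>f. gact q f g)"

lemma lin_gop [simp, intro]: "lin (gop q g)" by (simp add: gop_def)

lemma lin_gop_comp: "lin T \<Longrightarrow> lin (\<lambda>v. gop q g (T v))"
  by (rule lin_comp[OF lin_gop])

lemmas lin_intros' = lin_intros lin_gop lin_gop_comp

lemmas gop_lin = lin_add[OF lin_gop] lin_scal[OF lin_gop] lin_0[OF lin_gop]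
  lin_diff[OF lin_gop] lin_uminus[OF lin_gop]

lemma gop_Mvec: "gop q g (Mvec f) = gact q f g" by (simp add: gop_def)

lemma gop_1: "gop q g 1 = (case g of qE i \<Rightarrow> 0 | qF i \<Rightarrow> 0 | qK i \<Rightarrow> 1 | qKinv i \<Rightarrow> 1)"
  using gop_Mvec[of q g "[]"] by simp

lemma gop_eta: "gop q g (eta j) = eta_act q g j"
  by (cases g) (simp_all add: gop_Mvec)

lemma gop_K_mult: "gop q (qK i) (x * y) = gop q (qK i) x * gop q (qK i) y"
proof (rule bilin_eqM[of "\<lambda>x y. gop q (qK i) (x * y)" "\<lambda>x y. gop q (qK i) x * gop q (qK i) y"])
  show "gop q (qK i) (Mvec f * Mvec g) = gop q (qK i) (Mvec f) * gop q (qK i) (Mvec g)" for f g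
    by (induction f) (simp_all add: Mvec_mult gop_Mvec gop_1 mult.assoc)
qed (intro lin_intros')+

lemma gop_Kinv_mult: "gop q (qKinv i) (x * y) = gop q (qKinv i) x * gop q (qKinv i) y"
proof (rule bilin_eqM[of "\<lambda>x y. gop q (qKinv i) (x * y)" "\<lambda>x y. gop q (qKinv i) x * gop q (qKinv i) y"])
  show "gop q (qKinv i) (Mvec f * Mvec g) = gop q (qKinv i) (Mvec f) * gop q (qKinv i) (Mvec g)" for f g
    by (induction f) (simp_all add: Mvec_mult gop_Mvec gop_1 mult.assoc)
qed (intro lin_intros')+

text \<open>The recursion of \<open>gact\<close> splits after one letter; coassociativity, in the
  form of the induction on f, gives the same rule for a split at any place.\<close>

lemma gop_E_mult: "gop q (qE i) (x * y) = x * gop q (qE i) y + gop q (qE i) x * gop q (qKinv i) y"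
proof (rule bilin_eqM[of "\<lambda>x y. gop q (qE i) (x * y)" "\<lambda>x y. x * gop q (qE i) y + gop q (qE i) x * gop q (qKinv i) y"])
  show "gop q (qE i) (Mvec f * Mvec g) = Mvec f * gop q (qE i) (Mvec g) + gop q (qE i) (Mvec f) * gop q (qKinv i) (Mvec g)" for f g
  proof (induction f)
    case (Cons j f)
    have "gop q (qE i) (Mvec (j # f) * Mvec g)
        = eta j * gop q (qE i) (Mvec f * Mvec g) + eta_act q (qE i) j * gop q (qKinv i) (Mvec f * Mvec g)"
      by (simp add: Mvec_mult gop_Mvec)
    also have "\<dots> = Mvec (j # f) * gop q (qE i) (Mvec g) + gop q (qE i) (Mvec (j # f)) * gop q (qKinv i) (Mvec g)"
      unfolding Cons gop_Kinv_mult
      by (simp add: gop_Mvec distrib_left distrib_right mult.assoc del: eta_act.simps)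
        (simp add: Mvec_mult mult.assoc[symmetric])
    finally show ?case .
  qed (simp add: gop_1)
qed (intro lin_intros')+

lemma gop_F_mult: "gop q (qF i) (x * y) = gop q (qF i) x * y + gop q (qK i) x * gop q (qF i) y"
proof (rule bilin_eqM[of "\<lambda>x y. gop q (qF i) (x * y)" "\<lambda>x y. gop q (qF i) x * y + gop q (qK i) x * gop q (qF i) y"])
  show "gop q (qF i) (Mvec f * Mvec g) = gop q (qF i) (Mvec f) * Mvec g + gop q (qK i) (Mvec f) * gop q (qF i) (Mvec g)" for f g
  proof (induction f)
    case (Cons j f)
    have "gop q (qF i) (Mvec (j # f) * Mvec g)
        = eta_act q (qF i) j * (Mvec f * Mvec g) + eta_act q (qK i) j * gop q (qF i) (Mvec f * Mvec g)"
      by (simp add: Mvec_mult gop_Mvec)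
    also have "\<dots> = gop q (qF i) (Mvec (j # f)) * Mvec g + gop q (qK i) (Mvec (j # f)) * gop q (qF i) (Mvec g)"
      unfolding Cons by (simp add: gop_Mvec algebra_simps del: eta_act.simps)
    finally show ?case .
  qed (simp add: gop_1)
qed (intro lin_intros')+

lemmas gop_mult = gop_K_mult gop_Kinv_mult gop_E_mult gop_F_mult

lemma scal_pull:
  "gop q g x * (scal c * w) = scal c * (gop q g x * w)"
  "Mvec f * (scal c * w) = scal c * (Mvec f * w)"
  by (rule scal_left_commute)+

lemma tensor_induct_eq:
  assumes "lin S" "lin T" "S 1 = T 1" "\<And>j y. S y = T y \<Longrightarrow> S (eta j * y) = T (eta j * y)"
  shows "S v = T v"
proof (rule lin_eqM[OF assms(1,2)])
  show "S (Mvec f) = T (Mvec f)" for f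
  proof (induction f)
    case (Cons j f)
    then show ?case unfolding Mvec_Cons[of j f] by (rule assms(4))
  qed (simp add: assms(3))
qed

text \<open>Codes the half-integer n + 1/2 by n. Then \<open>qE i\<close> moves i to i - 1,
  \<open>qF i\<close> moves i - 1 to i, negation is n \<mapsto> - n - 1, and comparisons of letters
  become integer arithmetic.\<close>

definition hf :: "int \<Rightarrow> rat" where "hf n = of_int n + 1/2"

lemma hf_inj [simp]: "hf a = hf b \<longleftrightarrow> a = b" by (simp add: hf_def)

lemma eta_act_hf:
  "eta_act q (qE i) (hf n) = (if n = i then eta (hf (i - 1)) else 0)"
  "eta_act q (qF i) (hf n) = (if n = i - 1 then eta (hf i) else 0)"
  "eta_act q (qK i) (hf n) = (if n = i - 1 then scal q * eta (hf n) else if n = i then scal (inverse q) * eta (hf n) else eta (hf n))"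
  "eta_act q (qKinv i) (hf n) = (if n = i - 1 then scal (inverse q) * eta (hf n) else if n = i then scal q * eta (hf n) else eta (hf n))"
proof -
  have e: "of_int i - 1/2 = hf (i - 1)" "of_int i + 1/2 = hf i" by (simp_all add: hf_def)
  show "eta_act q (qE i) (hf n) = (if n = i then eta (hf (i - 1)) else 0)"
  "eta_act q (qF i) (hf n) = (if n = i - 1 then eta (hf i) else 0)"
  "eta_act q (qK i) (hf n) = (if n = i - 1 then scal q * eta (hf n) else if n = i then scal (inverse q) * eta (hf n) else eta (hf n))"
  "eta_act q (qKinv i) (hf n) = (if n = i - 1 then scal (inverse q) * eta (hf n) else if n = i then scal q * eta (hf n) else eta (hf n))"
    unfolding eta_act.simps e hf_inj by (rule refl)+
qed

text \<open>Letters that are not half-integers form trivial modules. With them the defining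
  relations hold on the whole tensor algebra, for all rational letters.\<close>

lemma eta_act_other:
  assumes "j \<notin> range hf"
  shows "eta_act q (qE i) j = 0" "eta_act q (qF i) j = 0" "eta_act q (qK i) j = eta j"
    "eta_act q (qKinv i) j = eta j"
proof -
  have "j \<noteq> hf (i - 1)" "j \<noteq> hf i" using assms by auto
  then have "j \<noteq> of_int i - 1/2" "j \<noteq> of_int i + 1/2" by (simp_all add: hf_def)
  then show "eta_act q (qE i) j = 0" "eta_act q (qF i) j = 0" "eta_act q (qK i) j = eta j"
    "eta_act q (qKinv i) j = eta j" by simp_all
qed

lemma letter_cases:
  assumes "j \<notin> range hf \<Longrightarrow> P j" "\<And>n. P (hf n)" shows "P j"
  using assms by (cases "j \<in> range hf") auto

lemmas letter_simps = gop_eta eta_act_hf eta_act_other gop_lin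

context
  fixes q :: "'k::field"
  assumes q0: "q \<noteq> 0"
begin

lemma gop_K_Kinv [simp]: "gop q (qK i) (gop q (qKinv i) v) = v"
proof (rule tensor_induct_eq[where v = v])
  fix j and y :: "rat list \<Rightarrow>\<^sub>0 'k" assume "gop q (qK i) (gop q (qKinv i) y) = y"
  moreover have "gop q (qK i) (gop q (qKinv i) (eta j)) = eta j"
    by (rule letter_cases[of j]) (use q0 in \<open>simp_all add: letter_simps scal_scal del: eta_act.simps\<close>)
  ultimately show "gop q (qK i) (gop q (qKinv i) (eta j * y)) = eta j * y" by (simp add: gop_mult)
qed (simp add: gop_1 | intro lin_intros')+

lemma gop_Kinv_K [simp]: "gop q (qKinv i) (gop q (qK i) v) = v"
proof (rule tensor_induct_eq[where v = v])
  fix j and y :: "rat list \<Rightarrow>\<^sub>0 'k" assume "gop q (qKinv i) (gop q (qK i) y) = y"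
  moreover have "gop q (qKinv i) (gop q (qK i) (eta j)) = eta j"
    by (rule letter_cases[of j]) (use q0 in \<open>simp_all add: letter_simps scal_scal del: eta_act.simps\<close>)
  ultimately show "gop q (qKinv i) (gop q (qK i) (eta j * y)) = eta j * y" by (simp add: gop_mult)
qed (simp add: gop_1 | intro lin_intros')+

lemma gop_K_K: "gop q (qK i) (gop q (qK j) v) = gop q (qK j) (gop q (qK i) v)"
proof (rule tensor_induct_eq[where v = v])
  fix a and y :: "rat list \<Rightarrow>\<^sub>0 'k" assume "gop q (qK i) (gop q (qK j) y) = gop q (qK j) (gop q (qK i) y)"
  moreover have "gop q (qK i) (gop q (qK j) (eta a)) = gop q (qK j) (gop q (qK i) (eta a))"
    by (rule letter_cases[of a]) (use q0 in \<open>simp_all add: letter_simps scal_scal mult.commute del: eta_act.simps\<close>)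
  ultimately show "gop q (qK i) (gop q (qK j) (eta a * y)) = gop q (qK j) (gop q (qK i) (eta a * y))"
    by (simp add: gop_mult)
qed (simp add: gop_1 | intro lin_intros')+

lemma gop_K_Kinv_commute: "gop q (qK i) (gop q (qKinv j) v) = gop q (qKinv j) (gop q (qK i) v)"
  by (metis gop_K_K gop_K_Kinv gop_Kinv_K)

lemma gop_Kinv_Kinv: "gop q (qKinv i) (gop q (qKinv j) v) = gop q (qKinv j) (gop q (qKinv i) v)"
  by (metis gop_K_Kinv_commute gop_K_Kinv gop_Kinv_K)

lemma gop_K_E: "gop q (qK i) (gop q (qE j) v) = scal (q powi cartan i j) * gop q (qE j) (gop q (qK i) v)"
proof (rule tensor_induct_eq[where v = v])
  fix a and y :: "rat list \<Rightarrow>\<^sub>0 'k"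
  assume y: "gop q (qK i) (gop q (qE j) y) = scal (q powi cartan i j) * gop q (qE j) (gop q (qK i) y)"
  have "gop q (qK i) (gop q (qE j) (eta a)) = scal (q powi cartan i j) * gop q (qE j) (gop q (qK i) (eta a))"
    by (rule letter_cases[of a])
       (use q0 in \<open>auto simp: letter_simps scal_scal cartan_def power_int_minus power2_eq_square mult.assoc simp del: eta_act.simps\<close>)
  then show "gop q (qK i) (gop q (qE j) (eta a * y))
      = scal (q powi cartan i j) * gop q (qE j) (gop q (qK i) (eta a * y))"
    by (simp add: gop_mult gop_lin y gop_K_Kinv_commute distrib_left mult.assoc scal_left_commute)
qed (simp add: gop_1 gop_lin | intro lin_intros')+

lemma gop_K_F: "gop q (qK i) (gop q (qF j) v) = scal (q powi (- cartan i j)) * gop q (qF j) (gop q (qK i) v)"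
proof (rule tensor_induct_eq[where v = v])
  fix a and y :: "rat list \<Rightarrow>\<^sub>0 'k"
  assume y: "gop q (qK i) (gop q (qF j) y) = scal (q powi (- cartan i j)) * gop q (qF j) (gop q (qK i) y)"
  have "gop q (qK i) (gop q (qF j) (eta a)) = scal (q powi (- cartan i j)) * gop q (qF j) (gop q (qK i) (eta a))"
    by (rule letter_cases[of a])
       (use q0 in \<open>auto simp: letter_simps scal_scal cartan_def power_int_minus power2_eq_square mult.assoc simp del: eta_act.simps\<close>)
  then show "gop q (qK i) (gop q (qF j) (eta a * y))
      = scal (q powi (- cartan i j)) * gop q (qF j) (gop q (qK i) (eta a * y))"
    by (simp add: gop_mult gop_lin y gop_K_K[of j i] distrib_left mult.assoc scal_left_commute)
qed (simp add: gop_1 gop_lin | intro lin_intros')+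

lemma gop_Kinv_E: "gop q (qKinv i) (gop q (qE j) v) = scal (q powi (- cartan i j)) * gop q (qE j) (gop q (qKinv i) v)"
proof -
  have "gop q (qKinv i) (gop q (qE j) v) = gop q (qKinv i) (gop q (qE j) (gop q (qK i) (gop q (qKinv i) v)))" by simp
  also have "\<dots> = scal (q powi (- cartan i j)) * gop q (qKinv i) (gop q (qK i) (gop q (qE j) (gop q (qKinv i) v)))"
    unfolding gop_K_E using q0 by (simp add: gop_lin scal_scal power_int_minus)
  finally show ?thesis by simp
qed

lemma gop_Kinv_F: "gop q (qKinv i) (gop q (qF j) v) = scal (q powi cartan i j) * gop q (qF j) (gop q (qKinv i) v)"
proof -
  have "gop q (qKinv i) (gop q (qF j) v) = gop q (qKinv i) (gop q (qF j) (gop q (qK i) (gop q (qKinv i) v)))" by simp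
  also have "\<dots> = scal (q powi cartan i j) * gop q (qKinv i) (gop q (qK i) (gop q (qF j) (gop q (qKinv i) v)))"
    unfolding gop_K_F using q0 by (simp add: gop_lin scal_scal power_int_minus)
  finally show ?thesis by simp
qed

lemma gop_E_F:
  assumes "q - inverse q \<noteq> 0"
  shows "gop q (qE i) (gop q (qF j) v) = gop q (qF j) (gop q (qE i) v)
    + (if i = j then scal (1 / (q - inverse q)) * (gop q (qK i) v - gop q (qKinv i) v) else 0)"
proof (rule tensor_induct_eq[where v = v])
  fix a and y :: "rat list \<Rightarrow>\<^sub>0 'k"
  let ?c = "scal (1 / (q - inverse q)) :: rat list \<Rightarrow>\<^sub>0 'k"
  assume y: "gop q (qE i) (gop q (qF j) y) = gop q (qF j) (gop q (qE i) y)
    + (if i = j then ?c * (gop q (qK i) y - gop q (qKinv i) y) else 0)"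
  have a: "gop q (qE i) (gop q (qF j) (eta a)) = gop q (qF j) (gop q (qE i) (eta a))
    + (if i = j then ?c * (gop q (qK i) (eta a) - gop q (qKinv i) (eta a)) else 0)"
  proof (rule letter_cases[of a])
    fix n
    have s: "scal q * v - scal (inverse q) * v = scal (q - inverse q) * v"
      "scal (inverse q) * v - scal q * v = scal (inverse q - q) * v" for v :: "rat list \<Rightarrow>\<^sub>0 'k"
      by (simp_all add: scal_diff scal_uminus algebra_simps)
    have "inverse q - q = - (q - inverse q)" by simp
    then have "1 / (q - inverse q) * (inverse q - q) = - 1" using assms by (simp only: mult_minus_right) simp
    then have t: "?c * (scal (q - inverse q) * v) = v" "?c * (scal (inverse q - q) * v) = - v" for v
      unfolding scal_scal using assms by (simp_all add: scal_uminus)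
    show "gop q (qE i) (gop q (qF j) (eta (hf n))) = gop q (qF j) (gop q (qE i) (eta (hf n)))
      + (if i = j then ?c * (gop q (qK i) (eta (hf n)) - gop q (qKinv i) (eta (hf n))) else 0)"
      by (auto simp: letter_simps s t simp del: eta_act.simps)
  qed (simp add: letter_simps del: eta_act.simps)
  \<comment> \<open>Mixed terms of the coproducts of EF and FE: moving K past E and K^{-1} past F
    produces the same power of q because the Cartan matrix is symmetric, so these terms
    cancel.\<close>
  have c: "gop q (qE i) (gop q (qK j) (eta a)) * gop q (qKinv i) (gop q (qF j) y)
      = gop q (qK j) (gop q (qE i) (eta a)) * gop q (qF j) (gop q (qKinv i) y)"
    unfolding gop_K_E gop_Kinv_F
    by (simp add: scal_pull mult.assoc cartan_def abs_minus_commute)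
  show "gop q (qE i) (gop q (qF j) (eta a * y)) = gop q (qF j) (gop q (qE i) (eta a * y))
    + (if i = j then ?c * (gop q (qK i) (eta a * y) - gop q (qKinv i) (eta a * y)) else 0)"
    by (simp add: gop_mult gop_lin a y c, simp add: algebra_simps scal_left_commute)
next
  show "lin (\<lambda>v. gop q (qF j) (gop q (qE i) v)
    + (if i = j then scal (1 / (q - inverse q)) * (gop q (qK i) v - gop q (qKinv i) v) else 0))"
  proof (cases "i = j")
    case True
    show ?thesis unfolding True by (simp only: refl if_True) (intro lin_intros')
  next
    case False
    show ?thesis unfolding if_not_P[OF False] by (intro lin_intros')
  qed
qed (simp add: gop_1 gop_lin | intro lin_intros')+

lemma gop_E_E_far:
  assumes "\<bar>i - j\<bar> > 1"
  shows "gop q (qE i) (gop q (qE j) v) = gop q (qE j) (gop q (qE i) v)"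
proof (rule tensor_induct_eq[where v = v])
  fix a and y :: "rat list \<Rightarrow>\<^sub>0 'k"
  assume y: "gop q (qE i) (gop q (qE j) y) = gop q (qE j) (gop q (qE i) y)"
  have a: "gop q (qE i) (gop q (qE j) (eta a)) = gop q (qE j) (gop q (qE i) (eta a))"
    by (rule letter_cases[of a]) (use assms in \<open>auto simp: letter_simps simp del: eta_act.simps\<close>)
  have c: "cartan i j = 0" "cartan j i = 0" using assms by (auto simp: cartan_def)
  show "gop q (qE i) (gop q (qE j) (eta a * y)) = gop q (qE j) (gop q (qE i) (eta a * y))"
    by (simp add: gop_mult gop_lin a y gop_Kinv_E c gop_Kinv_Kinv[of i j] algebra_simps)
qed (simp add: gop_1 gop_lin | intro lin_intros')+

lemma gop_F_F_far:
  assumes "\<bar>i - j\<bar> > 1"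
  shows "gop q (qF i) (gop q (qF j) v) = gop q (qF j) (gop q (qF i) v)"
proof (rule tensor_induct_eq[where v = v])
  fix a and y :: "rat list \<Rightarrow>\<^sub>0 'k"
  assume y: "gop q (qF i) (gop q (qF j) y) = gop q (qF j) (gop q (qF i) y)"
  have a: "gop q (qF i) (gop q (qF j) (eta a)) = gop q (qF j) (gop q (qF i) (eta a))"
    by (rule letter_cases[of a]) (use assms in \<open>auto simp: letter_simps simp del: eta_act.simps\<close>)
  have c: "cartan i j = 0" "cartan j i = 0" using assms by (auto simp: cartan_def)
  show "gop q (qF i) (gop q (qF j) (eta a * y)) = gop q (qF j) (gop q (qF i) (eta a * y))"
    by (simp add: gop_mult gop_lin a y gop_K_F c gop_K_K[of i j] algebra_simps)
qed (simp add: gop_1 gop_lin | intro lin_intros')+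

lemma gop_E_Serre:
  assumes "\<bar>i - j\<bar> = 1"
  shows "gop q (qE i) (gop q (qE i) (gop q (qE j) v)) =
    scal (q + inverse q) * gop q (qE i) (gop q (qE j) (gop q (qE i) v)) - gop q (qE j) (gop q (qE i) (gop q (qE i) v))"
proof (rule tensor_induct_eq[where v = v])
  fix a and y :: "rat list \<Rightarrow>\<^sub>0 'k"
  assume y: "gop q (qE i) (gop q (qE i) (gop q (qE j) y)) =
    scal (q + inverse q) * gop q (qE i) (gop q (qE j) (gop q (qE i) y)) - gop q (qE j) (gop q (qE i) (gop q (qE i) y))"
  \<comment> \<open>On one letter every cubic monomial of the relation vanishes, as each generator
    only connects two fixed letters. The mixed terms of the coproduct remain, and there the powers
    of q balance.\<close>
  have a: "gop q (qE i) (gop q (qE i) (eta a)) = 0" "gop q (qE i) (gop q (qE j) (gop q (qE i) (eta a))) = 0"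
    "gop q (qE i) (gop q (qE i) (gop q (qE j) (eta a))) = 0"
    by (rule letter_cases[of a]; use assms in \<open>auto simp: letter_simps simp del: eta_act.simps\<close>)+
  have c: "cartan i i = 2" "cartan i j = -1" "cartan j i = -1" using assms by (auto simp: cartan_def)
  show "gop q (qE i) (gop q (qE i) (gop q (qE j) (eta a * y))) =
    scal (q + inverse q) * gop q (qE i) (gop q (qE j) (gop q (qE i) (eta a * y))) - gop q (qE j) (gop q (qE i) (gop q (qE i) (eta a * y)))"
    by (rule poly_mapping_eqI)
       (use q0 in \<open>simp add: gop_mult gop_lin a y gop_Kinv_E c gop_Kinv_Kinv[of i j] lookup_add lookup_minus
         distrib_left distrib_right right_diff_distrib left_diff_distrib scal_pull scal_scal mult.assoc power_int_minus field_simps power2_eq_square\<close>)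
qed (simp add: gop_1 gop_lin | intro lin_intros')+

lemma gop_F_Serre:
  assumes "\<bar>i - j\<bar> = 1"
  shows "gop q (qF i) (gop q (qF i) (gop q (qF j) v)) =
    scal (q + inverse q) * gop q (qF i) (gop q (qF j) (gop q (qF i) v)) - gop q (qF j) (gop q (qF i) (gop q (qF i) v))"
proof (rule tensor_induct_eq[where v = v])
  fix a and y :: "rat list \<Rightarrow>\<^sub>0 'k"
  assume y: "gop q (qF i) (gop q (qF i) (gop q (qF j) y)) =
    scal (q + inverse q) * gop q (qF i) (gop q (qF j) (gop q (qF i) y)) - gop q (qF j) (gop q (qF i) (gop q (qF i) y))"
  have a: "gop q (qF i) (gop q (qF j) (gop q (qF i) (eta a))) = 0"
    "gop q (qF i) (gop q (qF i) (gop q (qF j) (eta a))) = 0"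
    "gop q (qF j) (gop q (qF i) (gop q (qF i) (eta a))) = 0"
    by (rule letter_cases[of a]; use assms in \<open>auto simp: letter_simps simp del: eta_act.simps\<close>)+
  have c: "cartan i i = 2" "cartan i j = -1" "cartan j i = -1" using assms by (auto simp: cartan_def)
  show "gop q (qF i) (gop q (qF i) (gop q (qF j) (eta a * y))) =
    scal (q + inverse q) * gop q (qF i) (gop q (qF j) (gop q (qF i) (eta a * y))) - gop q (qF j) (gop q (qF i) (gop q (qF i) (eta a * y)))"
    by (rule poly_mapping_eqI)
       (use q0 in \<open>simp add: gop_mult gop_lin a y gop_K_F c gop_K_K[of i j] lookup_add lookup_minus
         distrib_left distrib_right right_diff_distrib left_diff_distrib scal_pull scal_scal mult.assoc power_int_minus field_simps power2_eq_square\<close>)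
qed (simp add: gop_1 gop_lin | intro lin_intros')+

end

section \<open>Left actions of free algebras\<close>

definition lact :: "('g \<Rightarrow> ('a::monoid_add \<Rightarrow>\<^sub>0 'k::field) \<Rightarrow> ('a \<Rightarrow>\<^sub>0 'k)) \<Rightarrow> ('g list \<Rightarrow>\<^sub>0 'k) \<Rightarrow> ('a \<Rightarrow>\<^sub>0 'k) \<Rightarrow> ('a \<Rightarrow>\<^sub>0 'k)" where
  "lact op a v = lin_ext (\<lambda>w. foldr op w v) a"

lemma lin_foldr: "(\<And>g. lin (op g)) \<Longrightarrow> lin (foldr op w)"
  by (induction w) (auto simp: lin_def comp_def)

lemma lin_lact_left: "lin (\<lambda>a. lact op a v)" by (simp add: lact_def)

lemma lin_lact: "(\<And>g. lin (op g)) \<Longrightarrow> lin (lact op a)"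
  unfolding lact_def[abs_def] by (rule lin_ext_lin) (use lin_foldr in blast)

lemmas lact_lin_left = lin_add[OF lin_lact_left] lin_diff[OF lin_lact_left] lin_0[OF lin_lact_left]
  lin_uminus[OF lin_lact_left]

lemma lact_single: "lact op (mono1 w) v = foldr op w v" by (simp add: lact_def)
lemma lact_gen: "lact op (gen g) v = op g v" by (simp add: lact_def gen_def)
lemma lact_1: "lact op 1 v = v"
proof -
  have "foldr op 0 v = v" by (simp add: zero_list_def)
  then show ?thesis using lact_single[of op 0 v] by simp
qed
lemma lact_scal: "lact op (scal c) v = scal c * v"
  using lin_scal[OF lin_lact_left[of op v], of c 1] by (simp add: lact_1)

lemma lact_mult:
  assumes "\<And>g. lin (op g)"
  shows "lact op (a * b) v = lact op a (lact op b v)"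
proof -
  have *: "lact op (mono1 u * b) v = lact op (mono1 u) (lact op b v)" for u
  proof (rule lin_eq[of "\<lambda>b. lact op (mono1 u * b) v" "\<lambda>b. lact op (mono1 u) (lact op b v)"])
    show "lact op (mono1 u * mono1 w) v = lact op (mono1 u) (lact op (mono1 w) v)" for w
      by (simp add: mono1_mult lact_single plus_list_def)
    show "lin (\<lambda>b. lact op (mono1 u) (lact op b v))"
      by (rule lin_comp[OF lin_lact[OF assms] lin_lact_left])
    show "lin (\<lambda>b. lact op (mono1 u * b) v)"
      by (rule lin_comp[OF lin_lact_left]) (intro lin_left lin_id)
  qed
  show ?thesis
  proof (rule lin_eq[of "\<lambda>a. lact op (a * b) v" "\<lambda>a. lact op a (lact op b v)"])
    show "lin (\<lambda>a. lact op (a * b) v)"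
      by (rule lin_comp[OF lin_lact_left]) (intro lin_right lin_id)
  qed (rule lin_lact_left *)+
qed

lemmas lact_simps = lact_lin_left lact_gen lact_1 lact_scal lact_mult

text \<open>Here the annihilator of the whole tensor algebra is used; it is an ideal because the
  relations vanish on every vector.\<close>

lemma lact_rel_ideal:
  fixes op :: "'g \<Rightarrow> (rat list \<Rightarrow>\<^sub>0 'k::field) \<Rightarrow> (rat list \<Rightarrow>\<^sub>0 'k)"
  assumes "\<And>g. lin (op g)" "\<And>a v. a \<in> R \<Longrightarrow> lact op a v = 0" "R \<subseteq> carrier (free_alg X)"
    "a \<in> rel_ideal X R"
  shows "lact op a v = 0"
proof -
  let ?K = "{a :: 'g list \<Rightarrow>\<^sub>0 'k. supp a \<subseteq> lists X \<and> (\<forall>v. lact op a v = 0)}"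
  have "ideal ?K (free_alg X)"
  proof (rule ideal_kernel)
    fix a and x :: "'g list \<Rightarrow>\<^sub>0 'k" assume a: "a \<in> ?K" "x \<in> carrier (free_alg X)"
    then show "x * a \<in> ?K \<and> a * x \<in> ?K"
      by (auto simp: lact_mult assms(1) supp_mult_lists lin_0[OF lin_lact[OF assms(1)]])
  next
    fix a b assume "a \<in> ?K" "b \<in> ?K"
    then show "a + b \<in> ?K"
      using subset_trans[OF keys_add[of a b], of "lists X"] by (simp add: lact_simps)
  qed (auto simp: lact_simps supp_uminus)
  moreover have "R \<subseteq> ?K"
  proof
    fix a assume "a \<in> R"
    with assms(3) have "a \<in> carrier (free_alg X)" by blast
    with assms(2) \<open>a \<in> R\<close> show "a \<in> ?K" by simp
  qed
  ultimately have "rel_ideal X R \<subseteq> ?K" by (rule rel_ideal_minimal[rotated])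
  with assms(4) show ?thesis by auto
qed

lemma qrels_lact:
  fixes q :: "'k::field"
  assumes q0: "q \<noteq> 0" and q1: "q - inverse q \<noteq> 0" and a: "a \<in> qrels r q"
  shows "lact (gop q) a v = 0"
proof -
  have "qrels r q \<subseteq> {a. lact (gop q) a v = 0}"
    unfolding qrels_def
  proof (intro UN_least Un_least, goal_cases)
    case (1 i j)
    have "lact (gop q) (gen (qE i) * gen (qF j) - gen (qF j) * gen (qE i)
       - (if i = j then scal (1 / (q - inverse q)) * (gen (qK i) - gen (qKinv i)) else 0)) v = 0"
      using gop_E_F[OF q0 q1, of i j v] by (cases "i = j") (simp_all add: lact_simps)
    then show ?case
      by (simp add: lact_simps gop_K_Kinv[OF q0] gop_Kinv_K[OF q0] gop_K_K[OF q0, of i j]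
        gop_K_E[OF q0] gop_K_F[OF q0])
  next
    case (2 i j)
    then show ?case
      by (simp add: lact_simps power2_eq_square gop_E_Serre[OF q0] gop_F_Serre[OF q0])
  next
    case (3 i j)
    then show ?case
      by (simp add: lact_simps gop_E_E_far[OF q0, of i j] gop_F_F_far[OF q0, of i j])
  qed
  with a show ?thesis by blast
qed

section \<open>The iterated comultiplication\<close>

lemma lin_lin_ext_comm: "lin L \<Longrightarrow> L (lin_ext \<phi> p) = lin_ext (\<lambda>b. L (\<phi> b)) p"
  by (simp add: lin_ext_def lin_sum lin_scal)

text \<open>A pure tensor of two words acts on x and y separately and the results are multiplied.
  This pairs \<open>comult_word\<close> with the product of the tensor algebra.\<close>

definition tact :: "'k::field \<Rightarrow> (rat list \<Rightarrow>\<^sub>0 'k) \<Rightarrow> (rat list \<Rightarrow>\<^sub>0 'k) \<Rightarrow> (qgen list \<times> qgen list \<Rightarrow>\<^sub>0 'k) \<Rightarrow> (rat list \<Rightarrow>\<^sub>0 'k)" where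
  "tact q x y = lin_ext (\<lambda>(u, v). foldr (gop q) u x * foldr (gop q) v y)"

lemma lin_tact [simp]: "lin (tact q x y)" by (simp add: tact_def)

lemma tact_single [simp]: "tact q x y (mono1 (u, v)) = foldr (gop q) u x * foldr (gop q) v y"
  by (simp add: tact_def)

lemma tact_mult: "tact q x y (a * p) = lin_ext (\<lambda>(u, v). tact q (foldr (gop q) u x) (foldr (gop q) v y) a) p"
proof (rule lin_eq[where v = p])
  show "lin (\<lambda>p. tact q x y (a * p))"
    unfolding tact_def by (intro lin_intros)
  show "lin (lin_ext (\<lambda>(u, v). tact q (foldr (gop q) u x) (foldr (gop q) v y) a))" by simp
  fix uv :: "qgen list \<times> qgen list"
  obtain u v where uv: "uv = (u, v)" by (cases uv)
  have "tact q x y (a * mono1 (u, v)) = tact q (foldr (gop q) u x) (foldr (gop q) v y) a"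
  proof (rule lin_eq[where v = a])
    show "lin (\<lambda>a. tact q x y (a * mono1 (u, v)))"
      unfolding tact_def by (intro lin_intros)
    fix ab :: "qgen list \<times> qgen list"
    show "tact q x y (mono1 ab * mono1 (u, v)) = tact q (foldr (gop q) u x) (foldr (gop q) v y) (mono1 ab)"
      by (cases ab) (simp add: mono1_mult plus_list_def)
  qed simp
  then show "tact q x y (a * mono1 uv)
      = lin_ext (\<lambda>(u, v). tact q (foldr (gop q) u x) (foldr (gop q) v y) a) (mono1 uv)"
    by (simp add: uv)
qed

lemma tact_gen: "tact q x y (comult_gen g) = gop q g (x * y)"
  by (cases g) (simp_all add: lin_add gop_mult)

text \<open>Module algebra property for words. It follows from the one for generators,
  \<open>tact_gen\<close>, because the coproduct of a word is the product of the coproducts of its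
  letters.\<close>

lemma foldr_gop_mult: "foldr (gop q) w (x * y) = tact q x y (comult_word w)"
proof (induction w)
  case Nil
  have "(1 :: qgen list \<times> qgen list \<Rightarrow>\<^sub>0 'a) = mono1 ([], [])"
    by (simp add: zero_list_def[symmetric] zero_prod_def[symmetric])
  then have "tact q x y 1 = x * y" using tact_single[of q x y "[]" "[]"] by simp
  then show ?case by (simp add: comult_word_def)
next
  case (Cons g w)
  have "foldr (gop q) (g # w) (x * y) = gop q g (tact q x y (comult_word w))" by (simp add: Cons)
  also have "\<dots> = lin_ext (\<lambda>(u, v). gop q g (foldr (gop q) u x * foldr (gop q) v y)) (comult_word w)"
    unfolding tact_def by (subst lin_lin_ext_comm[OF lin_gop]) (simp add: case_prod_unfold)
  also have "\<dots> = tact q x y (comult_gen g * comult_word w)"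
    unfolding tact_mult tact_gen ..
  finally show ?case by (simp add: comult_word_def)
qed

lemma letter_tensors: "v \<in> tensors UNIV 1 \<Longrightarrow> gop q g v \<in> tensors UNIV 1"
  unfolding gop_def
proof (rule tensors_lin_ext)
  fix f :: "rat list" assume "f \<in> words UNIV 1"
  then obtain j where "f = [j]" by (auto simp: words_def length_Suc_conv)
  then show "gact q f g \<in> tensors UNIV 1"
    by (cases g) (auto intro!: tensors_scal simp: words_def)
qed

lemma letter_act:
  assumes "v \<in> tensors UNIV 1" shows "lin_ext (\<lambda>f. eta_act q g (hd f)) v = gop q g v"
proof (rule lin_eq_tensors[OF _ _ assms])
  fix f :: "rat list" assume "f \<in> words UNIV 1"
  then obtain j where "f = [j]" by (auto simp: words_def length_Suc_conv)
  then show "lin_ext (\<lambda>f. eta_act q g (hd f)) (Mvec f) = gop q g (Mvec f)" by (simp add: gop_eta)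
qed (intro lin_intros')+

lemma word_act_gop: "v \<in> tensors UNIV 1 \<Longrightarrow> word_act q w v = foldr (gop q) w v \<and> foldr (gop q) w v \<in> tensors UNIV 1"
  unfolding word_act_def by (induction w) (auto simp: letter_act[unfolded One_nat_def] letter_tensors[unfolded One_nat_def])

lemma word_act_eta: "word_act q w (eta j) = foldr (gop q) w (eta j)"
  using word_act_gop[of "eta j" q w] by (simp add: words_def)

lemma lin_comult_first_pow: "lin (comult_first ^^ j)"
proof (induction j)
  case (Suc j)
  have "lin comult_first" by (simp add: comult_first_def)
  from lin_comp[OF this Suc] show ?case by (simp add: comp_def)
qed (auto simp: id_def)

text \<open>\<open>comult_first\<close> always splits the first factor, so the factor created by its
  first use acts on the last letter of f1. The induction peels off that letter and therefore carries
  the finished factors t, which act on f2.\<close>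

lemma comult_first_pow_act:
  "length f1 = Suc j \<Longrightarrow> length f2 = length t \<Longrightarrow>
   lin_ext (\<lambda>ws. tensor_act q ws (f1 @ f2)) ((comult_first ^^ j) (mono1 (w # t)))
   = foldr (gop q) w (Mvec f1) * tensor_act q t f2"
proof (induction j arbitrary: w t f1 f2)
  case 0
  then obtain a where "f1 = [a]" by (auto simp: length_Suc_conv)
  then show ?case by (simp add: tensor_act_def word_act_eta)
next
  case (Suc j)
  define g where "g = butlast f1"
  define a where "a = last f1"
  have f1: "f1 = g @ [a]" "length g = Suc j"
    using Suc.prems(1) by (auto simp: g_def a_def) (metis append_butlast_last_id list.size(3) nat.simps(3))
  define L where "L = (\<lambda>p. lin_ext (\<lambda>ws. tensor_act q ws (f1 @ f2)) ((comult_first ^^ j) p))"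
  have L: "lin L" unfolding L_def by (rule lin_comp[OF lin_lin_ext lin_comult_first_pow])
  have Luv: "L (mono1 (u # v # t)) = foldr (gop q) u (Mvec g) * foldr (gop q) v (eta a) * tensor_act q t f2" for u v
    using Suc.IH[of g "a # f2" "v # t" u] Suc.prems(2) f1
    by (simp add: L_def tensor_act_def word_act_eta mult.assoc)
  have "lin_ext (\<lambda>ws. tensor_act q ws (f1 @ f2)) ((comult_first ^^ Suc j) (mono1 (w # t)))
      = L (comult_first (mono1 (w # t)))"
    by (simp add: L_def funpow_swap1)
  also have "\<dots> = L (lin_ext (\<lambda>(u, v). mono1 (u # v # t)) (comult_word w))"
    by (simp add: comult_first_def)
  also have "\<dots> = lin_ext (\<lambda>(u, v). foldr (gop q) u (Mvec g) * foldr (gop q) v (eta a) * tensor_act q t f2) (comult_word w)"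
    by (subst lin_lin_ext_comm[OF L]) (auto intro!: lin_ext_cong_supp simp: Luv)
  also have "\<dots> = tact q (Mvec g) (eta a) (comult_word w) * tensor_act q t f2"
    unfolding tact_def
    by (subst lin_lin_ext_comm[of "\<lambda>v. v * tensor_act q t f2"]) (auto intro!: lin_ext_cong_supp)
  also have "\<dots> = foldr (gop q) w (Mvec f1) * tensor_act q t f2"
    by (simp add: f1 Mvec_mult[symmetric] foldr_gop_mult)
  finally show ?case .
qed

text \<open>From here on the iterated comultiplication is replaced by the operators
  \<open>gop\<close>, which are the same for every m.\<close>

lemma Phi_free_lact:
  assumes "1 \<le> m"
  shows "Phi_free r m q a = (\<lambda>v\<in>tensors (I_big r) m. lact (gop q) a v)"
  unfolding Phi_free_def
proof (rule restrict_ext)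
  fix v :: "rat list \<Rightarrow>\<^sub>0 'a" assume v: "v \<in> tensors (I_big r) m"
  show "lin_ext (\<lambda>f. lin_ext (\<lambda>ws. tensor_act q ws f) (comult_iter m a)) v = lact (gop q) a v"
  proof (rule lin_eq_tensors[OF _ _ v])
    fix f assume f: "f \<in> words (I_big r) m"
    have "lin_ext (\<lambda>ws. tensor_act q ws f) (comult_iter m a) = lin_ext (\<lambda>w. foldr (gop q) w (Mvec f)) a"
    proof -
      define L where "L = (\<lambda>p. lin_ext (\<lambda>ws. tensor_act q ws f) ((comult_first ^^ (m - 1)) p))"
      have L: "lin L" unfolding L_def by (rule lin_comp[OF lin_lin_ext lin_comult_first_pow])
      have "L (mono1 [w]) = foldr (gop q) w (Mvec f)" for w
        using comult_first_pow_act[of f "m - 1" "[]" "[]" q w] f assms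
        by (simp add: L_def words_def tensor_act_def)
      then show ?thesis
        unfolding comult_iter_def L_def[symmetric]
        using lin_lin_ext_comm[OF L, of "\<lambda>w. mono1 [w]" a] by (simp add: L_def)
    qed
    then show "lin_ext (\<lambda>f. lin_ext (\<lambda>ws. tensor_act q ws f) (comult_iter m a)) (Mvec f) = lact (gop q) a (Mvec f)"
      by (simp add: lact_def)
  qed (simp_all add: lin_lact)
qed

section \<open>Half-integer letters and invariant letter sets\<close>

lemma hf_less [simp]: "hf a < hf b \<longleftrightarrow> a < b" by (simp add: hf_def)
lemma hf_uminus: "- hf a = hf (- a - 1)" by (simp add: hf_def)
lemma hf_pos [simp]: "0 < hf a \<longleftrightarrow> 0 \<le> a"
proof -
  have "0 < hf a \<longleftrightarrow> of_int (-1) < (2 * of_int a :: rat)" by (auto simp: hf_def field_simps)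
  also have "\<dots> \<longleftrightarrow> -1 < 2 * a" by (metis of_int_less_iff of_int_mult of_int_numeral)
  also have "\<dots> \<longleftrightarrow> 0 \<le> a" by presburger
  finally show ?thesis .
qed
lemma hf_neq_0 [simp]: "hf a \<noteq> 0" "0 \<noteq> hf a"
proof -
  show "hf a \<noteq> 0"
  proof
    assume "hf a = 0"
    then have "\<not> 0 \<le> a" "\<not> 0 \<le> - a - 1"
      using hf_pos[of a] hf_pos[of "- a - 1"] hf_uminus[of a] by (metis less_irrefl, metis less_irrefl neg_equal_0_iff_equal)
    then show False by linarith
  qed
  then show "0 \<noteq> hf a" by simp
qed

lemma half_idx_hf: "half_idx s = hf ` {- int s .. int s - 1}"
  by (simp add: half_idx_def hf_def)

lemma I_big_hf: "I_big r \<subseteq> range hf" by (auto simp: I_big_def half_idx_hf)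
lemma I_small_hf: "I_small r \<subseteq> range hf" by (auto simp: I_small_def half_idx_hf)
lemma hf_I_big [simp]: "hf n \<in> I_big r \<longleftrightarrow> - int r - 2 \<le> n \<and> n \<le> int r + 1"
  by (auto simp: I_big_def half_idx_hf)
lemma hf_I_small [simp]: "hf n \<in> I_small r \<longleftrightarrow> - int r - 1 \<le> n \<and> n \<le> int r"
  by (auto simp: I_small_def half_idx_hf)
lemma top_idx_hf: "top_idx r = hf (int r + 1)" by (simp add: top_idx_def hf_def)
lemma finite_I_big [simp]: "finite (I_big r)" by (simp add: I_big_def half_idx_def)
lemma finite_I_small [simp]: "finite (I_small r)" by (simp add: I_small_def half_idx_def)
lemma uminus_range_hf: "uminus ` range hf \<subseteq> range hf"
  by (auto simp: hf_uminus)
lemma uminus_I_big: "uminus ` I_big r \<subseteq> I_big r"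
  using I_big_hf[of r] by (auto simp: hf_uminus subset_iff)
lemma uminus_I_small: "uminus ` I_small r \<subseteq> I_small r"
  using I_small_hf[of r] by (auto simp: hf_uminus subset_iff)
lemma zero_notin [simp]: "0 \<notin> I_big r" "0 \<notin> I_small r" "0 \<notin> range hf"
  using I_big_hf[of r] I_small_hf[of r] by auto
lemma I_small_big: "I_small r \<subseteq> I_big r"
  using I_small_hf[of r] by auto

lemma tensors_one [simp]: "1 \<in> tensors J 0"
  using Mvec_in_tensors[of "[]" J 0] by simp

text \<open>The side conditions on \<open>qKinv i\<close> and \<open>qK i\<close> come from the
  coproducts of E and F, which contain them next to the generator itself.\<close>

lemma gop_tensors:
  assumes "\<And>j. j \<in> J \<Longrightarrow> eta_act q g j \<in> tensors J 1"
    and "\<And>i j. g = qE i \<Longrightarrow> j \<in> J \<Longrightarrow> eta_act q (qKinv i) j \<in> tensors J 1"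
    and "\<And>i j. g = qF i \<Longrightarrow> j \<in> J \<Longrightarrow> eta_act q (qK i) j \<in> tensors J 1"
    and "v \<in> tensors J n"
  shows "gop q g v \<in> tensors J n"
proof -
  have m: "x * y \<in> tensors J (Suc n)" if "x \<in> tensors J 1" "y \<in> tensors J n" for x y :: "rat list \<Rightarrow>\<^sub>0 'a" and n
    using tensors_mult[OF that] by simp
  have K: "gact q f h \<in> tensors J n"
    if "f \<in> words J n" "\<And>j. j \<in> J \<Longrightarrow> eta_act q h j \<in> tensors J 1" "h = qK i \<or> h = qKinv i" for f h n i
    using that
    by (induction f arbitrary: n) (auto simp: words_def simp del: eta_act.simps intro!: m)
  have "gact q f g \<in> tensors J n" if "f \<in> words J n" for f n
    using that
  proof (induction f arbitrary: n)
    case Nil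
    then show ?case by (cases g) (auto simp: words_def)
  next
    case (Cons j f)
    then obtain n' where n: "n = Suc n'" "j \<in> J" "f \<in> words J n'" by (auto simp: words_def)
    show ?case
    proof (cases g)
      case (qE i)
      have "gact q f (qKinv i) \<in> tensors J n'" by (rule K[OF n(3), of _ i]) (use assms(2) qE in blast)+
      then show ?thesis using assms(1) Cons.IH[OF n(3)] n qE
        by (auto simp del: eta_act.simps intro!: tensors_add m)
    next
      case (qF i)
      have "eta_act q (qK i) j \<in> tensors J 1" using assms(3) qF n by blast
      then show ?thesis using assms(1) Cons.IH[OF n(3)] n qF
        by (auto simp del: eta_act.simps intro!: tensors_add m)
    next
      case (qK i)
      then show ?thesis using assms(1) Cons.IH[OF n(3)] n
        by (auto simp del: eta_act.simps intro!: m)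
    next
      case (qKinv i)
      then show ?thesis using assms(1) Cons.IH[OF n(3)] n
        by (auto simp del: eta_act.simps intro!: m)
    qed
  qed
  then show ?thesis unfolding gop_def by (intro tensors_lin_ext[OF assms(4)])
qed

lemma eta_act_hf_tensors: "eta_act q g (hf n) \<in> tensors (range hf) 1"
  by (cases g) (auto simp: eta_act_hf words_def simp del: eta_act.simps intro!: tensors_scal)

lemma gop_hf: "v \<in> tensors (range hf) n \<Longrightarrow> gop q g v \<in> tensors (range hf) n"
  by (rule gop_tensors) (use eta_act_hf_tensors in blast)+

lemma eta_act_UNIV: "eta_act q g j \<in> tensors UNIV 1"
  by (cases g) (auto simp: words_def intro!: tensors_scal)

lemma gop_UNIV: "v \<in> tensors UNIV n \<Longrightarrow> gop q g v \<in> tensors UNIV n"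
  by (rule gop_tensors) (use eta_act_UNIV in blast)+

lemma hf_split2:
  assumes "f \<in> words (range hf) n" "1 \<le> i" "i < n"
  obtains p a b s where "f = p @ [hf a, hf b] @ s" "p \<in> words UNIV (i - 1)"
proof -
  define p where "p = take (i - 1) f"
  define s where "s = drop (i + 1) f"
  have "f = p @ [f ! (i - 1), f ! i] @ s"
    unfolding p_def s_def using assms
    by (cases i) (auto simp: words_def Cons_nth_drop_Suc id_take_nth_drop)
  moreover have "f ! (i - 1) \<in> range hf" "f ! i \<in> range hf"
    using assms nth_mem[of "i - 1" f] nth_mem[of i f] by (auto simp: words_def)
  moreover have "p \<in> words UNIV (i - 1)" using assms by (auto simp: p_def words_def)
  ultimately show ?thesis using that by (metis imageE)
qed

section \<open>Hecke operators commute with the coideal subalgebra\<close>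

context
  fixes q :: "'k::field"
  assumes q0: "q \<noteq> 0"
begin

text \<open>The two-factor case of quantum Schur-Weyl duality. A generator of index i sees only the
  letters i - 1/2 and i + 1/2, so there are nine positions of the pair (a, b) relative to them, each
  split by the order of a and b.\<close>

lemma Psi_gop2:
  "Psi_gen q 1 (gop q g (Mvec [hf a, hf b])) = gop q g (Psi_gen q 1 (Mvec [hf a, hf b]))"
proof -
  obtain i where i: "g \<in> {qE i, qF i, qK i, qKinv i}" by (cases g) auto
  have M: "M_act q 1 [x, y] = (if x = y then scal (inverse q) * Mvec [x, y]
      else if x < y then Mvec [y, x] else Mvec [y, x] + scal (inverse q - q) * Mvec [x, y])" for x y
    by (simp add: M_act_def place_def)
  have e: "eta x * (scal c * eta y) = scal c * Mvec [x, y]" for c x y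
    by (simp add: Mvec_mult scal_left_commute)
  consider "a \<notin> {i - 1, i}" "b \<notin> {i - 1, i}" | "a = i" "b \<notin> {i - 1, i}" | "a = i - 1" "b \<notin> {i - 1, i}"
    | "a \<notin> {i - 1, i}" "b = i" | "a \<notin> {i - 1, i}" "b = i - 1"
    | "a = i" "b = i" | "a = i" "b = i - 1" | "a = i - 1" "b = i" | "a = i - 1" "b = i - 1" by blast
  then show ?thesis
    using i
    by cases
      (rule poly_mapping_eqI; cases a b rule: linorder_cases;
        auto simp: gop_Mvec Psi_Mvec M[unfolded One_nat_def] gop_lin Psi_simps eta_act_hf e Mvec_mult scal_scal lookup_add
          mult.assoc q0 field_simps simp del: eta_act.simps)+
qed

lemma Psi_gop:
  assumes "v \<in> tensors (range hf) n" "1 \<le> i" "i < n"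
  shows "Psi_gen q i (gop q g v) = gop q g (Psi_gen q i v)"
proof (rule lin_eq_tensors[OF _ _ assms(1), of "\<lambda>v. Psi_gen q i (gop q g v)" "\<lambda>v. gop q g (Psi_gen q i v)"])
  fix f assume f: "f \<in> words (range hf) n"
  obtain p a b s where fa: "f = p @ [hf a, hf b] @ s" "p \<in> words UNIV (i - 1)"
    using hf_split2[OF f assms(2,3)] by blast
  have p: "Mvec p \<in> tensors UNIV (i - 1)" using fa by simp
  have R: "Psi_gen q i (x * (y * z)) = x * (Psi_gen q 1 y * z)"
    if "x \<in> tensors UNIV (i - 1)" "y \<in> tensors UNIV 2" for x y z
    using Psi_right[OF that(1), of 1 q "y * z"] Psi_left[OF that(2), of 1 q z] assms(2) by simp
  have ab: "Mvec [hf a, hf b] \<in> tensors UNIV 2" by (simp add: words_def)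
  note R' = R[OF gop_UNIV[OF p] gop_UNIV[OF ab]] R[OF p gop_UNIV[OF ab]] R[OF gop_UNIV[OF p] ab] R[OF p ab]
  have F: "Mvec f = Mvec p * (Mvec [hf a, hf b] * Mvec s)" by (simp add: fa Mvec_mult)
  show "Psi_gen q i (gop q g (Mvec f)) = gop q g (Psi_gen q i (Mvec f))"
    unfolding F
    by (cases g) (simp_all add: R' gop_mult lin_add[OF lin_Psi] distrib_left distrib_right Psi_gop2 del: One_nat_def)
qed (intro lin_intros')+

abbreviation Lop :: "(qgen list \<Rightarrow>\<^sub>0 'k) \<Rightarrow> (rat list \<Rightarrow>\<^sub>0 'k) \<Rightarrow> (rat list \<Rightarrow>\<^sub>0 'k)" where
  "Lop a \<equiv> lact (gop q) a"

lemma lin_Lop: "lin (Lop a)" by (rule lin_lact) simp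

lemma Lop_k: "Lop (k_el i) v = gop q (qK i) (gop q (qKinv (- i)) v)"
  by (simp add: k_el_def lact_simps)

lemma Lop_B: "Lop (B_el q i) v = (if i = 0 then gop q (qE 0) v + scal q * gop q (qF 0) (gop q (qKinv 0) v) + gop q (qKinv 0) v
    else gop q (qE i) v + gop q (qF (- i)) (gop q (qKinv i) v))"
  by (simp add: B_el_def lact_simps lin_add[OF lin_lact_left])

lemma Lop_k_mult: "Lop (k_el i) (x * y) = Lop (k_el i) x * Lop (k_el i) y"
  by (simp add: Lop_k gop_mult)

text \<open>The coideal property: only \<open>B\<^sub>i\<close> and \<open>k\<^sub>i\<^sup>-\<^sup>1\<close> act on the first tensor factor.\<close>

lemma Lop_B_mult: "Lop (B_el q i) (x * y) = Lop (B_el q i) x * gop q (qKinv i) y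
   + x * gop q (qE i) y + scal (if i = 0 then q else 1) * (gop q (qK (- i)) (gop q (qKinv i) x) * gop q (qF (- i)) (gop q (qKinv i) y))"
  by (simp add: Lop_B gop_mult gop_lin distrib_left distrib_right gop_K_Kinv[OF q0] mult.assoc)

text \<open>This explains the parameters in \<open>B_el q 0\<close>: on the span of the letters
  \<plusminus>1/2 it equals \<open>Psi_gen q 0\<close> plus q, and on the other letters it is the
  identity. For i \<noteq> 0 the operator commutes with negation and preserves the sign of a letter,
  which is all that \<open>Psi_gen q 0\<close> looks at.\<close>

lemma Psi0_letter:
  "Psi_gen q 0 (Lop (B_el q i) (eta (hf a))) = Lop (B_el q i) (Psi_gen q 0 (eta (hf a)))"
  "Psi_gen q 0 (gop q (qK j) (gop q (qKinv (- j)) (eta (hf a)))) = gop q (qK j) (gop q (qKinv (- j)) (Psi_gen q 0 (eta (hf a))))"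
proof -
  have P: "Psi_gen q 0 (eta (hf a)) = (if 0 \<le> a then eta (hf (- a - 1)) else eta (hf (- a - 1)) + scal (inverse q - q) * eta (hf a))" for a
    by (simp add: Psi_Mvec M_act_def place_def hf_uminus)
  have "Lop (B_el q i) (eta (hf a)) = (if i = 0 then if a = 0 then eta (hf (- 1)) + scal q * eta (hf 0)
     else if a = - 1 then eta (hf 0) + scal (inverse q) * eta (hf (- 1)) else eta (hf a)
     else if a = i then eta (hf (i - 1)) else if a = - i - 1 then eta (hf (- i)) else 0)" for a
    by (auto simp: Lop_B letter_simps scal_scal q0 simp del: eta_act.simps)
  note B = this
  show "Psi_gen q 0 (Lop (B_el q i) (eta (hf a))) = Lop (B_el q i) (Psi_gen q 0 (eta (hf a)))"
    by (rule poly_mapping_eqI)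
      (auto simp: B P lin_add[OF lin_Lop] lin_scal[OF lin_Lop] Psi_simps lin_0[OF lin_Lop] lookup_add lookup_minus scal_scal q0 field_simps)
  show "Psi_gen q 0 (gop q (qK j) (gop q (qKinv (- j)) (eta (hf a)))) = gop q (qK j) (gop q (qKinv (- j)) (Psi_gen q 0 (eta (hf a))))"
    by (rule poly_mapping_eqI)
      (auto simp: P letter_simps Psi_simps lookup_add lookup_minus scal_scal q0 field_simps simp del: eta_act.simps)
qed

lemma Psi0_Lop:
  assumes "v \<in> tensors (range hf) n" "0 < n"
  shows "Psi_gen q 0 (Lop (B_el q i) v) = Lop (B_el q i) (Psi_gen q 0 v)"
    and "Psi_gen q 0 (Lop (k_el i) v) = Lop (k_el i) (Psi_gen q 0 v)"
proof -
  have L: "Psi_gen q 0 (x * y) = Psi_gen q 0 x * y" if "x \<in> tensors UNIV 1" for x y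
    using Psi_left[OF that] by simp
  have P: "Psi_gen q 0 x \<in> tensors UNIV 1" if "x \<in> tensors UNIV 1" for x
    by (rule Psi_tensors[OF that]) auto
  have BL: "Lop (B_el q i) x \<in> tensors UNIV 1" if "x \<in> tensors UNIV 1" for x
    using that by (auto simp: Lop_B intro!: tensors_add tensors_scal gop_UNIV)
  have e: "\<exists>a g. f = hf a # g" if "f \<in> words (range hf) n" for f
    using that assms(2) by (cases f) (auto simp: words_def)
  have 1: "Psi_gen q 0 (Lop (B_el q i) (eta (hf a) * y)) = Lop (B_el q i) (Psi_gen q 0 (eta (hf a) * y))" for a y
    by (simp add: L words_def P BL gop_UNIV Lop_B_mult Psi_simps Psi0_letter(1) Psi0_letter(2)[of "- i", simplified] del: One_nat_def)
  have 2: "Psi_gen q 0 (Lop (k_el i) (eta (hf a) * y)) = Lop (k_el i) (Psi_gen q 0 (eta (hf a) * y))" for a y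
    by (simp add: L words_def P gop_UNIV Lop_k gop_mult Psi_simps Psi0_letter(2) del: One_nat_def)
  show "Psi_gen q 0 (Lop (B_el q i) v) = Lop (B_el q i) (Psi_gen q 0 v)"
  proof (rule lin_eq_tensors[OF lin_comp[OF lin_Psi lin_Lop] lin_comp[OF lin_Lop lin_Psi] assms(1)])
    fix f assume "f \<in> words (range hf) n"
    with e obtain a g where "f = hf a # g" by blast
    with 1[of a "Mvec g"] show "Psi_gen q 0 (Lop (B_el q i) (Mvec f)) = Lop (B_el q i) (Psi_gen q 0 (Mvec f))"
      by (simp add: Mvec_mult)
  qed
  show "Psi_gen q 0 (Lop (k_el i) v) = Lop (k_el i) (Psi_gen q 0 v)"
  proof (rule lin_eq_tensors[OF lin_comp[OF lin_Psi lin_Lop] lin_comp[OF lin_Lop lin_Psi] assms(1)])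
    fix f assume "f \<in> words (range hf) n"
    with e obtain a g where "f = hf a # g" by blast
    with 2[of a "Mvec g"] show "Psi_gen q 0 (Lop (k_el i) (Mvec f)) = Lop (k_el i) (Psi_gen q 0 (Mvec f))"
      by (simp add: Mvec_mult)
  qed
qed

lemma Psi_Lop:
  assumes "v \<in> tensors (range hf) n" "j < n"
  shows "Psi_gen q j (Lop (B_el q i) v) = Lop (B_el q i) (Psi_gen q j v)"
    and "Psi_gen q j (Lop (k_el i) v) = Lop (k_el i) (Psi_gen q j v)"
proof -
  have P: "Psi_gen q j (gop q g w) = gop q g (Psi_gen q j w)" if "j \<noteq> 0" "w \<in> tensors (range hf) n" for g w
    using Psi_gop[OF that(2), of j g] assms(2) that(1) by simp
  show "Psi_gen q j (Lop (B_el q i) v) = Lop (B_el q i) (Psi_gen q j v)"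
    using Psi0_Lop(1)[OF assms(1), of i] assms P[OF _ assms(1)] P[OF _ gop_hf[OF assms(1)]]
    by (cases "j = 0") (simp_all add: Lop_B Psi_simps)
  show "Psi_gen q j (Lop (k_el i) v) = Lop (k_el i) (Psi_gen q j v)"
    using Psi0_Lop(2)[OF assms(1), of i] assms P[OF _ assms(1)] P[OF _ gop_hf[OF assms(1)]]
    by (cases "j = 0") (simp_all add: Lop_k Psi_simps)
qed

end

section \<open>Patterns\<close>

lemma top_notin_small [simp]: "top_idx r \<notin> I_small r" "- top_idx r \<notin> I_small r"
  by (simp_all add: top_idx_hf hf_uminus)

lemma top_neq [simp]: "top_idx r \<noteq> 0" "0 \<noteq> top_idx r" "- top_idx r \<noteq> top_idx r" "top_idx r \<noteq> - top_idx r" "top_idx r > 0"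
  by (simp_all add: top_idx_def)

lemma I_big_eq: "I_big r = I_small r \<union> {top_idx r, - top_idx r}"
proof -
  have "{- int (r + 2) .. int (r + 2) - 1} = {- int (r + 1) .. int (r + 1) - 1} \<union> {int r + 1, - int r - 2}" by auto
  then show ?thesis unfolding I_big_def I_small_def half_idx_hf top_idx_hf hf_uminus
    by (simp only: image_Un) auto
qed

lemma I_small_less_top: "j \<in> I_small r \<Longrightarrow> - top_idx r < j \<and> j < top_idx r"
  by (auto simp: I_small_def half_idx_hf top_idx_hf hf_uminus)

text \<open>A pattern marks the positions of a word that carry a letter of \<open>V\<close> by \<open>0\<close>.\<close>

definition pat :: "nat \<Rightarrow> rat list \<Rightarrow> rat list" where
  "pat r f = map (\<lambda>j. if j \<in> I_small r then 0 else j) f"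

definition filt :: "nat \<Rightarrow> rat list \<Rightarrow> rat list" where
  "filt r f = filter (\<lambda>j. j \<in> I_small r) f"

text \<open>Inverse to taking the pattern and the part in V. The marker 0 cannot be mistaken for a
  letter, since all letters are half-integers.\<close>

primrec merge :: "rat list \<Rightarrow> rat list \<Rightarrow> rat list" where
  "merge [] v = []"
| "merge (p # P) v = (if p = 0 then hd v # merge P (tl v) else p # merge P v)"

definition nz :: "rat list \<Rightarrow> nat" where "nz P = length (filter (\<lambda>p. p = 0) P)"

definition pats :: "nat \<Rightarrow> nat \<Rightarrow> rat list set" where
  "pats r m = words {0, top_idx r, - top_idx r} m"

lemma nz_simps [simp]: "nz [] = 0" "nz (p # P) = (if p = 0 then Suc (nz P) else nz P)"
  by (simp_all add: nz_def)

lemma nz_le: "P \<in> pats r m \<Longrightarrow> nz P \<le> m"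
  by (auto simp: pats_def words_def nz_def)

lemma finite_pats: "finite (pats r m)" by (simp add: pats_def finite_words)

lemma pat_pats: "f \<in> words (I_big r) m \<Longrightarrow> pat r f \<in> pats r m"
  by (auto simp: pat_def pats_def words_def I_big_eq)

lemma filt_words: "f \<in> words (I_big r) m \<Longrightarrow> filt r f \<in> words (I_small r) (nz (pat r f))"
proof -
  assume f: "f \<in> words (I_big r) m"
  have "0 \<notin> set f" using f by (auto simp: words_def)
  then have "length (filt r f) = nz (pat r f)" by (induction f) (auto simp: filt_def pat_def)
  then show ?thesis by (auto simp: words_def filt_def)
qed

lemma merge_pat_filt: "merge (pat r f) (filt r f) = f" if "f \<in> words (I_big r) m"
proof -
  have "0 \<notin> set f" using that by (auto simp: words_def)
  then show ?thesis by (induction f) (auto simp: pat_def filt_def)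
qed

lemma merge_props:
  assumes "P \<in> pats r m" "v \<in> words (I_small r) (nz P)"
  shows "merge P v \<in> words (I_big r) m" "pat r (merge P v) = P" "filt r (merge P v) = v"
proof -
  have "merge P v \<in> words (I_big r) m \<and> pat r (merge P v) = P \<and> filt r (merge P v) = v"
    using assms
  proof (induction P arbitrary: v m)
    case (Cons p P)
    then obtain m' where m: "m = Suc m'" "P \<in> pats r m'" "p \<in> {0, top_idx r, - top_idx r}"
      by (cases m) (auto simp: pats_def)
    show ?case
    proof (cases "p = 0")
      case True
      with Cons.prems(2) obtain x v' where v: "v = x # v'" "x \<in> I_small r" "v' \<in> words (I_small r) (nz P)"
        by (cases v) (auto simp: words_def)
      with Cons.IH[OF m(2) v(3)] True m(1) I_small_big show ?thesis
        by (auto simp: pat_def filt_def)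
    next
      case False
      with Cons.IH[OF m(2), of v] Cons.prems(2) m show ?thesis
        by (auto simp: pat_def filt_def I_big_eq)
    qed
  qed (auto simp: pats_def words_def pat_def filt_def)
  then show "merge P v \<in> words (I_big r) m" "pat r (merge P v) = P" "filt r (merge P v) = v" by auto
qed

text \<open>\<open>mg P\<close> embeds the power \<open>nz P\<close> of V as the block of pattern P,
  and \<open>um r P\<close> is the projection to that block followed by the inverse identification.
  By \<open>um_mg\<close> and \<open>sum_mg_um\<close> the blocks decompose the tensor
  power.\<close>

definition mg :: "rat list \<Rightarrow> (rat list \<Rightarrow>\<^sub>0 'k::field) \<Rightarrow> (rat list \<Rightarrow>\<^sub>0 'k)" where
  "mg P = lin_ext (\<lambda>v. Mvec (merge P v))"

definition um :: "nat \<Rightarrow> rat list \<Rightarrow> (rat list \<Rightarrow>\<^sub>0 'k::field) \<Rightarrow> (rat list \<Rightarrow>\<^sub>0 'k)" where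
  "um r P = lin_ext (\<lambda>f. if pat r f = P then Mvec (filt r f) else 0)"

lemma lin_mg [simp, intro]: "lin (mg P)" and lin_um [simp, intro]: "lin (um r P)"
  by (simp_all add: mg_def um_def)

lemma mg_Mvec: "mg P (Mvec v) = Mvec (merge P v)" by (simp add: mg_def)

lemma mg_tensors: "P \<in> pats r m \<Longrightarrow> v \<in> tensors (I_small r) (nz P) \<Longrightarrow> mg P v \<in> tensors (I_big r) m"
  by (rule tensors_lin[OF lin_mg]) (auto simp: mg_Mvec intro: merge_props)

lemma um_tensors: "v \<in> tensors (I_big r) m \<Longrightarrow> um r P v \<in> tensors (I_small r) (nz P)"
  by (rule tensors_lin[OF lin_um]) (auto simp: um_def intro: filt_words)

lemma um_mg:
  assumes "P \<in> pats r m" "v \<in> tensors (I_small r) (nz P)"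
  shows "um r P' (mg P v) = (if P' = P then v else 0)"
proof (rule lin_eq_tensors[OF lin_comp[OF lin_um lin_mg] _ assms(2)])
  show "lin (\<lambda>v. if P' = P then v else 0)" by (cases "P' = P") auto
qed (use merge_props[OF assms(1)] in \<open>auto simp: mg_Mvec um_def\<close>)

lemma sum_mg_um:
  assumes "v \<in> tensors (I_big r) m"
  shows "(\<Sum>P\<in>pats r m. mg P (um r P v)) = v"
proof (rule lin_eq_tensors[OF _ _ assms])
  fix f assume f: "f \<in> words (I_big r) m"
  have "(\<Sum>P\<in>pats r m. mg P (um r P (Mvec f))) = (\<Sum>P\<in>pats r m. if P = pat r f then Mvec f else 0)"
    by (intro sum.cong) (auto simp: um_def mg_Mvec merge_pat_filt[OF f] lin_0)
  then show "(\<Sum>P\<in>pats r m. mg P (um r P (Mvec f))) = Mvec f"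
    using pat_pats[OF f] by (simp add: finite_pats)
qed (intro lin_Sum lin_comp[OF lin_mg lin_um] lin_id)+

lemma mg_Cons0: "mg (0 # P) (eta x * y) = eta x * mg P y"
proof (rule lin_eqM[of "\<lambda>y. mg (0 # P) (eta x * y)" "\<lambda>y. eta x * mg P y"])
  show "lin (\<lambda>y. mg (0 # P) (eta x * y))" by (rule lin_comp[OF lin_mg]) auto
qed (auto simp: Mvec_mult mg_Mvec)

lemma mg_Cons0': "z \<in> tensors UNIV 1 \<Longrightarrow> mg (0 # P) (z * y) = z * mg P y"
proof (rule lin_eq_tensors[of "\<lambda>z. mg (0 # P) (z * y)" "\<lambda>z. z * mg P y"])
  show "lin (\<lambda>z. mg (0 # P) (z * y))" by (rule lin_comp[OF lin_mg]) auto
  fix f :: "rat list" assume "f \<in> words UNIV 1"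
  then obtain x where "f = [x]" by (auto simp: words_def length_Suc_conv)
  then show "mg (0 # P) (Mvec f * y) = Mvec f * mg P y" by (simp add: mg_Cons0)
qed auto

lemma mg_Cons1: "p \<noteq> 0 \<Longrightarrow> mg (p # P) y = eta p * mg P y"
  by (rule lin_eqM[of "mg (p # P)" "\<lambda>y. eta p * mg P y"]) (auto simp: Mvec_mult mg_Mvec)

definition good :: "nat \<Rightarrow> qgen set" where
  "good r = (\<Union>i\<in>I_int r. {qE i, qF i, qK i, qKinv i})"

lemma good_simps [simp]: "qE i \<in> good r \<longleftrightarrow> \<bar>i\<bar> \<le> int r" "qF i \<in> good r \<longleftrightarrow> \<bar>i\<bar> \<le> int r"
   "qK i \<in> good r \<longleftrightarrow> \<bar>i\<bar> \<le> int r" "qKinv i \<in> good r \<longleftrightarrow> \<bar>i\<bar> \<le> int r"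
  by (auto simp: good_def I_int_def abs_le_iff)

lemma eta_act_small:
  assumes "g \<in> good r" "j \<in> I_small r" shows "eta_act q g j \<in> tensors (I_small r) 1"
proof -
  obtain n where "j = hf n" using assms(2) I_small_hf by blast
  with assms show ?thesis
    by (cases g) (auto simp: eta_act_hf words_def abs_le_iff simp del: eta_act.simps intro!: tensors_scal)
qed

lemma gop_small: "g \<in> good r \<Longrightarrow> v \<in> tensors (I_small r) n \<Longrightarrow> gop q g v \<in> tensors (I_small r) n"
  by (rule gop_tensors) (auto intro!: eta_act_small simp del: eta_act.simps One_nat_def)

lemma eta_act_big:
  assumes "g \<in> good (r + 1)" "j \<in> I_big r" shows "eta_act q g j \<in> tensors (I_big r) 1"
proof -
  have "I_big r = I_small (r + 1)" by (simp add: I_big_def I_small_def)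
  with eta_act_small[of g "r + 1" j] assms show ?thesis by simp
qed

lemma gop_big: "g \<in> good (r + 1) \<Longrightarrow> v \<in> tensors (I_big r) n \<Longrightarrow> gop q g v \<in> tensors (I_big r) n"
  by (rule gop_tensors) (auto intro!: eta_act_big simp del: eta_act.simps One_nat_def)

lemma eta_act_top:
  assumes "p \<in> {top_idx r, - top_idx r}" "\<bar>i\<bar> \<le> int r"
  shows "eta_act q (qE i) p = 0" "eta_act q (qF i) p = 0" "eta_act q (qK i) p = eta p" "eta_act q (qKinv i) p = eta p"
  using assms by (auto simp: top_idx_hf hf_uminus eta_act_hf simp del: eta_act.simps)

lemma mg_gop:
  assumes "P \<in> pats r m" "v \<in> tensors UNIV (nz P)" "g \<in> good r"
  shows "gop q g (mg P v) = mg P (gop q g v)"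
proof (rule lin_eq_tensors[OF lin_comp[OF lin_gop lin_mg] lin_comp[OF lin_mg lin_gop] assms(2)])
  fix f :: "rat list" assume "f \<in> words UNIV (nz P)"
  with assms(1,3) show "gop q g (mg P (Mvec f)) = mg P (gop q g (Mvec f))"
  proof (induction P arbitrary: f m g)
    case Nil
    have "mg [] 1 = (1 :: rat list \<Rightarrow>\<^sub>0 'a)" using mg_Mvec[of "[]" "[]"] by simp
    with Nil show ?case by (cases g) (auto simp: gop_1 lin_0)
  next
    case (Cons p P)
    then have p: "p \<in> {0, top_idx r, - top_idx r}" "P \<in> pats r (m - 1)" by (auto simp: pats_def words_def)
    obtain i where i: "g \<in> {qE i, qF i, qK i, qKinv i}" "\<bar>i\<bar> \<le> int r" using Cons.prems(2) by (cases g) auto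
    note E = eta_act_UNIV[of _ _ _, unfolded gop_eta[symmetric]]
    show ?case
    proof (cases "p = 0")
      case True
      with Cons.prems obtain x f' where f: "f = x # f'" "f' \<in> words UNIV (nz P)" by (cases f) (auto simp: words_def)
      have IH: "gop q h (mg P (Mvec f')) = mg P (gop q h (Mvec f'))" if "h \<in> good r" for h
        using Cons.IH[OF p(2) that f(2)] .
      have "gop q g (eta x * mg P (Mvec f')) = mg (0 # P) (gop q g (eta x * Mvec f'))"
        using i by (auto simp: gop_mult IH lin_add[OF lin_mg] mg_Cons0'[OF E] mg_Cons0)
      then show ?thesis unfolding True f Mvec_Cons[of x f'] mg_Cons0 .
    next
      case False
      have IH: "gop q h (mg P (Mvec f)) = mg P (gop q h (Mvec f))" if "h \<in> good r" for h
        using Cons.IH[OF p(2) that] Cons.prems(3) False by simp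
      have "p \<in> {top_idx r, - top_idx r}" using p False by auto
      note T = eta_act_top[OF this i(2)]
      show ?thesis unfolding mg_Cons1[OF False]
        using i by (auto simp: gop_mult IH gop_eta T simp del: eta_act.simps)
    qed
  qed
qed

lemma um_gop:
  assumes "v \<in> tensors (I_big r) m" "g \<in> good r"
  shows "gop q g (um r P v) = um r P (gop q g v)"
proof (rule lin_eq_tensors[OF lin_comp[OF lin_gop lin_um] lin_comp[OF lin_um lin_gop] assms(1)])
  fix f assume f: "f \<in> words (I_big r) m"
  let ?P = "pat r f" and ?v = "filt r f"
  have v: "Mvec ?v \<in> tensors (I_small r) (nz ?P)" using filt_words[OF f] by simp
  have v': "Mvec ?v \<in> tensors UNIV (nz ?P)" using v tensors_mono[of "I_small r" UNIV] by blast
  have "um r P (gop q g (Mvec f)) = um r P (gop q g (mg ?P (Mvec ?v)))"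
    by (simp add: mg_Mvec merge_pat_filt[OF f])
  also have "\<dots> = um r P (mg ?P (gop q g (Mvec ?v)))"
    by (simp add: mg_gop[OF pat_pats[OF f] v' assms(2)])
  also have "\<dots> = (if P = ?P then gop q g (Mvec ?v) else 0)"
    by (rule um_mg[OF pat_pats[OF f] gop_small[OF assms(2) v]])
  also have "\<dots> = gop q g (um r P (Mvec f))" by (auto simp: um_def lin_0)
  finally show "gop q g (um r P (Mvec f)) = um r P (gop q g (Mvec f))" ..
qed

section \<open>The projections onto the layers\<close>

definition bp :: "nat \<Rightarrow> nat \<Rightarrow> nat \<Rightarrow> rat list" where
  "bp r m l = replicate l 0 @ replicate (m - l) (top_idx r)"

lemma bp_pats: "l \<le> m \<Longrightarrow> bp r m l \<in> pats r m"
  by (auto simp: bp_def pats_def words_def)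

lemma nz_append: "nz (P @ Q) = nz P + nz Q" by (simp add: nz_def)

lemma nz_bp [simp]: "nz (bp r m l) = l"
proof -
  have "nz (replicate n (0::rat)) = n" for n by (induction n) auto
  moreover have "nz (replicate n (top_idx r)) = 0" for n by (induction n) auto
  ultimately show ?thesis by (simp add: bp_def nz_append)
qed

lemma bp_inj: "bp r m l = bp r m k \<Longrightarrow> l = k"
  by (metis nz_bp)

lemma merge_bp: "length v = l \<Longrightarrow> merge (bp r m l) v = v @ replicate (m - l) (top_idx r)"
proof (induction l arbitrary: v m)
  case 0
  have "merge (replicate n (top_idx r)) [] = replicate n (top_idx r)" for n by (induction n) auto
  with 0 show ?case by (simp add: bp_def)
next
  case (Suc l)
  then obtain x v' where v: "v = x # v'" "length v' = l" by (cases v) auto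
  have "bp r m (Suc l) = 0 # bp r (m - 1) l" by (simp add: bp_def)
  with Suc.IH[OF v(2), of "m - 1"] v show ?case by simp
qed

lemma mg_bp:
  assumes "v \<in> tensors J l"
  shows "mg (bp r m l) v = v * Mvec (replicate (m - l) (top_idx r))"
  by (rule lin_eq_tensors[OF _ _ assms]) (auto simp: mg_Mvec Mvec_mult merge_bp words_def)

lemma in_layer_nth:
  assumes "l \<le> m"
  shows "in_layer r m l f \<longleftrightarrow> length f = m \<and> (\<forall>p<m. if p < l then f ! p \<in> I_small r else f ! p = top_idx r)"
proof (cases "length f = m")
  case True
  have "set (take l f) \<subseteq> I_small r \<longleftrightarrow> (\<forall>p<l. f ! p \<in> I_small r)"
    using True assms by (auto simp: set_conv_nth)
  moreover have "drop l f = replicate (m - l) (top_idx r) \<longleftrightarrow> (\<forall>p<m - l. f ! (l + p) = top_idx r)"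
    using True assms by (auto simp: list_eq_iff_nth_eq)
  moreover have "(\<forall>p<m - l. f ! (l + p) = top_idx r) \<longleftrightarrow> (\<forall>p<m. l \<le> p \<longrightarrow> f ! p = top_idx r)"
    by (metis add.commute add_diff_inverse_nat le_add1 less_diff_conv not_less)
  ultimately show ?thesis using True assms unfolding in_layer_def by auto
qed (simp add: in_layer_def)

lemma in_layer_pat:
  assumes "l \<le> m" "f \<in> words (I_big r) m"
  shows "in_layer r m l f \<longleftrightarrow> pat r f = bp r m l"
proof -
  have "pat r f = bp r m l \<longleftrightarrow> (\<forall>p<m. (if f ! p \<in> I_small r then 0 else f ! p) = (if p < l then 0 else top_idx r))"
    using assms by (auto simp: list_eq_iff_nth_eq pat_def bp_def words_def nth_append)
  also have "\<dots> \<longleftrightarrow> (\<forall>p<m. if p < l then f ! p \<in> I_small r else f ! p = top_idx r)"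
  proof (intro all_cong)
    fix p assume "p < m"
    then have "f ! p \<in> I_big r" using assms(2) by (auto simp: words_def)
    then have "f ! p \<noteq> 0" by auto
    then show "((if f ! p \<in> I_small r then 0 else f ! p) = (if p < l then 0 else top_idx r)) =
        (if p < l then f ! p \<in> I_small r else f ! p = top_idx r)" by auto
  qed
  finally show ?thesis using assms in_layer_nth[OF assms(1)] by (auto simp: words_def)
qed

definition proj :: "nat \<Rightarrow> nat \<Rightarrow> nat \<Rightarrow> (rat list \<Rightarrow>\<^sub>0 'k::field) \<Rightarrow> (rat list \<Rightarrow>\<^sub>0 'k)" where
  "proj r m l = lin_ext (\<lambda>f. if in_layer r m l f then Mvec f else 0)"

lemma lin_proj [simp, intro]: "lin (proj r m l)" by (simp add: proj_def)

lemma proj_tensors: "v \<in> tensors (I_big r) m \<Longrightarrow> proj r m l v \<in> tensors (I_big r) m"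
  by (rule tensors_lin[OF lin_proj]) (auto simp: proj_def)

lemma proj_mg_um:
  assumes "l \<le> m" "v \<in> tensors (I_big r) m"
  shows "proj r m l v = mg (bp r m l) (um r (bp r m l) v)"
proof (rule lin_eq_tensors[OF lin_proj lin_comp[OF lin_mg lin_um] assms(2)])
  fix f assume f: "f \<in> words (I_big r) m"
  show "proj r m l (Mvec f) = mg (bp r m l) (um r (bp r m l) (Mvec f))"
    using in_layer_pat[OF assms(1) f] merge_pat_filt[OF f] by (auto simp: proj_def um_def mg_Mvec lin_0)
qed

lemma proj_proj:
  assumes "l \<le> m" "k \<le> m" "v \<in> tensors (I_big r) m"
  shows "proj r m k (proj r m l v) = (if k = l then proj r m l v else 0)"
proof (rule lin_eq_tensors[OF lin_comp[OF lin_proj lin_proj] _ assms(3)])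
  show "lin (\<lambda>v. if k = l then proj r m l v else 0)" by (cases "k = l") auto
  fix f assume "f \<in> words (I_big r) m"
  with in_layer_pat[OF assms(1) this] in_layer_pat[OF assms(2) this]
  show "proj r m k (proj r m l (Mvec f)) = (if k = l then proj r m l (Mvec f) else 0)"
    by (auto simp: proj_def lin_ext_simps dest: bp_inj)
qed

lemma proj_gop:
  assumes "l \<le> m" "v \<in> tensors (I_big r) m" "g \<in> good r"
  shows "gop q g (proj r m l v) = proj r m l (gop q g v)"
proof -
  have g: "g \<in> good (r + 1)" using assms(3) by (auto simp: good_def I_int_def)
  have t: "um r (bp r m l) v \<in> tensors UNIV (nz (bp r m l))"
    using um_tensors[OF assms(2), of "bp r m l"] tensors_mono[of "I_small r" UNIV] by blast
  show ?thesis
    by (simp add: proj_mg_um[OF assms(1,2)] proj_mg_um[OF assms(1) gop_big[OF g assms(2)]]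
       mg_gop[OF bp_pats[OF assms(1)] t assms(3)] um_gop[OF assms(2,3)])
qed

lemma K_diag: "\<exists>c. gop q (qK i) (Mvec f) = scal c * Mvec f" "\<exists>c. gop q (qKinv i) (Mvec f) = scal c * Mvec f"
proof -
  have "\<exists>c. gact q f h = scal c * Mvec f" if "h = qK i \<or> h = qKinv i" for h
    using that
  proof (induction f)
    case Nil
    then show ?case by (auto intro!: exI[of _ 1])
  next
    case (Cons j f)
    then obtain c where c: "gact q f h = scal c * Mvec f" by blast
    have "\<exists>d. eta_act q h j = scal d * eta j"
      using Cons.prems by (cases "j = of_int i - 1/2"; cases "j = of_int i + 1/2") (auto intro: exI[of _ 1])
    then obtain d where d: "eta_act q h j = scal d * eta j" by blast
    have "gact q (j # f) h = eta_act q h j * gact q f h" using Cons.prems by auto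
    also have "\<dots> = scal (d * c) * Mvec (j # f)"
      unfolding c d Mvec_Cons[of j f] by (simp add: mult.assoc scal_pull scal_scal)
    finally show ?case by blast
  qed
  then show "\<exists>c. gop q (qK i) (Mvec f) = scal c * Mvec f" "\<exists>c. gop q (qKinv i) (Mvec f) = scal c * Mvec f"
    by (auto simp: gop_Mvec)
qed

text \<open>Serves \<open>k_el i\<close> with i = \<plusminus>(r + 1), whose factors are not
  \<open>good\<close> generators. They are diagonal in the basis of words, and a coordinate
  projection commutes with every diagonal operator.\<close>

lemma proj_K:
  assumes "g = qK i \<or> g = qKinv i"
  shows "gop q g (proj r m l v) = proj r m l (gop q g v)"
proof (rule lin_eqM[OF lin_comp[OF lin_gop lin_proj] lin_comp[OF lin_proj lin_gop]])
  fix f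
  obtain c where "gop q g (Mvec f) = scal c * Mvec f" using K_diag assms by blast
  then show "gop q g (proj r m l (Mvec f)) = proj r m l (gop q g (Mvec f))"
    by (auto simp: proj_def lin_ext_simps lin_0)
qed

lemma place_place: "i < length f \<Longrightarrow> place (place f i) i = (f :: rat list)"
  by (rule nth_equalityI) (auto simp: place_def nth_list_update)

text \<open>The swap with i = l would exchange the last letter of V with the first
  \<open>top_idx r\<close>; every other adjacent swap stays on one side of the border.\<close>

lemma in_layer_place:
  assumes "l \<le> m" "0 < i" "i < m" "i \<noteq> l"
  shows "in_layer r m l (place f i) \<longleftrightarrow> in_layer r m l f"
proof -
  have *: "in_layer r m l (place f i)" if "in_layer r m l f" for f
  proof -
    from that have f: "length f = m" "\<And>p. p < m \<Longrightarrow> if p < l then f ! p \<in> I_small r else f ! p = top_idx r"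
      by (auto simp: in_layer_nth[OF assms(1)])
    have "if p < l then place f i ! p \<in> I_small r else place f i ! p = top_idx r" if "p < m" for p
      using f(2)[OF that] f(2)[of i] f(2)[of "i - 1"] assms that f(1)
      by (auto simp: place_def nth_list_update split: if_splits simp del: One_nat_def)
    then show ?thesis by (simp add: in_layer_nth[OF assms(1)] f(1)) (simp add: place_def f(1))
  qed
  show ?thesis
  proof
    assume a: "in_layer r m l (place f i)"
    then have "length f = m" by (auto simp: in_layer_def place_def split: if_splits)
    with *[OF a] show "in_layer r m l f" using assms by (simp add: place_place)
  qed (rule *)
qed

lemma proj_Psi:
  assumes "l \<le> m" "0 < i" "i < m" "i \<noteq> l" "v \<in> tensors (I_big r) m"
  shows "proj r m l (Psi_gen q i v) = Psi_gen q i (proj r m l v)"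
proof (rule lin_eqM[OF lin_comp[OF lin_proj lin_Psi] lin_comp[OF lin_Psi lin_proj]])
  fix f
  show "proj r m l (Psi_gen q i (Mvec f)) = Psi_gen q i (proj r m l (Mvec f))"
    using assms(2) in_layer_place[OF assms(1-4), of r f]
    by (auto simp: Psi_Mvec M_act_def proj_def lin_ext_simps Psi_simps)
qed

lemma Psi_proj_top:
  assumes "l \<le> m" "l < i" "i < m"
  shows "Psi_gen q i (proj r m l v) = scal (inverse q) * proj r m l v"
proof (rule lin_eqM[OF lin_comp[OF lin_Psi lin_proj] lin_scal_mult[OF lin_proj]])
  fix f
  have "f ! (i - 1) = f ! i" if "in_layer r m l f"
  proof -
    have "\<And>p. p < m \<Longrightarrow> if p < l then f ! p \<in> I_small r else f ! p = top_idx r"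
      using that by (auto simp: in_layer_nth[OF assms(1)])
    from this[of i] this[of "i - 1"] assms show ?thesis by (auto split: if_splits simp del: One_nat_def)
  qed
  then show "Psi_gen q i (proj r m l (Mvec f)) = scal (inverse q) * proj r m l (Mvec f)"
    using assms(2) by (auto simp: proj_def Psi_simps Psi_Mvec M_act_def)
qed

section \<open>Well-definedness of the representation of the duplex Hecke algebra\<close>

lemma free_alg_closed:
  "supp a \<subseteq> lists X \<Longrightarrow> supp b \<subseteq> lists X \<Longrightarrow> supp (a + b) \<subseteq> lists X"
  "supp a \<subseteq> lists X \<Longrightarrow> supp b \<subseteq> lists X \<Longrightarrow> supp (a - b) \<subseteq> lists X"
  "supp (scal c :: _ \<Rightarrow>\<^sub>0 'k::field) \<subseteq> lists X" "g \<in> X \<Longrightarrow> supp (gen g :: _ \<Rightarrow>\<^sub>0 'k::field) \<subseteq> lists X"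
  "supp (1 :: _ \<Rightarrow>\<^sub>0 'k::field) \<subseteq> lists X"
  for a b :: "'g list \<Rightarrow>\<^sub>0 'k::field"
proof -
  assume "supp a \<subseteq> lists X" "supp b \<subseteq> lists X"
  then show "supp (a + b) \<subseteq> lists X" "supp (a - b) \<subseteq> lists X"
    using keys_add[of a b] keys_add[of a "- b"] supp_uminus[of b] by (blast, simp) (metis Un_least order_trans)
qed (auto simp: scal_def gen_def zero_list_def split: if_splits)

lemmas fc = free_alg_closed supp_mult_lists

lemma hecke_rels_closed:
  assumes "\<And>i. i < l \<Longrightarrow> supp (h i) \<subseteq> lists X"
  shows "hecke_rels q l h \<subseteq> carrier (free_alg X)"
  unfolding hecke_rels_def free_alg_simps
proof (intro Un_least subsetI, goal_cases)
  case (1 x)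
  then obtain i where "i < l" "x = (h i - scal (inverse q)) * (h i + scal q)" by blast
  then show ?case by (simp only: mem_Collect_eq) (intro fc assms)
next
  case (2 x)
  then obtain i where "i < l" "i + 1 < l" "x = h i * h (i + 1) * h i - h (i + 1) * h i * h (i + 1)" by auto
  then show ?case by (simp only: mem_Collect_eq) (intro fc assms)
next
  case (3 x)
  then obtain i j where "i < l" "j < l" "x = h i * h j - h j * h i" by blast
  then show ?case by (simp only: mem_Collect_eq) (intro fc assms)
next
  case (4 x)
  then have "0 < l" "1 < l" "x = h 0 * h 1 * h 0 * h 1 - h 1 * h 0 * h 1 * h 0" by (auto split: if_splits)
  then show ?case by (simp only: mem_Collect_eq) (intro fc assms)
qed

lemma prod_list_gen: "prod_list (map gen w) = (mono1 w :: 'g list \<Rightarrow>\<^sub>0 'k::field)"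
proof (induction w)
  case Nil
  have "(1 :: 'g list \<Rightarrow>\<^sub>0 'k) = mono1 0" by simp
  then show ?case by (simp add: zero_list_def)
qed (simp add: gen_def mono1_mult plus_list_def)

abbreviation Psiw :: "'k::field \<Rightarrow> nat list \<Rightarrow> (rat list \<Rightarrow>\<^sub>0 'k) \<Rightarrow> (rat list \<Rightarrow>\<^sub>0 'k)" where
  "Psiw q w \<equiv> fold (Psi_gen q) w"

lemma lin_Psiw [simp, intro]: "lin (Psiw q w)" by (rule lin_fold) simp

lemma Psi_big: "v \<in> tensors (I_big r) m \<Longrightarrow> i < m \<Longrightarrow> Psi_gen q i v \<in> tensors (I_big r) m"
  by (rule Psi_tensors) (auto simp: uminus_I_big)
lemma Psi_small: "v \<in> tensors (I_small r) m \<Longrightarrow> i < m \<Longrightarrow> Psi_gen q i v \<in> tensors (I_small r) m"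
  by (rule Psi_tensors) (auto simp: uminus_I_small)
lemma Psiw_big: "v \<in> tensors (I_big r) m \<Longrightarrow> set w \<subseteq> {..<m} \<Longrightarrow> Psiw q w v \<in> tensors (I_big r) m"
  by (rule fold_tensors) (auto intro: Psi_big)
lemma Psiw_small: "v \<in> tensors (I_small r) m \<Longrightarrow> set w \<subseteq> {..<m} \<Longrightarrow> Psiw q w v \<in> tensors (I_small r) m"
  by (rule fold_tensors) (auto intro: Psi_small)

lemma Psiw_left:
  "v \<in> tensors UNIV n \<Longrightarrow> set w \<subseteq> {..<n} \<Longrightarrow> Psiw q w (v * z) = Psiw q w v * z"
proof (induction w arbitrary: v)
  case (Cons i w)
  have "Psi_gen q i v \<in> tensors UNIV n" using Cons.prems by (intro Psi_tensors) auto
  with Cons show ?case by (simp add: Psi_left[OF Cons.prems(1)])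
qed simp

text \<open>Unfolds the inner \<open>descend\<close>: the coset of the reduced word acts as the word
  itself, because \<open>Psi_gen\<close> satisfies the Hecke relations on
  \<open>tensors (I_small r) l\<close>.\<close>

lemma PsiV_H_perm:
  fixes q :: "'k::field"
  assumes "q \<noteq> 0" "\<sigma> \<in> Sym l" "v \<in> tensors (I_small r) l"
  shows "PsiV r q l (H_perm q l \<sigma>) v = Psiw q (reduced_expr l \<sigma>) v"
proof -
  have "descend (free_right_act (tensors (I_small r) l) (Psi_gen q)) (cls {..<l} (hecke_rels q l gen) (mono1 (reduced_expr l \<sigma>)))
      = (\<lambda>v\<in>tensors (I_small r) l. ract (Psi_gen q) (mono1 (reduced_expr l \<sigma>)) v)"
  proof (rule descend_free_right_act)
    show "hecke_rels q l gen \<subseteq> carrier (free_alg {..<l})" by (rule hecke_rels_closed) (intro fc, simp)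
    show "ract (Psi_gen q) a v = 0" if "a \<in> hecke_rels q l gen" "v \<in> tensors (I_small r) l" for a v
      by (rule hecke_rels_Psi[OF _ _ assms(1) _ _ that(2,1)]) (auto simp: ract_gen)
  qed (auto intro: Psi_small)
  with assms(3) show ?thesis
    by (simp add: PsiV_def H_perm_def Hecke_cls_def prod_list_gen ract_single)
qed

context
  fixes r m :: nat and q :: "'k::field"
  assumes q0: "q \<noteq> 0" and q1: "q - inverse q \<noteq> 0" and m2: "2 \<le> m"
begin

abbreviation "W \<equiv> tensors (I_big r) m :: (rat list \<Rightarrow>\<^sub>0 'k) set"

lemma lin_Xi_gen: "lin (Xi_gen r m q g)" by (cases g) simp_all

text \<open>A reduced word only moves the first l positions, so it may be applied to the full tensor
  power after projecting to the layer. All relations of the duplex algebra thereby become statements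
  about \<open>proj\<close> and \<open>Psi_gen\<close>.\<close>

lemma Xi_DX:
  assumes "l \<le> m" "\<sigma> \<in> Sym l" "v \<in> W"
  shows "Xi_gen r m q (DX l \<sigma>) v = Psiw q (reduced_expr l \<sigma>) (proj r m l v)"
proof (rule lin_eq_tensors[OF lin_Xi_gen lin_comp[OF lin_Psiw lin_proj] assms(3)])
  fix f assume f: "f \<in> words (I_big r) m"
  show "Xi_gen r m q (DX l \<sigma>) (Mvec f) = Psiw q (reduced_expr l \<sigma>) (proj r m l (Mvec f))"
  proof (cases "in_layer r m l f")
    case True
    then have t: "Mvec (take l f) \<in> tensors (I_small r) l"
      using assms(1) by (auto simp: in_layer_def words_def)
    have t': "Mvec (take l f) \<in> tensors UNIV l" using assms(1) f by (auto simp: words_def)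
    have s: "set (reduced_expr l \<sigma>) \<subseteq> {..<l}" using reduced_expr(1)[OF assms(2)] by auto
    show ?thesis
      using Psiw_left[OF t' s, of q "Mvec (drop l f)"] True
      by (simp add: PsiV_H_perm[OF q0 assms(2) t] proj_def Mvec_mult)
  next
    case False
    then show ?thesis by (simp add: proj_def lin_0)
  qed
qed

lemma Xi_gen_W: "g \<in> dgens m \<Longrightarrow> v \<in> W \<Longrightarrow> Xi_gen r m q g v \<in> W"
proof (cases g)
  case (DX l \<sigma>)
  assume g: "g \<in> dgens m" "v \<in> W"
  with DX have l: "l \<le> m" "\<sigma> \<in> Sym l" by (auto simp: dgens_def)
  show ?thesis unfolding DX Xi_DX[OF l g(2)]
    using reduced_expr(1)[OF l(2)] l by (intro Psiw_big proj_tensors g(2)) auto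
qed (auto simp: dgens_def Psi_big)

lemma Psi_matsumoto:
  assumes "l \<le> m" "x \<in> W" "set u \<subseteq> {1..<l}" "set v \<subseteq> {1..<l}" "perm_of_word u = perm_of_word v"
    "length u = ninv l (perm_of_word u)" "length v = ninv l (perm_of_word v)"
  shows "Psiw q u x = Psiw q v x"
proof (rule matsumoto[where W = W and op = "Psi_gen q" and l = l])
  show "Psi_gen q i (Psi_gen q (i + 1) (Psi_gen q i x)) = Psi_gen q (i + 1) (Psi_gen q i (Psi_gen q (i + 1) x))"
    if "1 \<le> i" "i + 1 < l" "x \<in> W" for i x
    using that assms(1) by (intro Psi_braid[OF q0 that(3)]) auto
  show "Psi_gen q i (Psi_gen q j x) = Psi_gen q j (Psi_gen q i x)"
    if "1 \<le> i" "i + 1 < j" "j < l" "x \<in> W" for i j x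
    using that assms(1) by (intro Psi_far[OF that(4)]) auto
qed (use assms in \<open>auto intro: Psi_big\<close>)

text \<open>In a right action a right factor s_i is applied last. Appending i to a reduced word of
  \<sigma> gives a reduced word of the product, which \<open>Psi_matsumoto\<close> identifies with
  the chosen one.\<close>

lemma red_up_right:
  assumes "l \<le> m" "\<sigma> \<in> Sym l" "0 < i" "i < l" "x \<in> W" "len l (\<sigma> \<circ> transp i) = len l \<sigma> + 1"
  shows "Psi_gen q i (Psiw q (reduced_expr l \<sigma>) x) = Psiw q (reduced_expr l (\<sigma> \<circ> transp i)) x"
proof -
  have s: "\<sigma> \<circ> transp i \<in> Sym l" using assms by (intro comp_Sym transp_Sym)
  note R = reduced_expr[OF assms(2)] reduced_expr[OF s]
  have p: "perm_of_word (reduced_expr l \<sigma> @ [i]) = \<sigma> \<circ> transp i"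
    unfolding perm_of_word_append R(2) by auto
  have "Psiw q (reduced_expr l \<sigma> @ [i]) x = Psiw q (reduced_expr l (\<sigma> \<circ> transp i)) x"
    using assms(3,4,6) by (intro Psi_matsumoto[OF assms(1,5)]) (unfold p R, use R len_ninv[OF s] len_ninv[OF assms(2)] in auto)
  then show ?thesis by simp
qed

lemma red_up_left:
  assumes "l \<le> m" "\<sigma> \<in> Sym l" "0 < i" "i < l" "x \<in> W" "len l (transp i \<circ> \<sigma>) = len l \<sigma> + 1"
  shows "Psiw q (reduced_expr l \<sigma>) (Psi_gen q i x) = Psiw q (reduced_expr l (transp i \<circ> \<sigma>)) x"
proof -
  have s: "transp i \<circ> \<sigma> \<in> Sym l" using assms by (intro comp_Sym transp_Sym)
  note R = reduced_expr[OF assms(2)] reduced_expr[OF s]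
  have p: "perm_of_word (i # reduced_expr l \<sigma>) = transp i \<circ> \<sigma>"
    unfolding perm_of_word_Cons R(2) by auto
  have "Psiw q (i # reduced_expr l \<sigma>) x = Psiw q (reduced_expr l (transp i \<circ> \<sigma>)) x"
    using assms(3,4,6) by (intro Psi_matsumoto[OF assms(1,5)]) (unfold p R, use R len_ninv[OF s] len_ninv[OF assms(2)] in auto)
  then show ?thesis by simp
qed

lemma red_id: "reduced_expr l id = []"
  using reduced_expr(3)[OF id_Sym, of l] by simp

lemma red_transp:
  assumes "l \<le> m" "0 < i" "i < l" "x \<in> W"
  shows "Psiw q (reduced_expr l (transp i)) x = Psi_gen q i x"
proof -
  have "ninv l (id \<circ> transp i) = ninv l id + 1" using assms by (intro ninv_up) auto
  then have "len l (id \<circ> transp i) = len l id + 1"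
    using assms by (simp add: len_ninv transp_Sym)
  from red_up_right[OF assms(1) id_Sym assms(2-4) this] show ?thesis by (simp add: red_id)
qed

text \<open>With \<tau> = \<sigma> s_i the length goes up from \<tau> to \<sigma>, so the word
  chosen for \<sigma> may be replaced by one ending in i, and the quadratic relation
  applies.\<close>

lemma red_down_right:
  assumes "l \<le> m" "\<sigma> \<in> Sym l" "0 < i" "i < l" "x \<in> W" "len l \<sigma> = len l (\<sigma> \<circ> transp i) + 1"
  shows "Psi_gen q i (Psiw q (reduced_expr l \<sigma>) x)
     = Psiw q (reduced_expr l (\<sigma> \<circ> transp i)) x + scal (inverse q - q) * Psiw q (reduced_expr l \<sigma>) x"
proof -
  let ?\<tau> = "\<sigma> \<circ> transp i"
  have \<tau>: "?\<tau> \<in> Sym l" using assms by (intro comp_Sym transp_Sym)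
  have "len l (?\<tau> \<circ> transp i) = len l ?\<tau> + 1" using assms(6) by (simp only: comp_transp_transp)
  from red_up_right[OF assms(1) \<tau> assms(3-5) this]
  have e: "Psiw q (reduced_expr l \<sigma>) x = Psi_gen q i (Psiw q (reduced_expr l ?\<tau>) x)"
    by (simp only: comp_transp_transp)
  have "Psiw q (reduced_expr l ?\<tau>) x \<in> W"
    using reduced_expr(1)[OF \<tau>] assms(1) by (intro Psiw_big[OF assms(5)]) auto
  then show ?thesis unfolding e using assms by (intro Psi_quad[OF q0, where J = "I_big r" and n = m]) auto
qed

lemma red_down_left:
  assumes "l \<le> m" "\<sigma> \<in> Sym l" "0 < i" "i < l" "x \<in> W" "len l \<sigma> = len l (transp i \<circ> \<sigma>) + 1"
  shows "Psiw q (reduced_expr l \<sigma>) (Psi_gen q i x)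
     = Psiw q (reduced_expr l (transp i \<circ> \<sigma>)) x + scal (inverse q - q) * Psiw q (reduced_expr l \<sigma>) x"
proof -
  let ?\<tau> = "transp i \<circ> \<sigma>"
  have \<tau>: "?\<tau> \<in> Sym l" using assms by (intro comp_Sym transp_Sym)
  have tt: "transp i \<circ> ?\<tau> = \<sigma>" by (simp only: comp_assoc[symmetric] transp_transp id_comp)
  have "len l (transp i \<circ> ?\<tau>) = len l ?\<tau> + 1" using assms(6) by (simp only: tt)
  note up = red_up_left[where \<sigma> = ?\<tau>, OF assms(1) \<tau> assms(3,4) _ this, unfolded tt]
  have x: "Psi_gen q i x \<in> W" using assms by (intro Psi_big) auto
  have "Psiw q (reduced_expr l \<sigma>) (Psi_gen q i x) = Psiw q (reduced_expr l ?\<tau>) (Psi_gen q i (Psi_gen q i x))"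
    using up[OF x] by (rule sym)
  also have "Psi_gen q i (Psi_gen q i x) = x + scal (inverse q - q) * Psi_gen q i x"
    using assms by (intro Psi_quad[OF q0, where J = "I_big r" and n = m]) auto
  finally show ?thesis by (simp only: up[OF assms(5)] lin_add[OF lin_Psiw] lin_scal[OF lin_Psiw])
qed

lemma proj_Psiw:
  assumes "l \<le> m" "set w \<subseteq> {1..<l}" "v \<in> W"
  shows "proj r m l (Psiw q w v) = Psiw q w (proj r m l v)"
  using assms(2,3)
proof (induction w arbitrary: v)
  case (Cons i w)
  then have "0 < i" "i < l" by auto
  with assms(1) Cons show ?case by (simp add: Psi_big proj_Psi)
qed simp

lemma drels_ract:
  assumes "a \<in> drels m q" "v \<in> W" shows "ract (Xi_gen r m q) a v = 0"
proof -
  note lin = lin_Xi_gen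
  have DT: "Xi_gen r m q (DT i) x = Psi_gen q i x" for i x by simp
  \<comment> \<open>Hecke words in the letters 1, ..., l - 1 keep a vector of layer l in that layer.
    In a product of two generators \<open>DX l\<close> the second projection therefore acts as the
    identity.\<close>
  have key: "\<exists>u. u = proj r m l v \<and> u \<in> W \<and> proj r m l u = u \<and>
      (\<forall>w. set w \<subseteq> {1..<l} \<longrightarrow> Psiw q w u \<in> W \<and> proj r m l (Psiw q w u) = Psiw q w u)" if "l \<le> m" for l
  proof -
    let ?u = "proj r m l v"
    have u: "?u \<in> W" "proj r m l ?u = ?u" using proj_proj[OF that that assms(2)] by (simp_all add: proj_tensors assms(2))
    moreover have "Psiw q w ?u \<in> W \<and> proj r m l (Psiw q w ?u) = Psiw q w ?u" if w: "set w \<subseteq> {1..<l}" for w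
      using proj_Psiw[OF \<open>l \<le> m\<close> w u(1)] u w \<open>l \<le> m\<close> by (auto intro!: Psiw_big)
    ultimately show ?thesis by blast
  qed
  have red: "set (reduced_expr l \<sigma>) \<subseteq> {1..<l}" if "\<sigma> \<in> Sym l" for l \<sigma> using reduced_expr(1)[OF that] .
  from assms(1) show ?thesis
    unfolding drels_def Un_iff mem_Collect_eq
  proof (elim disjE exE conjE, goal_cases)
    case 1
    then show ?thesis
      by (intro hecke_rels_Psi[OF lin _ q0 _ _ assms(2)]) (auto simp: ract_gen)
  next
    case (2 l \<sigma> i)
    note ur = 2(2-6) 2(1)
    obtain u where u: "u = proj r m l v" "u \<in> W" "proj r m l u = u"
      "\<And>w. set w \<subseteq> {1..<l} \<Longrightarrow> Psiw q w u \<in> W \<and> proj r m l (Psiw q w u) = Psiw q w u" using key[OF ur(1)] by blast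
    have "\<sigma> \<circ> transp i \<in> Sym l" "transp i \<in> Sym l" using ur by (auto intro!: comp_Sym transp_Sym)
    then show ?thesis
      using red_up_right[OF ur(1-4) u(2) ur(5)] u(4)[OF red[OF ur(2)]] ur
      by (simp add: ract_simps lin Xi_DX assms(2) u(1)[symmetric] red_transp del: Xi_gen.simps(2))
  next
    case (3 l \<sigma> i)
    note dr = 3(2-6) 3(1)
    obtain u where u: "u = proj r m l v" "u \<in> W" "proj r m l u = u"
      "\<And>w. set w \<subseteq> {1..<l} \<Longrightarrow> Psiw q w u \<in> W \<and> proj r m l (Psiw q w u) = Psiw q w u" using key[OF dr(1)] by blast
    have "\<sigma> \<circ> transp i \<in> Sym l" "transp i \<in> Sym l" using dr by (auto intro!: comp_Sym transp_Sym)
    then show ?thesis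
      using red_down_right[OF dr(1-4) u(2) dr(5)] u(4)[OF red[OF dr(2)]] dr
      by (simp add: ract_simps lin Xi_DX assms(2) u(1)[symmetric] red_transp tensors_scal lin_scal lin_proj lin_Psiw del: Xi_gen.simps(2))
  next
    case (4 l \<sigma> i)
    note ul = 4(2-6) 4(1)
    obtain u where u: "u = proj r m l v" "u \<in> W" "proj r m l u = u"
      "\<And>w. set w \<subseteq> {1..<l} \<Longrightarrow> Psiw q w u \<in> W \<and> proj r m l (Psiw q w u) = Psiw q w u" using key[OF ul(1)] by blast
    have s: "transp i \<circ> \<sigma> \<in> Sym l" "transp i \<in> Sym l" using ul by (auto intro!: comp_Sym transp_Sym)
    show ?thesis
      using red_up_left[OF ul(1-4) u(2) ul(5)] u(4)[OF red[OF s(2)]] ul s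
      by (simp add: ract_simps lin Xi_DX assms(2) u(1)[symmetric] red_transp u(2) del: Xi_gen.simps(2))
  next
    case (5 l \<sigma> i)
    note dl = 5(2-6) 5(1)
    obtain u where u: "u = proj r m l v" "u \<in> W" "proj r m l u = u"
      "\<And>w. set w \<subseteq> {1..<l} \<Longrightarrow> Psiw q w u \<in> W \<and> proj r m l (Psiw q w u) = Psiw q w u" using key[OF dl(1)] by blast
    have s: "transp i \<circ> \<sigma> \<in> Sym l" "transp i \<in> Sym l" using dl by (auto intro!: comp_Sym transp_Sym)
    show ?thesis
      using red_down_left[OF dl(1-4) u(2) dl(5)] u(4)[OF red[OF s(2)]] dl s
      by (simp add: ract_simps lin Xi_DX assms(2) u(1)[symmetric] red_transp u(2) tensors_scal lin_scal lin_proj lin_Psiw del: Xi_gen.simps(2))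
  next
    case (6 l k \<sigma> \<gamma>)
    note z = 6(2-6) 6(1)
    obtain u where u: "u = proj r m l v" "u \<in> W" "proj r m l u = u"
      "\<And>w. set w \<subseteq> {1..<l} \<Longrightarrow> Psiw q w u \<in> W \<and> proj r m l (Psiw q w u) = Psiw q w u" using key[OF z(1)] by blast
    have y: "Psiw q (reduced_expr l \<sigma>) u \<in> W" "proj r m l (Psiw q (reduced_expr l \<sigma>) u) = Psiw q (reduced_expr l \<sigma>) u"
      using u(4)[OF red[OF z(4)]] by auto
    have "proj r m k (Psiw q (reduced_expr l \<sigma>) u) = 0"
      using proj_proj[OF z(1,2) y(1)] z(3) by (simp add: y(2))
    then show ?thesis using z y(1)
      by (simp add: ract_simps lin Xi_DX assms(2) u(1)[symmetric] lin_0[OF lin_Psiw] del: Xi_gen.simps(2))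
  next
    case (7 l \<sigma> i)
    note tx = 7(2-5) 7(1)
    obtain u where u: "u = proj r m l v" "u \<in> W" "proj r m l u = u"
      "\<And>w. set w \<subseteq> {1..<l} \<Longrightarrow> Psiw q w u \<in> W \<and> proj r m l (Psiw q w u) = Psiw q w u" using key[OF tx(1)] by blast
    have s: "transp i \<in> Sym l" using tx by (auto intro!: transp_Sym)
    have "Psi_gen q i v \<in> W" "proj r m l (Psi_gen q i v) = Psi_gen q i u"
      using tx assms(2) by (auto simp: u(1) intro!: Psi_big proj_Psi)
    then show ?thesis using u(4)[OF red[OF s]] tx s
      by (simp add: ract_simps lin Xi_DX assms(2) u(1)[symmetric] red_transp u(2) DT del: Xi_gen.simps)
  next
    case (8 l \<sigma> i)
    note xt = 8(2-5) 8(1)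
    obtain u where u: "u = proj r m l v" "u \<in> W" "proj r m l u = u"
      "\<And>w. set w \<subseteq> {1..<l} \<Longrightarrow> Psiw q w u \<in> W \<and> proj r m l (Psiw q w u) = Psiw q w u" using key[OF xt(1)] by blast
    have s: "transp i \<in> Sym l" using xt by (auto intro!: transp_Sym)
    show ?thesis using u(4)[OF red[OF xt(2)]] xt s
      by (simp add: ract_simps lin Xi_DX assms(2) u(1)[symmetric] red_transp u(2) DT del: Xi_gen.simps)
  next
    case (9 l \<sigma> i)
    note tq = 9(2-5) 9(1)
    have "Psi_gen q i v \<in> W" "proj r m l (Psi_gen q i v) = scal (inverse q) * proj r m l v"
      using tq assms(2) by (auto simp: Psi_proj_top proj_Psi intro!: Psi_big)
    then show ?thesis using tq
      by (simp add: ract_simps lin Xi_DX assms(2) tensors_scal lin_scal lin_proj lin_Psiw DT del: Xi_gen.simps)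
  next
    case (10 l \<sigma> i)
    note qt = 10(2-5) 10(1)
    obtain u where u: "u = proj r m l v" "u \<in> W" "proj r m l u = u"
      "\<And>w. set w \<subseteq> {1..<l} \<Longrightarrow> Psiw q w u \<in> W \<and> proj r m l (Psiw q w u) = Psiw q w u" using key[OF qt(1)] by blast
    let ?y = "Psiw q (reduced_expr l \<sigma>) u"
    have y: "proj r m l ?y = ?y" using u(4)[OF red[OF qt(2)]] by auto
    have "Psi_gen q i ?y = scal (inverse q) * ?y"
      using Psi_proj_top[OF qt(1,3,4), of q r ?y] unfolding y .
    then show ?thesis using qt
      by (simp add: ract_simps lin Xi_DX assms(2) u(1)[symmetric] tensors_scal lin_scal lin_proj lin_Psiw DT del: Xi_gen.simps)
  qed
qed

lemma drels_closed: "drels m q \<subseteq> carrier (free_alg (dgens m))"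
proof -
  have g: "DT i \<in> dgens m" if "i < m" for i using that by (auto simp: dgens_def)
  have x: "DX l \<sigma> \<in> dgens m" if "l \<le> m" "\<sigma> \<in> Sym l" for l \<sigma> using that by (auto simp: dgens_def)
  have h: "hecke_rels q m (\<lambda>i. gen (DT i)) \<subseteq> carrier (free_alg (dgens m))"
    by (rule hecke_rels_closed) (intro fc g)
  show ?thesis
  proof
    fix a assume "a \<in> drels m q"
    then show "a \<in> carrier (free_alg (dgens m))"
      unfolding drels_def Un_iff mem_Collect_eq
    proof (elim disjE exE conjE, goal_cases)
      case 1
      then show ?case by (rule subsetD[OF h])
    qed (hypsubst, (unfold free_alg_simps mem_Collect_eq)?, (intro fc g x comp_Sym transp_Sym; simp))+
  qed
qed

text \<open>Removes the cosets from the duplex side: what remains is the set of operators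
  \<open>ract\<close> of free algebra elements.\<close>

lemma Xi_image: "Xi r m q ` carrier (HH m q) = {\<lambda>v\<in>W. ract (Xi_gen r m q) a v | a. supp a \<subseteq> lists (dgens m)}"
proof -
  have "Xi r m q (cls (dgens m) (drels m q) a) = (\<lambda>v\<in>W. ract (Xi_gen r m q) a v)" for a
    unfolding Xi_def
    by (rule descend_free_right_act[OF lin_Xi_gen Xi_gen_W drels_ract drels_closed])
  then show ?thesis
    unfolding HH_def carrier_presented by (simp add: image_image setcompr_eq_image)
qed

end

section \<open>The commutant\<close>

lemma qrels_closed: "qrels r q \<subseteq> carrier (free_alg (qgens r))"
proof -
  have g: "qE i \<in> qgens r" "qF i \<in> qgens r" "qK i \<in> qgens r" "qKinv i \<in> qgens r" if "i \<in> I_int (r + 1)" for i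
    using that by (auto simp: qgens_def)
  have z: "supp (0 :: qgen list \<Rightarrow>\<^sub>0 'a) \<subseteq> lists (qgens r)" by simp
  show ?thesis
    unfolding qrels_def power2_eq_square free_alg_simps
  proof (intro UN_least Un_least, goal_cases)
    case (1 i j)
    then show ?case by (cases "i = j") (simp_all only: insert_subset mem_Collect_eq empty_subsetI simp_thms if_True if_False,
        (intro conjI fc g z; assumption)+)
  next
    case (2 i j)
    then show ?case by (cases "\<bar>i - j\<bar> = 1") (simp_all only: insert_subset mem_Collect_eq empty_subsetI simp_thms if_True if_False,
        (intro conjI fc g z; assumption)?)
  next
    case (3 i j)
    then show ?case by (cases "\<bar>i - j\<bar> > 1") (simp_all only: insert_subset mem_Collect_eq empty_subsetI simp_thms if_True if_False,
        (intro conjI fc g z; assumption)?)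
  qed
qed

text \<open>Representatives in the free algebra of the elements of \<open>L_iota\<close>. The
  clauses mirror \<open>generate_ring\<close>, so that commutation is proved by induction on free
  algebra elements instead of cosets.\<close>

inductive_set Lfree :: "nat \<Rightarrow> 'k::field \<Rightarrow> (qgen list \<Rightarrow>\<^sub>0 'k) set" for r q where
  scal: "scal c \<in> Lfree r q"
| k: "i \<in> I_int (r + 1) \<Longrightarrow> k_el i \<in> Lfree r q"
| B: "i \<in> I_int r \<Longrightarrow> B_el q i \<in> Lfree r q"
| add: "a \<in> Lfree r q \<Longrightarrow> b \<in> Lfree r q \<Longrightarrow> a + b \<in> Lfree r q"
| uminus: "a \<in> Lfree r q \<Longrightarrow> - a \<in> Lfree r q"
| mult: "a \<in> Lfree r q \<Longrightarrow> b \<in> Lfree r q \<Longrightarrow> a * b \<in> Lfree r q"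

lemma Lfree_closed: "a \<in> Lfree r q \<Longrightarrow> supp a \<subseteq> lists (qgens r)"
proof (induction rule: Lfree.induct)
  case (k i)
  then show ?case unfolding k_el_def by (intro fc) (auto simp: qgens_def I_int_def)
next
  case (B i)
  have g: "qE i \<in> qgens r" "qF i \<in> qgens r" "qK i \<in> qgens r" "qKinv i \<in> qgens r" if "i \<in> I_int r" for i
    using that by (auto simp: qgens_def I_int_def)
  have "- i \<in> I_int r" "0 \<in> I_int r" using B by (auto simp: I_int_def)
  with B show ?case unfolding B_el_def by (cases "i = 0"; simp only: simp_thms if_True if_False; intro fc g)
qed (simp_all only: supp_uminus free_alg_closed supp_mult_lists)

lemma Uq_cls_hom:
  assumes "supp a \<subseteq> lists (qgens r)" "supp b \<subseteq> lists (qgens r)"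
  shows "Uq_cls r q a \<oplus>\<^bsub>Uq r q\<^esub> Uq_cls r q b = Uq_cls r q (a + b)"
    "Uq_cls r q a \<otimes>\<^bsub>Uq r q\<^esub> Uq_cls r q b = Uq_cls r q (a * b)"
    "\<ominus>\<^bsub>Uq r q\<^esub> Uq_cls r q a = Uq_cls r q (- a)"
    "\<one>\<^bsub>Uq r q\<^esub> = Uq_cls r q 1"
proof -
  let ?A = "free_alg (qgens r) :: (qgen list \<Rightarrow>\<^sub>0 'a) ring"
  let ?I = "rel_ideal (qgens r) (qrels r q)"
  interpret ideal ?I ?A by (rule rel_ideal_ideal[OF qrels_closed])
  have h: "(+>\<^bsub>?A\<^esub>) ?I \<in> ring_hom ?A (Uq r q)"
    using rcos_ring_hom by (simp add: Uq_def presented_def)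
  have e: "Uq_cls r q x = ?I +>\<^bsub>?A\<^esub> x" for x by (simp add: Uq_cls_def cls_def)
  have c: "a \<in> carrier ?A" "b \<in> carrier ?A" "- a \<in> carrier ?A" using assms by (simp_all add: supp_uminus)
  show add: "Uq_cls r q a \<oplus>\<^bsub>Uq r q\<^esub> Uq_cls r q b = Uq_cls r q (a + b)"
    using ring_hom_add[OF h c(1,2)] unfolding e by (simp only: free_alg_simps)
  show "Uq_cls r q a \<otimes>\<^bsub>Uq r q\<^esub> Uq_cls r q b = Uq_cls r q (a * b)"
    using ring_hom_mult[OF h c(1,2)] unfolding e by (simp only: free_alg_simps)
  show "\<one>\<^bsub>Uq r q\<^esub> = Uq_cls r q 1"
    using ring_hom_one[OF h] unfolding e by (simp only: free_alg_simps)
  interpret U: ring "Uq r q"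
    unfolding Uq_def presented_def by (rule quotient_is_ring)
  have cl: "Uq_cls r q a \<in> carrier (Uq r q)" "Uq_cls r q (- a) \<in> carrier (Uq r q)"
    using ring_hom_closed[OF h c(1)] ring_hom_closed[OF h c(3)] unfolding e by auto
  have "Uq_cls r q (- a) \<oplus>\<^bsub>Uq r q\<^esub> Uq_cls r q a = Uq_cls r q 0"
    using ring_hom_add[OF h c(3,1)] unfolding e by (simp only: free_alg_simps) simp
  also have "\<dots> = \<zero>\<^bsub>Uq r q\<^esub>"
  proof -
    have z: "0 \<in> carrier ?A" by simp
    have zc: "Uq_cls r q 0 \<in> carrier (Uq r q)" using ring_hom_closed[OF h z] unfolding e .
    have "Uq_cls r q 0 \<oplus>\<^bsub>Uq r q\<^esub> Uq_cls r q 0 = Uq_cls r q 0"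
      using ring_hom_add[OF h z z] unfolding e by (simp only: free_alg_simps) simp
    then show ?thesis using zc by (metis U.add.l_cancel_one)
  qed
  finally show "\<ominus>\<^bsub>Uq r q\<^esub> Uq_cls r q a = Uq_cls r q (- a)"
    using cl by (intro U.minus_equality)
qed

lemma L_iota_Lfree:
  assumes "u \<in> L_iota r q" shows "\<exists>a \<in> Lfree r q. u = Uq_cls r q a"
  using assms unfolding L_iota_def Uq_subalg_def
proof (induction rule: generate_ring.induct)
  case one
  have "\<one>\<^bsub>Uq r q\<^esub> = Uq_cls r q (1 :: qgen list \<Rightarrow>\<^sub>0 'a)"
    by (rule Uq_cls_hom(4)[of 0 r 0]) simp_all
  then show ?case using Lfree.scal[of 1] by auto
next
  case (incl h)
  then show ?case by (auto intro: Lfree.scal Lfree.B Lfree.k[simplified])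
next
  case (a_inv h)
  then obtain a where a: "a \<in> Lfree r q" "h = Uq_cls r q a" by blast
  then show ?case using Uq_cls_hom(3)[OF Lfree_closed[OF a(1)] Lfree_closed[OF a(1)]] Lfree.uminus[OF a(1)] by auto
next
  case (eng_add h1 h2)
  then obtain a b where ab: "a \<in> Lfree r q" "h1 = Uq_cls r q a" "b \<in> Lfree r q" "h2 = Uq_cls r q b" by blast
  then show ?case using Uq_cls_hom(1)[OF Lfree_closed[OF ab(1)] Lfree_closed[OF ab(3)]] Lfree.add[OF ab(1,3)] ab by auto
next
  case (eng_mult h1 h2)
  then obtain a b where ab: "a \<in> Lfree r q" "h1 = Uq_cls r q a" "b \<in> Lfree r q" "h2 = Uq_cls r q b" by blast
  then show ?case using Uq_cls_hom(2)[OF Lfree_closed[OF ab(1)] Lfree_closed[OF ab(3)]] Lfree.mult[OF ab(1,3)] ab by auto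
qed

lemma ract_commute:
  assumes "lin L" "\<And>v. v \<in> M \<Longrightarrow> L v \<in> M" "\<And>g v. g \<in> X \<Longrightarrow> v \<in> M \<Longrightarrow> op g v \<in> M"
    "\<And>g v. g \<in> X \<Longrightarrow> v \<in> M \<Longrightarrow> op g (L v) = L (op g v)" "supp a \<subseteq> lists X" "v \<in> M"
  shows "ract op a (L v) = L (ract op a v)"
proof -
  have "fold op w (L v) = L (fold op w v)" if "w \<in> lists X" "v \<in> M" for w v
    using that by (induction w arbitrary: v) (auto simp: assms(2-4))
  then show ?thesis
    unfolding ract_def lin_lin_ext_comm[OF assms(1)] using assms(5,6)
    by (intro lin_ext_cong_supp) auto
qed

context
  fixes r m :: nat and q :: "'k::field"
  assumes q0: "q \<noteq> 0" and q1: "q - inverse q \<noteq> 0" and m2: "2 \<le> m"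
begin

definition Lgens :: "(qgen list \<Rightarrow>\<^sub>0 'k) set" where
  "Lgens = k_el ` I_int (r + 1) \<union> B_el q ` I_int r"

lemma Phi_cls: "Phi r m q (Uq_cls r q a) = (\<lambda>v\<in>W r m. Lop q a v)"
proof -
  have P: "Phi_free r m q b = (\<lambda>v\<in>W r m. Lop q b v)" for b
    using Phi_free_lact[of m r q b] m2 by simp
  have "descend (Phi_free r m q) (cls (qgens r) (qrels r q) a) = Phi_free r m q a"
  proof (rule descend_cls)
    fix i assume i: "i \<in> rel_ideal (qgens r) (qrels r q)"
    have "Lop q i v = 0" for v
      by (rule lact_rel_ideal[OF lin_gop qrels_lact[OF q0 q1] qrels_closed i])
    then show "Phi_free r m q (i + a) = Phi_free r m q a"
      unfolding P by (intro restrict_ext) (simp add: lact_lin_left)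
  qed (rule zero_in_rel_ideal[OF qrels_closed])
  then show ?thesis by (simp add: Phi_def Uq_cls_def P)
qed

lemma Lgens_W: "a \<in> Lgens \<Longrightarrow> v \<in> W r m \<Longrightarrow> Lop q a v \<in> W r m"
  unfolding Lgens_def
  by (auto simp: Lop_k[OF q0] Lop_B[OF q0] I_int_def intro!: tensors_add tensors_scal gop_big)

lemma Lfree_W: "a \<in> Lfree r q \<Longrightarrow> v \<in> W r m \<Longrightarrow> Lop q a v \<in> W r m"
proof (induction arbitrary: v rule: Lfree.induct)
  case (k i)
  then show ?case by (intro Lgens_W) (auto simp: Lgens_def)
next
  case (B i)
  then show ?case by (intro Lgens_W) (auto simp: Lgens_def)
qed (auto simp: lact_simps)

text \<open>Commuting with the generators is inherited by sums, negatives and products. Products use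
  that the generators preserve the tensor power, since S is known to commute only there.\<close>

lemma End_L_iff:
  "S \<in> End_L r m q \<longleftrightarrow> S \<in> lin_endos (W r m) \<and> (\<forall>a\<in>Lgens. \<forall>v\<in>W r m. S (Lop q a v) = Lop q a (S v))"
proof
  assume S: "S \<in> End_L r m q"
  then have SW: "S v \<in> W r m" if "v \<in> W r m" for v using that by (auto simp: End_L_def lin_endos_def)
  have "S (Lop q a v) = Lop q a (S v)" if "a \<in> Lgens" "v \<in> W r m" for a v
  proof -
    have "Uq_cls r q a \<in> L_iota r q"
      using that(1) unfolding L_iota_def Uq_subalg_def Lgens_def by (auto intro!: generate_ring.incl)
    with S that(2) have "S (Phi r m q (Uq_cls r q a) v) = Phi r m q (Uq_cls r q a) (S v)"
      by (auto simp: End_L_def)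
    with that SW show ?thesis by (simp add: Phi_cls)
  qed
  with S show "S \<in> lin_endos (W r m) \<and> (\<forall>a\<in>Lgens. \<forall>v\<in>W r m. S (Lop q a v) = Lop q a (S v))"
    by (auto simp: End_L_def)
next
  assume S: "S \<in> lin_endos (W r m) \<and> (\<forall>a\<in>Lgens. \<forall>v\<in>W r m. S (Lop q a v) = Lop q a (S v))"
  then have SW: "S v \<in> W r m" and Sadd: "v \<in> W r m \<Longrightarrow> S (u + v) = S u + S v" and Sscal: "S (scal c * u) = scal c * S u"
    if "u \<in> W r m" "v \<in> W r m" for u v c using that by (auto simp: lin_endos_def)
  have Suminus: "S (- u) = - S u" if "u \<in> W r m" for u
    using Sscal[OF that that, of "-1"] by (simp add: scal_uminus)
  have "S (Lop q a v) = Lop q a (S v)" if "a \<in> Lfree r q" "v \<in> W r m" for a v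
    using that
  proof (induction arbitrary: v rule: Lfree.induct)
    case (k i)
    then show ?case using S by (auto simp: Lgens_def)
  next
    case (B i)
    then show ?case using S by (auto simp: Lgens_def)
  next
    case (mult a b)
    then show ?case by (simp add: lact_simps Lfree_W)
  next
    case (add a b)
    then show ?case by (simp add: lact_simps Sadd Lfree_W)
  next
    case (uminus a)
    then show ?case by (simp add: lact_simps Suminus Lfree_W)
  qed (auto simp: lact_simps Sscal)
  then have "S (Phi r m q u v) = Phi r m q u (S v)" if "u \<in> L_iota r q" "v \<in> W r m" for u v
    using L_iota_Lfree[OF that(1)] that(2) SW by (auto simp: Phi_cls)
  with S show "S \<in> End_L r m q" by (auto simp: End_L_def)
qed

lemma Psi_Lgens:
  assumes "a \<in> Lgens" "v \<in> tensors (range hf) n" "j < n"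
  shows "Psi_gen q j (Lop q a v) = Lop q a (Psi_gen q j v)"
  using assms(1) Psi_Lop[OF q0 assms(2,3)] by (auto simp: Lgens_def)

lemma W_hf: "v \<in> W r m \<Longrightarrow> v \<in> tensors (range hf) m"
  using tensors_mono[OF I_big_hf] by blast

lemma proj_Lgens:
  assumes "a \<in> Lgens" "v \<in> W r m" "l \<le> m"
  shows "proj r m l (Lop q a v) = Lop q a (proj r m l v)"
proof -
  from assms(1) have "(\<exists>i. a = k_el i) \<or> (\<exists>i. \<bar>i\<bar> \<le> int r \<and> a = B_el q i)"
    unfolding Lgens_def I_int_def by (auto simp: abs_le_iff image_iff)
  then consider i where "a = k_el i" | i where "\<bar>i\<bar> \<le> int r" "a = B_el q i" by blast
  then show ?thesis
  proof cases
    case 1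
    then show ?thesis by (simp add: Lop_k[OF q0] proj_K)
  next
    case 2
    have W: "gop q (qKinv i) v \<in> W r m" using 2 assms(2) by (intro gop_big) auto
    show ?thesis
      using 2 W assms proj_gop[OF assms(3,2)] proj_gop[OF assms(3) W]
      by (cases "i = 0") (simp_all add: Lop_B[OF q0] lin_add[OF lin_proj] lin_scal[OF lin_proj])
  qed
qed

lemma Xi_gen_Lgens:
  assumes "a \<in> Lgens" "v \<in> W r m" "g \<in> dgens m"
  shows "Xi_gen r m q g (Lop q a v) = Lop q a (Xi_gen r m q g v)"
proof (cases g)
  case (DT i)
  with assms show ?thesis by (auto simp: dgens_def intro!: Psi_Lgens W_hf)
next
  case (DX l \<sigma>)
  with assms(3) have l: "l \<le> m" "\<sigma> \<in> Sym l" by (auto simp: dgens_def)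
  have P: "Psiw q w (Lop q a u) = Lop q a (Psiw q w u)" if "set w \<subseteq> {..<m}" "u \<in> W r m" for w u
    using that by (induction w arbitrary: u) (auto simp: Psi_Lgens[OF assms(1) W_hf] Psi_big)
  have "set (reduced_expr l \<sigma>) \<subseteq> {..<m}" using reduced_expr(1)[OF l(2)] l(1) by auto
  then show ?thesis
    unfolding DX Xi_DX[OF q0 q1 m2 l assms(2)] Xi_DX[OF q0 q1 m2 l Lgens_W[OF assms(1,2)]]
    by (simp add: proj_Lgens[OF assms(1,2) l(1)] P proj_tensors[OF assms(2)])
qed

lemma Xi_subset: "Xi r m q ` carrier (HH m q) \<subseteq> End_L r m q"
proof -
  have "(\<lambda>v\<in>W r m. ract (Xi_gen r m q) b v) \<in> End_L r m q" if b: "supp b \<subseteq> lists (dgens m)" for b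
  proof -
    let ?T = "ract (Xi_gen r m q) b"
    have T: "lin ?T" by (rule lin_ract[OF lin_Xi_gen[OF q0 q1 m2]])
    have TW: "?T v \<in> W r m" if "v \<in> W r m" for v
      by (rule ract_tensors[OF Xi_gen_W[OF q0 q1 m2] b that])
    have "?T (Lop q a v) = Lop q a (?T v)" if "a \<in> Lgens" "v \<in> W r m" for a v
      by (rule ract_commute[where M = "W r m" and L = "Lop q a" and op = "Xi_gen r m q", OF lin_Lop[OF q0] Lgens_W[OF that(1)] Xi_gen_W[OF q0 q1 m2] Xi_gen_Lgens[OF that(1)] b that(2)])
    then show ?thesis
      unfolding End_L_iff lin_endos_def
      by (auto simp: TW Lgens_W lin_add[OF T] lin_scal[OF T])
  qed
  then show ?thesis unfolding Xi_image[OF q0 q1 m2] by blast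
qed

end

section \<open>Orthogonal projections\<close>

text \<open>Gram-Schmidt without normalisation, which builds P as the matrix of the orthogonal
  projection onto the span of B. Anisotropy stands in for positivity, so that a vector of norm zero
  can be discarded. The coefficients c record that the columns of P lie in the span of B.\<close>

lemma orth_kernel:
  fixes B :: "('x \<Rightarrow> 'k::field) set"
  assumes X: "finite X" and aniso: "\<And>v :: 'x \<Rightarrow> 'k. (\<Sum>x\<in>X. v x * v x) = 0 \<Longrightarrow> \<forall>x\<in>X. v x = 0"
    and B: "finite B"
  shows "\<exists>P c. (\<forall>x y. P x y = (\<Sum>b\<in>B. c b y * b x)) \<and> (\<forall>x y. P x y = P y x)
     \<and> (\<forall>b\<in>B. \<forall>x\<in>X. (\<Sum>y\<in>X. P x y * b y) = b x)"
  using B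
proof (induction B rule: finite_induct)
  case empty
  then show ?case by (intro exI[of _ "\<lambda>x y. 0"]) auto
next
  case (insert b B)
  then obtain P c where P0: "(\<forall>x y. P x y = (\<Sum>b\<in>B. c b y * b x)) \<and> (\<forall>x y. P x y = P y x)
     \<and> (\<forall>b\<in>B. \<forall>x\<in>X. (\<Sum>y\<in>X. P x y * b y) = b x)" by blast
  have P1: "P x y = (\<Sum>b\<in>B. c b y * b x)" for x y using P0 by simp
  have P2: "P x y = P y x" for x y using conjunct1[OF conjunct2[OF P0]] by blast
  have P3: "(\<Sum>y\<in>X. P x y * b y) = b x" if "b \<in> B" "x \<in> X" for b x using P0 that by blast
  note P = P1 P2 P3
  define d where "d b' = (\<Sum>y\<in>X. c b' y * b y)" for b'
  define w where "w x = b x - (\<Sum>y\<in>X. P x y * b y)" for x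
  define N where "N = (\<Sum>x\<in>X. w x * w x)"
  have w: "w x = b x - (\<Sum>b'\<in>B. d b' * b' x)" for x
  proof -
    have "(\<Sum>y\<in>X. P x y * b y) = (\<Sum>y\<in>X. \<Sum>b'\<in>B. c b' y * b' x * b y)"
      by (simp only: P(1) sum_distrib_right)
    also have "\<dots> = (\<Sum>b'\<in>B. d b' * b' x)"
      unfolding d_def sum_distrib_right by (subst sum.swap) (simp only: ac_simps)
    finally show ?thesis by (simp add: w_def)
  qed
  have wB: "(\<Sum>y\<in>X. w y * b' y) = 0" if b': "b' \<in> B" for b'
  proof -
    have "(\<Sum>y\<in>X. (\<Sum>z\<in>X. P y z * b z) * b' y) = (\<Sum>y\<in>X. \<Sum>z\<in>X. P z y * b' y * b z)"
      unfolding sum_distrib_right by (intro sum.cong refl) (metis P(2) mult.assoc mult.commute)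
    also have "\<dots> = (\<Sum>z\<in>X. (\<Sum>y\<in>X. P z y * b' y) * b z)"
      unfolding sum_distrib_right by (rule sum.swap)
    also have "\<dots> = (\<Sum>z\<in>X. b' z * b z)" using P(3)[OF b'] by simp
    finally have "(\<Sum>y\<in>X. (\<Sum>z\<in>X. P y z * b z) * b' y) = (\<Sum>z\<in>X. b z * b' z)" by (simp only: mult.commute)
    then show ?thesis by (simp only: w_def left_diff_distrib sum_subtractf diff_self)
  qed
  have wb: "(\<Sum>y\<in>X. w y * b y) = N"
  proof -
    have "N = (\<Sum>y\<in>X. w y * b y) - (\<Sum>y\<in>X. w y * (\<Sum>b'\<in>B. d b' * b' y))"
    proof -
      have "N = (\<Sum>y\<in>X. w y * (b y - (\<Sum>b'\<in>B. d b' * b' y)))"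
        unfolding N_def by (simp only: w[symmetric])
      then show ?thesis by (simp only: right_diff_distrib sum_subtractf)
    qed
    also have "(\<Sum>y\<in>X. w y * (\<Sum>b'\<in>B. d b' * b' y)) = (\<Sum>b'\<in>B. d b' * (\<Sum>y\<in>X. w y * b' y))"
      unfolding sum_distrib_left by (subst sum.swap) (simp only: ac_simps)
    also have "\<dots> = 0" using wB by simp
    finally show ?thesis by simp
  qed
  show ?case
  proof (cases "N = 0")
    case True
    then have w0: "\<forall>x\<in>X. w x = 0" unfolding N_def by (rule aniso)
    have "P x y = (\<Sum>b'\<in>insert b B. (c(b := \<lambda>_. 0)) b' y * b' x)" for x y
      using insert.hyps by (simp add: P(1)) (intro sum.cong, auto)
    moreover have "(\<Sum>y\<in>X. P x y * b' y) = b' x" if "b' \<in> insert b B" "x \<in> X" for b' x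
      using that w0 P(3) by (auto simp: w_def)
    ultimately show ?thesis using P(2) by blast
  next
    case False
    \<comment> \<open>Adds the projection onto the line of w, the part of b orthogonal to the old
      span, whose norm is N. The coefficients in \<open>c'\<close> absorb the expansion of w in b
      and the old vectors.\<close>
    define P' where "P' x y = P x y + w x * w y / N" for x y
    define c' where "c' = (\<lambda>b' y. c b' y - d b' * w y / N)(b := \<lambda>y. w y / N)"
    have e: "(\<Sum>b'\<in>insert b B. c' b' y * b' x) = (\<Sum>b'\<in>B. (c b' y - d b' * w y / N) * b' x) + w y / N * b x" for x y
    proof -
      have "(\<Sum>b'\<in>B. c' b' y * b' x) = (\<Sum>b'\<in>B. (c b' y - d b' * w y / N) * b' x)"
        by (intro sum.cong) (use insert.hyps in \<open>auto simp: c'_def\<close>)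
      then show ?thesis using insert.hyps by (simp add: c'_def)
    qed
    have "P' x y = (\<Sum>b'\<in>insert b B. c' b' y * b' x)" for x y
    proof -
      have "(\<Sum>b'\<in>B. (c b' y - d b' * w y / N) * b' x) = P x y - w y / N * (\<Sum>b'\<in>B. d b' * b' x)"
        unfolding P(1) sum_distrib_left sum_subtractf[symmetric]
        by (intro sum.cong) (simp_all add: algebra_simps)
      moreover have "p + (\<beta> - D) * \<omega> / N = p - \<omega> / N * D + \<omega> / N * \<beta>" for p \<beta> D \<omega> :: 'k
        by (simp add: divide_inverse algebra_simps)
      ultimately show ?thesis unfolding e P'_def w[of x] by (simp only:)
    qed
    moreover have "P' x y = P' y x" for x y by (simp add: P'_def P(2)[of x y] mult.commute)
    moreover have "(\<Sum>y\<in>X. P' x y * b' y) = b' x" if "b' \<in> insert b B" "x \<in> X" for b' x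
    proof -
      have "(\<Sum>y\<in>X. P' x y * b' y) = (\<Sum>y\<in>X. P x y * b' y) + w x / N * (\<Sum>y\<in>X. w y * b' y)"
        unfolding P'_def sum_distrib_left sum.distrib[symmetric]
        by (intro sum.cong) (simp_all add: algebra_simps)
      then show ?thesis using that False wB wb P(3) by (auto simp: w_def)
    qed
    ultimately show ?thesis by blast
  qed
qed

section \<open>Derivations of the tensor algebra\<close>

primrec derw :: "(rat \<Rightarrow> (rat list \<Rightarrow>\<^sub>0 'k::field)) \<Rightarrow> rat list \<Rightarrow> (rat list \<Rightarrow>\<^sub>0 'k)" where
  "derw \<phi> [] = 0"
| "derw \<phi> (j # f) = \<phi> j * Mvec f + eta j * derw \<phi> f"

definition der :: "(rat \<Rightarrow> (rat list \<Rightarrow>\<^sub>0 'k::field)) \<Rightarrow> (rat list \<Rightarrow>\<^sub>0 'k) \<Rightarrow> (rat list \<Rightarrow>\<^sub>0 'k)" where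
  "der \<phi> = lin_ext (derw \<phi>)"

lemma lin_der [simp]: "lin (der \<phi>)" by (simp add: der_def)
lemma lin_der_comp: "lin T \<Longrightarrow> lin (\<lambda>v. der \<phi> (T v))" by (rule lin_comp[OF lin_der])

lemmas lin_intros'' = lin_intros' lin_der lin_der_comp
lemmas der_lin = lin_add[OF lin_der] lin_scal[OF lin_der] lin_0[OF lin_der] lin_diff[OF lin_der] lin_sum[OF lin_der]

lemma der_Mvec: "der \<phi> (Mvec f) = derw \<phi> f" by (simp add: der_def)
lemma der_eta [simp]: "der \<phi> (eta j) = \<phi> j" by (simp add: der_Mvec)
lemma der_1 [simp]: "der \<phi> 1 = 0" using der_Mvec[of \<phi> "[]"] by simp

lemma der_mult: "der \<phi> (x * y) = der \<phi> x * y + x * der \<phi> y"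
proof (rule bilin_eqM[of "\<lambda>x y. der \<phi> (x * y)" "\<lambda>x y. der \<phi> x * y + x * der \<phi> y"])
  show "der \<phi> (Mvec f * Mvec g) = der \<phi> (Mvec f) * Mvec g + Mvec f * der \<phi> (Mvec g)" for f g
  proof (induction f)
    case (Cons j f)
    have "der \<phi> (Mvec (j # f) * Mvec g) = \<phi> j * (Mvec f * Mvec g) + eta j * der \<phi> (Mvec f * Mvec g)"
      by (simp add: Mvec_mult der_Mvec)
    also have "\<dots> = der \<phi> (Mvec (j # f)) * Mvec g + Mvec (j # f) * der \<phi> (Mvec g)"
      unfolding Cons by (simp add: der_Mvec distrib_left distrib_right mult.assoc)
        (simp add: Mvec_mult mult.assoc[symmetric])
    finally show ?case .
  qed simp
qed (intro lin_intros'')+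

lemma der_tensors:
  assumes "v \<in> tensors J n" "\<And>j. j \<in> J \<Longrightarrow> \<phi> j \<in> tensors J 1"
  shows "der \<phi> v \<in> tensors J n"
proof (rule tensors_lin[OF lin_der assms(1)])
  fix f assume "f \<in> words J n"
  then show "der \<phi> (Mvec f) \<in> tensors J n"
    unfolding der_Mvec
  proof (induction f arbitrary: n)
    case (Cons j f)
    then obtain n' where n: "n = Suc n'" "j \<in> J" "f \<in> words J n'" by (auto simp: words_def)
    have m: "u * v \<in> tensors J (Suc n')" if "u \<in> tensors J 1" "v \<in> tensors J n'" for u v :: "rat list \<Rightarrow>\<^sub>0 'a"
      using tensors_mult[OF that] by simp
    have "\<phi> j * Mvec f \<in> tensors J (Suc n')" "eta j * derw \<phi> f \<in> tensors J (Suc n')"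
      using n Cons.IH[OF n(3)] by (auto intro!: m[OF assms(2)] m[of "eta j"] simp del: One_nat_def) (simp add: words_def)
    then show ?case by (auto simp: n(1) intro: tensors_add)
  qed (simp add: words_def)
qed

lemma der_comm: "der \<phi> (der \<psi> v) - der \<psi> (der \<phi> v) = der (\<lambda>j. der \<phi> (\<psi> j) - der \<psi> (\<phi> j)) v"
proof (rule tensor_induct_eq[of "\<lambda>v. der \<phi> (der \<psi> v) - der \<psi> (der \<phi> v)" "der (\<lambda>j. der \<phi> (\<psi> j) - der \<psi> (\<phi> j))"])
  fix j y
  assume "der \<phi> (der \<psi> y) - der \<psi> (der \<phi> y) = der (\<lambda>j. der \<phi> (\<psi> j) - der \<psi> (\<phi> j)) y"
  then show "der \<phi> (der \<psi> (eta j * y)) - der \<psi> (der \<phi> (eta j * y)) = der (\<lambda>j. der \<phi> (\<psi> j) - der \<psi> (\<phi> j)) (eta j * y)"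
    by (simp add: der_mult der_lin algebra_simps flip: right_diff_distrib)
qed (simp add: der_lin | intro lin_intros'')+

lemma der_diff_left: "der (\<lambda>j. \<phi> j - \<psi> j) v = der \<phi> v - der \<psi> v"
proof (rule tensor_induct_eq[of "der (\<lambda>j. \<phi> j - \<psi> j)" "\<lambda>v. der \<phi> v - der \<psi> v"])
  fix j y assume "der (\<lambda>j. \<phi> j - \<psi> j) y = der \<phi> y - der \<psi> y"
  then show "der (\<lambda>j. \<phi> j - \<psi> j) (eta j * y) = der \<phi> (eta j * y) - der \<psi> (eta j * y)"
    by (simp add: der_mult left_diff_distrib right_diff_distrib)
qed (simp | intro lin_intros'')+

lemma der_zero_left: "der (\<lambda>j. 0) v = 0"
  by (rule tensor_induct_eq[of "der (\<lambda>j. 0)" "\<lambda>v. 0"]) (auto simp: der_mult)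

text \<open>The matrix unit sending b to a, symmetrised under simultaneous negation. These matrices
  span the centraliser of the sign change of letters, which is the fixed point Lie algebra. For b
  \<noteq> 0 the two summands never apply to the same letter.\<close>

definition XX :: "rat \<Rightarrow> rat \<Rightarrow> rat \<Rightarrow> (rat list \<Rightarrow>\<^sub>0 'k::field)" where
  "XX a b j = (if j = b then eta a else 0) + (if j = - b then eta (- a) else 0)"

lemma XX_sym: "XX (- a) (- b) = XX a b" by (auto simp: XX_def add.commute fun_eq_iff)

text \<open>The matrices are closed under products and not only under commutators; the polarisation
  below composes them.\<close>

lemma XX_comp:
  assumes "b \<noteq> 0" "d \<noteq> 0"
  shows "(\<lambda>j. der (XX a b) (XX c d j)) = (if c = b then XX a d else if c = - b then XX a (- d) else (\<lambda>j. 0))"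
proof
  fix j
  have e: "der (XX a b) (XX c d j) = (if j = d then XX a b c else 0) + (if j = - d then XX a b (- c) else 0)"
    by (simp add: XX_def[of c d] der_lin)
  have c: "- c = b \<longleftrightarrow> c = - b" by auto
  show "der (XX a b) (XX c d j) = (if c = b then XX a d else if c = - b then XX a (- d) else (\<lambda>j. 0)) j"
    unfolding e using assms by (cases "c = b"; cases "c = - b") (simp_all add: XX_def c add.commute)
qed

lemma XX_tensors: "0 \<notin> J \<Longrightarrow> uminus ` J \<subseteq> J \<Longrightarrow> a \<in> J \<Longrightarrow> XX a b j \<in> tensors J 1"
  by (auto simp: XX_def intro!: tensors_add)

section \<open>Polarised symmetric tensors\<close>

text \<open>\<open>Nw x f I\<close> is the sum, over all injections of \<open>I\<close> into the positions of \<open>f\<close>, of the words in which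
  the operators \<open>x i\<close>, \<open>i \<in> I\<close>, have been applied to the letters at these positions.\<close>

primrec Nw :: "(nat \<Rightarrow> rat \<Rightarrow> (rat list \<Rightarrow>\<^sub>0 'k::field)) \<Rightarrow> rat list \<Rightarrow> nat set \<Rightarrow> (rat list \<Rightarrow>\<^sub>0 'k)" where
  "Nw x [] I = (if I = {} then 1 else 0)"
| "Nw x (j # f) I = eta j * Nw x f I + (\<Sum>i\<in>I. x i j * Nw x f (I - {i}))"

lemma Nw_cong: "(\<And>i. i \<in> I \<Longrightarrow> x i = y i) \<Longrightarrow> Nw x f I = Nw y f I"
proof (induction f arbitrary: I)
  case (Cons j f)
  have "Nw x f I = Nw y f I" by (rule Cons.IH) (rule Cons.prems)
  moreover have "Nw x f (I - {i}) = Nw y f (I - {i})" for i by (rule Cons.IH) (use Cons.prems in auto)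
  ultimately show ?case using Cons.prems by simp
qed simp

text \<open>A derivation hits one position of each word. Either that position is still untouched,
  which amounts to placing y under the new index k, or it already carries some x i, which is then
  composed with y.\<close>

lemma der_Nw:
  assumes "finite I" "k \<notin> I"
  shows "der y (Nw x f I) = Nw (x(k := y)) f (insert k I) + (\<Sum>i\<in>I. Nw (x(i := \<lambda>j. der y (x i j))) f I)"
  using assms
proof (induction f arbitrary: I)
  case (Cons j f)
  let ?x = "\<lambda>i. x(i := \<lambda>j. der y (x i j))"
  have IH: "der y (Nw x f I) = Nw (x(k := y)) f (insert k I) + (\<Sum>i\<in>I. Nw (?x i) f I)"
    by (rule Cons.IH) (use Cons.prems in auto)
  have IH': "der y (Nw x f (I - {i})) = Nw (x(k := y)) f (insert k (I - {i})) + (\<Sum>i'\<in>I - {i}. Nw (?x i') f (I - {i}))" for i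
    by (rule Cons.IH) (use Cons.prems in auto)
  have k: "insert k I - {k} = I" "i \<in> I \<Longrightarrow> insert k I - {i} = insert k (I - {i})" for i
    using Cons.prems by auto
  have c1: "Nw (x(k := y)) f I = Nw x f I" by (rule Nw_cong) (use Cons.prems in auto)
  have c2: "Nw (?x i) f (I - {i}) = Nw x f (I - {i})" for i by (rule Nw_cong) auto
  have R1: "Nw (x(k := y)) (j # f) (insert k I) = eta j * Nw (x(k := y)) f (insert k I) + y j * Nw x f I
      + (\<Sum>i\<in>I. x i j * Nw (x(k := y)) f (insert k (I - {i})))"
  proof -
    have "(\<Sum>i\<in>I. (x(k := y)) i j * Nw (x(k := y)) f (insert k I - {i}))
        = (\<Sum>i\<in>I. x i j * Nw (x(k := y)) f (insert k (I - {i})))"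
      by (intro sum.cong) (use Cons.prems k in auto)
    then show ?thesis using Cons.prems by (simp add: k(1) c1 add.assoc)
  qed
  have R2: "Nw (?x i') (j # f) I = eta j * Nw (?x i') f I + der y (x i' j) * Nw x f (I - {i'})
      + (\<Sum>i\<in>I - {i'}. x i j * Nw (?x i') f (I - {i}))" if "i' \<in> I" for i'
  proof -
    have "(\<Sum>i\<in>I. ?x i' i j * Nw (?x i') f (I - {i}))
        = ?x i' i' j * Nw (?x i') f (I - {i'}) + (\<Sum>i\<in>I - {i'}. ?x i' i j * Nw (?x i') f (I - {i}))"
      by (rule sum.remove) (use Cons.prems that in auto)
    also have "(\<Sum>i\<in>I - {i'}. ?x i' i j * Nw (?x i') f (I - {i})) = (\<Sum>i\<in>I - {i'}. x i j * Nw (?x i') f (I - {i}))"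
      by (intro sum.cong) auto
    finally show ?thesis by (simp only: Nw.simps fun_upd_same c2 add.assoc)
  qed
  have sw: "(\<Sum>i'\<in>I. \<Sum>i\<in>I - {i'}. g i i') = (\<Sum>i\<in>I. \<Sum>i'\<in>I - {i}. g i i')" for g :: "nat \<Rightarrow> nat \<Rightarrow> (rat list \<Rightarrow>\<^sub>0 'a)"
  proof -
    have "(\<Sum>i'\<in>I. \<Sum>i\<in>I - {i'}. g i i') = (\<Sum>i'\<in>I. \<Sum>i\<in>I. if i \<noteq> i' then g i i' else 0)"
      by (intro sum.cong refl sum.mono_neutral_cong_left) (use Cons.prems in auto)
    also have "\<dots> = (\<Sum>i\<in>I. \<Sum>i'\<in>I. if i \<noteq> i' then g i i' else 0)" by (rule sum.swap)
    also have "\<dots> = (\<Sum>i\<in>I. \<Sum>i'\<in>I - {i}. g i i')"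
      by (intro sum.cong refl sum.mono_neutral_cong_right) (use Cons.prems in auto)
    finally show ?thesis .
  qed
  have "der y (Nw x (j # f) I) = y j * Nw x f I + eta j * der y (Nw x f I)
     + (\<Sum>i\<in>I. der y (x i j) * Nw x f (I - {i}) + x i j * der y (Nw x f (I - {i})))"
    by (simp add: der_lin der_mult)
  also have "\<dots> = y j * Nw x f I + (eta j * Nw (x(k := y)) f (insert k I) + (\<Sum>i\<in>I. eta j * Nw (?x i) f I))
     + ((\<Sum>i\<in>I. der y (x i j) * Nw x f (I - {i})) + ((\<Sum>i\<in>I. x i j * Nw (x(k := y)) f (insert k (I - {i})))
     + (\<Sum>i\<in>I. \<Sum>i'\<in>I - {i}. x i j * Nw (?x i') f (I - {i}))))"
    unfolding IH IH' by (simp add: distrib_left sum.distrib sum_distrib_left)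
  also have "\<dots> = Nw (x(k := y)) (j # f) (insert k I) + (\<Sum>i'\<in>I. Nw (?x i') (j # f) I)"
    unfolding R1 using R2 sw[of "\<lambda>i i'. x i j * Nw (?x i') f (I - {i})", symmetric]
    by (simp add: sum.distrib add_ac del: Nw.simps)
  finally show ?case .
qed (auto simp: der_lin)

definition Nop :: "(nat \<Rightarrow> rat \<Rightarrow> (rat list \<Rightarrow>\<^sub>0 'k::field)) \<Rightarrow> nat set \<Rightarrow> (rat list \<Rightarrow>\<^sub>0 'k) \<Rightarrow> (rat list \<Rightarrow>\<^sub>0 'k)" where
  "Nop x I = lin_ext (\<lambda>f. Nw x f I)"

lemma lin_Nop [simp]: "lin (Nop x I)" by (simp add: Nop_def)

text \<open>Read as a recursion, this writes \<open>Nop\<close> as a noncommutative polynomial in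
  derivations: the operator with one more index is a derivation after the smaller one, corrected by
  operators with as many indices as before but a composed label.\<close>

lemma Nop_insert:
  assumes "finite I" "k \<notin> I"
  shows "Nop x (insert k I) v = der (x k) (Nop x I v) - (\<Sum>i\<in>I. Nop (x(i := \<lambda>j. der (x k) (x i j))) I v)"
proof (rule lin_eqM[of "Nop x (insert k I)" "\<lambda>v. der (x k) (Nop x I v) - (\<Sum>i\<in>I. Nop (x(i := \<lambda>j. der (x k) (x i j))) I v)"])
  show "lin (\<lambda>v. der (x k) (Nop x I v) - (\<Sum>i\<in>I. Nop (x(i := \<lambda>j. der (x k) (x i j))) I v))"
    by (intro lin_minus lin_Sum lin_der_comp lin_Nop)
  fix f
  show "Nop x (insert k I) (Mvec f) = der (x k) (Nop x I (Mvec f)) - (\<Sum>i\<in>I. Nop (x(i := \<lambda>j. der (x k) (x i j))) I (Mvec f))"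
    using der_Nw[OF assms, of "x k" x f] by (simp add: Nop_def)
qed simp

lemma Nw_tensors:
  assumes "\<And>i j. i \<in> I \<Longrightarrow> j \<in> J \<Longrightarrow> x i j \<in> tensors J 1" "f \<in> words J n"
  shows "Nw x f I \<in> tensors J n"
  using assms
proof (induction f arbitrary: n I)
  case (Cons j f)
  then obtain n' where n: "n = Suc n'" "j \<in> J" "f \<in> words J n'" by (auto simp: words_def)
  have m: "u * v \<in> tensors J (Suc n')" if "u \<in> tensors J 1" "v \<in> tensors J n'" for u v :: "rat list \<Rightarrow>\<^sub>0 'a"
    using tensors_mult[OF that] by simp
  have "Nw x f I \<in> tensors J n'" by (rule Cons.IH) (use Cons.prems n in auto)
  moreover have "Nw x f (I - {i}) \<in> tensors J n'" for i by (rule Cons.IH) (use Cons.prems n in auto)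
  moreover have "eta j \<in> tensors J 1" using n by (simp add: words_def)
  ultimately show ?case unfolding Nw.simps n(1)
    by (intro tensors_add tensors_sum m) (use Cons.prems n in auto)
qed (auto simp: words_def)

lemma Nop_tensors:
  "(\<And>i j. i \<in> I \<Longrightarrow> j \<in> J \<Longrightarrow> x i j \<in> tensors J 1) \<Longrightarrow> v \<in> tensors J n \<Longrightarrow> Nop x I v \<in> tensors J n"
  unfolding Nop_def by (rule tensors_lin_ext) (auto intro: Nw_tensors)

lemma Nop_commute:
  assumes J: "0 \<notin> J" "uminus ` J \<subseteq> J"
    and Y: "lin Y" "\<And>v. v \<in> tensors J l \<Longrightarrow> Y v \<in> tensors J l"
    and YX: "\<And>a b v. a \<in> J \<Longrightarrow> b \<in> J \<Longrightarrow> v \<in> tensors J l \<Longrightarrow> Y (der (XX a b) v) = der (XX a b) (Y v)"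
    and I: "finite I" and x: "\<And>i. i \<in> I \<Longrightarrow> x i = (\<lambda>j. 0) \<or> (\<exists>a\<in>J. \<exists>b\<in>J. x i = XX a b)"
    and v: "v \<in> tensors J l"
  shows "Y (Nop x I v) = Nop x I (Y v)"
  using I x
proof (induction I arbitrary: x rule: finite_induct)
  case empty
  have "Nop x {} u = u" for u :: "rat list \<Rightarrow>\<^sub>0 'a"
  proof (rule lin_eqM[of "Nop x {}" "\<lambda>u. u"])
    fix f
    have "Nw x f {} = (Mvec f :: rat list \<Rightarrow>\<^sub>0 'a)" by (induction f) (simp_all add: Mvec_mult)
    then show "Nop x {} (Mvec f) = Mvec f" by (simp add: Nop_def)
  qed auto
  then show ?case by simp
next
  case (insert k I)
  let ?G = "\<lambda>y :: rat \<Rightarrow> (rat list \<Rightarrow>\<^sub>0 'a). y = (\<lambda>j. 0) \<or> (\<exists>a\<in>J. \<exists>b\<in>J. y = XX a b)"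
  have G1: "y j \<in> tensors J 1" if "?G y" for y j using that XX_tensors[OF J] by auto
  have G2: "?G (\<lambda>j. der y (z j))" if "?G y" "?G z" for y z
  proof -
    consider "y = (\<lambda>j. 0)" | "z = (\<lambda>j. 0)" | a b c d where "a \<in> J" "b \<in> J" "c \<in> J" "d \<in> J" "y = XX a b" "z = XX c d"
      using \<open>?G y\<close> \<open>?G z\<close> by blast
    then show ?thesis
    proof cases
      case 1 then show ?thesis by (simp add: der_zero_left)
    next
      case 2 then show ?thesis by (simp add: der_lin)
    next
      case 3
      then have "b \<noteq> 0" "d \<noteq> 0" "- d \<in> J" using J by auto
      then show ?thesis using 3 XX_comp[of b d a c] by (auto split: if_splits)
    qed
  qed
  have Gder: "Y (der y u) = der y (Y u)" if "?G y" "u \<in> tensors J l" for y u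
    using that YX by (auto simp: der_zero_left lin_0[OF Y(1)])
  have xk: "?G (x k)" and xI: "\<And>i. i \<in> I \<Longrightarrow> ?G (x i)" using insert.prems by blast+
  have IH: "Y (Nop x I v) = Nop x I (Y v)" by (rule insert.IH) (rule xI)
  have IH': "Y (Nop (x(i := \<lambda>j. der (x k) (x i j))) I v) = Nop (x(i := \<lambda>j. der (x k) (x i j))) I (Y v)" if "i \<in> I" for i
    by (rule insert.IH) (use G2[OF xk xI[OF that]] xI in auto)
  have "Nop x I v \<in> tensors J l" by (rule Nop_tensors[OF _ v]) (use G1 xI in blast)
  then show ?case
    unfolding Nop_insert[OF insert.hyps]
    by (simp add: lin_diff[OF Y(1)] lin_sum[OF Y(1)] Gder[OF xk] IH IH')
qed

lemma cf_letter_mult: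
  assumes "v \<in> tensors UNIV 1"
  shows "cf (v * u) (j # f) = cf v [j] * cf u f"
proof -
  have 1: "cf (Mvec w * u) (j # f) = cf (Mvec w) [j] * cf u f" if "w \<in> words UNIV 1" for w
  proof -
    from that obtain a where a: "w = [a]" by (cases w) (auto simp: words_def)
    have "eta a * u = lin_ext (\<lambda>g. Mvec (a # g)) u"
      by (rule lin_eqM[of "\<lambda>u. eta a * u"]) (auto simp: Mvec_mult)
    then have "cf (eta a * u) (j # f) = (\<Sum>g\<in>supp u. cf u g * (if a # g = j # f then 1 else 0))"
      by (simp add: cf_lin_ext cf_Mvec)
    also have "\<dots> = (\<Sum>g\<in>supp u. if g = f then (if a = j then cf u f else 0) else 0)"
      by (intro sum.cong) auto
    also have "\<dots> = (if a = j then cf u f else 0)" by (auto simp: in_keys_iff)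
    finally show ?thesis by (simp add: a cf_Mvec)
  qed
  have "cf (v * u) (j # f) = cf ((\<Sum>w\<in>supp v. scal (cf v w) * Mvec w) * u) (j # f)"
    using Mvec_expand[of v] by simp
  also have "\<dots> = (\<Sum>w\<in>supp v. cf v w * cf (Mvec w * u) (j # f))"
    by (simp add: sum_distrib_right lookup_sum mult.assoc)
  also have "\<dots> = (\<Sum>w\<in>supp v. cf v w * (cf (Mvec w) [j] * cf u f))"
    by (intro sum.cong refl) (use assms 1 in \<open>auto simp: tensors_alt\<close>)
  also have "\<dots> = cf (\<Sum>w\<in>supp v. scal (cf v w) * Mvec w) [j] * cf u f"
    by (simp add: sum_distrib_right lookup_sum mult.assoc)
  finally show ?thesis using Mvec_expand[of v] by simp
qed

text \<open>Pairs of letters up to a common sign.\<close>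

definition cls2 :: "rat \<Rightarrow> rat \<Rightarrow> rat \<times> rat" where
  "cls2 j' j = (if 0 < j then (j', j) else (- j', - j))"

lemma XX_cls2:
  assumes "0 < snd p" "j \<noteq> 0"
  shows "cf (XX (fst p) (snd p) j :: rat list \<Rightarrow>\<^sub>0 'k::field) [j'] = (if cls2 j' j = p then 1 else 0)"
  using assms by (cases p) (auto simp: XX_def cls2_def lookup_add cf_Mvec)

text \<open>The order of the stabiliser, under permutations of the positions, of a list with content
  M.\<close>

definition mfact :: "'a multiset \<Rightarrow> nat" where
  "mfact M = (\<Prod>c\<in>set_mset M. fact (count M c))"

lemma mfact_remove: "c \<in># M \<Longrightarrow> mfact M = count M c * mfact (M - {#c#})"
proof -
  assume c: "c \<in># M"
  have "mfact M = fact (count M c) * (\<Prod>d\<in>set_mset M - {c}. fact (count M d))"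
    unfolding mfact_def using c by (intro prod.remove) auto
  also have "(\<Prod>d\<in>set_mset M - {c}. fact (count M d)) = (\<Prod>d\<in>set_mset M - {c}. fact (count (M - {#c#}) d) :: nat)"
    by (intro prod.cong) auto
  also have "fact (count M c) = count M c * (fact (count (M - {#c#}) c) :: nat)"
    using c by (cases "count M c") (auto simp: count_eq_zero_iff)
  finally have "mfact M = count M c * (fact (count (M - {#c#}) c) * (\<Prod>d\<in>set_mset M - {c}. fact (count (M - {#c#}) d)))"
    by (simp add: mult.assoc)
  also have "fact (count (M - {#c#}) c) * (\<Prod>d\<in>set_mset M - {c}. fact (count (M - {#c#}) d)) = (\<Prod>d\<in>set_mset M. fact (count (M - {#c#}) d))"
    using c by (intro prod.remove[symmetric]) auto
  also have "\<dots> = mfact (M - {#c#})"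
    unfolding mfact_def
    by (intro prod.mono_neutral_right) (auto dest: in_diffD simp: not_in_iff)
  finally show ?thesis .
qed

lemma mfact_pos: "mfact M > 0" by (simp add: mfact_def)

lemma Nw_large: "finite I \<Longrightarrow> length f < card I \<Longrightarrow> Nw x f I = 0"
proof (induction f arbitrary: I)
  case (Cons j f)
  then have "Nw x f (I - {i}) = 0" if "i \<in> I" for i using that by (intro Cons.IH) auto
  with Cons show ?case by simp
qed auto

text \<open>With as many operators as letters each letter receives exactly one. The coefficient
  counts the bijections from I to the positions that match \<open>A i\<close> with the pair of
  letters found there; if there are any, the stabiliser counted by \<open>mfact\<close> permutes
  them simply transitively.\<close>

lemma cf_Nw:
  fixes A :: "nat \<Rightarrow> rat \<times> rat"
  assumes "finite I" "length f = card I" "length f' = card I" "0 \<notin> set f" "\<And>i. i \<in> I \<Longrightarrow> 0 < snd (A i)"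
  shows "cf (Nw (\<lambda>i. XX (fst (A i)) (snd (A i))) f I :: rat list \<Rightarrow>\<^sub>0 'k::field_char_0) f'
    = (if mset (map2 cls2 f' f) = image_mset A (mset_set I) then of_nat (mfact (image_mset A (mset_set I))) else 0)"
  using assms
proof (induction f arbitrary: f' I)
  case Nil
  then have "I = {}" "f' = []" by auto
  then show ?case by (simp add: mfact_def cf_Mvec flip: Mvec_Nil)
next
  case (Cons j f)
  let ?x = "\<lambda>i. XX (fst (A i)) (snd (A i)) :: rat \<Rightarrow> rat list \<Rightarrow>\<^sub>0 'k"
  obtain j' g where f': "f' = j' # g" using Cons.prems by (cases f') auto
  let ?c = "cls2 j' j" and ?M = "image_mset A (mset_set I)" and ?R = "mset (map2 cls2 g f)"
  have t: "XX a b i \<in> tensors UNIV 1" for a b i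
    by (auto simp: XX_def words_def intro!: tensors_add)
  \<comment> \<open>The first letter cannot be left untouched, since too few letters would remain
    for the operators.\<close>
  have "Nw ?x f I = 0" by (rule Nw_large) (use Cons.prems in auto)
  then have "cf (Nw ?x (j # f) I) f' = (\<Sum>i\<in>I. (if ?c = A i then 1 else 0) * cf (Nw ?x f (I - {i})) g)"
    using Cons.prems by (simp add: f' lookup_sum cf_letter_mult[OF t] XX_cls2)
  also have "\<dots> = (\<Sum>i\<in>{i\<in>I. A i = ?c}. if ?R = ?M - {#?c#} then of_nat (mfact (?M - {#?c#})) else 0)"
  proof (rule sum.mono_neutral_cong_right)
    fix i assume "i \<in> {i \<in> I. A i = ?c}"
    then have i: "i \<in> I" "A i = ?c" by auto
    have "image_mset A (mset_set (I - {i})) = ?M - {#?c#}"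
      using i Cons.prems(1) by (simp add: mset_set_Diff image_mset_Diff)
    moreover have "cf (Nw ?x f (I - {i})) g = (if ?R = image_mset A (mset_set (I - {i})) then of_nat (mfact (image_mset A (mset_set (I - {i})))) else 0)"
      by (rule Cons.IH) (use Cons.prems i f' in auto)
    ultimately show "(if ?c = A i then 1 else 0) * cf (Nw ?x f (I - {i})) g = (if ?R = ?M - {#?c#} then of_nat (mfact (?M - {#?c#})) else (0::'k))"
      using i by simp
  qed (use Cons.prems in auto)
  also have "\<dots> = of_nat (count ?M ?c) * (if ?R = ?M - {#?c#} then of_nat (mfact (?M - {#?c#})) else 0)"
  proof -
    have "card {i\<in>I. A i = ?c} = count ?M ?c"
      using Cons.prems(1) by (simp add: count_image_mset_eq_card_vimage)
    then show ?thesis by simp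
  qed
  also have "\<dots> = (if add_mset ?c ?R = ?M then of_nat (mfact ?M) else 0)"
  proof (cases "?c \<in># ?M")
    case True
    then have "add_mset ?c ?R = ?M \<longleftrightarrow> ?R = ?M - {#?c#}" by (metis add_mset_remove_trivial insert_DiffM)
    with mfact_remove[OF True] show ?thesis by simp
  next
    case False
    then have "count ?M ?c = 0" by (simp only: not_in_iff)
    moreover have "add_mset ?c ?R \<noteq> ?M" using False by (metis union_single_eq_member)
    ultimately show ?thesis by simp
  qed
  finally show ?case by (simp add: f')
qed

section \<open>The Lie algebra at q = 1\<close>

lemma gop1_K [simp]: "gop 1 (qK i) v = v" "gop 1 (qKinv i) v = v"
proof -
  show "gop 1 (qK i) v = v"
    by (rule tensor_induct_eq[of "gop 1 (qK i)" "\<lambda>v. v"]) (auto simp: gop_1 gop_mult gop_eta)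
  show "gop 1 (qKinv i) v = v"
    by (rule tensor_induct_eq[of "gop 1 (qKinv i)" "\<lambda>v. v"]) (auto simp: gop_1 gop_mult gop_eta)
qed

text \<open>At q = 1 every K becomes the identity and the coproducts become primitive, so the
  generators are derivations. The summand v for i = 0 is what remains of the term
  \<open>gen (qKinv 0)\<close>.\<close>

lemma Lop1_B: "lact (gop 1) (B_el 1 i) v = (if i = 0 then v + der (XX (hf 0) (hf (- 1))) v else der (XX (hf (i - 1)) (hf i)) v)"
proof -
  have 0: "gop 1 (qE 0) v + gop 1 (qF 0) v = der (XX (hf 0) (hf (- 1))) v" for v :: "rat list \<Rightarrow>\<^sub>0 'a"
  proof (rule tensor_induct_eq[of "\<lambda>v. gop 1 (qE 0) v + gop 1 (qF 0) v" "der (XX (hf 0) (hf (- 1)))"])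
    fix j and y :: "rat list \<Rightarrow>\<^sub>0 'a"
    assume y: "gop 1 (qE 0) y + gop 1 (qF 0) y = der (XX (hf 0) (hf (- 1))) y"
    have j: "gop 1 (qE 0) (eta j) + gop 1 (qF 0) (eta j) = (XX (hf 0) (hf (- 1)) j :: rat list \<Rightarrow>\<^sub>0 'a)"
      by (rule letter_cases[of j]) (auto simp: letter_simps XX_def hf_uminus simp del: eta_act.simps)
    show "gop 1 (qE 0) (eta j * y) + gop 1 (qF 0) (eta j * y) = der (XX (hf 0) (hf (- 1))) (eta j * y)"
      by (simp add: gop_mult der_mult flip: y j) (simp add: algebra_simps)
  qed (simp add: gop_1 | intro lin_intros'')+
  have 1: "gop 1 (qE i) v + gop 1 (qF (- i)) v = der (XX (hf (i - 1)) (hf i)) v" if "i \<noteq> 0" for v :: "rat list \<Rightarrow>\<^sub>0 'a"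
  proof (rule tensor_induct_eq[of "\<lambda>v. gop 1 (qE i) v + gop 1 (qF (- i)) v" "der (XX (hf (i - 1)) (hf i))"])
    fix j and y :: "rat list \<Rightarrow>\<^sub>0 'a"
    assume y: "gop 1 (qE i) y + gop 1 (qF (- i)) y = der (XX (hf (i - 1)) (hf i)) y"
    have j: "gop 1 (qE i) (eta j) + gop 1 (qF (- i)) (eta j) = (XX (hf (i - 1)) (hf i) j :: rat list \<Rightarrow>\<^sub>0 'a)"
      by (rule letter_cases[of j]) (use that in \<open>auto simp: letter_simps XX_def hf_uminus simp del: eta_act.simps\<close>)
    show "gop 1 (qE i) (eta j * y) + gop 1 (qF (- i)) (eta j * y) = der (XX (hf (i - 1)) (hf i)) (eta j * y)"
      by (simp add: gop_mult der_mult flip: y j) (simp add: algebra_simps)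
  qed (simp add: gop_1 | intro lin_intros'')+
  show ?thesis using 0[of v] 1[of v] by (simp add: Lop_B add.commute)
qed

definition wt :: "rat \<Rightarrow> rat list \<Rightarrow> nat" where
  "wt a f = length (filter (\<lambda>j. \<bar>j\<bar> = a) f)"

lemma der_XX_diag:
  fixes v :: "rat list \<Rightarrow>\<^sub>0 'k::field"
  assumes "0 < a" shows "der (XX a a) v = lin_ext (\<lambda>f. scal (of_nat (wt a f)) * Mvec f) v"
proof (rule lin_eqM[of "der (XX a a)" "lin_ext (\<lambda>f. scal (of_nat (wt a f)) * Mvec f)"])
  fix f
  have "XX a a j = (scal (if \<bar>j\<bar> = a then 1 else 0) * eta j :: rat list \<Rightarrow>\<^sub>0 'k)" for j
    using assms by (auto simp: XX_def abs_if)
  then have "derw (XX a a) f = (scal (of_nat (wt a f)) * Mvec f :: rat list \<Rightarrow>\<^sub>0 'k)"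
  proof (induction f)
    case (Cons j f)
    then show ?case
      by (cases "\<bar>j\<bar> = a") (simp_all add: wt_def Mvec_Cons[of j f] scal_add distrib_right scal_left_commute mult.assoc)
  qed (simp add: wt_def)
  then show "der (XX a a) (Mvec f) = lin_ext (\<lambda>f. scal (of_nat (wt a f)) * Mvec f) (Mvec f :: rat list \<Rightarrow>\<^sub>0 'k)"
    by (simp add: der_Mvec)
qed simp_all

lemma cf_diag: "cf (lin_ext (\<lambda>f. scal (c f) * Mvec f) v) h = c h * cf v h"
proof -
  have "cf (lin_ext (\<lambda>f. scal (c f) * Mvec f) v) h = (\<Sum>f\<in>supp v. if f = h then c h * cf v h else 0)"
    unfolding cf_lin_ext by (intro sum.cong) (auto simp: cf_Mvec)
  then show ?thesis by (auto simp: in_keys_iff)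
qed

text \<open>The B_i supply the \<open>XX\<close> of neighbouring letters and of the pair
  \<plusminus>1/2, and brackets produce the other off-diagonal ones. The diagonal
  \<open>XX a a\<close> act by the weights of words, so their commutation comes from the hypothesis
  on \<open>wt\<close>, which is later obtained from the \<open>k_el i\<close> at generic q.\<close>

lemma commute_all_XX:
  fixes Y :: "(rat list \<Rightarrow>\<^sub>0 'k::field) \<Rightarrow> (rat list \<Rightarrow>\<^sub>0 'k)" and r l :: nat
  defines "J \<equiv> I_small r"
  assumes Y: "lin Y" "\<And>v. v \<in> tensors J l \<Longrightarrow> Y v \<in> tensors J l"
    and B: "\<And>i v. \<bar>i\<bar> \<le> int r \<Longrightarrow> v \<in> tensors J l \<Longrightarrow> Y (lact (gop 1) (B_el 1 i) v) = lact (gop 1) (B_el 1 i) (Y v)"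
    and wt: "\<And>f h a. f \<in> words J l \<Longrightarrow> h \<in> words J l \<Longrightarrow> cf (Y (Mvec f)) h \<noteq> 0 \<Longrightarrow> a \<in> J \<Longrightarrow> 0 < a \<Longrightarrow> wt a f = wt a h"
    and ab: "a \<in> J" "b \<in> J" and v: "v \<in> tensors J l"
  shows "Y (der (XX a b) v) = der (XX a b) (Y v)"
proof -
  define G where "G a b \<longleftrightarrow> (\<forall>v\<in>tensors J l. Y (der (XX a b) v) = der (XX a b) (Y v))" for a b
  have J0: "0 \<notin> J" "uminus ` J \<subseteq> J" by (auto simp: J_def uminus_I_small)
  have dT: "der (XX a b) u \<in> tensors J l" if "a \<in> J" "u \<in> tensors J l" for a b and u :: "rat list \<Rightarrow>\<^sub>0 'k"
    by (rule der_tensors[OF that(2)]) (rule XX_tensors[OF J0 that(1)])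
  have Gsym: "G (- a) (- b) \<longleftrightarrow> G a b" for a b by (simp add: G_def XX_sym)
  \<comment> \<open>The bracket of b \<mapsto> a with c \<mapsto> b is c \<mapsto> a unless the
    product in the other order is nonzero, which happens only for c = \<plusminus>a.\<close>
  have br: "der (XX a b) (der (XX b c) u) - der (XX b c) (der (XX a b) u) = (if c = a then der (XX a c) u - der (XX b b) u
      else if c = - a then der (XX a c) u - der (XX b (- b)) u else der (XX a c) u)"
    if "a \<in> J" "b \<in> J" "c \<in> J" for a b c and u :: "rat list \<Rightarrow>\<^sub>0 'k"
  proof -
    have n: "a \<noteq> 0" "b \<noteq> 0" "c \<noteq> 0" using that J0 by auto
    have e: "(\<lambda>j. der (XX a b) (XX b c j) - der (XX b c) (XX a b j)) = (\<lambda>j. XX a c j - (if c = a then XX b b else if c = - a then XX b (- b) else (\<lambda>j. 0)) j :: rat list \<Rightarrow>\<^sub>0 'k)"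
      using fun_cong[OF XX_comp[OF n(2,3), of a b, where ?'a = 'k]] fun_cong[OF XX_comp[OF n(3,2), of b a, where ?'a = 'k]]
      by (auto simp: fun_eq_iff)
    show ?thesis unfolding der_comm e by (simp add: der_diff_left der_zero_left)
  qed
  have Gtrans: "G a c" if "G a b" "G b c" "a \<in> J" "b \<in> J" "c \<in> J" "c \<noteq> a" "c \<noteq> - a" for a b c
  proof -
    have e: "der (XX a c) u = der (XX a b) (der (XX b c) u) - der (XX b c) (der (XX a b) u)" for u :: "rat list \<Rightarrow>\<^sub>0 'k"
      using br[OF that(3-5)] that by simp
    show ?thesis unfolding G_def e using that dT by (auto simp: G_def lin_diff[OF Y(1)])
  qed
  \<comment> \<open>For c = - a the bracket leaves the extra term \<open>XX b (- b)\<close>, whose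
    commutation has to be known first. Below b is the letter 1/2, where it comes from B_0.\<close>
  have Gminus: "G a (- a)" if "G a b" "G b (- a)" "a \<in> J" "b \<in> J" "a \<noteq> 0" "G b (- b)" for a b
  proof -
    have m: "- a \<in> J" using that J0 by auto
    have e: "der (XX a (- a)) u = der (XX a b) (der (XX b (- a)) u) - der (XX b (- a)) (der (XX a b) u) + der (XX b (- b)) u" for u :: "rat list \<Rightarrow>\<^sub>0 'k"
      using br[OF that(3,4) m, of u] that by simp
    show ?thesis unfolding G_def e using that m dT by (auto simp: G_def lin_diff[OF Y(1)] lin_add[OF Y(1)])
  qed
  define P where "P n = hf (int n)" for n :: nat
  have PJ: "P n \<in> J" "- P n \<in> J" "0 < P n" if "n \<le> r" for n
    using that by (auto simp: P_def J_def hf_uminus)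
  have Pne: "P n \<noteq> - P k" "- P k \<noteq> P n" for n k by (auto simp: P_def hf_uminus)
  have Pinj: "P n = P k \<longleftrightarrow> n = k" for n k by (simp add: P_def)
  have Gdiag: "G (P n) (P n)" if "n \<le> r" for n
    unfolding G_def
  proof
    fix v :: "rat list \<Rightarrow>\<^sub>0 'k" assume v: "v \<in> tensors J l"
    have "Y (der (XX (P n) (P n)) (Mvec f)) = der (XX (P n) (P n)) (Y (Mvec f))" if f: "f \<in> words J l" for f
    proof (rule tensors_eqI)
      have fT: "Mvec f \<in> tensors J l" using f by simp
      show "Y (der (XX (P n) (P n)) (Mvec f)) \<in> tensors J l" "der (XX (P n) (P n)) (Y (Mvec f)) \<in> tensors J l"
        using PJ[OF \<open>n \<le> r\<close>] fT Y(2) dT by auto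
      fix h assume "h \<in> words J l"
      then show "cf (Y (der (XX (P n) (P n)) (Mvec f))) h = cf (der (XX (P n) (P n)) (Y (Mvec f))) h"
        unfolding der_XX_diag[OF PJ(3)[OF \<open>n \<le> r\<close>]] cf_diag
        using wt[OF f _ _ PJ(1,3)[OF \<open>n \<le> r\<close>], of h] by (cases "cf (Y (Mvec f)) h = 0") (auto simp: lin_scal[OF Y(1)])
    qed
    then show "Y (der (XX (P n) (P n)) v) = der (XX (P n) (P n)) (Y v)"
      by (intro lin_eq_tensors[OF lin_comp[OF Y(1) lin_der] lin_comp[OF lin_der Y(1)] v])
  qed
  have Gdown: "G (P n) (P (Suc n))" "G (P (Suc n)) (P n)" if "Suc n \<le> r" for n
  proof -
    have i: "\<bar>int (Suc n)\<bar> \<le> int r" "\<bar>- int (Suc n)\<bar> \<le> int r" using that by auto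
    have e: "hf (int (Suc n) - 1) = P n" "hf (int (Suc n)) = P (Suc n)"
      "hf (- int (Suc n) - 1) = - P (Suc n)" "hf (- int (Suc n)) = - P n" by (simp_all add: P_def hf_uminus)
    have "lact (gop 1) (B_el 1 (int (Suc n))) v = der (XX (P n) (P (Suc n))) v" for v :: "rat list \<Rightarrow>\<^sub>0 'k"
      unfolding Lop1_B e by simp
    with B[OF i(1)] show "G (P n) (P (Suc n))" by (simp only: G_def) blast
    have "lact (gop 1) (B_el 1 (- int (Suc n))) v = der (XX (P (Suc n)) (P n)) v" for v :: "rat list \<Rightarrow>\<^sub>0 'k"
      unfolding Lop1_B e XX_sym by simp
    with B[OF i(2)] show "G (P (Suc n)) (P n)" by (simp only: G_def) blast
  qed
  have G0: "G (P 0) (- P 0)"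
  proof -
    have "hf (- 1) = - P 0" "hf 0 = P 0" by (simp_all add: P_def hf_uminus)
    then have "Y (v + der (XX (P 0) (- P 0)) v) = Y v + der (XX (P 0) (- P 0)) (Y v)" if "v \<in> tensors J l" for v
      using B[of 0 v] that by (simp add: Lop1_B)
    then show ?thesis by (simp add: G_def lin_add[OF Y(1)])
  qed
  have Gpos: "G (P n) (P k)" if "n \<le> r" "k \<le> r" for n k
  proof (cases n k rule: linorder_cases)
    case equal
    then show ?thesis using Gdiag that by simp
  next
    case less
    have "Suc (n + d) \<le> r \<Longrightarrow> G (P n) (P (Suc (n + d)))" for d
    proof (induction d)
      case (Suc d)
      then show ?case using Gtrans[of "P n" "P (Suc (n + d))" "P (Suc (Suc (n + d)))"] Gdown(1)[of "Suc (n + d)"] PJ Pne Pinj by auto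
    qed (use Gdown in simp)
    from this[of "k - n - 1"] less that show ?thesis by simp
  next
    case greater
    have "Suc (k + d) \<le> r \<Longrightarrow> G (P (Suc (k + d))) (P k)" for d
    proof (induction d)
      case (Suc d)
      then show ?case using Gtrans[of "P (Suc (Suc (k + d)))" "P (Suc (k + d))" "P k"] Gdown(2)[of "Suc (k + d)"] PJ Pne Pinj by auto
    qed (use Gdown in simp)
    from this[of "n - k - 1"] greater that show ?thesis by simp
  qed
  have Gneg: "G (P n) (- P k)" if "n \<le> r" "k \<le> r" for n k
  proof -
    have n0: "G (P n) (- P 0)"
    proof (cases "n = 0")
      case False
      then show ?thesis using Gtrans[OF Gpos[OF that(1), of 0] G0] PJ that Pne Pinj by auto
    qed (use G0 in simp)
    have k0: "G (- P 0) (- P k)" using Gpos[of 0 k] that by (simp add: Gsym)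
    show ?thesis
    proof (cases "n = k")
      case False
      then show ?thesis using Gtrans[OF n0 k0] PJ that Pne Pinj by auto
    next
      case True
      have "G (P 0) (- P k)" if "k \<noteq> 0"
        using Gtrans[OF G0 k0] PJ \<open>k \<le> r\<close> Pne Pinj that by auto
      then show ?thesis
        using True n0 less_imp_neq[OF PJ(3)[OF that(2)]] Gminus[of "P k" "P 0"] Gpos[OF that(2), of 0] G0 PJ that J0 by (cases "k = 0") auto
    qed
  qed
  have rep: "\<exists>n\<le>r. j = P n \<or> j = - P n" if "j \<in> J" for j
  proof -
    from that obtain k where k: "j = hf k" "- int r - 1 \<le> k" "k \<le> int r"
      by (auto simp: J_def I_small_def half_idx_hf)
    show ?thesis
    proof (cases "0 \<le> k")
      case True
      then show ?thesis using k by (intro exI[of _ "nat k"]) (auto simp: P_def)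
    next
      case False
      then show ?thesis using k by (intro exI[of _ "nat (- k - 1)"]) (auto simp: P_def hf_uminus)
    qed
  qed
  from rep[OF ab(1)] rep[OF ab(2)] obtain n k where nk: "n \<le> r" "k \<le> r" "a = P n \<or> a = - P n" "b = P k \<or> b = - P k" by blast
  then have "G a b"
    using Gpos[OF nk(1,2)] Gneg[OF nk(1,2)] Gsym[of "P n" "P k"] Gsym[of "P n" "- P k"] by auto
  with v show ?thesis by (simp add: G_def)
qed

section \<open>The commutant of the Lie algebra at q = 1\<close>

text \<open>Adjacent swaps generate all rearrangements. The fixed prefix pre lets the induction
  bring the next letter into place and never touch it again.\<close>

lemma mset_invariant:
  assumes swap: "\<And>p a b s. p @ [a, b] @ s \<in> words S l \<Longrightarrow> F (p @ [a, b] @ s) = F (p @ [b, a] @ s)"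
  shows "pre @ u \<in> words S l \<Longrightarrow> mset u = mset u' \<Longrightarrow> F (pre @ u) = F (pre @ u')"
proof (induction u arbitrary: pre u')
  case (Cons a u)
  have move: "F (pre @ p @ [a] @ s) = F (pre @ [a] @ p @ s)" if "pre @ p @ [a] @ s \<in> words S l" for p s
    using that
  proof (induction p arbitrary: s rule: rev_induct)
    case (snoc b p)
    have "F ((pre @ p) @ [b, a] @ s) = F ((pre @ p) @ [a, b] @ s)"
      by (rule swap) (use snoc.prems in simp)
    also have "\<dots> = F (pre @ [a] @ p @ [b] @ s)"
      using snoc.IH[of "b # s"] snoc.prems by (simp add: words_def)
    finally show ?case by simp
  qed simp
  have "a \<in> set u'" using Cons.prems(2) by (metis list.set_intros(1) set_mset_mset)
  then obtain p s where u': "u' = p @ a # s" by (meson split_list)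
  have m: "mset u = mset (p @ s)" using Cons.prems(2) by (simp add: u')
  have "F ((pre @ [a]) @ u) = F ((pre @ [a]) @ (p @ s))"
    by (rule Cons.IH) (use Cons.prems(1) m in simp_all)
  also have "\<dots> = F (pre @ p @ [a] @ s)"
  proof -
    have "set u = set (p @ s)" "length u = length (p @ s)" using m by (metis set_mset_mset, metis size_mset)
    then have "pre @ p @ [a] @ s \<in> words S l" using Cons.prems(1) by (auto simp: words_def)
    from move[OF this] show ?thesis by simp
  qed
  finally show ?case by (simp add: u')
qed simp

text \<open>Acting on both words at once, the generators exchange neighbouring pairs of letters or
  negate both entries of the first pair. The orbits on pairs of words are therefore classified by
  the multiset of pairs up to a common sign.\<close>

lemma cls2_invariant:
  assumes J: "0 \<notin> J" "uminus ` J \<subseteq> J"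
    and Z: "\<And>f' f i. f' \<in> words J l \<Longrightarrow> f \<in> words J l \<Longrightarrow> i < l \<Longrightarrow> Z (place f' i) (place f i) = Z f' f"
    and f: "f' \<in> words J l" "f \<in> words J l" "g' \<in> words J l" "g \<in> words J l"
      "mset (map2 cls2 f' f) = mset (map2 cls2 g' g)"
  shows "Z f' f = Z g' g"
proof -
  define F where "F u = Z (map fst u) (map snd u)" for u
  let ?S = "J \<times> J"
  define ng where "ng = (\<lambda>(a :: rat, b :: rat). (- a, - b))"
  have w: "map fst u \<in> words J l" "map snd u \<in> words J l" if "u \<in> words ?S l" for u
    using that by (auto simp: words_def)
  have swap: "F (p @ [a, b] @ s) = F (p @ [b, a] @ s)" if "p @ [a, b] @ s \<in> words ?S l" for p a b s
  proof -
    have i: "Suc (length p) < l" using that by (simp add: words_def)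
    have pl: "place (map h (p @ [a, b] @ s)) (Suc (length p)) = map h (p @ [b, a] @ s)" for h :: "rat \<times> rat \<Rightarrow> rat"
      by (simp add: place_def nth_append list_update_append)
    show ?thesis unfolding F_def using Z[OF w[OF that] i] unfolding pl by simp
  qed
  have neg: "F (a # s) = F (ng a # s)" if "a # s \<in> words ?S l" for a s
  proof -
    have i: "0 < l" using that by (auto simp: words_def)
    show ?thesis using Z[OF w[OF that] i] by (simp add: F_def place_def ng_def case_prod_unfold)
  qed
  have ngS: "ng a \<in> ?S" if "a \<in> ?S" for a using that J by (auto simp: ng_def)
  note inv = mset_invariant[where F = F and S = ?S and l = l, OF swap]
  \<comment> \<open>The pair is moved to the front, negated there, and moved back.\<close>
  have neg': "F (p @ a # s) = F (p @ ng a # s)" if "p @ a # s \<in> words ?S l" for p a s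
  proof -
    have 1: "a # p @ s \<in> words ?S l" and 2: "ng a # p @ s \<in> words ?S l"
      using that ngS[of a] by (auto simp: words_def)
    have "F (p @ a # s) = F (a # p @ s)" using inv[of "[]" "p @ a # s" "a # p @ s"] that by simp
    also have "\<dots> = F (ng a # p @ s)" by (rule neg[OF 1])
    also have "\<dots> = F (p @ ng a # s)" using inv[of "[]" "ng a # p @ s" "p @ ng a # s"] 2 by simp
    finally show ?thesis .
  qed
  have cl: "cls2 a b = (a, b) \<or> cls2 a b = ng (a, b)" for a b by (auto simp: cls2_def ng_def)
  have norm: "F (p @ u) = F (p @ map (case_prod cls2) u)" if "p @ u \<in> words ?S l" for p u
    using that
  proof (induction u arbitrary: p)
    case (Cons a u)
    let ?c = "case_prod cls2 a"
    have c: "?c = a \<or> ?c = ng a" using cl by (cases a) auto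
    then have "F (p @ a # u) = F (p @ ?c # u)" using neg'[OF Cons.prems] by auto
    moreover have "(p @ [?c]) @ u \<in> words ?S l" using c Cons.prems ngS[of a] by (auto simp: words_def)
    from Cons.IH[OF this] have "F (p @ ?c # u) = F (p @ ?c # map (case_prod cls2) u)" by simp
    ultimately show ?case by simp
  qed simp
  have z: "zip f' f \<in> words ?S l" "zip g' g \<in> words ?S l"
    using f by (auto simp: words_def dest: set_zip_leftD set_zip_rightD)
  have cw: "map (case_prod cls2) (zip f' f) \<in> words ?S l"
  proof -
    have "case_prod cls2 a \<in> ?S" if "a \<in> ?S" for a using cl[of "fst a" "snd a"] ngS[OF that] that by (cases a) auto
    moreover have "set (zip f' f) \<subseteq> ?S" "length (zip f' f) = l" using z(1) by (simp_all only: words_def mem_Collect_eq)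
    ultimately have "set (map (case_prod cls2) (zip f' f)) \<subseteq> ?S" unfolding set_map by blast
    with \<open>length (zip f' f) = l\<close> show ?thesis by (simp only: words_def mem_Collect_eq length_map)
  qed
  have len: "length f' = length f" "length g' = length g" using f by (simp_all add: words_def)
  have "Z f' f = F (zip f' f)" using len by (simp add: F_def)
  also have "\<dots> = F (map (case_prod cls2) (zip f' f))" using norm[of "[]"] z by simp
  also have "\<dots> = F (map (case_prod cls2) (zip g' g))" using inv[of "[]"] cw f(5) by simp
  also have "\<dots> = F (zip g' g)" using norm[of "[]"] z by simp
  also have "\<dots> = Z g' g" using len by (simp add: F_def)
  finally show ?thesis .
qed

definition mop :: "rat list set \<Rightarrow> (rat list \<Rightarrow> rat list \<Rightarrow> 'k::field) \<Rightarrow> (rat list \<Rightarrow>\<^sub>0 'k) \<Rightarrow> (rat list \<Rightarrow>\<^sub>0 'k)" where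
  "mop F Z = lin_ext (\<lambda>f. \<Sum>h\<in>F. scal (Z h f) * Mvec h)"

lemma lin_mop [simp]: "lin (mop F Z)" by (simp add: mop_def)

lemma cf_sum_Mvec: "finite F \<Longrightarrow> h \<in> F \<Longrightarrow> cf (\<Sum>f\<in>F. scal (c f) * Mvec f) h = c h"
  by (simp add: lookup_sum cf_Mvec if_distrib cong: if_cong)

lemma map2_image_mset:
  assumes "length f' = l" "length f = l"
  shows "mset (map2 h f' f) = image_mset (\<lambda>i. h (f' ! i) (f ! i)) (mset_set {..<l})"
proof -
  have "map2 h f' f = map (\<lambda>i. h (f' ! i) (f ! i)) [0..<l]"
    by (rule nth_equalityI) (use assms in auto)
  then show ?thesis by (simp add: lessThan_atLeast0)
qed

text \<open>One half of the double commutant: a matrix that is constant on the orbits of signed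
  permutations is a combination of polarised operators, one for each orbit, and these are
  polynomials in the derivations \<open>der (XX a b)\<close>.\<close>

lemma mop_commute:
  fixes Y :: "(rat list \<Rightarrow>\<^sub>0 'k::field_char_0) \<Rightarrow> (rat list \<Rightarrow>\<^sub>0 'k)"
  assumes J: "finite J" "0 \<notin> J" "uminus ` J \<subseteq> J"
    and Y: "lin Y" "\<And>v. v \<in> tensors J l \<Longrightarrow> Y v \<in> tensors J l"
    and YX: "\<And>a b v. a \<in> J \<Longrightarrow> b \<in> J \<Longrightarrow> v \<in> tensors J l \<Longrightarrow> Y (der (XX a b) v) = der (XX a b) (Y v)"
    and Z: "\<And>f' f i. f' \<in> words J l \<Longrightarrow> f \<in> words J l \<Longrightarrow> i < l \<Longrightarrow> Z (place f' i) (place f i) = Z f' f"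
    and v: "v \<in> tensors J l"
  shows "Y (mop (words J l) Z v) = mop (words J l) Z (Y v)"
proof -
  define F where "F = words J l"
  have fF: "finite F" using J(1) by (simp add: F_def finite_words)
  define ty where "ty p = mset (map2 cls2 (fst p) (snd p))" for p
  define Ms where "Ms = ty ` (F \<times> F)"
  have "\<forall>M\<in>Ms. \<exists>p. p \<in> F \<times> F \<and> ty p = M" by (auto simp: Ms_def)
  then obtain e where e: "\<And>M. M \<in> Ms \<Longrightarrow> e M \<in> F \<times> F \<and> ty (e M) = M" by metis
  define A where "A M i = cls2 (fst (e M) ! i) (snd (e M) ! i)" for M i
  define x where "x M i = (XX (fst (A M i)) (snd (A M i)) :: rat \<Rightarrow> rat list \<Rightarrow>\<^sub>0 'k)" for M i
  \<comment> \<open>The polarised operator of the orbit M has the constant entry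
    \<open>mfact M\<close> on that orbit, hence this denominator, which is nonzero in characteristic
    0.\<close>
  define \<zeta> where "\<zeta> M = Z (fst (e M)) (snd (e M)) / of_nat (mfact M)" for M
  have AM: "image_mset (A M) (mset_set {..<l}) = M" if "M \<in> Ms" for M
  proof -
    have "length (fst (e M)) = l" "length (snd (e M)) = l" using e[OF that] by (auto simp: F_def words_def)
    from map2_image_mset[OF this, of cls2] e[OF that] show ?thesis by (simp add: A_def[abs_def] ty_def)
  qed
  have AJ: "fst (A M i) \<in> J \<and> snd (A M i) \<in> J \<and> 0 < snd (A M i)" if "M \<in> Ms" "i < l" for M i
  proof -
    have "fst (e M) ! i \<in> J" "snd (e M) ! i \<in> J" using e[OF that(1)] that(2) by (auto simp: F_def words_def)
    moreover from this have "snd (e M) ! i \<noteq> 0" using J(2) by auto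
    ultimately show ?thesis using J(3) by (auto simp: A_def cls2_def)
  qed
  have Zop: "mop F Z u = (\<Sum>M\<in>Ms. scal (\<zeta> M) * Nop (x M) {..<l} u)" if u: "u \<in> tensors J l" for u
  proof (rule lin_eq_tensors[OF lin_mop _ u])
    show "lin (\<lambda>u. \<Sum>M\<in>Ms. scal (\<zeta> M) * Nop (x M) {..<l} u)" by (intro lin_Sum lin_scal_mult lin_Nop)
    fix g assume g: "g \<in> words J l"
    show "mop F Z (Mvec g) = (\<Sum>M\<in>Ms. scal (\<zeta> M) * Nop (x M) {..<l} (Mvec g))"
    proof (rule tensors_eqI)
      show "mop F Z (Mvec g) \<in> tensors J l" by (auto simp: mop_def F_def intro!: tensors_sum tensors_scal)
      show "(\<Sum>M\<in>Ms. scal (\<zeta> M) * Nop (x M) {..<l} (Mvec g)) \<in> tensors J l"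
        using g AJ by (intro tensors_sum tensors_scal Nop_tensors) (auto simp: x_def intro!: XX_tensors J simp del: One_nat_def)
      fix g' assume g': "g' \<in> words J l"
      let ?M = "ty (g', g)"
      have M: "?M \<in> Ms" using g g' by (auto simp: Ms_def F_def)
      have N: "cf (Nop (x M) {..<l} (Mvec g)) g' = (if M = ?M then of_nat (mfact M) else 0)" if "M \<in> Ms" for M
      proof -
        have "cf (Nw (x M) g {..<l}) g' = (if mset (map2 cls2 g' g) = image_mset (A M) (mset_set {..<l}) then of_nat (mfact (image_mset (A M) (mset_set {..<l}))) else 0)"
          unfolding x_def by (rule cf_Nw) (use g g' J AJ[OF that] in \<open>auto simp: words_def\<close>)
        then show ?thesis unfolding AM[OF that] by (auto simp: Nop_def ty_def)
      qed
      have "cf (\<Sum>M\<in>Ms. scal (\<zeta> M) * Nop (x M) {..<l} (Mvec g)) g' = (\<Sum>M\<in>Ms. if M = ?M then \<zeta> M * of_nat (mfact M) else 0)"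
        unfolding lookup_sum cf_scal by (intro sum.cong) (simp_all add: N)
      also have "\<dots> = Z (fst (e ?M)) (snd (e ?M))"
        using M fF mfact_pos[of ?M] by (simp add: Ms_def \<zeta>_def)
      also have "\<dots> = Z g' g"
        by (rule cls2_invariant[where Z = Z and J = J and l = l, OF J(2,3) Z]) (use e[OF M] g g' in \<open>auto simp: F_def ty_def\<close>)
      finally show "cf (mop F Z (Mvec g)) g' = cf (\<Sum>M\<in>Ms. scal (\<zeta> M) * Nop (x M) {..<l} (Mvec g)) g'"
        using fF g' by (simp add: mop_def cf_sum_Mvec F_def)
    qed
  qed
  have "Y (Nop (x M) {..<l} v) = Nop (x M) {..<l} (Y v)" if "M \<in> Ms" for M
    by (rule Nop_commute[OF J(2,3) Y YX _ _ v]) (use AJ[OF that] in \<open>auto simp: x_def\<close>)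
  then show ?thesis
    unfolding F_def[symmetric] Zop[OF v] Zop[OF Y(2)[OF v]]
    by (simp add: lin_sum[OF Y(1)] lin_scal[OF Y(1)])
qed

definition tw :: "nat list \<Rightarrow> rat list \<Rightarrow> rat list" where
  "tw w f = fold (\<lambda>i f. place f i) w f"

lemma Psiw1: "Psiw 1 w (Mvec f) = Mvec (tw w f)"
proof (induction w arbitrary: f)
  case (Cons i w)
  have "Psi_gen 1 i (Mvec f) = (Mvec (place f i) :: rat list \<Rightarrow>\<^sub>0 'a)"
    by (auto simp: Psi_Mvec M_act_def place_def list_update_id) (metis list_update_id)
  with Cons show ?case by (simp add: tw_def)
qed (simp add: tw_def)

lemma tw_words:
  assumes "uminus ` J \<subseteq> J" "f \<in> words J l" "set w \<subseteq> {..<l}" shows "tw w f \<in> words J l"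
  using assms(2,3) by (induction w arbitrary: f) (auto simp: tw_def place_words assms(1))

text \<open>A double commutant argument: the orthogonal projection onto the span of the signed permutations
  is left equivariant, so its coefficients lie in the commutant of the signed permutations.\<close>

lemma classical_commutant:
  fixes Y :: "(rat list \<Rightarrow>\<^sub>0 rat) \<Rightarrow> (rat list \<Rightarrow>\<^sub>0 rat)"
  assumes J: "finite J" "0 \<notin> J" "uminus ` J \<subseteq> J"
    and Y: "lin Y" "\<And>v. v \<in> tensors J l \<Longrightarrow> Y v \<in> tensors J l"
    and YX: "\<And>a b v. a \<in> J \<Longrightarrow> b \<in> J \<Longrightarrow> v \<in> tensors J l \<Longrightarrow> Y (der (XX a b) v) = der (XX a b) (Y v)"
    and orth: "\<And>w. set w \<subseteq> {..<l} \<Longrightarrow> (\<Sum>f\<in>words J l. cf (Y (Mvec f)) (tw w f)) = 0"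
    and g: "g \<in> words J l"
  shows "Y (Mvec g) = 0"
proof -
  define F where "F = words J l"
  have fF: "finite F" using J(1) by (simp add: F_def finite_words)
  define X where "X = F \<times> F"
  have fX: "finite X" using fF by (simp add: X_def)
  define mat where "mat t = (\<lambda>(h, f). if f \<in> F \<and> h = t f then (1::rat) else 0)" for t :: "rat list \<Rightarrow> rat list"
  define B where "B = (\<lambda>w. mat (restrict (tw w) F)) ` {w. set w \<subseteq> {..<l}}"
  have twF: "tw w f \<in> F" if "f \<in> F" "set w \<subseteq> {..<l}" for w f
    using tw_words[OF J(3)] that by (simp add: F_def)
  have mat: "mat (restrict (tw w) F) (h, f) = (if h = tw w f then 1 else 0)" if "f \<in> F" for w h f
    using that by (simp add: mat_def)
  have fB: "finite B"
  proof -
    have "B \<subseteq> mat ` (F \<rightarrow>\<^sub>E F)" using twF by (auto simp: B_def)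
    moreover have "finite (F \<rightarrow>\<^sub>E F)" using fF by (intro finite_PiE) auto
    ultimately show ?thesis by (meson finite_imageI finite_subset)
  qed
  have aniso: "\<forall>x\<in>X. v x = 0" if "(\<Sum>x\<in>X. v x * v x) = 0" for v :: "rat list \<times> rat list \<Rightarrow> rat"
    using that sum_nonneg_eq_0_iff[OF fX, of "\<lambda>x. v x * v x"] by auto
  from orth_kernel[OF fX aniso fB] obtain P c where P0:
    "(\<forall>x y. P x y = (\<Sum>b\<in>B. c b y * b x)) \<and> (\<forall>x y. P x y = P y x) \<and> (\<forall>b\<in>B. \<forall>x\<in>X. (\<Sum>y\<in>X. P x y * b y) = b x)"
    by blast
  have P1: "P x y = (\<Sum>b\<in>B. c b y * b x)" for x y using conjunct1[OF P0] by blast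
  have P2: "P x y = P y x" for x y using conjunct1[OF conjunct2[OF P0]] by blast
  have P3: "(\<Sum>y\<in>X. P x y * b y) = b x" if "b \<in> B" "x \<in> X" for b x using P0 that by blast
  \<comment> \<open>Left translation by a generator permutes B, hence preserves its span and, being
    an orthogonal map, commutes with the projection onto it.\<close>
  have equiv: "P (place h i, f) (place h' i, f') = P (h, f) (h', f')"
    if i: "i < l" and hf: "h \<in> F" "f \<in> F" "h' \<in> F" "f' \<in> F" for h f h' f' i
  proof -
    define t where "t x = (place (fst x) i, snd x)" for x :: "rat list \<times> rat list"
    have pF: "place h i \<in> F" "place (place h i) i = h" if "h \<in> F" for h
      using that i J(3) place_words[of h J l i] place_place[of i h] by (auto simp: F_def words_def)
    have tX: "t x \<in> X" "t (t x) = x" if "x \<in> X" for x using that pF by (auto simp: t_def X_def)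
    have bij: "bij_betw t X X" by (rule bij_betw_byWitness[where f' = t]) (use tX in auto)
    have bt: "\<exists>b'\<in>B. \<forall>x\<in>X. b' x = b (t x)" if "b \<in> B" for b
    proof -
      from that obtain w where w: "set w \<subseteq> {..<l}" "b = mat (restrict (tw w) F)" by (auto simp: B_def)
      have "mat (restrict (tw (w @ [i])) F) \<in> B" using w(1) i by (auto simp: B_def)
      moreover have "mat (restrict (tw (w @ [i])) F) (h, f) = b (t (h, f))" if "h \<in> F" "f \<in> F" for h f
        using pF[OF that(1)] pF[OF twF[OF that(2) w(1)]] that by (auto simp: w(2) mat t_def) (auto simp: tw_def)
      ultimately show ?thesis by (auto simp: X_def)
    qed
    \<comment> \<open>The same sum is evaluated twice: the first factor reproduces the translated
      columns of P, and by symmetry of P the second factor reproduces the columns of the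
      first.\<close>
    have "(\<Sum>y\<in>X. P x y * P (t y) (t z)) = P (t x) (t z)" if "x \<in> X" for x z
    proof -
      have "(\<Sum>y\<in>X. P x y * P (t y) (t z)) = (\<Sum>b\<in>B. c b (t z) * (\<Sum>y\<in>X. P x y * b (t y)))"
        unfolding P1[of _ "t z"] sum_distrib_left by (subst sum.swap) (simp only: ac_simps)
      also have "\<dots> = (\<Sum>b\<in>B. c b (t z) * b (t x))"
      proof (intro sum.cong refl arg_cong2[where f = "(*)"])
        fix b assume "b \<in> B"
        from bt[OF this] obtain b' where b': "b' \<in> B" "\<And>x. x \<in> X \<Longrightarrow> b' x = b (t x)" by blast
        then show "(\<Sum>y\<in>X. P x y * b (t y)) = b (t x)" using P3[OF b'(1) that] b'(2) that by simp
      qed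
      finally show ?thesis by (simp add: P1)
    qed
    moreover have "(\<Sum>y\<in>X. P x y * P (t y) (t z)) = P x z" if "x \<in> X" "z \<in> X" for x z
    proof -
      have "(\<Sum>y\<in>X. P (t z) (t y) * b y) = b z" if "b \<in> B" for b
      proof -
        from bt[OF that] obtain b' where b': "b' \<in> B" "\<And>x. x \<in> X \<Longrightarrow> b' x = b (t x)" by blast
        have "(\<Sum>y\<in>X. P (t z) (t y) * b y) = (\<Sum>y\<in>X. P (t z) (t y) * b' (t y))"
          using b'(2) tX by (intro sum.cong) auto
        also have "\<dots> = (\<Sum>y\<in>X. P (t z) y * b' y)"
          using sum.reindex_bij_betw[OF bij, of "\<lambda>y. P (t z) y * b' y"] .
        also have "\<dots> = b z" using P3[OF b'(1) tX(1)[OF \<open>z \<in> X\<close>]] b'(2) tX \<open>z \<in> X\<close> by simp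
        finally show ?thesis .
      qed
      note Pt = this
      have "(\<Sum>y\<in>X. P x y * P (t y) (t z)) = (\<Sum>y\<in>X. P (t z) (t y) * P y x)"
        by (intro sum.cong refl) (metis P2 mult.commute)
      also have "\<dots> = (\<Sum>b\<in>B. c b x * (\<Sum>y\<in>X. P (t z) (t y) * b y))"
        unfolding P1[of _ x] sum_distrib_left by (subst sum.swap) (simp only: ac_simps)
      also have "\<dots> = P z x" using Pt by (simp add: P1)
      finally show ?thesis by (simp add: P2)
    qed
    ultimately have "P (t (h, f)) (t (h', f')) = P (h, f) (h', f')" using hf by (auto simp: X_def)
    then show ?thesis by (simp add: t_def)
  qed
  \<comment> \<open>For fixed g and g2 the projection becomes a kernel in the two remaining words.
    It is invariant under simultaneous signed permutations by \<open>equiv\<close>, so the operator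
    with this matrix commutes with Y.\<close>
  define Z where "Z g2 = (\<lambda>h f. P (h, g) (f, g2))" for g2
  have gF: "g \<in> F" using g by (simp add: F_def)
  have com: "Y (mop F (Z g2) v) = mop F (Z g2) (Y v)" if "g2 \<in> F" "v \<in> tensors J l" for g2 v
    unfolding F_def by (rule mop_commute[OF J Y YX _ that(2)])
      (use equiv gF that(1) in \<open>auto simp: Z_def F_def\<close>)
  have one: "mat (restrict (tw []) F) \<in> B" by (force simp: B_def)
  \<comment> \<open>The identity matrix belongs to the empty word, so it lies in B and P fixes it;
    this is column g of that equation.\<close>
  have Mg: "Mvec g = (\<Sum>g2\<in>F. mop F (Z g2) (Mvec g2))"
  proof (rule tensors_eqI)
    show "Mvec g \<in> tensors J l" using g by simp
    show "(\<Sum>g2\<in>F. mop F (Z g2) (Mvec g2)) \<in> tensors J l"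
      by (auto simp: mop_def F_def intro!: tensors_sum tensors_scal)
    fix h assume h: "h \<in> words J l"
    then have hF: "h \<in> F" by (simp add: F_def)
    have "cf (\<Sum>g2\<in>F. mop F (Z g2) (Mvec g2)) h = (\<Sum>g2\<in>F. P (h, g) (g2, g2))"
      unfolding lookup_sum by (intro sum.cong refl) (simp add: mop_def cf_sum_Mvec[OF fF hF] Z_def)
    also have "\<dots> = (\<Sum>g2\<in>F. \<Sum>f\<in>F. P (h, g) (f, g2) * mat (restrict (tw []) F) (f, g2))"
    proof (intro sum.cong refl)
      fix g2 assume "g2 \<in> F"
      then have "(\<Sum>f\<in>F. P (h, g) (f, g2) * mat (restrict (tw []) F) (f, g2)) = (\<Sum>f\<in>F. if f = g2 then P (h, g) (g2, g2) else 0)"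
        by (intro sum.cong) (auto simp: mat tw_def)
      then show "P (h, g) (g2, g2) = (\<Sum>f\<in>F. P (h, g) (f, g2) * mat (restrict (tw []) F) (f, g2))"
        using fF \<open>g2 \<in> F\<close> by simp
    qed
    also have "\<dots> = (\<Sum>y\<in>X. P (h, g) y * mat (restrict (tw []) F) y)"
      unfolding X_def by (subst sum.swap) (simp add: sum.cartesian_product case_prod_unfold)
    also have "\<dots> = mat (restrict (tw []) F) (h, g)" by (rule P3[OF one]) (simp add: X_def hF gF)
    also have "\<dots> = cf (Mvec g) h" by (auto simp: mat[OF gF] tw_def cf_Mvec)
    finally show "cf (Mvec g) h = cf (\<Sum>g2\<in>F. mop F (Z g2) (Mvec g2)) h" ..
  qed
  have YF: "Y (Mvec f) \<in> tensors J l" if "f \<in> F" for f using Y(2) that by (simp add: F_def)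
  show ?thesis
  proof (rule tensors_eqI)
    show "Y (Mvec g) \<in> tensors J l" by (rule YF[OF gF])
    fix h assume "h \<in> words J l"
    then have hF: "h \<in> F" by (simp add: F_def)
    \<comment> \<open>Moving Y inside turns the coefficient at h into the pairing of the row (h, g)
      of P with the matrix of Y. That row is a combination of B, to which Y is orthogonal.\<close>
    have "Y (Mvec g) = (\<Sum>g2\<in>F. mop F (Z g2) (Y (Mvec g2)))"
      unfolding Mg lin_sum[OF Y(1)] by (intro sum.cong refl com) (simp_all add: F_def)
    then have "cf (Y (Mvec g)) h = (\<Sum>g2\<in>F. cf (mop F (Z g2) (Y (Mvec g2))) h)" by (simp add: lookup_sum)
    also have "\<dots> = (\<Sum>g2\<in>F. \<Sum>f\<in>F. P (h, g) (f, g2) * cf (Y (Mvec g2)) f)"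
    proof (intro sum.cong refl)
      fix g2 assume g2: "g2 \<in> F"
      have "supp (Y (Mvec g2)) \<subseteq> F" using YF[OF g2] by (simp add: tensors_alt F_def)
      then have "mop F (Z g2) (Y (Mvec g2)) = (\<Sum>f\<in>F. scal (cf (Y (Mvec g2)) f) * (\<Sum>h\<in>F. scal (Z g2 h f) * Mvec h))"
        unfolding mop_def by (intro lin_ext_superset fF)
      then have "cf (mop F (Z g2) (Y (Mvec g2))) h = (\<Sum>f\<in>F. cf (scal (cf (Y (Mvec g2)) f) * (\<Sum>h\<in>F. scal (Z g2 h f) * Mvec h)) h)"
        by (simp only: lookup_sum)
      also have "\<dots> = (\<Sum>f\<in>F. P (h, g) (f, g2) * cf (Y (Mvec g2)) f)"
        by (intro sum.cong refl) (simp only: cf_scal cf_sum_Mvec[OF fF hF] Z_def mult.commute)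
      finally show "cf (mop F (Z g2) (Y (Mvec g2))) h = (\<Sum>f\<in>F. P (h, g) (f, g2) * cf (Y (Mvec g2)) f)" .
    qed
    also have "\<dots> = (\<Sum>g2\<in>F. \<Sum>f\<in>F. \<Sum>b\<in>B. c b (h, g) * (b (f, g2) * cf (Y (Mvec g2)) f))"
    proof -
      have "P (h, g) y = (\<Sum>b\<in>B. c b (h, g) * b y)" for y
        using P2[of "(h, g)" y] P1[of y "(h, g)"] by (rule trans)
      then show ?thesis by (simp only: sum_distrib_right mult.assoc)
    qed
    also have "\<dots> = (\<Sum>b\<in>B. \<Sum>g2\<in>F. \<Sum>f\<in>F. c b (h, g) * (b (f, g2) * cf (Y (Mvec g2)) f))"
    proof -
      have "(\<Sum>g2\<in>F. \<Sum>f\<in>F. \<Sum>b\<in>B. c b (h, g) * (b (f, g2) * cf (Y (Mvec g2)) f))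
        = (\<Sum>g2\<in>F. \<Sum>b\<in>B. \<Sum>f\<in>F. c b (h, g) * (b (f, g2) * cf (Y (Mvec g2)) f))"
        by (intro sum.cong refl sum.swap)
      also have "\<dots> = (\<Sum>b\<in>B. \<Sum>g2\<in>F. \<Sum>f\<in>F. c b (h, g) * (b (f, g2) * cf (Y (Mvec g2)) f))"
        by (rule sum.swap)
      finally show ?thesis .
    qed
    also have "\<dots> = (\<Sum>b\<in>B. c b (h, g) * (\<Sum>g2\<in>F. \<Sum>f\<in>F. b (f, g2) * cf (Y (Mvec g2)) f))"
      by (simp only: sum_distrib_left)
    also have "\<dots> = 0"
    proof (intro sum.neutral ballI)
      fix b assume "b \<in> B"
      then obtain w where w: "set w \<subseteq> {..<l}" "b = mat (restrict (tw w) F)" by (auto simp: B_def)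
      have "(\<Sum>f\<in>F. b (f, g2) * cf (Y (Mvec g2)) f) = cf (Y (Mvec g2)) (tw w g2)" if g2: "g2 \<in> F" for g2
      proof -
        have "(\<Sum>f\<in>F. b (f, g2) * cf (Y (Mvec g2)) f) = (\<Sum>f\<in>F. if f = tw w g2 then cf (Y (Mvec g2)) (tw w g2) else 0)"
          by (intro sum.cong) (auto simp: w(2) mat[OF g2])
        then show ?thesis using fF twF[OF g2 w(1)] by simp
      qed
      then show "c b (h, g) * (\<Sum>g2\<in>F. \<Sum>f\<in>F. b (f, g2) * cf (Y (Mvec g2)) f) = 0"
        using orth[OF w(1)] by (simp add: F_def)
    qed
    finally show "cf (Y (Mvec g)) h = cf 0 h" by simp
  qed simp
qed

section \<open>Weights\<close>

text \<open>For i \<ge> 1 this is the exponent of q by which \<open>k_el i\<close> scales the word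
  f. The product of K_i and the inverse of K_{-i} acts alike on a letter and its negative, so only
  absolute values are counted.\<close>

definition kexp :: "int \<Rightarrow> rat list \<Rightarrow> int" where
  "kexp i f = int (wt (hf (i - 1)) f) - int (wt (hf i) f)"

lemma abs_hf: "\<bar>hf n\<bar> = hf (if 0 \<le> n then n else - n - 1)"
proof -
  have "hf n < 0 \<longleftrightarrow> \<not> 0 \<le> n" using hf_pos[of n] hf_neq_0[of n] by linarith
  then show ?thesis by (simp add: abs_if hf_uminus)
qed

text \<open>The exponents give the differences of consecutive weights, and the weights add up to the
  length of the word, which fixes the remaining constant.\<close>

lemma wt_determined:
  assumes "f \<in> words (I_small s) l" "h \<in> words (I_small s) l" "\<And>i. 1 \<le> i \<Longrightarrow> i \<le> int s \<Longrightarrow> kexp i f = kexp i h"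
    and "n \<le> s"
  shows "wt (hf (int n)) f = wt (hf (int n)) h"
proof -
  have tot: "(\<Sum>n\<le>s. wt (hf (int n)) f) = l" if "f \<in> words (I_small s) l" for f
    using that
  proof (induction f arbitrary: l)
    case (Cons j f)
    then obtain l' where l: "l = Suc l'" "j \<in> I_small s" "f \<in> words (I_small s) l'" by (auto simp: words_def)
    obtain k where k: "j = hf k" "- int s - 1 \<le> k" "k \<le> int s" using l(2) by (auto simp: I_small_def half_idx_hf)
    define a where "a = nat (if 0 \<le> k then k else - k - 1)"
    have a: "\<bar>j\<bar> = hf (int a)" "a \<le> s" using k by (auto simp: abs_hf a_def)
    have "(\<Sum>n\<le>s. wt (hf (int n)) (j # f)) = (\<Sum>n\<le>s. wt (hf (int n)) f + (if n = a then 1 else 0))"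
      by (intro sum.cong) (auto simp: wt_def a(1))
    then show ?case using Cons.IH[OF l(3)] a(2) l(1) by (simp add: sum.distrib)
  qed (simp add: wt_def words_def)
  define d where "d n = int (wt (hf (int n)) f) - int (wt (hf (int n)) h)" for n
  have const: "n \<le> s \<Longrightarrow> d n = d 0" for n
  proof (induction n)
    case (Suc n)
    then show ?case using assms(3)[of "int (Suc n)"] by (simp add: d_def kexp_def)
  qed simp
  have "(\<Sum>n\<le>s. d n) = int (\<Sum>n\<le>s. wt (hf (int n)) f) - int (\<Sum>n\<le>s. wt (hf (int n)) h)"
    by (simp add: d_def sum_subtractf)
  also have "\<dots> = 0" using tot[OF assms(1)] tot[OF assms(2)] by simp
  finally have "(\<Sum>n\<le>s. d n) = 0" .
  moreover have "(\<Sum>n\<le>s. d n) = (\<Sum>n\<le>s. d 0)" by (intro sum.cong refl const) auto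
  ultimately have "d 0 = 0" by simp
  then show ?thesis using const[OF assms(4)] by (simp add: d_def)
qed

section \<open>Specialisation at q = 1\<close>

text \<open>Rational polynomials are kept among the polynomials over \<open>'k\<close>, so that the
  same object can be evaluated at q and at 1.\<close>

definition ratp :: "'k::field_char_0 poly \<Rightarrow> bool" where
  "ratp p \<longleftrightarrow> (\<forall>i. Polynomial.coeff p i \<in> \<rat>)"

lemma ratp_0 [simp]: "ratp 0" and ratp_1 [simp]: "ratp 1"
  and ratp_add: "ratp a \<Longrightarrow> ratp b \<Longrightarrow> ratp (a + b)"
  and ratp_uminus: "ratp a \<Longrightarrow> ratp (- a)"
  and ratp_diff: "ratp a \<Longrightarrow> ratp b \<Longrightarrow> ratp (a - b)"
  and ratp_mult: "ratp a \<Longrightarrow> ratp b \<Longrightarrow> ratp (a * b)"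
  by (auto simp: ratp_def coeff_mult intro!: Rats_sum)

lemma ratp_pCons: "c \<in> \<rat> \<Longrightarrow> ratp p \<Longrightarrow> ratp (pCons c p)"
  by (auto simp: ratp_def coeff_pCons split: nat.split)

lemma ratp_prod: "(\<And>i. i \<in> I \<Longrightarrow> ratp (b i)) \<Longrightarrow> ratp (\<Prod>i\<in>I. b i)"
  by (induction I rule: infinite_finite_induct) (auto intro: ratp_mult)

lemma ratp_poly_1: "ratp p \<Longrightarrow> poly p 1 \<in> \<rat>"
  unfolding poly_altdef ratp_def by (intro Rats_sum) simp

lemma ratp_divide_linear:
  fixes r :: "'k::field_char_0 poly"
  assumes "ratp ([:-1, 1:] * r)" shows "ratp r"
proof -
  have c: "Polynomial.coeff ([:-1, 1:] * r) i \<in> \<rat>" for i using assms by (simp add: ratp_def)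
  have "Polynomial.coeff r i \<in> \<rat>" for i
  proof (induction i)
    case 0
    have "- Polynomial.coeff r 0 \<in> \<rat>" using c[of 0] by simp
    then show ?case by simp
  next
    case (Suc i)
    have "Polynomial.coeff r i - Polynomial.coeff r (Suc i) \<in> \<rat>" using c[of "Suc i"] by (simp add: algebra_simps)
    from Rats_diff[OF Suc this] show ?case by simp
  qed
  then show ?thesis by (simp add: ratp_def)
qed

text \<open>Extracts the largest power of X - 1 common to the family. The degree of the nonzero
  member i0 bounds the number of divisions.\<close>

lemma divide_out_linear:
  fixes p :: "'i \<Rightarrow> 'k::field_char_0 poly"
  assumes "i0 \<in> I" "p i0 \<noteq> 0" "\<And>i. i \<in> I \<Longrightarrow> ratp (p i)"
  shows "\<exists>n r. (\<forall>i\<in>I. p i = [:-1, 1:] ^ n * r i \<and> ratp (r i)) \<and> (\<exists>i\<in>I. poly (r i) 1 \<noteq> 0)"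
  using assms(2,3)
proof (induction "Polynomial.degree (p i0)" arbitrary: p rule: less_induct)
  case less
  show ?case
  proof (cases "\<exists>i\<in>I. poly (p i) 1 \<noteq> 0")
    case True
    then show ?thesis using less.prems by (intro exI[of _ 0] exI[of _ p]) auto
  next
    case False
    then have "\<forall>i\<in>I. \<exists>s. p i = [:-1, 1:] * s" by (auto simp: poly_eq_0_iff_dvd dvd_def)
    then obtain s where s: "\<And>i. i \<in> I \<Longrightarrow> p i = [:-1, 1:] * s i" by metis
    have rs: "ratp (s i)" if "i \<in> I" for i
      using less.prems(2)[OF that] unfolding s[OF that] by (rule ratp_divide_linear)
    have s0: "s i0 \<noteq> 0" using less.prems(1) s[OF assms(1)] by auto
    then have "Polynomial.degree (s i0) < Polynomial.degree (p i0)"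
      unfolding s[OF assms(1)] by (subst degree_mult_eq) auto
    from less.hyps[where p = s, OF this s0 rs] obtain n r where
      "\<forall>i\<in>I. s i = [:-1, 1:] ^ n * r i \<and> ratp (r i)" "\<exists>i\<in>I. poly (r i) 1 \<noteq> 0" by blast
    moreover from this have "p i = [:-1, 1:] ^ Suc n * r i" if "i \<in> I" for i
      using that by (simp only: s power_Suc mult.assoc)
    ultimately show ?thesis by blast
  qed
qed

text \<open>Evaluation at q = 1 on the local ring of functions regular there, given as a relation
  because it is partial and fractions have many representatives. It is single-valued by
  \<open>spec1_unique\<close>, where q is transcendental.\<close>

definition spec1 :: "'k::field_char_0 \<Rightarrow> 'k \<Rightarrow> rat \<Rightarrow> bool" where
  "spec1 q x y \<longleftrightarrow> (\<exists>a b. ratp a \<and> ratp b \<and> poly b q \<noteq> 0 \<and> poly b 1 \<noteq> 0 \<and> x = poly a q / poly b q \<and> of_rat y = poly a 1 / poly b 1)"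

lemma spec1_add: "spec1 q x y \<Longrightarrow> spec1 q x' y' \<Longrightarrow> spec1 q (x + x') (y + y')"
proof -
  assume "spec1 q x y" "spec1 q x' y'"
  then obtain a b a' b' where h: "ratp a" "ratp b" "poly b q \<noteq> 0" "poly b 1 \<noteq> 0" "x = poly a q / poly b q" "of_rat y = poly a 1 / poly b 1"
     "ratp a'" "ratp b'" "poly b' q \<noteq> 0" "poly b' 1 \<noteq> 0" "x' = poly a' q / poly b' q" "of_rat y' = poly a' 1 / poly b' 1"
    unfolding spec1_def by blast
  then show ?thesis unfolding spec1_def
    by (intro exI[of _ "a * b' + a' * b"] exI[of _ "b * b'"])
       (simp add: ratp_mult ratp_add of_rat_add add_frac_eq)
qed

lemma spec1_mult: "spec1 q x y \<Longrightarrow> spec1 q x' y' \<Longrightarrow> spec1 q (x * x') (y * y')"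
proof -
  assume "spec1 q x y" "spec1 q x' y'"
  then obtain a b a' b' where h: "ratp a" "ratp b" "poly b q \<noteq> 0" "poly b 1 \<noteq> 0" "x = poly a q / poly b q" "of_rat y = poly a 1 / poly b 1"
     "ratp a'" "ratp b'" "poly b' q \<noteq> 0" "poly b' 1 \<noteq> 0" "x' = poly a' q / poly b' q" "of_rat y' = poly a' 1 / poly b' 1"
    unfolding spec1_def by blast
  then show ?thesis unfolding spec1_def
    by (intro exI[of _ "a * a'"] exI[of _ "b * b'"]) (simp add: ratp_mult of_rat_mult)
qed

lemma spec1_poly: "ratp a \<Longrightarrow> of_rat y = poly a 1 \<Longrightarrow> spec1 q (poly a q) y"
  unfolding spec1_def by (intro exI[of _ a] exI[of _ 1]) simp

lemma spec1_0 [simp]: "spec1 q 0 0" and spec1_1 [simp]: "spec1 q 1 1" and spec1_m1: "spec1 q (- 1) (- 1)"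
  using spec1_poly[of 0 0 q] spec1_poly[of 1 1 q] spec1_poly[of "- 1" "- 1" q] by (simp_all add: ratp_uminus of_rat_minus)

lemma spec1_uminus: "spec1 q x y \<Longrightarrow> spec1 q (- x) (- y)"
  using spec1_mult[OF spec1_m1, of q x y] by simp

lemma spec1_diff: "spec1 q x y \<Longrightarrow> spec1 q x' y' \<Longrightarrow> spec1 q (x - x') (y - y')"
  using spec1_add[OF _ spec1_uminus, of q x y x' y'] by simp

lemma spec1_sum: "(\<And>i. i \<in> I \<Longrightarrow> spec1 q (x i) (y i)) \<Longrightarrow> spec1 q (\<Sum>i\<in>I. x i) (\<Sum>i\<in>I. y i)"
  by (induction I rule: infinite_finite_induct) (auto intro: spec1_add)

lemma spec1_q: "spec1 q q 1"
  using spec1_poly[of "[:0, 1:]" 1 q] by (simp add: ratp_pCons)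

lemma spec1_inverse_q: "q \<noteq> 0 \<Longrightarrow> spec1 q (inverse q) 1"
  unfolding spec1_def by (intro exI[of _ 1] exI[of _ "[:0, 1:]"]) (simp add: ratp_pCons field_simps)

lemma ratp_transcendental:
  assumes "\<not> algebraic q" "ratp p" "poly p q = 0" shows "p = 0"
  using assms unfolding algebraic_altdef ratp_def by auto

lemma spec1_unique:
  assumes "\<not> algebraic q" "spec1 q x y" "spec1 q x y'" shows "y = y'"
proof -
  from assms(2,3) obtain a b a' b' where h: "ratp a" "ratp b" "poly b q \<noteq> 0" "poly b 1 \<noteq> 0" "x = poly a q / poly b q" "of_rat y = poly a 1 / poly b 1"
     "ratp a'" "ratp b'" "poly b' q \<noteq> 0" "poly b' 1 \<noteq> 0" "x = poly a' q / poly b' q" "of_rat y' = poly a' 1 / poly b' 1"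
    unfolding spec1_def by blast
  have "poly (a * b' - a' * b) q = 0" using h(3,5,9,11) by (simp add: frac_eq_eq)
  then have "a * b' - a' * b = 0" by (intro ratp_transcendental[OF assms(1)]) (auto intro!: ratp_diff ratp_mult h)
  then have "poly (a * b' - a' * b) 1 = 0" by simp
  then have "poly a 1 / poly b 1 = poly a' 1 / poly b' 1" using h(4,10) by (simp add: frac_eq_eq)
  then have "(of_rat y :: 'a) = of_rat y'" using h(6,12) by simp
  then show ?thesis by simp
qed

text \<open>The factor c is the common denominator divided by the largest power of q - 1 common to
  all numerators, so that the scaled entries are regular at 1 and do not all vanish there.\<close>

lemma spec1_normalise:
  fixes q :: "'k::field_char_0" and x :: "'i \<Rightarrow> 'k"
  assumes "\<not> algebraic q" "rat_adjoin q = UNIV" "finite I" "i0 \<in> I" "x i0 \<noteq> 0"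
  shows "\<exists>c y. (\<forall>i\<in>I. spec1 q (c * x i) (y i)) \<and> (\<exists>i\<in>I. y i \<noteq> 0)"
proof -
  have "\<exists>a b. ratp a \<and> ratp b \<and> poly b q \<noteq> 0 \<and> z = poly a q / poly b q" for z :: 'k
  proof -
    have "z \<in> rat_adjoin q" using assms(2) by simp
    then show ?thesis unfolding rat_adjoin_def ratp_def by blast
  qed
  then obtain a b where ab: "\<And>z. ratp (a z)" "\<And>z. ratp (b z)" "\<And>z. poly (b z) q \<noteq> 0" "\<And>z. z = poly (a z) q / poly (b z) q"
    by metis
  define D where "D = (\<Prod>i\<in>I. b (x i))"
  define p where "p i = a (x i) * (\<Prod>j\<in>I - {i}. b (x j))" for i
  have Dx: "poly D q * x i = poly (p i) q" if "i \<in> I" for i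
  proof -
    have "D = b (x i) * (\<Prod>j\<in>I - {i}. b (x j))" unfolding D_def using assms(3) that by (rule prod.remove)
    then have "poly D q * x i = poly (b (x i)) q * x i * poly (\<Prod>j\<in>I - {i}. b (x j)) q" by simp
    also have "poly (b (x i)) q * x i = poly (a (x i)) q" using ab(3)[of "x i"] ab(4)[of "x i"] by (metis nonzero_mult_div_cancel_left times_divide_eq_right)
    finally show ?thesis by (simp add: p_def)
  qed
  have D0: "poly D q \<noteq> 0" using assms(3) ab(3) by (simp add: D_def poly_prod)
  have rp: "ratp (p i)" for i by (auto simp: p_def intro!: ratp_mult ratp_prod ab)
  have "p i0 \<noteq> 0" using Dx[OF assms(4)] D0 assms(5) by auto
  from divide_out_linear[where p = p, OF assms(4) this rp] obtain n r where r: "\<forall>i\<in>I. p i = [:-1, 1:] ^ n * r i \<and> ratp (r i)" "\<exists>i\<in>I. poly (r i) 1 \<noteq> 0"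
    by blast
  have "poly [:-1, 1:] q \<noteq> 0"
    using ratp_transcendental[OF assms(1), of "[:-1, 1:]"] by (auto simp: ratp_pCons)
  then have q1: "poly ([:-1, 1:] ^ n) q \<noteq> 0" by (simp add: poly_power)
  define c where "c = poly D q / poly ([:-1, 1:] ^ n) q"
  have cx: "c * x i = poly (r i) q" if "i \<in> I" for i
  proof -
    have "c * x i = poly (p i) q / poly ([:-1, 1:] ^ n) q" using Dx[OF that] by (simp add: c_def)
    then show ?thesis using r(1) that q1 by (metis nonzero_mult_div_cancel_left poly_mult)
  qed
  have "\<forall>i\<in>I. \<exists>y. of_rat y = poly (r i) 1" using r(1) ratp_poly_1 by (metis Rats_cases)
  then obtain y where y: "\<And>i. i \<in> I \<Longrightarrow> of_rat (y i) = poly (r i) 1" by metis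
  have "\<forall>i\<in>I. spec1 q (c * x i) (y i)" using cx y r(1) by (auto intro: spec1_poly)
  moreover have "\<exists>i\<in>I. y i \<noteq> 0" using r(2) y by (metis of_rat_0)
  ultimately show ?thesis by blast
qed

text \<open>After scaling, a vanishing sum of squares would specialise to a vanishing sum of
  rational squares with a nonzero term.\<close>

lemma aniso_transcendental:
  fixes q :: "'k::field_char_0" and v :: "'i \<Rightarrow> 'k"
  assumes "\<not> algebraic q" "rat_adjoin q = UNIV" "finite I" "(\<Sum>i\<in>I. v i * v i) = 0"
  shows "\<forall>i\<in>I. v i = 0"
proof (rule ccontr)
  assume "\<not> ?thesis"
  then obtain i0 where "i0 \<in> I" "v i0 \<noteq> 0" by blast
  from spec1_normalise[OF assms(1-3), of i0 v, OF this] obtain c y where y: "\<And>i. i \<in> I \<Longrightarrow> spec1 q (c * v i) (y i)" "\<exists>i\<in>I. y i \<noteq> 0" by blast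
  have "spec1 q (\<Sum>i\<in>I. (c * v i) * (c * v i)) (\<Sum>i\<in>I. y i * y i)" by (intro spec1_sum spec1_mult y)
  moreover have "(\<Sum>i\<in>I. (c * v i) * (c * v i)) = c * c * (\<Sum>i\<in>I. v i * v i)"
    unfolding sum_distrib_left by (intro sum.cong) (simp_all add: ac_simps)
  ultimately have "spec1 q 0 (\<Sum>i\<in>I. y i * y i)" using assms(4) by simp
  from spec1_unique[OF assms(1) this spec1_0] have "\<forall>i\<in>I. y i * y i = 0"
    using sum_nonneg_eq_0_iff[OF assms(3), of "\<lambda>i. y i * y i"] by auto
  with y(2) show False by auto
qed

section \<open>Specialisation of vectors and operators\<close>

definition vspec :: "'k::field_char_0 \<Rightarrow> (rat list \<Rightarrow>\<^sub>0 'k) \<Rightarrow> (rat list \<Rightarrow>\<^sub>0 rat) \<Rightarrow> bool" where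
  "vspec q v w \<longleftrightarrow> (\<forall>f. spec1 q (cf v f) (cf w f))"

lemma vspec_0 [simp]: "vspec q 0 0" by (simp add: vspec_def)
lemma vspec_Mvec [simp]: "vspec q (Mvec f) (Mvec f)" by (simp add: vspec_def cf_Mvec)
lemma vspec_1 [simp]: "vspec q 1 1" using vspec_Mvec[of q "[]"] by simp
lemma vspec_add: "vspec q v w \<Longrightarrow> vspec q v' w' \<Longrightarrow> vspec q (v + v') (w + w')"
  by (simp add: vspec_def lookup_add spec1_add)
lemma vspec_scal: "spec1 q c d \<Longrightarrow> vspec q v w \<Longrightarrow> vspec q (scal c * v) (scal d * w)"
  by (simp add: vspec_def spec1_mult)
lemma vspec_sum: "(\<And>i. i \<in> I \<Longrightarrow> vspec q (v i) (w i)) \<Longrightarrow> vspec q (\<Sum>i\<in>I. v i) (\<Sum>i\<in>I. w i)"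
  by (simp add: vspec_def lookup_sum spec1_sum)

lemma vspec_lin_ext:
  assumes "\<And>f. vspec q (\<phi> f) (\<psi> f)" "vspec q v w"
  shows "vspec q (lin_ext \<phi> v) (lin_ext \<psi> w)"
proof -
  let ?A = "supp v \<union> supp w"
  have "lin_ext \<phi> v = (\<Sum>a\<in>?A. scal (cf v a) * \<phi> a)" "lin_ext \<psi> w = (\<Sum>a\<in>?A. scal (cf w a) * \<psi> a)"
    by (auto intro!: lin_ext_superset)
  then show ?thesis using assms by (simp only:) (intro vspec_sum vspec_scal, auto simp: vspec_def)
qed

lemma vspec_mult:
  assumes "vspec q v w" "vspec q v' w'" shows "vspec q (v * v') (w * w')"
proof -
  have e: "u * u' = lin_ext (\<lambda>f. lin_ext (\<lambda>g. Mvec (f @ g)) u') u" for u u' :: "rat list \<Rightarrow>\<^sub>0 'x::field"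
  proof (rule lin_eqM[of "\<lambda>u. u * u'"])
    fix f
    have "Mvec f * u' = lin_ext (\<lambda>g. Mvec (f @ g)) u'"
      by (rule lin_eqM[of "\<lambda>u'. Mvec f * u'"]) (auto simp: Mvec_mult)
    then show "Mvec f * u' = lin_ext (\<lambda>f. lin_ext (\<lambda>g. Mvec (f @ g)) u') (Mvec f)" by simp
  qed auto
  show ?thesis unfolding e by (intro vspec_lin_ext vspec_Mvec assms)
qed

lemma vspec_unique:
  assumes "\<not> algebraic q" "vspec q v w" "vspec q v w'" shows "w = w'"
proof (rule poly_mapping_eqI)
  fix k
  have "spec1 q (cf v k) (cf w k)" "spec1 q (cf v k) (cf w' k)" using assms(2,3) by (simp_all add: vspec_def)
  then show "cf w k = cf w' k" by (rule spec1_unique[OF assms(1)])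
qed

text \<open>For operators such as \<open>R'\<close> and \<open>Y\<close> in
  \<open>core_commutant\<close>, which are compared only on the words of one tensor power;
  \<open>vspec_lin_ext\<close> asks for a comparison on every word.\<close>

lemma vspec_lin:
  assumes "finite J" "lin L" "lin L'" "v \<in> tensors J l" "w \<in> tensors J l" "vspec q v w"
    "\<And>f. f \<in> words J l \<Longrightarrow> vspec q (L (Mvec f)) (L' (Mvec f))"
  shows "vspec q (L v) (L' w)"
proof -
  have "L v = (\<Sum>f\<in>words J l. scal (cf v f) * L (Mvec f))"
    using tensors_expand[OF assms(1,4)] lin_sum[OF assms(2)] lin_scal[OF assms(2)] by (metis (no_types, lifting) sum.cong)
  moreover have "L' w = (\<Sum>f\<in>words J l. scal (cf w f) * L' (Mvec f))"
    using tensors_expand[OF assms(1,5)] lin_sum[OF assms(3)] lin_scal[OF assms(3)] by (metis (no_types, lifting) sum.cong)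
  ultimately show ?thesis using assms(6,7) by (simp only:) (intro vspec_sum vspec_scal, auto simp: vspec_def)
qed

context
  fixes q :: "'k::field_char_0"
  assumes na: "\<not> algebraic q"
begin

lemma q_neq_0: "q \<noteq> 0" using na by auto

lemma q_not_root: "q ^ n = 1 \<Longrightarrow> n = 0"
proof (rule ccontr)
  assume n: "q ^ n = 1" "n \<noteq> 0"
  have "algebraic q"
    unfolding algebraic_altdef
  proof (intro exI conjI allI)
    show "Polynomial.coeff (Polynomial.monom 1 n - 1 :: 'k poly) i \<in> \<rat>" for i by (auto simp: coeff_1)
    show "poly (Polynomial.monom 1 n - 1) q = 0" using n by (simp add: poly_monom)
    have "Polynomial.coeff (Polynomial.monom 1 n - 1 :: 'k poly) n = 1" using n(2) by (simp add: coeff_1)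
    then show "Polynomial.monom 1 n - 1 \<noteq> (0 :: 'k poly)" by (metis coeff_0 zero_neq_one)
  qed
  with na show False by simp
qed

lemma q_inverse_neq: "q - inverse q \<noteq> 0"
proof
  assume "q - inverse q = 0"
  then have "q ^ 2 = 1" using q_neq_0 by (simp add: power2_eq_square field_simps)
  from q_not_root[OF this] show False by simp
qed

lemma powi_inj: "q powi a = q powi b \<longleftrightarrow> a = b"
proof
  have *: "a = b" if "q powi a = q powi b" "a \<le> b" for a b
  proof -
    have "q powi (b - a) = 1" using that q_neq_0 by (simp add: power_int_diff)
    then have "q ^ nat (b - a) = 1" using that by (simp add: power_int_def)
    from q_not_root[OF this] that show ?thesis by simp
  qed
  assume "q powi a = q powi b"
  then show "a = b" using *[of a b] *[of b a] by (cases "a \<le> b") (simp_all add: eq_commute)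
qed simp

lemma vspec_eta_act: "vspec q (eta_act q g j) (eta_act 1 g j)"
proof -
  have A: "vspec q (scal q * eta j) (eta j)" for j using vspec_scal[OF spec1_q vspec_Mvec[of q "[j]"]] by simp
  have B: "vspec q (scal (inverse q) * eta j) (eta j)" for j
    using vspec_scal[OF spec1_inverse_q[OF q_neq_0] vspec_Mvec[of q "[j]"]] by simp
  show ?thesis by (cases g) (simp_all add: A B)
qed

lemma vspec_gact: "vspec q (gact q f g) (gact 1 f g)"
proof (induction f arbitrary: g)
  case Nil
  then show ?case by (cases g) auto
next
  case (Cons j f)
  show ?case
  proof (cases g)
    case (qE i)
    then show ?thesis using vspec_add[OF vspec_mult[OF vspec_Mvec[of q "[j]"] Cons[of "qE i"]] vspec_mult[OF vspec_eta_act[of "qE i" j] Cons[of "qKinv i"]]]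
      by (simp del: eta_act.simps)
  next
    case (qF i)
    then show ?thesis using vspec_add[OF vspec_mult[OF vspec_eta_act[of "qF i" j] vspec_Mvec[of q f]] vspec_mult[OF vspec_eta_act[of "qK i" j] Cons[of "qF i"]]]
      by (simp del: eta_act.simps)
  next
    case (qK i)
    then show ?thesis using vspec_mult[OF vspec_eta_act[of "qK i" j] Cons[of "qK i"]] by (simp del: eta_act.simps)
  next
    case (qKinv i)
    then show ?thesis using vspec_mult[OF vspec_eta_act[of "qKinv i" j] Cons[of "qKinv i"]] by (simp del: eta_act.simps)
  qed
qed

lemma vspec_gop: "vspec q v w \<Longrightarrow> vspec q (gop q g v) (gop 1 g w)"
  unfolding gop_def by (rule vspec_lin_ext[OF vspec_gact])

lemma vspec_B: "vspec q v w \<Longrightarrow> vspec q (lact (gop q) (B_el q i) v) (lact (gop 1) (B_el 1 i) w)"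
  unfolding Lop_B[OF q_neq_0] Lop_B[OF one_neq_zero]
  by (cases "i = 0") (simp_all only: if_True if_False simp_thms, (intro vspec_add vspec_scal[OF spec1_q] vspec_gop; assumption)+)

lemma vspec_Psi: "vspec q v w \<Longrightarrow> vspec q (Psi_gen q i v) (Psi_gen 1 i w)"
  unfolding Psi_gen_def
proof (rule vspec_lin_ext)
  fix f
  have "spec1 q (inverse q - q) (inverse 1 - 1)" using spec1_diff[OF spec1_inverse_q[OF q_neq_0] spec1_q] by simp
  moreover have "spec1 q (inverse q) (inverse 1)" using spec1_inverse_q[OF q_neq_0] by simp
  ultimately show "vspec q (M_act q i f) (M_act 1 i f)"
    unfolding M_act_def by (auto intro!: vspec_add vspec_scal simp del: inverse_1 diff_self scal_0 scal_1)
qed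

lemma vspec_Psiw: "vspec q v w \<Longrightarrow> vspec q (Psiw q u v) (Psiw 1 u w)"
  by (induction u arbitrary: v w) (auto intro: vspec_Psi)

lemma Lop_k_Mvec:
  assumes "1 \<le> i" "set f \<subseteq> range hf"
  shows "lact (gop q) (k_el i) (Mvec f) = scal (q powi kexp i f) * Mvec f"
  using assms(2)
proof (induction f)
  case Nil
  then show ?case by (simp add: Lop_k[OF q_neq_0] gop_1 kexp_def wt_def)
next
  case (Cons j f)
  then obtain n where n: "j = hf n" by auto
  have "lact (gop q) (k_el i) (eta (hf n)) = scal (q powi kexp i [hf n]) * eta (hf n)"
    using assms(1) q_neq_0
    by (auto simp: Lop_k[OF q_neq_0] letter_simps scal_scal kexp_def wt_def abs_hf power_int_minus simp del: eta_act.simps)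
  moreover have "kexp i (j # f) = kexp i [j] + kexp i f" by (auto simp: kexp_def wt_def)
  ultimately show ?case
    using Cons q_neq_0 unfolding n Mvec_Cons[of _ f] Lop_k_mult[OF q_neq_0]
    by (simp add: power_int_add scal_mult mult.assoc scal_pull)
qed

text \<open>Words are eigenvectors of \<open>k_el i\<close> with eigenvalue q to the power
  \<open>kexp i\<close>, and distinct exponents give distinct eigenvalues because q is not a root of
  unity.\<close>

lemma k_commute_weight:
  assumes "J \<subseteq> range hf" "lin S" "\<And>v. v \<in> tensors J l \<Longrightarrow> S v \<in> tensors J l" "1 \<le> i"
    "S (lact (gop q) (k_el i) (Mvec f)) = lact (gop q) (k_el i) (S (Mvec f))"
    "f \<in> words J l" "cf (S (Mvec f)) h \<noteq> 0"
  shows "kexp i f = kexp i h"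
proof -
  have w: "set g \<subseteq> range hf" if "g \<in> words J l" for g using that assms(1) by (auto simp: words_def)
  have "lact (gop q) (k_el i) (S (Mvec f)) = lin_ext (\<lambda>g. scal (q powi kexp i g) * Mvec g) (S (Mvec f))"
    by (rule lin_eq_tensors[OF lin_Lop[OF q_neq_0] lin_lin_ext assms(3)[of "Mvec f"]])
       (use assms(6) Lop_k_Mvec[OF assms(4) w] in auto)
  then have "cf (lact (gop q) (k_el i) (S (Mvec f))) h = q powi kexp i h * cf (S (Mvec f)) h"
    by (simp add: cf_diag)
  moreover have "S (lact (gop q) (k_el i) (Mvec f)) = scal (q powi kexp i f) * S (Mvec f)"
    by (simp add: Lop_k_Mvec[OF assms(4) w[OF assms(6)]] lin_scal[OF assms(2)])
  ultimately have "q powi kexp i f * cf (S (Mvec f)) h = q powi kexp i h * cf (S (Mvec f)) h"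
    using assms(5) by simp
  then show ?thesis using assms(7) powi_inj by simp
qed

section \<open>The commutant of the coideal subalgebra on tensor powers of V\<close>

theorem core_commutant:
  assumes ra: "rat_adjoin q = UNIV" and S: "lin S" "\<And>v. v \<in> tensors (I_small r) l \<Longrightarrow> S v \<in> tensors (I_small r) l"
    and SB: "\<And>i v. \<bar>i\<bar> \<le> int r \<Longrightarrow> v \<in> tensors (I_small r) l \<Longrightarrow> S (lact (gop q) (B_el q i) v) = lact (gop q) (B_el q i) (S v)"
    and Sk: "\<And>i v. \<bar>i\<bar> \<le> int r \<Longrightarrow> v \<in> tensors (I_small r) l \<Longrightarrow> S (lact (gop q) (k_el i) v) = lact (gop q) (k_el i) (S v)"
  shows "\<exists>Ws c. finite Ws \<and> (\<forall>w\<in>Ws. set w \<subseteq> {..<l}) \<and>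
    (\<forall>v\<in>tensors (I_small r) l. S v = (\<Sum>w\<in>Ws. scal (c w) * Psiw q w v))"
proof -
  define J where "J = I_small r"
  define F where "F = words J l"
  have J: "finite J" "0 \<notin> J" "uminus ` J \<subseteq> J" "J \<subseteq> range hf" by (auto simp: J_def uminus_I_small I_small_hf intro: subsetD[OF I_small_hf])
  have fF: "finite F" by (simp add: F_def finite_words J(1))
  define X where "X = F \<times> F"
  have fX: "finite X" using fF by (simp add: X_def)
  let ?U = "{w. set w \<subseteq> {..<l}}"
  have twF: "tw w f \<in> F" if "f \<in> F" "set w \<subseteq> {..<l}" for w f
    using tw_words[OF J(3)] that by (simp add: F_def)
  have "(\<lambda>w. restrict (tw w) F) ` ?U \<subseteq> F \<rightarrow>\<^sub>E F" using twF by auto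
  then have "finite ((\<lambda>w. restrict (tw w) F) ` ?U)" by (rule finite_subset) (use fF in \<open>intro finite_PiE, auto\<close>)
  \<comment> \<open>W0 contains a word for every signed permutation of F. Nothing is claimed about
    the Hecke operators of the discarded words: orthogonality to those of W0 already specialises to
    orthogonality to all signed permutations.\<close>
  from finite_subset_image[OF this subset_refl] obtain W0 where
    W0: "W0 \<subseteq> ?U" "finite W0" "(\<lambda>w. restrict (tw w) F) ` ?U = (\<lambda>w. restrict (tw w) F) ` W0" by blast
  define Bm where "Bm w = (\<lambda>(h, f). cf (Psiw q w (Mvec f)) h)" for w
  \<comment> \<open>Different words may give the same matrix. Thinning to Ws makes \<open>Bm\<close>
    injective, so that sums over the set of matrices can be written as sums over words.\<close>
  obtain Ws where Ws: "Ws \<subseteq> W0" "inj_on Bm Ws" "Bm ` W0 = Bm ` Ws"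
    using subset_image_inj[of "Bm ` W0" Bm W0] by auto
  have fWs: "finite Ws" using Ws(1) W0(2) finite_subset by blast
  have UWs: "set w \<subseteq> {..<l}" if "w \<in> Ws" for w using that Ws(1) W0(1) by auto
  have fB: "finite (Bm ` Ws)" using fWs by simp
  from orth_kernel[OF fX aniso_transcendental[OF na ra fX] fB] obtain P c where P0:
    "(\<forall>x y. P x y = (\<Sum>b\<in>Bm ` Ws. c b y * b x)) \<and> (\<forall>x y. P x y = P y x) \<and> (\<forall>b\<in>Bm ` Ws. \<forall>x\<in>X. (\<Sum>y\<in>X. P x y * b y) = b x)"
    by blast
  have P1: "P x y = (\<Sum>b\<in>Bm ` Ws. c b y * b x)" for x y using conjunct1[OF P0] by blast
  have P2: "P x y = P y x" for x y using conjunct1[OF conjunct2[OF P0]] by blast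
  have P3: "(\<Sum>y\<in>X. P x y * b y) = b x" if "b \<in> Bm ` Ws" "x \<in> X" for b x using P0 that by blast
  define s0 where "s0 = (\<lambda>(h, f). cf (S (Mvec f)) h)"
  define d where "d w = (\<Sum>y\<in>X. c (Bm w) y * s0 y)" for w
  \<comment> \<open>S minus its orthogonal projection onto the span of the matrices
    \<open>Bm w\<close>. It commutes with the same generators as S because the Hecke words
    do.\<close>
  define R where "R v = S v - (\<Sum>w\<in>Ws. scal (d w) * Psiw q w v)" for v
  define \<rho> where "\<rho> = (\<lambda>(h, f). cf (R (Mvec f)) h)"
  have linR: "lin R" unfolding R_def[abs_def] by (intro lin_minus S lin_Sum lin_scal_mult lin_Psiw)
  have PsiwT: "Psiw q w v \<in> tensors J l" if "set w \<subseteq> {..<l}" "v \<in> tensors J l" for w v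
    using Psiw_small[of v r l w q] that by (simp add: J_def)
  have RT: "R v \<in> tensors J l" if "v \<in> tensors J l" for v
    using that S(2) PsiwT UWs by (auto simp: R_def J_def[symmetric] intro!: tensors_diff tensors_sum tensors_scal)
  have \<rho>e: "\<rho> x = s0 x - (\<Sum>y\<in>X. P x y * s0 y)" for x
  proof -
    have "(\<Sum>y\<in>X. P x y * s0 y) = (\<Sum>y\<in>X. \<Sum>w\<in>Ws. c (Bm w) y * Bm w x * s0 y)"
      by (simp only: P1 sum.reindex[OF Ws(2)] comp_def sum_distrib_right)
    also have "\<dots> = (\<Sum>w\<in>Ws. d w * Bm w x)"
      unfolding d_def sum_distrib_right by (subst sum.swap) (simp only: ac_simps)
    also have "\<dots> = (case x of (h, f) \<Rightarrow> cf (\<Sum>w\<in>Ws. scal (d w) * Psiw q w (Mvec f)) h)"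
      by (simp add: lookup_sum Bm_def case_prod_unfold)
    finally show ?thesis by (simp add: \<rho>_def s0_def R_def lookup_minus case_prod_unfold)
  qed
  have orthR: "(\<Sum>x\<in>X. \<rho> x * Bm w x) = 0" if w: "w \<in> W0" for w
  proof -
    have b: "Bm w \<in> Bm ` Ws" using w Ws(3) by blast
    have "(\<Sum>x\<in>X. (\<Sum>y\<in>X. P x y * s0 y) * Bm w x) = (\<Sum>x\<in>X. \<Sum>y\<in>X. s0 y * (P y x * Bm w x))"
      unfolding sum_distrib_right by (intro sum.cong refl) (metis P2 mult.assoc mult.commute)
    also have "\<dots> = (\<Sum>y\<in>X. s0 y * (\<Sum>x\<in>X. P y x * Bm w x))"
      unfolding sum_distrib_left by (rule sum.swap)
    also have "\<dots> = (\<Sum>y\<in>X. s0 y * Bm w y)" using P3[OF b] by simp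
    finally show ?thesis by (simp only: \<rho>e left_diff_distrib sum_subtractf diff_self)
  qed
  have RL: "R (lact (gop q) a v) = lact (gop q) a (R v)"
    if "v \<in> tensors J l" "(\<exists>i. \<bar>i\<bar> \<le> int r \<and> (a = B_el q i \<or> a = k_el i))" for a v
  proof -
    have hfv: "v \<in> tensors (range hf) l" using that(1) tensors_mono[OF J(4)] by blast
    have P: "Psiw q w (lact (gop q) a u) = lact (gop q) a (Psiw q w u)" if "set w \<subseteq> {..<l}" "u \<in> tensors (range hf) l" for w u
      using that
    proof (induction w arbitrary: u)
      case (Cons j w)
      have "Psi_gen q j u \<in> tensors (range hf) l" using Cons.prems by (intro Psi_tensors uminus_range_hf) auto
      then show ?case using Cons.IH[of "Psi_gen q j u"] Cons.prems \<open>\<exists>i. \<bar>i\<bar> \<le> int r \<and> (a = B_el q i \<or> a = k_el i)\<close>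
          Psi_Lop[OF q_neq_0 Cons.prems(2), of j]
        by auto
    qed simp
    have "S (lact (gop q) a v) = lact (gop q) a (S v)" using that SB Sk by (auto simp: J_def)
    then show ?thesis
      by (simp add: P[OF UWs hfv] lin_diff[OF lin_Lop[OF q_neq_0]] lin_sum[OF lin_Lop[OF q_neq_0]] lin_scal[OF lin_Lop[OF q_neq_0]] R_def)
  qed
  have "\<rho> x = 0" if x: "x \<in> X" for x
  proof (rule ccontr)
    assume "\<rho> x \<noteq> 0"
    from spec1_normalise[where x = \<rho>, OF na ra fX x this] obtain c0 y where
      y: "\<And>x. x \<in> X \<Longrightarrow> spec1 q (c0 * \<rho> x) (y x)" "\<exists>x\<in>X. y x \<noteq> 0" by blast
    define Y where "Y = mop F (\<lambda>h f. y (h, f))"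
    have linY: "lin Y" by (simp add: Y_def)
    have YM: "Y (Mvec f) = (\<Sum>h\<in>F. scal (y (h, f)) * Mvec h)" for f by (simp add: Y_def mop_def)
    have cfY: "cf (Y (Mvec f)) h = y (h, f)" if "h \<in> F" for h f
      unfolding YM by (rule cf_sum_Mvec[OF fF that])
    have YT: "Y v \<in> tensors J l" if "v \<in> tensors J l" for v
      by (rule tensors_lin[OF linY that]) (auto simp: YM F_def intro!: tensors_sum tensors_scal)
    define R' where "R' v = scal c0 * R v" for v
    have linR': "lin R'" unfolding R'_def[abs_def] by (intro lin_scal_mult linR)
    have MT: "Mvec f \<in> tensors J l" if "f \<in> F" for f using that by (simp add: F_def)
    have MT': "(Mvec f :: rat list \<Rightarrow>\<^sub>0 rat) \<in> tensors J l" if "f \<in> F" for f using that by (simp add: F_def)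
    have sp: "vspec q (R' (Mvec f)) (Y (Mvec f))" if f: "f \<in> F" for f
      unfolding vspec_def
    proof
      fix h show "spec1 q (cf (R' (Mvec f)) h) (cf (Y (Mvec f)) h)"
      proof (cases "h \<in> F")
        case True
        then show ?thesis using y(1)[of "(h, f)"] f by (simp add: cfY R'_def \<rho>_def X_def)
      next
        case False
        have "cf (R' (Mvec f)) h = 0" "cf (Y (Mvec f)) h = 0"
          using False RT[OF MT[OF f]] YT[OF MT'[OF f]] by (auto simp: R'_def F_def tensors_cf)
        then show ?thesis by simp
      qed
    qed
    have BT: "lact (gop q) (B_el q i) v \<in> tensors J l" if "\<bar>i\<bar> \<le> int r" "v \<in> tensors J l" for i v
      using that by (auto simp: Lop_B[OF q_neq_0] J_def intro!: tensors_add tensors_scal gop_small)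
    have BT': "lact (gop 1) (B_el 1 i) v \<in> tensors J l" if "\<bar>i\<bar> \<le> int r" "v \<in> tensors J l" for i and v :: "rat list \<Rightarrow>\<^sub>0 rat"
      using that by (auto simp: Lop_B[OF one_neq_zero] J_def intro!: tensors_add tensors_scal gop_small simp del: gop1_K)
    \<comment> \<open>Both sides are specialisations of the same vector over \<rat>(q), hence
      equal.\<close>
    have YB: "Y (lact (gop 1) (B_el 1 i) v) = lact (gop 1) (B_el 1 i) (Y v)"
      if i: "\<bar>i\<bar> \<le> int r" and v: "v \<in> tensors J l" for i v
    proof (rule lin_eq_tensors[OF lin_comp[OF linY lin_Lop[OF one_neq_zero]] lin_comp[OF lin_Lop[OF one_neq_zero] linY] v])
      fix f assume "f \<in> words J l"
      then have f: "f \<in> F" by (simp add: F_def)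
      have "vspec q (R' (lact (gop q) (B_el q i) (Mvec f))) (Y (lact (gop 1) (B_el 1 i) (Mvec f)))"
        by (rule vspec_lin[OF J(1) linR' linY BT[OF i MT[OF f]] BT'[OF i MT'[OF f]] vspec_B[OF vspec_Mvec]]) (use sp in \<open>simp add: F_def\<close>)
      moreover have "R' (lact (gop q) (B_el q i) (Mvec f)) = lact (gop q) (B_el q i) (R' (Mvec f))"
      proof -
        have "R (lact (gop q) (B_el q i) (Mvec f)) = lact (gop q) (B_el q i) (R (Mvec f))"
          by (rule RL[OF MT[OF f]]) (use i in blast)
        then show ?thesis by (simp add: R'_def lin_scal[OF lin_Lop[OF q_neq_0]])
      qed
      moreover have "vspec q (lact (gop q) (B_el q i) (R' (Mvec f))) (lact (gop 1) (B_el 1 i) (Y (Mvec f)))"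
        by (rule vspec_B[OF sp[OF f]])
      ultimately show "Y (lact (gop 1) (B_el 1 i) (Mvec f)) = lact (gop 1) (B_el 1 i) (Y (Mvec f))"
        using vspec_unique[OF na] by metis
    qed
    \<comment> \<open>A nonzero entry of Y comes from a nonzero entry of R at generic q, where the
      \<open>k_el i\<close> still separate weights.\<close>
    have Ywt: "wt a f = wt a h" if "f \<in> words J l" "h \<in> words J l" "cf (Y (Mvec f)) h \<noteq> 0" "a \<in> J" "0 < a" for f h a
    proof -
      have "y (h, f) \<noteq> 0" using that cfY[of h f] by (simp add: F_def)
      moreover have "spec1 q (c0 * \<rho> (h, f)) (y (h, f))" using y(1)[of "(h, f)"] that by (simp add: X_def F_def)
      ultimately have "\<rho> (h, f) \<noteq> 0" using spec1_unique[OF na _ spec1_0, of "y (h, f)"] by auto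
      then have n0: "cf (R (Mvec f)) h \<noteq> 0" by (simp add: \<rho>_def)
      from that(4) obtain k where k: "a = hf k" "- int r - 1 \<le> k" "k \<le> int r" by (auto simp: J_def I_small_def half_idx_hf)
      with that(5) have k0: "0 \<le> k" by simp
      have "wt (hf (int (nat k))) f = wt (hf (int (nat k))) h"
      proof (rule wt_determined[where s = r and l = l])
        show "kexp i f = kexp i h" if "1 \<le> i" "i \<le> int r" for i
        proof (rule k_commute_weight[OF J(4) linR RT that(1) _ \<open>f \<in> words J l\<close> n0])
          show "R (lact (gop q) (k_el i) (Mvec f)) = lact (gop q) (k_el i) (R (Mvec f))"
            by (rule RL) (use that \<open>f \<in> words J l\<close> in \<open>auto intro!: exI[of _ i]\<close>)
        qed
      qed (use that k k0 in \<open>auto simp: J_def\<close>)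
      then show ?thesis using k k0 by simp
    qed
    \<comment> \<open>The word w is exchanged for a word w0 of W0 with the same permutation;
      orthogonality of R to \<open>Bm w0\<close> then specialises.\<close>
    have Yorth: "(\<Sum>f\<in>words J l. cf (Y (Mvec f)) (tw w f)) = 0" if "set w \<subseteq> {..<l}" for w
    proof -
      from that W0(3) obtain w0 where w0: "w0 \<in> W0" "restrict (tw w) F = restrict (tw w0) F" by blast
      then have t: "tw w f = tw w0 f" if "f \<in> F" for f using that by (metis restrict_apply')
      have w0U: "set w0 \<subseteq> {..<l}" using w0(1) W0(1) by auto
      have "spec1 q (\<Sum>x\<in>X. (c0 * \<rho> x) * Bm w0 x) (\<Sum>x\<in>X. y x * (case x of (h, f) \<Rightarrow> cf (Mvec (tw w0 f)) h))"
      proof (intro spec1_sum spec1_mult y)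
        fix x assume "x \<in> X"
        show "spec1 q (Bm w0 x) (case x of (h, f) \<Rightarrow> cf (Mvec (tw w0 f)) h)"
          using vspec_Psiw[OF vspec_Mvec, of w0 "snd x"] by (auto simp: Bm_def vspec_def Psiw1 case_prod_unfold)
      qed
      moreover have "(\<Sum>x\<in>X. (c0 * \<rho> x) * Bm w0 x) = 0"
        using orthR[OF w0(1)] by (simp add: mult.assoc flip: sum_distrib_left)
      ultimately have "(\<Sum>x\<in>X. y x * (case x of (h, f) \<Rightarrow> cf (Mvec (tw w0 f)) h)) = 0"
        using spec1_unique[OF na _ spec1_0] by metis
      also have "(\<Sum>x\<in>X. y x * (case x of (h, f) \<Rightarrow> cf (Mvec (tw w0 f)) h)) = (\<Sum>h\<in>F. \<Sum>f\<in>F. y (h, f) * cf (Mvec (tw w0 f)) h)"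
        unfolding X_def by (simp add: sum.cartesian_product case_prod_unfold)
      also have "\<dots> = (\<Sum>f\<in>F. \<Sum>h\<in>F. y (h, f) * cf (Mvec (tw w0 f)) h)" by (rule sum.swap)
      also have "\<dots> = (\<Sum>f\<in>F. cf (Y (Mvec f)) (tw w f))"
      proof (intro sum.cong refl)
        fix f assume f: "f \<in> F"
        have "(\<Sum>h\<in>F. y (h, f) * cf (Mvec (tw w0 f)) h) = (\<Sum>h\<in>F. if h = tw w0 f then y (tw w0 f, f) else 0)"
          by (intro sum.cong) (auto simp: cf_Mvec)
        then show "(\<Sum>h\<in>F. y (h, f) * cf (Mvec (tw w0 f)) h) = cf (Y (Mvec f)) (tw w f)"
          using fF twF[OF f w0U] by (simp add: t[OF f] cfY)
      qed
      finally show ?thesis by (simp add: F_def)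
    qed
    have YX: "Y (der (XX a b) v) = der (XX a b) (Y v)" if "a \<in> J" "b \<in> J" "v \<in> tensors J l" for a b v
      using commute_all_XX[of Y r l a b v] linY YT YB Ywt that unfolding J_def by blast
    have Y0: "Y (Mvec g) = 0" if "g \<in> words J l" for g
      by (rule classical_commutant[OF J(1-3) linY YT YX Yorth that])
    from y(2) obtain h f where "h \<in> F" "f \<in> F" "y (h, f) \<noteq> 0" by (auto simp: X_def)
    with Y0[of f] cfY[of h f] show False by (simp add: F_def)
  qed
  then have R0: "R (Mvec f) = 0" if "f \<in> words J l" for f
    using that RT[of "Mvec f"] by (intro tensors_eqI[where J = J and n = l]) (auto simp: X_def F_def \<rho>_def)
  have "R v = 0" if "v \<in> tensors J l" for v
    by (rule lin_eq_tensors[OF linR _ that]) (auto simp: R0)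
  then have "\<forall>v\<in>tensors (I_small r) l. S v = (\<Sum>w\<in>Ws. scal (d w) * Psiw q w v)" by (simp add: R_def J_def)
  then show ?thesis using fWs UWs by blast
qed

end

section \<open>Reaching all patterns\<close>

text \<open>On an ascent the Hecke operator is a bare permutation without correction term. Patterns
  are reached by such moves and by the sign change of a positive first letter only.\<close>

lemma Psi_ascent:
  assumes "y < x"
  shows "Psi_gen q (Suc (length p)) (Mvec (p @ [y, x] @ s)) = Mvec (p @ [x, y] @ s)"
proof -
  have 1: "M_act q (Suc 0) [y, x] = Mvec [x, y]" using assms by (simp add: M_act_def place_def)
  have 2: "M_act q (Suc 0) ([y, x] @ s) = Mvec ([x, y] @ s)" using M_act_left[of "Suc 0" "[y, x]" q s] 1 by (simp add: Mvec_mult)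
  show ?thesis unfolding Psi_Mvec using M_act_right[of q 0 p "[y, x] @ s"] 2 by (simp add: Mvec_mult)
qed

lemma not_sorted_descent: "\<not> sorted P \<Longrightarrow> \<exists>pre a b s. P = pre @ [a, b] @ s \<and> a > b" for P :: "rat list"
proof (induction P)
  case (Cons p P)
  show ?case
  proof (cases "sorted P")
    case True
    then obtain p' P' where P: "P = p' # P'" using Cons.prems by (cases P) auto
    with True Cons.prems have "p > p'" by (fastforce simp: not_le)
    then show ?thesis unfolding P by (intro exI[of _ "[]"] exI[of _ p] exI[of _ p'] exI[of _ P']) simp
  next
    case False
    from Cons.IH[OF this] obtain pre a b s where "P = pre @ [a, b] @ s \<and> a > b" by blast
    then show ?thesis by (intro exI[of _ "p # pre"] exI[of _ a] exI[of _ b] exI[of _ s]) simp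
  qed
qed simp

lemma sorted_pattern:
  "sorted P \<Longrightarrow> set P \<subseteq> {0, t} \<Longrightarrow> 0 < t \<Longrightarrow> P = replicate (nz P) 0 @ replicate (length P - nz P) t"
  for P :: "rat list"
proof (induction P)
  case (Cons p P)
  show ?case
  proof (cases "p = 0")
    case False
    then have "p = t" "\<forall>x\<in>set P. x = t" using Cons.prems by fastforce+
    moreover from this have "nz P = 0" using Cons.prems(3) by (auto simp: nz_def filter_empty_conv)
    ultimately have "p # P = replicate (length (p # P)) t" by (simp add: replicate_eqI)
    then show ?thesis using \<open>nz P = 0\<close> False by simp
  qed (use Cons in auto)
qed simp

text \<open>A position-weighted sum of the entries. It grows when a descent is turned into an ascent
  and when a leading negative entry changes sign, and so measures progress towards the basic
  pattern.\<close>

primrec pweight :: "rat \<Rightarrow> rat list \<Rightarrow> rat" where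
  "pweight k [] = 0"
| "pweight k (p # P) = k * p + pweight (k + 1) P"

lemma pweight_append: "pweight k (P @ Q) = pweight k P + pweight (k + of_nat (length P)) Q"
  by (induction P arbitrary: k) (simp_all add: algebra_simps)

text \<open>Worked backwards from P: as long as P is not basic, undoing a descent or a leading
  \<open>- top_idx r\<close> gives a pattern of larger \<open>pweight\<close>, from which one Hecke
  generator leads back to P. The induction is on the number of patterns of larger weight.\<close>

lemma reach_pattern:
  assumes "P \<in> pats r m"
  shows "\<exists>w. set w \<subseteq> {..<m} \<and> (\<forall>v\<in>words (I_small r) (nz P). Psiw q w (Mvec (merge (bp r m (nz P)) v)) = Mvec (merge P v))"
  using assms
proof (induction "card {Q \<in> pats r m. pweight 1 P < pweight 1 Q}" arbitrary: P rule: less_induct)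
  case less
  note P = less.prems
  have fin: "finite {Q \<in> pats r m. pweight 1 P' < pweight 1 Q}" for P' by (simp add: finite_pats)
  have step: ?case if Q: "Q \<in> pats r m" "nz Q = nz P" "pweight 1 P < pweight 1 Q" "i < m"
    and Psi: "\<And>v. v \<in> words (I_small r) (nz P) \<Longrightarrow> Psi_gen q i (Mvec (merge Q v)) = Mvec (merge P v)" for Q i
  proof -
    have "{Q' \<in> pats r m. pweight 1 Q < pweight 1 Q'} \<subset> {Q' \<in> pats r m. pweight 1 P < pweight 1 Q'}"
      using Q by auto
    then have "card {Q' \<in> pats r m. pweight 1 Q < pweight 1 Q'} < card {Q' \<in> pats r m. pweight 1 P < pweight 1 Q'}"
      by (intro psubset_card_mono fin)
    from less.hyps[OF this Q(1)] obtain w where w: "set w \<subseteq> {..<m}"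
      "\<And>v. v \<in> words (I_small r) (nz P) \<Longrightarrow> Psiw q w (Mvec (merge (bp r m (nz P)) v)) = Mvec (merge Q v)"
      by (auto simp: Q(2))
    then show ?thesis using Psi Q(4) by (intro exI[of _ "w @ [i]"]) auto
  qed
  have PS: "set P \<subseteq> {0, top_idx r, - top_idx r}" "length P = m" using P by (auto simp: pats_def words_def)
  \<comment> \<open>A sorted pattern either starts with \<open>- top_idx r\<close> or consists of
    entries 0 followed by entries \<open>top_idx r\<close>, which is the basic pattern.\<close>
  consider "P = bp r m (nz P)" | pre a b s where "P = pre @ [a, b] @ s" "b < a" | s where "P = - top_idx r # s"
  proof (cases "sorted P")
    case False
    then show ?thesis using not_sorted_descent[OF False] that(2) by blast
  next
    case sP: True
    show ?thesis
    proof (cases "- top_idx r \<in> set P")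
      case True
      then obtain p s where p: "P = p # s" by (cases P) auto
      then have "p \<le> - top_idx r" using sP True by auto
      moreover have "- top_idx r \<le> p" using PS(1) p less_imp_le[OF top_neq(5)[of r]] by auto
      ultimately show ?thesis using that(3) p by auto
    next
      case False
      then have "set P \<subseteq> {0, top_idx r}" using PS(1) by auto
      from sorted_pattern[OF sP this] show ?thesis using that(1) PS(2) by (simp add: bp_def)
    qed
  qed
  then show ?case
  proof cases
    case 1
    then show ?thesis by (intro exI[of _ "[]"]) auto
  next
    case 2
    let ?Q = "pre @ [b, a] @ s"
    show ?thesis
    proof (rule step[of ?Q "Suc (length pre)"])
      show "?Q \<in> pats r m" using P 2(1) by (auto simp: pats_def words_def)
      show "nz ?Q = nz P" by (simp add: 2(1) nz_append)
      show "pweight 1 P < pweight 1 ?Q" using 2(2) by (simp add: 2(1) pweight_append algebra_simps)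
      show "Suc (length pre) < m" using PS(2) 2(1) by simp
      fix v assume v: "v \<in> words (I_small r) (nz P)"
      define f where "f = merge P v"
      have f: "f \<in> words (I_big r) m" "pat r f = pre @ [a, b] @ s" "filt r f = v"
        using merge_props[OF P v] by (simp_all add: f_def 2(1))
      define p' where "p' = take (length pre) f"
      have "length f = length pre + 2 + length s" using arg_cong[OF f(2), of length] by (simp add: pat_def)
      then obtain x y s' where s': "drop (length pre) f = x # y # s'"
        by (cases "drop (length pre) f"; cases "tl (drop (length pre) f)") (auto simp: drop_eq_Nil dest: arg_cong[of _ _ length])
      have ff: "f = p' @ [x, y] @ s'" using s' by (metis append_Cons append_Nil append_take_drop_id p'_def)
      have "length p' = length pre" using \<open>length f = _\<close> by (simp add: p'_def)
      then have pt: "pat r p' = pre" "pat r [x] = [a]" "pat r [y] = [b]" "pat r s' = s"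
        using f(2) unfolding ff by (auto simp: pat_def)
      have xI: "x \<in> I_big r" "y \<in> I_big r" using f(1) unfolding ff by (auto simp: words_def)
      \<comment> \<open>A descent of the pattern is a descent of the word because letters of V lie
        strictly between the two extreme ones. The exchanged letters are not both in V, so the part
        in V keeps its order.\<close>
      have sm: "y < x \<and> \<not> (x \<in> I_small r \<and> y \<in> I_small r)"
        using pt(2,3) 2(2) xI I_small_less_top[of x r] I_small_less_top[of y r] top_neq(5)[of r]
        by (auto simp: pat_def I_big_eq split: if_splits)
      let ?f = "p' @ [y, x] @ s'"
      have "?f \<in> words (I_big r) m" using f(1) unfolding ff by (auto simp: words_def)
      moreover have "pat r ?f = ?Q" using pt by (simp add: pat_def)
      moreover have "filt r ?f = v" using f(3) sm unfolding ff by (auto simp: filt_def)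
      ultimately have "merge ?Q v = ?f" using merge_pat_filt[of ?f r m] by simp
      then show "Psi_gen q (Suc (length pre)) (Mvec (merge ?Q v)) = Mvec (merge P v)"
        using Psi_ascent[of y x q p' s'] sm \<open>length p' = length pre\<close> by (simp add: f_def[symmetric] ff)
    qed
  next
    case 3
    let ?Q = "top_idx r # s"
    show ?thesis
    proof (rule step[of ?Q 0])
      show "?Q \<in> pats r m" using P 3 by (auto simp: pats_def words_def)
      show "nz ?Q = nz P" by (simp add: 3)
      show "pweight 1 P < pweight 1 ?Q" using top_neq(5)[of r] by (simp add: 3)
      show "0 < m" using PS(2) 3 by auto
      fix v assume v: "v \<in> words (I_small r) (nz P)"
      show "Psi_gen q 0 (Mvec (merge ?Q v)) = Mvec (merge P v)"
        using top_neq(5)[of r] by (simp add: 3 Psi_Mvec M_act_def place_def)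
    qed
  qed
qed

section \<open>Transposition\<close>

definition bil :: "'a set \<Rightarrow> ('a \<Rightarrow>\<^sub>0 'k::field) \<Rightarrow> ('a \<Rightarrow>\<^sub>0 'k) \<Rightarrow> 'k" where
  "bil F x y = (\<Sum>f\<in>F. cf x f * cf y f)"

text \<open>Off the diagonal the matrix of a Hecke generator is that of the involution
  \<open>place\<close>, hence symmetric.\<close>

lemma M_act_sym:
  assumes "f \<in> words J n" "g \<in> words J n" "i < n" "0 \<notin> J"
  shows "cf (M_act q i f) g = cf (M_act q i g) f"
proof (cases "f = g")
  case False
  have *: "cf (M_act q i f) g = (if place f i = g then 1 else 0)" if "f \<noteq> g" for f g
    using that by (auto simp: M_act_def cf_Mvec lookup_add place_def list_update_id split: if_splits) (metis list_update_id)+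
  have "place f i = g \<longleftrightarrow> place g i = f" using assms place_place[of i f] place_place[of i g] by (auto simp: words_def)
  then show ?thesis using *[OF False] *[of g f] False by auto
qed simp

lemma bil_Psi:
  assumes J: "finite J" "0 \<notin> J" "uminus ` J \<subseteq> J" and xy: "x \<in> tensors J n" "y \<in> tensors J n" and i: "i < n"
  shows "bil (words J n) (Psi_gen q i x) y = bil (words J n) x (Psi_gen q i y)"
proof -
  let ?F = "words J n"
  have e: "cf (Psi_gen q i x) f = (\<Sum>g\<in>?F. cf x g * cf (M_act q i g) f)" if "x \<in> tensors J n" for x f
  proof -
    have "Psi_gen q i x = (\<Sum>g\<in>?F. scal (cf x g) * M_act q i g)"
      unfolding Psi_gen_def by (rule lin_ext_superset) (use that J(1) in \<open>auto simp: tensors_alt finite_words\<close>)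
    then show ?thesis by (simp add: lookup_sum)
  qed
  have "bil ?F (Psi_gen q i x) y = (\<Sum>f\<in>?F. \<Sum>g\<in>?F. cf x g * cf (M_act q i g) f * cf y f)"
    unfolding bil_def e[OF xy(1)] sum_distrib_right ..
  also have "\<dots> = (\<Sum>g\<in>?F. \<Sum>f\<in>?F. cf x g * cf (M_act q i g) f * cf y f)" by (rule sum.swap)
  also have "\<dots> = (\<Sum>g\<in>?F. \<Sum>f\<in>?F. cf x g * (cf y f * cf (M_act q i f) g))"
  proof (intro sum.cong refl)
    fix g f assume "g \<in> ?F" "f \<in> ?F"
    then have "cf (M_act q i g) f = cf (M_act q i f) g" using M_act_sym i J(2) by blast
    then show "cf x g * cf (M_act q i g) f * cf y f = cf x g * (cf y f * cf (M_act q i f) g)" by simp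
  qed
  also have "\<dots> = bil ?F x (Psi_gen q i y)" unfolding bil_def e[OF xy(2)] sum_distrib_left ..
  finally show ?thesis .
qed

lemma bil_Psiw:
  assumes "x \<in> tensors (I_big r) n" "y \<in> tensors (I_big r) n" "set w \<subseteq> {..<n}"
  shows "bil (words (I_big r) n) (Psiw q w x) y = bil (words (I_big r) n) x (Psiw q (rev w) y)"
  using assms
proof (induction w arbitrary: x)
  case (Cons i w)
  have y: "Psiw q (rev w) y \<in> tensors (I_big r) n" using Cons.prems by (intro Psiw_big) auto
  have "bil (words (I_big r) n) (Psiw q (i # w) x) y = bil (words (I_big r) n) (Psi_gen q i x) (Psiw q (rev w) y)"
    using Cons by (simp add: Psi_big)
  also have "\<dots> = bil (words (I_big r) n) x (Psi_gen q i (Psiw q (rev w) y))"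
    using Cons.prems y by (intro bil_Psi) (auto simp: uminus_I_big)
  finally show ?case by simp
qed simp

lemma bil_Mvec: "finite F \<Longrightarrow> f \<in> F \<Longrightarrow> bil F x (Mvec f) = cf x f"
  by (simp add: bil_def cf_Mvec if_distrib cong: if_cong)

lemma cf_um:
  assumes "P \<in> pats r m" "u \<in> words (I_small r) (nz P)" "v \<in> tensors (I_big r) m"
  shows "cf (um r P v) u = cf v (merge P u)"
proof -
  have "cf (um r P v) u = (\<Sum>f\<in>supp v. cf v f * cf (if pat r f = P then Mvec (filt r f) else 0) u)"
    by (simp add: um_def cf_lin_ext)
  also have "\<dots> = (\<Sum>f\<in>supp v. if f = merge P u then cf v (merge P u) else 0)"
  proof (intro sum.cong refl)
    fix f assume "f \<in> supp v"
    then have f: "f \<in> words (I_big r) m" using assms(3) by (auto simp: tensors_alt)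
    have "pat r f = P \<and> filt r f = u \<longleftrightarrow> f = merge P u"
      using merge_pat_filt[OF f] merge_props[OF assms(1,2)] by auto
    then show "cf v f * cf (if pat r f = P then Mvec (filt r f) else 0) u = (if f = merge P u then cf v (merge P u) else 0)"
      by (auto simp: cf_Mvec)
  qed
  also have "\<dots> = cf v (merge P u)" by (auto simp: in_keys_iff)
  finally show ?thesis .
qed

text \<open>\<open>um r P\<close> is the transpose of \<open>mg P\<close>. Transposing the
  factorisation of \<open>mg P\<close> through the basic pattern reverses the Hecke word, since each
  generator is symmetric.\<close>

lemma um_transpose:
  assumes P: "P \<in> pats r m" and w: "set w \<subseteq> {..<m}"
    "\<forall>v\<in>words (I_small r) (nz P). Psiw q w (Mvec (merge (bp r m (nz P)) v)) = Mvec (merge P v)"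
    and v: "v \<in> tensors (I_big r) m"
  shows "um r P v = um r (bp r m (nz P)) (Psiw q (rev w) v)"
proof (rule tensors_eqI)
  let ?b = "bp r m (nz P)"
  have b: "?b \<in> pats r m" using nz_le[OF P] by (rule bp_pats)
  have v': "Psiw q (rev w) v \<in> tensors (I_big r) m" using v w by (intro Psiw_big) auto
  show "um r P v \<in> tensors (I_small r) (nz P)" by (rule um_tensors[OF v])
  show "um r ?b (Psiw q (rev w) v) \<in> tensors (I_small r) (nz P)" using um_tensors[OF v', of ?b] by simp
  fix u assume u: "u \<in> words (I_small r) (nz P)"
  let ?F = "words (I_big r) m"
  have fF: "finite ?F" by (simp add: finite_words)
  have m1: "merge ?b u \<in> ?F" using merge_props(1)[OF b] u by simp
  have m2: "merge P u \<in> ?F" using merge_props(1)[OF P u] .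
  have "cf (um r ?b (Psiw q (rev w) v)) u = bil ?F (Psiw q (rev w) v) (Mvec (merge ?b u))"
    using cf_um[OF b _ v', of u] u by (simp add: bil_Mvec[OF fF m1])
  also have "\<dots> = bil ?F v (Psiw q w (Mvec (merge ?b u)))"
    using bil_Psiw[OF v, of "Mvec (merge ?b u)" "rev w" q] m1 w by simp
  also have "\<dots> = cf v (merge P u)" using w(2) u by (simp add: bil_Mvec[OF fF m2])
  also have "\<dots> = cf (um r P v) u" using cf_um[OF P u v] by simp
  finally show "cf (um r P v) u = cf (um r ?b (Psiw q (rev w) v)) u" ..
qed

section \<open>The algebra generated by the duplex Hecke algebra\<close>

context
  fixes r m :: nat and q :: "'k::field_char_0"
  assumes na: "\<not> algebraic q" and ra: "rat_adjoin q = UNIV" and m2: "2 \<le> m"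
begin

lemmas q0 = q_neq_0[OF na]
lemmas q1 = q_inverse_neq[OF na]

text \<open>Agreement is asked on the tensor power only, so that operators on the whole tensor
  algebra can be combined freely; extensionality is restored at the end.\<close>

definition XiA :: "((rat list \<Rightarrow>\<^sub>0 'k) \<Rightarrow> (rat list \<Rightarrow>\<^sub>0 'k)) \<Rightarrow> bool" where
  "XiA T \<longleftrightarrow> (\<exists>a. supp a \<subseteq> lists (dgens m) \<and> (\<forall>v\<in>W r m. T v = ract (Xi_gen r m q) a v))"

lemma XiA_cong: "XiA T \<Longrightarrow> (\<And>v. v \<in> W r m \<Longrightarrow> T' v = T v) \<Longrightarrow> XiA T'"
  by (auto simp: XiA_def)

lemma XiA_zero: "XiA (\<lambda>v. 0)"
  unfolding XiA_def by (intro exI[of _ 0]) simp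

lemma XiA_add: "XiA S \<Longrightarrow> XiA T \<Longrightarrow> XiA (\<lambda>v. S v + T v)"
  unfolding XiA_def by (metis free_alg_closed(1) ract_add)

lemma XiA_sum: "(\<And>i. i \<in> I \<Longrightarrow> XiA (T i)) \<Longrightarrow> XiA (\<lambda>v. \<Sum>i\<in>I. T i v)"
  by (induction I rule: infinite_finite_induct) (auto intro: XiA_zero XiA_add)

lemma XiA_comp:
  assumes "XiA S" "XiA T" shows "XiA (\<lambda>v. T (S v))"
proof -
  from assms obtain a b where ab: "supp a \<subseteq> lists (dgens m)" "\<And>v. v \<in> W r m \<Longrightarrow> S v = ract (Xi_gen r m q) a v"
    "supp b \<subseteq> lists (dgens m)" "\<And>v. v \<in> W r m \<Longrightarrow> T v = ract (Xi_gen r m q) b v" unfolding XiA_def by blast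
  have "ract (Xi_gen r m q) a v \<in> W r m" if "v \<in> W r m" for v
    by (rule ract_tensors[OF Xi_gen_W[OF q0 q1 m2] ab(1) that])
  then show ?thesis unfolding XiA_def
    by (intro exI[of _ "a * b"]) (auto simp: ab supp_mult_lists ract_mult[OF lin_Xi_gen[OF q0 q1 m2]] simp del: subset_iff)
qed

lemma XiA_scal: "XiA T \<Longrightarrow> XiA (\<lambda>v. scal c * T v)"
proof -
  have "XiA (\<lambda>v. scal c * v)"
    unfolding XiA_def by (intro exI[of _ "scal c"]) (simp only: ract_scal free_alg_closed, simp)
  then show "XiA T \<Longrightarrow> XiA (\<lambda>v. scal c * T v)" using XiA_comp by blast
qed

lemma XiA_Psi: "i < m \<Longrightarrow> XiA (Psi_gen q i)"
  unfolding XiA_def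
  by (intro exI[of _ "gen (DT i)"] conjI free_alg_closed(4)) (auto simp: dgens_def ract_gen)

lemma XiA_id: "XiA (\<lambda>v. v)"
  unfolding XiA_def by (intro exI[of _ 1] conjI free_alg_closed(5)) (simp add: ract_1)

lemma XiA_Psiw: "set w \<subseteq> {..<m} \<Longrightarrow> XiA (Psiw q w)"
proof (induction w)
  case Nil
  then show ?case using XiA_id by (simp add: id_def)
next
  case (Cons i w)
  then show ?case using XiA_comp[OF XiA_Psi[of i] Cons.IH] by (simp add: comp_def)
qed

text \<open>The identity permutation has the empty reduced word, so \<open>DX l id\<close> acts as
  the bare projection.\<close>

lemma XiA_proj: "l \<le> m \<Longrightarrow> XiA (proj r m l)"
  unfolding XiA_def
  by (intro exI[of _ "gen (DX l id)"] conjI free_alg_closed(4))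
     (auto simp: dgens_def ract_gen Xi_DX[OF q0 q1 m2 _ id_Sym] red_id[OF q0 q1 m2] simp del: Xi_gen.simps)

text \<open>A block from P' to P factors through the basic pattern: a transposed Hecke word leads to
  it, \<open>DX l id\<close> cuts out the layer, w acts there on the first l factors, and another
  Hecke word leads on to P.\<close>

lemma XiA_block:
  assumes P: "P \<in> pats r m" "P' \<in> pats r m" "nz P = l" "nz P' = l" and w: "set w \<subseteq> {..<l}"
  shows "XiA (\<lambda>v. mg P (Psiw q w (um r P' v)))"
proof -
  have l: "l \<le> m" using nz_le[OF P(1)] P(3) by simp
  let ?b = "bp r m l"
  obtain wP where wP: "set wP \<subseteq> {..<m}" "\<forall>v\<in>words (I_small r) l. Psiw q wP (Mvec (merge ?b v)) = Mvec (merge P v)"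
    using reach_pattern[OF P(1), of q] P(3) by auto
  obtain wP' where wP': "set wP' \<subseteq> {..<m}" "\<forall>v\<in>words (I_small r) l. Psiw q wP' (Mvec (merge ?b v)) = Mvec (merge P' v)"
    using reach_pattern[OF P(2), of q] P(4) by auto
  have 1: "mg P u = Psiw q wP (mg ?b u)" if "u \<in> tensors (I_small r) l" for u
    by (rule lin_eq_tensors[OF lin_mg lin_comp[OF lin_Psiw lin_mg] that]) (use wP(2) in \<open>simp add: mg_Mvec\<close>)
  have 2: "mg ?b (Psiw q w u) = Psiw q w (mg ?b u)" if u: "u \<in> tensors (I_small r) l" for u
  proof -
    have "Psiw q w u \<in> tensors (I_small r) l" by (rule Psiw_small[OF u w])
    moreover have "u \<in> tensors UNIV l" using u tensors_mono[of "I_small r" UNIV] by blast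
    ultimately show ?thesis using u by (simp add: mg_bp Psiw_left[OF _ w])
  qed
  have "mg P (Psiw q w (um r P' v)) = Psiw q wP (Psiw q w (proj r m l (Psiw q (rev wP') v)))" if v: "v \<in> W r m" for v
  proof -
    have u: "um r P' v \<in> tensors (I_small r) l" using um_tensors[OF v, of P'] P(4) by simp
    have v': "Psiw q (rev wP') v \<in> W r m" using v wP'(1) by (intro Psiw_big) auto
    have "mg ?b (um r P' v) = proj r m l (Psiw q (rev wP') v)"
      using um_transpose[OF P(2) wP'(1) _ v, of q] wP'(2) P(4) by (simp add: proj_mg_um[OF l v'])
    then show ?thesis using 1[OF Psiw_small[OF u w]] 2[OF u] by simp
  qed
  moreover have "set w \<subseteq> {..<m}" using w l by auto
  then have "XiA (\<lambda>v. Psiw q wP (Psiw q w (proj r m l (Psiw q (rev wP') v))))"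
    using XiA_comp[OF XiA_comp[OF XiA_comp[OF XiA_Psiw[of "rev wP'"] XiA_proj[OF l]] XiA_Psiw[of w]] XiA_Psiw[of wP]]
      wP(1) wP'(1) by simp
  ultimately show ?thesis by (rule XiA_cong[rotated]) 
qed

lemma mg_L:
  assumes "P \<in> pats r m" "v \<in> tensors (I_small r) (nz P)" "\<bar>i\<bar> \<le> int r" "a = B_el q i \<or> a = k_el i"
  shows "lact (gop q) a (mg P v) = mg P (lact (gop q) a v)"
proof -
  have G: "gop q g (mg P u) = mg P (gop q g u)" if "g \<in> good r" "u \<in> tensors UNIV (nz P)" for g u
    by (rule mg_gop[OF assms(1) that(2,1)])
  have v: "v \<in> tensors UNIV (nz P)" using assms(2) tensors_mono[of "I_small r" UNIV] by blast
  show ?thesis using assms(3,4) v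
    by (auto simp: Lop_B[OF q0] Lop_k[OF q0] G gop_UNIV lin_add[OF lin_mg] lin_scal[OF lin_mg])
qed

lemma um_L:
  assumes "v \<in> W r m" "\<bar>i\<bar> \<le> int r" "a = B_el q i \<or> a = k_el i"
  shows "lact (gop q) a (um r P v) = um r P (lact (gop q) a v)"
proof -
  have G: "gop q g (um r P u) = um r P (gop q g u)" if "g \<in> good r" "u \<in> W r m" for g u
    by (rule um_gop[OF that(2,1)])
  have big: "gop q g u \<in> W r m" if "g \<in> good r" "u \<in> W r m" for g u
    using that by (intro gop_big) (auto simp: good_def I_int_def)
  show ?thesis using assms
    by (auto simp: Lop_B[OF q0] Lop_k[OF q0] G big lin_add[OF lin_um] lin_scal[OF lin_um])
qed

text \<open>The letters of absolute value \<open>top_idx r\<close> are exactly those that a pattern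
  does not mark by 0, so weights determine the number of letters of V.\<close>

lemma wt_top: "f \<in> words (I_big r) m \<Longrightarrow> wt (top_idx r) f + nz (pat r f) = m"
proof -
  assume f: "f \<in> words (I_big r) m"
  have "wt (top_idx r) f + nz (pat r f) = length f" if "set f \<subseteq> I_big r"
    using that
  proof (induction f)
    case (Cons j f)
    have "\<bar>j\<bar> = top_idx r \<longleftrightarrow> j \<notin> I_small r"
      using Cons.prems I_small_less_top[of j r] less_imp_le[OF top_neq(5)[of r]] by (auto simp: I_big_eq)
    moreover have "j \<noteq> 0" using Cons.prems by auto
    ultimately show ?case using Cons by (auto simp: wt_def pat_def)
  qed (simp add: wt_def pat_def)
  with f show ?thesis by (simp add: words_def)
qed

lemma End_L_subset: "End_L r m q \<subseteq> Xi r m q ` carrier (HH m q)"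
proof
  fix S assume S: "S \<in> End_L r m q"
  then have Se: "S \<in> lin_endos (W r m)" "\<And>a v. a \<in> Lgens r q \<Longrightarrow> v \<in> W r m \<Longrightarrow> S (lact (gop q) a v) = lact (gop q) a (S v)"
    using End_L_iff[OF q0 q1 m2, of S r] by auto
  define F where "F = words (I_big r) m"
  \<comment> \<open>S is \<open>undefined\<close> outside the tensor power. \<open>Sh\<close> is a
    linear operator on the whole tensor algebra with the same values on that power, to which the
    lemmas on \<open>lin\<close> apply.\<close>
  define Sh where "Sh = lin_ext (\<lambda>f. if f \<in> F then S (Mvec f) else 0)"
  have linSh: "lin Sh" by (simp add: Sh_def)
  have SW: "S v \<in> W r m" if "v \<in> W r m" for v using Se(1) that by (auto simp: lin_endos_def)
  have Sadd: "S (u + v) = S u + S v" if "u \<in> W r m" "v \<in> W r m" for u v using Se(1) that by (auto simp: lin_endos_def)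
  have Sscal: "S (scal c * v) = scal c * S v" if "v \<in> W r m" for c v using Se(1) that by (auto simp: lin_endos_def)
  have ShS: "Sh v = S v" if v: "v \<in> W r m" for v
  proof -
    have S0: "S 0 = 0" using Sscal[of 0 0] by simp
    have "S (\<Sum>f\<in>G. scal (cf v f) * Mvec f) = (\<Sum>f\<in>G. scal (cf v f) * S (Mvec f))" if "G \<subseteq> F" for G
    proof -
      have "finite G" using that finite_subset[of G F] by (simp add: F_def finite_words)
      then show ?thesis using that
      proof (induction G rule: finite_induct)
        case (insert x G)
        have "scal (cf v x) * Mvec x \<in> W r m" "(\<Sum>f\<in>G. scal (cf v f) * Mvec f) \<in> W r m"
          using insert.prems by (auto simp: F_def intro!: tensors_sum tensors_scal)
        moreover have "Mvec x \<in> W r m" using insert.prems by (simp add: F_def)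
        ultimately show ?case using insert by (simp add: Sadd Sscal)
      qed (simp add: S0)
    qed
    from this[of F] have "S v = (\<Sum>f\<in>F. scal (cf v f) * S (Mvec f))"
      using tensors_expand[OF _ v] by (simp add: F_def)
    also have "\<dots> = (\<Sum>f\<in>F. scal (cf v f) * (if f \<in> F then S (Mvec f) else 0))" by (intro sum.cong) auto
    also have "\<dots> = Sh v" unfolding Sh_def
      by (rule lin_ext_superset[symmetric]) (use v in \<open>auto simp: F_def tensors_alt finite_words\<close>)
    finally show ?thesis ..
  qed
  have ShW: "Sh v \<in> W r m" if "v \<in> W r m" for v using ShS SW that by simp
  have ShL: "Sh (lact (gop q) a v) = lact (gop q) a (Sh v)" if "a \<in> Lgens r q" "v \<in> W r m" for a v
    using Se(2)[OF that] ShS that Lgens_W[OF q0 q1 m2 that] by simp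
  have Lg: "a \<in> Lgens r q" if "\<bar>i\<bar> \<le> int r" "a = B_el q i \<or> a = k_el i" for a i
    using that by (auto simp: Lgens_def[OF q0 q1 m2] I_int_def abs_le_iff)
  \<comment> \<open>The block of S from pattern P' to pattern P, read as a map between powers of
    V.\<close>
  define C where "C P P' v = um r P (Sh (mg P' v))" for P P' v
  have linC: "lin (C P P')" for P P' unfolding C_def[abs_def] by (rule lin_comp[OF lin_um lin_comp[OF linSh lin_mg]])
  have blk: "XiA (\<lambda>v. mg P (C P P' (um r P' v)))" if P: "P \<in> pats r m" "P' \<in> pats r m" for P P'
  proof (cases "nz P = nz P'")
    case True
    let ?l = "nz P"
    have CL: "C P P' (lact (gop q) a v) = lact (gop q) a (C P P' v)"
      if "\<bar>i\<bar> \<le> int r" "a = B_el q i \<or> a = k_el i" "v \<in> tensors (I_small r) ?l" for a i v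
    proof -
      have v: "v \<in> tensors (I_small r) (nz P')" using that(3) True by simp
      have "C P P' (lact (gop q) a v) = um r P (Sh (lact (gop q) a (mg P' v)))"
        using mg_L[OF P(2) v that(1,2)] by (simp add: C_def)
      also have "\<dots> = lact (gop q) a (C P P' v)"
        using ShL[OF Lg[OF that(1,2)] mg_tensors[OF P(2) v]] um_L[OF ShW[OF mg_tensors[OF P(2) v]] that(1,2)]
        by (simp add: C_def)
      finally show ?thesis .
    qed
    have CT: "C P P' v \<in> tensors (I_small r) ?l" if "v \<in> tensors (I_small r) ?l" for v
      unfolding C_def by (rule um_tensors[OF ShW[OF mg_tensors[OF P(2)]]]) (use that True in simp)
    obtain Ws c where Ws: "finite Ws" "\<And>w. w \<in> Ws \<Longrightarrow> set w \<subseteq> {..<?l}"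
      "\<And>v. v \<in> tensors (I_small r) ?l \<Longrightarrow> C P P' v = (\<Sum>w\<in>Ws. scal (c w) * Psiw q w v)"
    proof -
      have "\<exists>Ws c. finite Ws \<and> (\<forall>w\<in>Ws. set w \<subseteq> {..<?l}) \<and>
        (\<forall>v\<in>tensors (I_small r) ?l. C P P' v = (\<Sum>w\<in>Ws. scal (c w) * Psiw q w v))"
        by (rule core_commutant[OF na ra linC]) (blast intro: CT CL)+
      then show ?thesis using that by metis
    qed
    have "mg P (C P P' (um r P' v)) = (\<Sum>w\<in>Ws. scal (c w) * mg P (Psiw q w (um r P' v)))" if "v \<in> W r m" for v
      using Ws(3)[of "um r P' v"] um_tensors[OF that, of P'] True by (simp add: lin_sum[OF lin_mg] lin_scal[OF lin_mg])
    moreover have "XiA (\<lambda>v. \<Sum>w\<in>Ws. scal (c w) * mg P (Psiw q w (um r P' v)))"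
      by (intro XiA_sum XiA_scal XiA_block[OF P refl]) (use True Ws(2) in auto)
    ultimately show ?thesis by (rule XiA_cong[rotated])
  next
    case False
    \<comment> \<open>The exponents of \<open>k_el i\<close> for i up to r + 1 determine the number
      of letters \<plusminus>(r + 3/2), so an operator commuting with them has no entry between the
      two patterns.\<close>
    have "C P P' u = 0" if "u \<in> tensors (I_small r) (nz P')" for u
    proof (rule lin_eq_tensors[OF linC lin_zero that])
      fix x assume x: "x \<in> words (I_small r) (nz P')"
      let ?f = "merge P' x"
      have f: "?f \<in> words (I_big r) m" "pat r ?f = P'" using merge_props[OF P(2) x] by auto
      have fW: "Mvec ?f \<in> W r m" using f by simp
      show "C P P' (Mvec x) = 0"
      proof (rule tensors_eqI)
        show "C P P' (Mvec x) \<in> tensors (I_small r) (nz P)"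
          unfolding C_def mg_Mvec by (rule um_tensors[OF ShW[OF fW]])
        fix u assume u: "u \<in> words (I_small r) (nz P)"
        let ?h = "merge P u"
        have h: "?h \<in> words (I_big r) m" "pat r ?h = P" using merge_props[OF P(1) u] by auto
        have "cf (Sh (Mvec ?f)) ?h = 0"
        proof (rule ccontr)
          assume n0: "cf (Sh (Mvec ?f)) ?h \<noteq> 0"
          have IB: "I_big r = I_small (r + 1)" by (simp add: I_big_def I_small_def)
          have "wt (hf (int (r + 1))) ?f = wt (hf (int (r + 1))) ?h"
          proof (rule wt_determined[where s = "r + 1" and l = m])
            show "kexp i ?f = kexp i ?h" if "1 \<le> i" "i \<le> int (r + 1)" for i
            proof (rule k_commute_weight[OF na I_big_hf linSh ShW that(1) _ f(1) n0])
              have "k_el i \<in> Lgens r q" using that by (auto simp: Lgens_def[OF q0 q1 m2] I_int_def)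
              then show "Sh (lact (gop q) (k_el i) (Mvec ?f)) = lact (gop q) (k_el i) (Sh (Mvec ?f))" by (rule ShL[OF _ fW])
            qed
          qed (use f h IB in auto)
          then have "wt (top_idx r) ?f = wt (top_idx r) ?h" by (simp add: top_idx_hf add.commute)
          with wt_top[OF f(1)] wt_top[OF h(1)] f(2) h(2) False show False by simp
        qed
        then show "cf (C P P' (Mvec x)) u = cf 0 u"
          using cf_um[OF P(1) u ShW[OF fW]] by (simp add: C_def mg_Mvec)
      qed simp
    qed
    then show ?thesis by (intro XiA_cong[OF XiA_zero]) (simp add: um_tensors lin_0[OF lin_mg])
  qed
  have "S v = (\<Sum>P'\<in>pats r m. \<Sum>P\<in>pats r m. mg P (C P P' (um r P' v)))" if v: "v \<in> W r m" for v
  proof -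
    have "S v = Sh (\<Sum>P'\<in>pats r m. mg P' (um r P' v))" using ShS[OF v] sum_mg_um[OF v] by simp
    also have "\<dots> = (\<Sum>P'\<in>pats r m. Sh (mg P' (um r P' v)))" by (rule lin_sum[OF linSh])
    also have "\<dots> = (\<Sum>P'\<in>pats r m. \<Sum>P\<in>pats r m. mg P (C P P' (um r P' v)))"
    proof (intro sum.cong refl)
      fix P' assume P': "P' \<in> pats r m"
      have "Sh (mg P' (um r P' v)) \<in> W r m" by (intro ShW mg_tensors[OF P'] um_tensors[OF v])
      from sum_mg_um[OF this] show "Sh (mg P' (um r P' v)) = (\<Sum>P\<in>pats r m. mg P (C P P' (um r P' v)))"
        by (simp add: C_def)
    qed
    finally show ?thesis .
  qed
  moreover have "XiA (\<lambda>v. \<Sum>P'\<in>pats r m. \<Sum>P\<in>pats r m. mg P (C P P' (um r P' v)))"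
    by (intro XiA_sum blk)
  ultimately have "XiA S" by (rule XiA_cong[rotated])
  then obtain a where a: "supp a \<subseteq> lists (dgens m)" "\<And>v. v \<in> W r m \<Longrightarrow> S v = ract (Xi_gen r m q) a v"
    unfolding XiA_def by blast
  \<comment> \<open>Off the tensor power both sides are \<open>undefined\<close>.\<close>
  have "S = (\<lambda>v\<in>W r m. ract (Xi_gen r m q) a v)"
  proof
    fix v show "S v = (\<lambda>v\<in>W r m. ract (Xi_gen r m q) a v) v"
      using a(2) Se(1) by (cases "v \<in> W r m") (auto simp: lin_endos_def PiE_def extensional_def)
  qed
  then show "S \<in> Xi r m q ` carrier (HH m q)"
    unfolding Xi_image[OF q0 q1 m2] using a(1) by blast
qed

end

theorem theorem3p9:
  fixes q :: "'k::field_char_0" and r m :: nat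
  assumes "r \<ge> 1" and "m \<ge> 2"
    and "\<not> algebraic q"
    and "rat_adjoin q = UNIV"
  shows "Xi r m q ` carrier (HH m q) = End_L r m q"
proof
  note q = q_neq_0[OF assms(3)] q_inverse_neq[OF assms(3)]
  show "Xi r m q ` carrier (HH m q) \<subseteq> End_L r m q" by (rule Xi_subset[OF q assms(2)])
  show "End_L r m q \<subseteq> Xi r m q ` carrier (HH m q)" by (rule End_L_subset[OF assms(3,4,2)])
qed

end
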